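(* Let $(\Omega,\Sigma,\mu)$ be a non-atomic $\sigma$-finite complete measure space. Let $M$ and $N$ be complementary Musielak-Orlicz functions on $\Omega$, and put $v=1/b_M$, $w=a_N$, $\Omega_\infty=\{t\in\Omega: a_M(t)=b_M(t)\}$. Then the following conditions are equivalent. (i) $L_M$ has the Daugavet property. (ii) $L_M=L_{1,w}$, or $L_M=L_{\infty,v}$, or $L_M=L_{\infty,v}(\Omega_\infty)\oplus_\infty L_{1,w}(\Omega\setminus\Omega_\infty)$. (iii) $L_N^o=L_{\infty,1/w}$, or $L_N^o=L_{1,1/v}$, or $L_N^o=L_{1,1/v}(\Omega_\infty)\oplus_1 L_{\infty,1/w}(\Omega\setminus\Omega_\infty)$. (iv) $L_N^o$ has the Daugavet property.
   Context: All Banach spaces are real. A Banach space $X$ has the Daugavet property if $\|I+T\|=1+\|T\|$ for every rank one bounded linear operator $T:X\to X$. $L_0=L_0(\Omega)$ is the set of ($\mu$-a.e. equivalence classes of) measurable extended-real valued functions on $\Omega$. Conventions: $a/0=\infty$, $a/\infty=0$ for $a\in(0,\infty)$, $0\cdot\infty=0$. An Orlicz function is $\varphi:[0,\infty)\to[0,\infty]$, not identically $0$, with $\lim_{u\to0^+}\varphi(u)=\varphi(0)=0$, left continuous and convex on $(0,b_\varphi]$, where $b_\varphi=\sup\{u>0:\varphi(u)<\infty\}$. A Musielak-Orlicz function is $M:\Omega\times[0,\infty)\to[0,\infty]$ such that $M(t,\cdot)$ is an Orlicz function for $\mu$-a.e. $t$ and $M(\cdot,u)$ is measurable for all $u\ge0$.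 Put $a_M(t)=\sup\{u\ge0:M(t,u)=0\}$, $b_M(t)=\sup\{u>0:M(t,u)<\infty\}$. The complementary function is $N(t,u)=\sup\{uv-M(t,v):v>0\}$, which is again a Musielak-Orlicz function; $a_N$ is defined analogously. $\rho_M(x)=\int_\Omega M(t,|x(t)|)\,d\mu$; $L_M=\{x\in L_0:\rho_M(\lambda x)<\infty\text{ for some }\lambda>0\}$ with the Luxemburg norm $\|x\|_M=\inf\{\lambda>0:\rho_M(x/\lambda)\le1\}$. $L_N^o$ is the space $L_N$ (defined the same way from $N$) with the Orlicz norm $\|x\|_N^o=\sup\{\int_\Omega|xy|\,d\mu:\rho_M(y)\le1\}$. For measurable $\Gamma\subset\Omega$ and a weight $u$ on $\Gamma$ (measurable, $0<u<\infty$ $\mu$-a.e. on $\Gamma$): $L_{1,u}(\Gamma)=\{x\in L_0: x=0\ \mu\text{-a.e. off }\Gamma,\ \|x\|_{1,u}=\int_\Gamma|xu|\,d\mu<\infty\}$, and $L_{\infty,u}(\Gamma)=\{x\in L_0:x=0\ \mu\text{-a.e. off }\Gamma,\ \|x\|_{\infty,u}=\operatorname{ess\,sup}_{t\in\Gamma}|x(t)u(t)|<\infty\}$; $L_{1,u}=L_{1,u}(\Omega)$, $L_{\infty,u}=L_{\infty,u}(\Omega)$. $X\oplus_1Y$ and $X\oplus_\infty Y$ are the direct sums with norms $\|x\|_X+\|y\|_Y$ and $\max\{\|x\|_X,\|y\|_Y\}$. An equality of spaces means equality as sets of functions with equality of norms; for the direct sums, a function $x$ is identified with $(x\chi_{\Omega_\infty},x\chi_{\Omega\setminus\Omega_\infty})$.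 Asserting such an equality includes that the functions appearing as weights are weights on the indicated sets. *)

theory Defs
  imports "HOL-Analysis.Analysis" "HOL-Probability.Essential_Supremum"
begin

section \<open>Normed spaces on explicit carriers and the Daugavet property\<close>

text \<open>The spaces below depend on a measure, so they cannot be types of class
  \<^class>\<open>real_normed_vector\<close>.\<close>

record 'v nspace =
  vcarrier :: "'v set"
  vadd :: "'v \<Rightarrow> 'v \<Rightarrow> 'v"
  vscale :: "real \<Rightarrow> 'v \<Rightarrow> 'v"
  vzero :: "'v"
  vnorm :: "'v \<Rightarrow> real"

definition linear_operator :: "('v, 'r) nspace_scheme \<Rightarrow> ('v \<Rightarrow> 'v) \<Rightarrow> bool" where
  "linear_operator X T \<longleftrightarrow>
     (\<forall>x\<in>vcarrier X. T x \<in> vcarrier X) \<and>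
     (\<forall>x\<in>vcarrier X. \<forall>y\<in>vcarrier X. T (vadd X x y) = vadd X (T x) (T y)) \<and>
     (\<forall>c. \<forall>x\<in>vcarrier X. T (vscale X c x) = vscale X c (T x))"

definition bounded_operator :: "('v, 'r) nspace_scheme \<Rightarrow> ('v \<Rightarrow> 'v) \<Rightarrow> bool" where
  "bounded_operator X T \<longleftrightarrow>
     linear_operator X T \<and> (\<exists>K. \<forall>x\<in>vcarrier X. vnorm X (T x) \<le> K * vnorm X x)"

definition operator_norm :: "('v, 'r) nspace_scheme \<Rightarrow> ('v \<Rightarrow> 'v) \<Rightarrow> real" where
  "operator_norm X T = Sup {vnorm X (T x) |x. x \<in> vcarrier X \<and> vnorm X x \<le> 1}"

definition rank_one :: "('v, 'r) nspace_scheme \<Rightarrow> ('v \<Rightarrow> 'v) \<Rightarrow> bool" where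
  "rank_one X T \<longleftrightarrow>
     (\<exists>y\<in>vcarrier X. y \<noteq> vzero X \<and> T ` vcarrier X = range (\<lambda>c. vscale X c y))"

definition daugavet_property :: "('v, 'r) nspace_scheme \<Rightarrow> bool" where
  "daugavet_property X \<longleftrightarrow>
     (\<forall>T. bounded_operator X T \<and> rank_one X T \<longrightarrow>
        operator_norm X (\<lambda>x. vadd X x (T x)) = 1 + operator_norm X T)"

definition direct_sum :: "(real \<Rightarrow> real \<Rightarrow> real) \<Rightarrow> 'v nspace \<Rightarrow> 'w nspace \<Rightarrow> ('v \<times> 'w) nspace" where
  "direct_sum p X Y = \<lparr>
     vcarrier = vcarrier X \<times> vcarrier Y,
     vadd = (\<lambda>(x, y) (x', y'). (vadd X x x', vadd Y y y')),
     vscale = (\<lambda>c (x, y). (vscale X c x, vscale Y c y)),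
     vzero = (vzero X, vzero Y),
     vnorm = (\<lambda>(x, y). p (vnorm X x) (vnorm Y y)) \<rparr>"

definition sum_1 :: "'v nspace \<Rightarrow> 'w nspace \<Rightarrow> ('v \<times> 'w) nspace" where
  "sum_1 = direct_sum (+)"

definition sum_inf :: "'v nspace \<Rightarrow> 'w nspace \<Rightarrow> ('v \<times> 'w) nspace" where
  "sum_inf = direct_sum max"

section \<open>The space of classes of measurable functions\<close>

definition nonatomic :: "'a measure \<Rightarrow> bool" where
  "nonatomic \<mu> \<longleftrightarrow>
     (\<forall>A\<in>sets \<mu>. 0 < emeasure \<mu> A \<longrightarrow>
        (\<exists>B\<in>sets \<mu>. B \<subseteq> A \<and> 0 < emeasure \<mu> B \<and> emeasure \<mu> B < emeasure \<mu> A))"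

definition ae_eq :: "'a measure \<Rightarrow> (('a \<Rightarrow> ereal) \<times> ('a \<Rightarrow> ereal)) set" where
  "ae_eq \<mu> = {(x, y). x \<in> borel_measurable \<mu> \<and> y \<in> borel_measurable \<mu> \<and> (AE t in \<mu>. x t = y t)}"

lemma equiv_ae_eq: "equiv (borel_measurable \<mu>) (ae_eq \<mu>)"
  by (rule equivI) (auto simp: ae_eq_def refl_on_def sym_def trans_def)

abbreviation ae_class :: "'a measure \<Rightarrow> ('a \<Rightarrow> ereal) \<Rightarrow> ('a \<Rightarrow> ereal) set" where
  "ae_class \<mu> x \<equiv> ae_eq \<mu> `` {x}"

text \<open>Given a set \<open>S\<close> of measurable functions that is closed under a.e. equality and a norm
  \<open>n\<close> on functions that does not distinguish a.e. equal functions, \<open>function_space \<mu> S n\<close>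
  is the corresponding space of a.e. equivalence classes. Sums of classes are independent of
  representatives for extended-real valued functions as well; all members of the spaces
  below are finite a.e., so the value assigned to \<open>\<infinity> - \<infinity>\<close> plays no role.\<close>

definition function_space ::
    "'a measure \<Rightarrow> ('a \<Rightarrow> ereal) set \<Rightarrow> (('a \<Rightarrow> ereal) \<Rightarrow> real) \<Rightarrow> ('a \<Rightarrow> ereal) set nspace" where
  "function_space \<mu> S n = \<lparr>
     vcarrier = ae_class \<mu> ` S,
     vadd = (\<lambda>X Y. \<Union>x\<in>X. \<Union>y\<in>Y. ae_class \<mu> (\<lambda>t. x t + y t)),
     vscale = (\<lambda>c X. \<Union>x\<in>X. ae_class \<mu> (\<lambda>t. ereal c * x t)),
     vzero = ae_class \<mu> (\<lambda>t. 0),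
     vnorm = (\<lambda>X. the_elem (n ` X)) \<rparr>"

text \<open>The class of \<open>x \<chi>\<^sub>A\<close>, for \<open>x\<close> in the class \<open>X\<close>.\<close>

definition restrict_class ::
    "'a measure \<Rightarrow> 'a set \<Rightarrow> ('a \<Rightarrow> ereal) set \<Rightarrow> ('a \<Rightarrow> ereal) set" where
  "restrict_class \<mu> A X = (\<Union>x\<in>X. ae_class \<mu> (\<lambda>t. x t * indicator A t))"

definition same_space :: "'v nspace \<Rightarrow> 'v nspace \<Rightarrow> bool" where
  "same_space X Y \<longleftrightarrow> vcarrier X = vcarrier Y \<and> (\<forall>x\<in>vcarrier X. vnorm X x = vnorm Y x)"

text \<open>Equality of a function space \<open>X\<close> with a direct sum \<open>Z\<close> of spaces of functions vanishing
  off \<open>A\<close> and off its complement, where \<open>x\<close> is identified with \<open>(x \<chi>\<^sub>A, x \<chi>\<^bsub>\<Omega> - A\<^esub>)\<close>.\<close>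

definition same_space_split ::
    "'a measure \<Rightarrow> 'a set \<Rightarrow> ('a \<Rightarrow> ereal) set nspace
      \<Rightarrow> (('a \<Rightarrow> ereal) set \<times> ('a \<Rightarrow> ereal) set) nspace \<Rightarrow> bool" where
  "same_space_split \<mu> A X Z \<longleftrightarrow>
     (let split = (\<lambda>x. (restrict_class \<mu> A x, restrict_class \<mu> (space \<mu> - A) x)) in
       split ` vcarrier X = vcarrier Z \<and> (\<forall>x\<in>vcarrier X. vnorm X x = vnorm Z (split x)))"

section \<open>Musielak-Orlicz spaces\<close>

text \<open>Only the values of Orlicz functions on nonnegative arguments are relevant.\<close>

definition zero_bound :: "(real \<Rightarrow> ennreal) \<Rightarrow> ennreal" where
  "zero_bound \<phi> = Sup {ennreal u |u. 0 \<le> u \<and> \<phi> u = 0}"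

definition finite_bound :: "(real \<Rightarrow> ennreal) \<Rightarrow> ennreal" where
  "finite_bound \<phi> = Sup {ennreal u |u. 0 < u \<and> \<phi> u < \<infinity>}"

definition orlicz_function :: "(real \<Rightarrow> ennreal) \<Rightarrow> bool" where
  "orlicz_function \<phi> \<longleftrightarrow>
     (\<exists>u\<ge>0. \<phi> u \<noteq> 0) \<and>
     \<phi> 0 = 0 \<and> (\<phi> \<longlongrightarrow> 0) (at_right 0) \<and>
     (\<forall>u>0. ennreal u \<le> finite_bound \<phi> \<longrightarrow> continuous (at_left u) \<phi>) \<and>
     (\<forall>u>0. \<forall>v>0. \<forall>s\<in>{0..1}. ennreal u \<le> finite_bound \<phi> \<longrightarrow> ennreal v \<le> finite_bound \<phi> \<longrightarrow>
        \<phi> ((1 - s) * u + s * v) \<le> ennreal (1 - s) * \<phi> u + ennreal s * \<phi> v)"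

definition musielak_orlicz :: "'a measure \<Rightarrow> ('a \<Rightarrow> real \<Rightarrow> ennreal) \<Rightarrow> bool" where
  "musielak_orlicz \<mu> M \<longleftrightarrow>
     (AE t in \<mu>. orlicz_function (M t)) \<and>
     (\<forall>u\<ge>0. (\<lambda>t. M t u) \<in> borel_measurable \<mu>)"

text \<open>The supremum is taken in the extended reals; for \<open>u \<ge> 0\<close> and an Orlicz function \<open>M t\<close>
  it is nonnegative (let \<open>v\<close> tend to \<open>0\<close>).\<close>

definition complementary :: "('a \<Rightarrow> real \<Rightarrow> ennreal) \<Rightarrow> 'a \<Rightarrow> real \<Rightarrow> ennreal" where
  "complementary M t u = e2ennreal (SUP v\<in>{0<..}. ereal (u * v) - enn2ereal (M t v))"

text \<open>An Orlicz function tends to \<open>\<infinity>\<close> at \<open>\<infinity>\<close>, hence \<open>M(t, \<infinity>) = \<infinity>\<close>.\<close>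

definition modular :: "'a measure \<Rightarrow> ('a \<Rightarrow> real \<Rightarrow> ennreal) \<Rightarrow> ('a \<Rightarrow> ereal) \<Rightarrow> ennreal" where
  "modular \<mu> M x =
     (\<integral>\<^sup>+ t. (if \<bar>x t\<bar> = \<infinity> then \<infinity> else M t (real_of_ereal \<bar>x t\<bar>)) \<partial>\<mu>)"

definition mo_functions :: "'a measure \<Rightarrow> ('a \<Rightarrow> real \<Rightarrow> ennreal) \<Rightarrow> ('a \<Rightarrow> ereal) set" where
  "mo_functions \<mu> M =
     {x \<in> borel_measurable \<mu>. \<exists>c>0. modular \<mu> M (\<lambda>t. ereal c * x t) < \<infinity>}"

definition luxemburg_norm :: "'a measure \<Rightarrow> ('a \<Rightarrow> real \<Rightarrow> ennreal) \<Rightarrow> ('a \<Rightarrow> ereal) \<Rightarrow> real" where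
  "luxemburg_norm \<mu> M x = Inf {c. 0 < c \<and> modular \<mu> M (\<lambda>t. x t / ereal c) \<le> 1}"

text \<open>The Orlicz norm on the space of the function complementary to \<open>M\<close>.\<close>

definition orlicz_norm :: "'a measure \<Rightarrow> ('a \<Rightarrow> real \<Rightarrow> ennreal) \<Rightarrow> ('a \<Rightarrow> ereal) \<Rightarrow> real" where
  "orlicz_norm \<mu> M x =
     enn2real (SUP y\<in>{y \<in> borel_measurable \<mu>. modular \<mu> M y \<le> 1}. \<integral>\<^sup>+ t. e2ennreal \<bar>x t * y t\<bar> \<partial>\<mu>)"

definition luxemburg_space ::
    "'a measure \<Rightarrow> ('a \<Rightarrow> real \<Rightarrow> ennreal) \<Rightarrow> ('a \<Rightarrow> ereal) set nspace" where
  "luxemburg_space \<mu> M = function_space \<mu> (mo_functions \<mu> M) (luxemburg_norm \<mu> M)"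

text \<open>\<open>orlicz_space \<mu> N M\<close> is the space given by \<open>N\<close>, normed through its complementary
  function \<open>M\<close>.\<close>

definition orlicz_space ::
    "'a measure \<Rightarrow> ('a \<Rightarrow> real \<Rightarrow> ennreal) \<Rightarrow> ('a \<Rightarrow> real \<Rightarrow> ennreal) \<Rightarrow> ('a \<Rightarrow> ereal) set nspace" where
  "orlicz_space \<mu> N M = function_space \<mu> (mo_functions \<mu> N) (orlicz_norm \<mu> M)"

section \<open>Weighted spaces\<close>

definition weight_on :: "'a measure \<Rightarrow> 'a set \<Rightarrow> ('a \<Rightarrow> ennreal) \<Rightarrow> bool" where
  "weight_on \<mu> \<Gamma> u \<longleftrightarrow>
     u \<in> borel_measurable (restrict_space \<mu> \<Gamma>) \<and> (AE t in \<mu>. t \<in> \<Gamma> \<longrightarrow> 0 < u t \<and> u t < \<infinity>)"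

definition norm_1 :: "'a measure \<Rightarrow> 'a set \<Rightarrow> ('a \<Rightarrow> ennreal) \<Rightarrow> ('a \<Rightarrow> ereal) \<Rightarrow> ennreal" where
  "norm_1 \<mu> \<Gamma> u x = (\<integral>\<^sup>+ t\<in>\<Gamma>. e2ennreal \<bar>x t\<bar> * u t \<partial>\<mu>)"

definition norm_inf :: "'a measure \<Rightarrow> 'a set \<Rightarrow> ('a \<Rightarrow> ennreal) \<Rightarrow> ('a \<Rightarrow> ereal) \<Rightarrow> ennreal" where
  "norm_inf \<mu> \<Gamma> u x = esssup (restrict_space \<mu> \<Gamma>) (\<lambda>t. e2ennreal \<bar>x t\<bar> * u t)"

definition functions_on :: "'a measure \<Rightarrow> 'a set \<Rightarrow> ('a \<Rightarrow> ereal) set" where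
  "functions_on \<mu> \<Gamma> = {x \<in> borel_measurable \<mu>. AE t in \<mu>. t \<notin> \<Gamma> \<longrightarrow> x t = 0}"

definition L_1 :: "'a measure \<Rightarrow> 'a set \<Rightarrow> ('a \<Rightarrow> ennreal) \<Rightarrow> ('a \<Rightarrow> ereal) set nspace" where
  "L_1 \<mu> \<Gamma> u = function_space \<mu>
     {x \<in> functions_on \<mu> \<Gamma>. norm_1 \<mu> \<Gamma> u x < \<infinity>} (\<lambda>x. enn2real (norm_1 \<mu> \<Gamma> u x))"

definition L_inf :: "'a measure \<Rightarrow> 'a set \<Rightarrow> ('a \<Rightarrow> ennreal) \<Rightarrow> ('a \<Rightarrow> ereal) set nspace" where
  "L_inf \<mu> \<Gamma> u = function_space \<mu>
     {x \<in> functions_on \<mu> \<Gamma>. norm_inf \<mu> \<Gamma> u x < \<infinity>} (\<lambda>x. enn2real (norm_inf \<mu> \<Gamma> u x))"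

end

theory Submission
  imports Defs
begin

text \<open>
  Write \<open>b t\<close> for the point up to which \<open>M t\<close> is finite, \<open>a t\<close> for the point up to which it
  vanishes and \<open>w t\<close> for the slope of the steepest line through the origin below \<open>M t\<close>, which
  is the point up to which the complementary function vanishes. All four conditions hold if and only
  if one of the following alternatives does:

  \<^item> at almost every \<open>t\<close> with \<open>a t < b t\<close> the function \<open>M t\<close> is the line \<open>u \<mapsto> w t * u\<close>;
  \<^item> the values \<open>sup {M t u | u < b t}\<close> have integral at most \<open>1\<close>.

  \<^bold>\<open>The alternatives give the formulas.\<close> In both cases the unit ball of the modular is a product:
  for some \<open>D\<close>, a function \<open>r\<close> has modular at most \<open>1\<close> exactly when \<open>\<bar>r\<bar> \<le> b\<close> a.e. on \<open>D\<close> and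
  \<open>\<bar>r\<bar> * w\<close> has integral at most \<open>1\<close> off \<open>D\<close> (\<open>split_ball\<close>). In the first case \<open>D\<close> is the set
  where \<open>a = b\<close>, on which \<open>M t\<close> jumps from \<open>0\<close> to \<open>\<infinity>\<close>; in the second it is the whole space. The gauge
  of a product is the maximum, and the support function of a product is the sum, of those of the
  factors; so the Luxemburg norm is the maximum and the Orlicz norm the sum of a weighted
  \<open>L\<^sub>1\<close> and a weighted \<open>L\<^sub>\<infinity>\<close> norm (\<open>luxemburg_weighted_sum\<close>, \<open>orlicz_weighted_sum\<close>).

  \<^bold>\<open>The formulas give the Daugavet property.\<close> A rank one operator is \<open>x \<mapsto> f x * y\<close> for a bounded
  functional \<open>f\<close>. Over a non-atomic measure, a unit vector of an \<open>L\<^sub>1\<close> space can be replaced by one that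
  lives where \<open>y\<close> has almost no mass, without decreasing \<open>f\<close>; its norm then adds to that of any
  multiple of \<open>y\<close> (\<open>concentrate_L1\<close>). In an \<open>L\<^sub>\<infinity>\<close> space, an element of the unit ball can be
  changed to modulus one, with the sign of \<open>y\<close>, on one of many disjoint small sets where \<open>\<bar>y\<bar>\<close> is
  nearly maximal, and for one of these sets \<open>f\<close> hardly notices (\<open>perturb_Linf\<close>).

  \<^bold>\<open>The Daugavet property gives the alternatives.\<close> Let \<open>x\<close> have modular \<open>1\<close> and let \<open>g\<close> have dual norm
  \<open>1\<close>. For the Luxemburg norm, the operator \<open>z \<mapsto> - (\<integral>g z) x\<close> yields for every \<open>c < 2\<close> some \<open>z\<close> in
  the unit ball with \<open>z - (\<integral>g z) x\<close> of norm above \<open>c\<close> (\<open>slice_property\<close>). For the Orlicz norm the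
  transposed operator \<open>z \<mapsto> - (\<integral>z x) g\<close> yields the same, because the functional \<open>\<integral>z x\<close> has norm one:
  it is nearly attained at the chord slopes of \<open>M t\<close> to the right of \<open>x t\<close>
  (\<open>chord_slopes_nearly_norming\<close>). Now suppose that both alternatives fail. The failure of the
  second provides functions of modular above \<open>1\<close>, hence functions \<open>x\<close> of modular \<open>1\<close> with
  prescribed values on small sets (\<open>splice_to_modular_one\<close>); the failure of the first provides a set of positive
  measure on which \<open>M t\<close> bends, uniformly in \<open>t\<close>. With \<open>x\<close> and \<open>g\<close> chosen on such a set, the
  convexity estimate of \<open>M ((z - s x) / c)\<close> by the mean of \<open>M z\<close> and \<open>M x\<close> loses a fixed amount, whereas the
  slice property for \<open>c\<close> close to \<open>2\<close> says that it is almost sharp (\<open>slice_property_loss\<close>).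
\<close>

section \<open>Orlicz functions\<close>

lemma finite_below_finite_bound:
  assumes "orlicz_function \<phi>" "0 \<le> u" "ennreal u < finite_bound \<phi>"
  shows "\<exists>v>u. \<phi> v < \<infinity>"
proof -
  from assms(3) obtain v where v: "ennreal u < ennreal v" "0 < v" "\<phi> v < \<infinity>"
    unfolding finite_bound_def less_Sup_iff by auto
  then show ?thesis using assms(2) by (auto simp: ennreal_less_iff)
qed

lemma le_finite_bound: "0 < u \<Longrightarrow> \<phi> u < \<infinity> \<Longrightarrow> ennreal u \<le> finite_bound \<phi>"
  unfolding finite_bound_def by (rule Sup_upper) auto

text \<open>Convexity of an Orlicz function is only given on the open half line; letting one of the two
  points tend to \<open>0\<close>, where the function is continuous, extends it to chords from the origin.\<close>

lemma orlicz_scale: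
  assumes \<phi>: "orlicz_function \<phi>" and u: "0 \<le> u" and s: "0 \<le> s" "s \<le> 1"
  shows "\<phi> (s * u) \<le> ennreal s * \<phi> u"
proof -
  have zero: "\<phi> 0 = 0" and lim: "(\<phi> \<longlongrightarrow> 0) (at_right 0)"
    and conv: "\<And>u v s. 0 < u \<Longrightarrow> 0 < v \<Longrightarrow> s \<in> {0..1} \<Longrightarrow> ennreal u \<le> finite_bound \<phi> \<Longrightarrow>
      ennreal v \<le> finite_bound \<phi> \<Longrightarrow> \<phi> ((1 - s) * u + s * v) \<le> ennreal (1 - s) * \<phi> u + ennreal s * \<phi> v"
    using \<phi> unfolding orlicz_function_def by blast+
  consider "u = 0 \<or> s = 0 \<or> s = 1" | "\<phi> u = \<infinity>" "s \<noteq> 0" | "0 < u" "0 < s" "s < 1" "\<phi> u < \<infinity>"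
    using u s by (metis antisym_conv1 infinity_ennreal_def less_top)
  then show ?thesis
  proof cases
    case 1 then show ?thesis using zero by auto
  next
    case 2 then show ?thesis using s by (auto simp: ennreal_mult_eq_top_iff top_unique)
  next
    case 3
    have ub: "ennreal u \<le> finite_bound \<phi>" using 3 by (intro le_finite_bound)
    have ev: "eventually (\<lambda>v. \<phi> (s * u) \<le> ennreal s * \<phi> u + \<phi> v) (at_right 0)"
    proof (rule eventually_at_rightI)
      show "0 < s * u" using 3 by simp
      fix v assume v: "v \<in> {0<..<s * u}"
      have vu: "v < u" using v 3 by (auto intro: order.strict_trans2 simp: mult_le_cancel_right1)
      define r where "r = (s * u - v) / (u - v)"
      have r: "0 \<le> r" "r \<le> s" "r \<le> 1"
      proof -
        show "0 \<le> r" using v vu by (auto simp: r_def)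
        have "s * v \<le> 1 * v" using v 3 by (intro mult_right_mono) auto
        then have "s * u - v \<le> s * (u - v)" by (auto simp: algebra_simps)
        then show "r \<le> s" using vu by (simp add: r_def divide_le_eq)
        then show "r \<le> 1" using 3 by simp
      qed
      have "ennreal v \<le> finite_bound \<phi>" using ub vu v by (meson ennreal_leI less_imp_le order_trans)
      with conv[of v u r] have "\<phi> ((1 - r) * v + r * u) \<le> ennreal (1 - r) * \<phi> v + ennreal r * \<phi> u"
        using v r ub 3 by auto
      moreover have "r * (u - v) = s * u - v" using vu by (simp add: r_def)
      then have "(1 - r) * v + r * u = s * u" by (simp add: algebra_simps)
      moreover have "ennreal (1 - r) * \<phi> v \<le> 1 * \<phi> v" using r by (intro mult_right_mono) (auto simp: ennreal_le_1)
      moreover have "ennreal r * \<phi> u \<le> ennreal s * \<phi> u" using r by (intro mult_right_mono) (auto intro: ennreal_leI)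
      ultimately show "\<phi> (s * u) \<le> ennreal s * \<phi> u + \<phi> v"
        by (metis add.commute add_mono mult_1 order_trans)
    qed
    have "((\<lambda>v. ennreal s * \<phi> u + \<phi> v) \<longlongrightarrow> ennreal s * \<phi> u + 0) (at_right 0)"
      by (intro tendsto_intros lim)
    from tendsto_lowerbound[OF this ev] show ?thesis by simp
  qed
qed

lemma orlicz_mono:
  assumes "orlicz_function \<phi>" "0 \<le> u" "u \<le> v" shows "\<phi> u \<le> \<phi> v"
proof (cases "v = 0")
  case False
  then have "\<phi> (u / v * v) \<le> ennreal (u / v) * \<phi> v"
    using assms by (intro orlicz_scale) auto
  also have "\<dots> \<le> 1 * \<phi> v" using assms False by (intro mult_right_mono) (auto simp: ennreal_le_1)
  finally show ?thesis using False by simp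
qed (use assms in auto)

lemma orlicz_zero: "orlicz_function \<phi> \<Longrightarrow> \<phi> 0 = 0"
  by (simp add: orlicz_function_def)

lemma orlicz_convex:
  assumes \<phi>: "orlicz_function \<phi>" and u: "0 \<le> u" "0 \<le> v" and s: "0 \<le> s" "s \<le> 1"
  shows "\<phi> ((1 - s) * u + s * v) \<le> ennreal (1 - s) * \<phi> u + ennreal s * \<phi> v"
proof -
  consider "u = 0" | "v = 0" | "s = 0 \<or> s = 1" | "\<phi> u = \<infinity>" "s < 1" | "\<phi> v = \<infinity>" "0 < s"
    | "0 < u" "0 < v" "\<phi> u < \<infinity>" "\<phi> v < \<infinity>"
    using u s by (metis antisym_conv1 infinity_ennreal_def less_top)
  then show ?thesis
  proof cases
    case 1 then show ?thesis using orlicz_scale[OF \<phi>, of v s] u s by (simp add: orlicz_zero[OF \<phi>])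
  next
    case 2 then show ?thesis using orlicz_scale[OF \<phi>, of u "1 - s"] u s by (simp add: orlicz_zero[OF \<phi>])
  next
    case 3 then show ?thesis by auto
  next
    case 4 then show ?thesis by (auto simp: ennreal_mult_eq_top_iff)
  next
    case 5 then show ?thesis by (auto simp: ennreal_mult_eq_top_iff)
  next
    case 6
    then show ?thesis using \<phi> s le_finite_bound[of u \<phi>] le_finite_bound[of v \<phi>]
      unfolding orlicz_function_def by auto
  qed
qed

text \<open>Left continuity is part of the definition up to the finite bound only; beyond it the function is
  infinite to the left of \<open>u\<close> as well.\<close>

lemma orlicz_left_continuous:
  assumes \<phi>: "orlicz_function \<phi>" and u: "0 < u" and le: "\<And>v. 0 < v \<Longrightarrow> v < u \<Longrightarrow> \<phi> v \<le> c"
  shows "\<phi> u \<le> c"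
proof (cases "ennreal u \<le> finite_bound \<phi>")
  case True
  then have "continuous (at_left u) \<phi>" using \<phi> u by (auto simp: orlicz_function_def)
  then have "(\<phi> \<longlongrightarrow> \<phi> u) (at_left u)" by (simp add: continuous_within)
  moreover have "eventually (\<lambda>v. \<phi> v \<le> c) (at_left u)"
    using u le by (intro eventually_at_leftI[of 0]) auto
  ultimately show ?thesis by (intro tendsto_upperbound) auto
next
  case False
  then have "finite_bound \<phi> < ennreal u" by simp
  then obtain d where d: "finite_bound \<phi> < d" "d < ennreal u" using dense by blast
  then obtain v where v: "d = ennreal v" "0 \<le> v" by (cases d) auto
  have "0 < v" using d v by (metis ennreal_0 not_less_zero order_le_less)
  moreover have "v < u" using d v by (simp add: ennreal_less_iff)
  moreover have "\<phi> v = \<infinity>" using le_finite_bound[of v \<phi>] \<open>0 < v\<close> d v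
    by (metis infinity_ennreal_def leD less_top)
  ultimately show ?thesis using le[of v] by (simp add: top_unique)
qed

lemma orlicz_finite_somewhere:
  assumes "orlicz_function \<phi>" shows "\<exists>u>0. \<phi> u < \<infinity>"
proof -
  have "(\<phi> \<longlongrightarrow> 0) (at_right 0)" using assms by (simp add: orlicz_function_def)
  then have "eventually (\<lambda>u. \<phi> u < \<infinity>) (at_right 0)" by (rule order_tendstoD) simp
  then show ?thesis unfolding eventually_at_right_field by (meson dense)
qed

lemma orlicz_lower_line:
  assumes "orlicz_function \<phi>" "0 < u" "u \<le> v" shows "ennreal (v / u) * \<phi> u \<le> \<phi> v"
proof -
  have "\<phi> (u / v * v) \<le> ennreal (u / v) * \<phi> v" using assms by (intro orlicz_scale) auto
  then have "ennreal (v / u) * \<phi> u \<le> ennreal (v / u) * (ennreal (u / v) * \<phi> v)"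
    using assms by (intro mult_left_mono) auto
  also have "\<dots> = \<phi> v" using assms by (simp add: mult.assoc[symmetric] ennreal_mult[symmetric])
  finally show ?thesis .
qed

lemma orlicz_unbounded:
  assumes \<phi>: "orlicz_function \<phi>" and c: "c < \<infinity>" shows "\<exists>u>0. c < \<phi> u"
proof -
  obtain u where u: "0 \<le> u" "\<phi> u \<noteq> 0" using \<phi> by (auto simp: orlicz_function_def)
  then have u0: "0 < u" using orlicz_zero[OF \<phi>] by (cases "u = 0") auto
  obtain c' where c': "c = ennreal c'" "0 \<le> c'" using c by (cases c) auto
  show ?thesis
  proof (cases "\<phi> u")
    case (real d)
    then have d: "0 < d" using u by auto
    define r where "r = (c' + 1) / d + 1"
    have r: "1 \<le> r" "c' < r * d" using c' d by (auto simp: r_def field_simps add_pos_nonneg)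
    have "ennreal (r * d) \<le> \<phi> (r * u)"
      using orlicz_lower_line[OF \<phi> u0, of "r * u"] r u0 real d by (simp add: ennreal_mult)
    moreover have "c < ennreal (r * d)" using c' r by (simp add: ennreal_less_iff)
    ultimately show ?thesis using r u0 by (intro exI[of _ "r * u"]) auto
  next
    case top then show ?thesis using c u0 by (intro exI[of _ u]) auto
  qed
qed

lemma finite_bound_pos: "orlicz_function \<phi> \<Longrightarrow> 0 < finite_bound \<phi>"
  using orlicz_finite_somewhere[of \<phi>] le_finite_bound[of _ \<phi>]
  by (metis ennreal_less_zero_iff order_less_le_trans)

lemma orlicz_finite_below:
  assumes "orlicz_function \<phi>" "0 \<le> u" "ennreal u < finite_bound \<phi>" shows "\<phi> u < \<infinity>"
  using finite_below_finite_bound[OF assms] orlicz_mono[OF assms(1,2)] by (meson less_imp_le order_le_less_trans)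

lemma orlicz_zero_below:
  assumes "orlicz_function \<phi>" "0 \<le> u" "ennreal u < zero_bound \<phi>" shows "\<phi> u = 0"
proof -
  from assms(3) obtain v where v: "ennreal u < ennreal v" "0 \<le> v" "\<phi> v = 0"
    unfolding zero_bound_def less_Sup_iff by auto
  then have "u \<le> v" using assms by (auto simp: ennreal_less_iff)
  then show ?thesis using orlicz_mono[OF assms(1,2), of v] v by simp
qed

lemma le_zero_bound: "0 \<le> u \<Longrightarrow> \<phi> u = 0 \<Longrightarrow> ennreal u \<le> zero_bound \<phi>"
  unfolding zero_bound_def by (rule Sup_upper) auto

lemma zero_bound_finite: assumes "orlicz_function \<phi>" shows "zero_bound \<phi> < \<infinity>"
proof -
  obtain u where u: "0 \<le> u" "\<phi> u \<noteq> 0" using assms by (auto simp: orlicz_function_def)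
  then have "\<not> ennreal u < zero_bound \<phi>" using orlicz_zero_below[OF assms] by blast
  then show ?thesis by (metis ennreal_less_top infinity_ennreal_def linorder_neqE order_less_trans not_less_iff_gr_or_eq)
qed

lemma zero_bound_le_finite_bound:
  assumes "orlicz_function \<phi>" shows "zero_bound \<phi> \<le> finite_bound \<phi>"
proof -
  have "ennreal u \<le> finite_bound \<phi>" if "0 \<le> u" "\<phi> u = 0" for u
    using le_finite_bound[of u \<phi>] that by (cases "u = 0") auto
  then show ?thesis unfolding zero_bound_def by (auto intro!: Sup_least)
qed

lemma e2ennreal_le_iff: "e2ennreal x \<le> c \<longleftrightarrow> x \<le> enn2ereal c"
proof (cases "0 \<le> x")
  case True
  then show ?thesis by (metis e2ennreal_enn2ereal e2ennreal_mono enn2ereal_e2ennreal less_eq_ennreal.rep_eq)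
next
  case False
  then have "x \<le> 0" by simp
  then show ?thesis using enn2ereal_nonneg[of c] e2ennreal_neg[of x] order_trans[of x 0] by auto
qed

text \<open>Stated with a sum on the right, Young's inequality needs no subtraction of infinite values.\<close>

lemma complementary_le_iff:
  "complementary M t u \<le> c \<longleftrightarrow> (\<forall>v>0. ennreal (u * v) \<le> M t v + c)"
proof -
  have "ereal a - enn2ereal m \<le> enn2ereal c \<longleftrightarrow> ennreal a \<le> m + c" for a m
  proof (cases m; cases c)
    fix r s assume rs: "m = ennreal r" "0 \<le> r" "c = ennreal s" "0 \<le> s"
    then have "ereal a - enn2ereal m \<le> enn2ereal c \<longleftrightarrow> a \<le> r + s"
      by (simp add: enn2ereal_ennreal) linarith
    also have "\<dots> \<longleftrightarrow> ennreal a \<le> ennreal (r + s)" using rs by (simp add: ennreal_le_iff del: ennreal_plus)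
    finally show ?thesis using rs by (simp only: ennreal_plus)
  qed auto
  then show ?thesis unfolding complementary_def e2ennreal_le_iff SUP_le_iff by (simp add: Ball_def)
qed

lemma young_inequality: "0 < v \<Longrightarrow> ennreal (u * v) \<le> M t v + complementary M t u"
  using complementary_le_iff[of M t u "complementary M t u"] by simp

text \<open>The complementary function vanishes at \<open>u\<close> exactly when the line of slope \<open>u\<close> through the
  origin stays below \<open>M t\<close>. So its zero bound is the greatest such slope.\<close>

lemma slope_le:
  assumes "0 < v" shows "zero_bound (complementary M t) * ennreal v \<le> M t v"
proof -
  have "zero_bound (complementary M t) \<le> M t v / ennreal v"
    unfolding zero_bound_def
  proof (rule Sup_least)
    fix x assume "x \<in> {ennreal u |u. 0 \<le> u \<and> complementary M t u = 0}"
    then obtain u where u: "x = ennreal u" "0 \<le> u" "complementary M t u \<le> 0" by auto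
    then have "ennreal (u * v) \<le> M t v + 0" using assms complementary_le_iff[of M t u 0] by blast
    then have "x * ennreal v \<le> M t v" using assms u by (simp add: ennreal_mult)
    then show "x \<le> M t v / ennreal v"
      using assms by (metis divide_right_mono_ennreal ennreal_mult_divide_eq ennreal_neq_top ennreal_eq_zero_iff less_le_not_le)
  qed
  then have "zero_bound (complementary M t) * ennreal v \<le> M t v / ennreal v * ennreal v"
    by (rule mult_right_mono) simp
  then show ?thesis using assms by (simp add: ennreal_divide_times ennreal_mult_divide_eq)
qed

lemma le_slope:
  assumes "0 \<le> u" "\<And>v. 0 < v \<Longrightarrow> ennreal (u * v) \<le> M t v"
  shows "ennreal u \<le> zero_bound (complementary M t)"
  using assms complementary_le_iff[of M t u 0] by (intro le_zero_bound) auto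

lemma complementary_zero_iff:
  "0 \<le> u \<Longrightarrow> complementary M t u = 0 \<longleftrightarrow> ennreal u \<le> zero_bound (complementary M t)"
proof
  assume u: "0 \<le> u" and le: "ennreal u \<le> zero_bound (complementary M t)"
  have "ennreal (u * v) \<le> M t v" if "0 < v" for v
    using mult_right_mono[OF le, of "ennreal v"] slope_le[OF that, of M t] u that
    by (auto simp: ennreal_mult)
  then show "complementary M t u = 0" using complementary_le_iff[of M t u 0] by auto
qed (rule le_zero_bound)

lemma slope_finite:
  assumes "orlicz_function (M t)" shows "zero_bound (complementary M t) < \<infinity>"
proof -
  obtain v where v: "0 < v" "M t v < \<infinity>" using orlicz_finite_somewhere[OF assms] by auto
  then have "zero_bound (complementary M t) * ennreal v < \<infinity>" using slope_le[of v M t] by (meson order_le_less_trans)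
  then show ?thesis using v by (auto simp: ennreal_mult_less_top)
qed

lemma slope_greatest:
  assumes \<phi>: "orlicz_function (M t)"
    and c: "\<And>v. 0 < v \<Longrightarrow> c * ennreal v \<le> M t v"
  shows "c \<le> zero_bound (complementary M t)"
proof (cases c)
  case (real r)
  then show ?thesis using le_slope[of r M t] c by (auto simp: ennreal_mult)
next
  case top
  obtain v where v: "0 < v" "M t v < \<infinity>" using orlicz_finite_somewhere[OF \<phi>] by auto
  then show ?thesis using c[of v] top by (auto simp: ennreal_top_mult top_unique)
qed

section \<open>Measurability\<close>

text \<open>By completeness, measurability of functions of \<open>t\<close> may be checked on formulas that are valid only
  where \<open>M t\<close> is an Orlicz function.\<close>

lemma (in complete_measure) borel_measurable_AE_eq:
  fixes f g :: "'a \<Rightarrow> 'b::topological_space"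
  assumes f: "f \<in> borel_measurable M" and eq: "AE t in M. f t = g t"
  shows "g \<in> borel_measurable M"
proof (rule measurableI)
  fix A :: "'b set" assume A: "A \<in> sets borel"
  show "g -` A \<inter> space M \<in> sets M"
  proof (rule in_sets_AE)
    show "f -` A \<inter> space M \<in> sets M" using f A by (rule measurable_sets)
    show "AE x in M. (x \<in> f -` A \<inter> space M) = (x \<in> g -` A \<inter> space M)"
      using eq by eventually_elim auto
  qed auto
qed auto

abbreviation pos_rats :: "real set" where "pos_rats \<equiv> {u \<in> \<rat>. 0 < u}"

lemma countable_pos_rats: "countable pos_rats"
  by (rule countable_subset[OF _ countable_rat]) auto

lemma pos_rat_between: assumes "a < b" "0 < b" obtains r where "r \<in> pos_rats" "a < r" "r < b"
proof -
  have "max a 0 < b" using assms by simp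
  then obtain r where "r \<in> \<rat>" "max a 0 < r" "r < b" using Rats_dense_in_real by blast
  then show thesis using that by auto
qed

lemma ennreal_le_left:
  assumes "0 < u" "\<And>v. 0 < v \<Longrightarrow> v < u \<Longrightarrow> ennreal v \<le> c"
  shows "ennreal u \<le> c"
proof (rule dense_le_bounded[of 0])
  fix z assume z: "0 < z" "z < ennreal u"
  then obtain v where v: "z = ennreal v" "0 \<le> v" by (cases z) auto
  then show "z \<le> c" using assms z by (auto simp: ennreal_less_iff)
qed (use assms in auto)

locale musielak_orlicz_space = sigma_finite_measure \<mu> + complete_measure \<mu> for \<mu> :: "'a measure" +
  fixes M :: "'a \<Rightarrow> real \<Rightarrow> ennreal"
  assumes musielak_orlicz: "musielak_orlicz \<mu> M"
begin

lemma AE_orlicz: "AE t in \<mu>. orlicz_function (M t)"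
  using musielak_orlicz by (simp add: musielak_orlicz_def)

lemma measurable_section[measurable]: "0 \<le> u \<Longrightarrow> (\<lambda>t. M t u) \<in> borel_measurable \<mu>"
  using musielak_orlicz by (simp add: musielak_orlicz_def)

text \<open>Left continuity writes the superposition as a countable supremum of sections at rational
  points.\<close>

lemma measurable_superposition[measurable]:
  fixes x :: "'a \<Rightarrow> real"
  assumes [measurable]: "x \<in> borel_measurable \<mu>"
  shows "(\<lambda>t. M t \<bar>x t\<bar>) \<in> borel_measurable \<mu>"
proof (rule borel_measurable_AE_eq)
  have [measurable]: "\<And>r. r \<in> pos_rats \<Longrightarrow> (\<lambda>t. M t r) \<in> borel_measurable \<mu>" by auto
  show "(\<lambda>t. SUP r\<in>pos_rats. if r < \<bar>x t\<bar> then M t r else 0) \<in> borel_measurable \<mu>"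
    by (rule borel_measurable_SUP[OF countable_pos_rats]) measurable
  show "AE t in \<mu>. (SUP r\<in>pos_rats. if r < \<bar>x t\<bar> then M t r else 0) = M t \<bar>x t\<bar>"
    using AE_orlicz
  proof eventually_elim
    case (elim t)
    note \<phi> = elim
    show ?case
    proof (rule antisym)
      show "(SUP r\<in>pos_rats. if r < \<bar>x t\<bar> then M t r else 0) \<le> M t \<bar>x t\<bar>"
        by (rule SUP_least) (auto intro: orlicz_mono[OF \<phi>])
      show "M t \<bar>x t\<bar> \<le> (SUP r\<in>pos_rats. if r < \<bar>x t\<bar> then M t r else 0)"
      proof (cases "x t = 0")
        case False
        show ?thesis
        proof (rule orlicz_left_continuous[OF \<phi>])
          fix v assume v: "0 < v" "v < \<bar>x t\<bar>"
          then obtain r where r: "r \<in> pos_rats" "v < r" "r < \<bar>x t\<bar>" using pos_rat_between[of v "\<bar>x t\<bar>"] by (metis order_less_trans)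
          have "M t v \<le> (if r < \<bar>x t\<bar> then M t r else 0)" using r v by (auto intro: orlicz_mono[OF \<phi>])
          also have "\<dots> \<le> (SUP r\<in>pos_rats. if r < \<bar>x t\<bar> then M t r else 0)" by (rule SUP_upper[OF r(1)])
          finally show "M t v \<le> (SUP r\<in>pos_rats. if r < \<bar>x t\<bar> then M t r else 0)" .
        qed (use False in auto)
      qed (simp add: orlicz_zero[OF \<phi>])
    qed
  qed
qed

lemma measurable_superposition_nonneg:
  fixes x :: "'a \<Rightarrow> real"
  assumes x: "x \<in> borel_measurable \<mu>" "\<And>t. 0 \<le> x t"
  shows "(\<lambda>t. M t (x t)) \<in> borel_measurable \<mu>"
  using measurable_superposition[OF x(1)] x(2) by simp

text \<open>\<open>flat\<close> is the function \<open>a\<^sub>M\<close>, \<open>bound\<close> is \<open>b\<^sub>M\<close>, and \<open>slope\<close> is \<open>a\<^sub>N\<close> for the complementary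
  function \<open>N\<close>.\<close>

definition bound where "bound t = finite_bound (M t)"
definition slope where "slope t = zero_bound (complementary M t)"
definition flat where "flat t = zero_bound (M t)"

lemma measurable_Sup_of_sections:
  assumes P: "\<And>r. r \<in> pos_rats \<Longrightarrow> Measurable.pred \<mu> (\<lambda>t. P (M t r))"
    and mono: "\<And>t u v. orlicz_function (M t) \<Longrightarrow> 0 < u \<Longrightarrow> u \<le> v \<Longrightarrow> P (M t v) \<Longrightarrow> P (M t u)"
  shows "(\<lambda>t. Sup {ennreal u |u. 0 < u \<and> P (M t u)}) \<in> borel_measurable \<mu>"
proof (rule borel_measurable_AE_eq)
  note P[measurable]
  show "(\<lambda>t. SUP r\<in>pos_rats. if P (M t r) then ennreal r else 0) \<in> borel_measurable \<mu>"
    by (rule borel_measurable_SUP[OF countable_pos_rats]) measurable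
  show "AE t in \<mu>. (SUP r\<in>pos_rats. if P (M t r) then ennreal r else 0) = Sup {ennreal u |u. 0 < u \<and> P (M t u)}"
    using AE_orlicz
  proof eventually_elim
    case (elim t)
    show ?case (is "?S = _")
    proof (rule antisym)
      show "?S \<le> Sup {ennreal u |u. 0 < u \<and> P (M t u)}"
        by (rule SUP_least) (auto intro!: Sup_upper)
      show "Sup {ennreal u |u. 0 < u \<and> P (M t u)} \<le> ?S"
      proof (rule Sup_least, clarify)
        fix u assume u: "0 < u" "P (M t u)"
        show "ennreal u \<le> ?S"
        proof (rule ennreal_le_left[OF u(1)])
          fix v assume v: "0 < v" "v < u"
          then obtain r where r: "r \<in> pos_rats" "v < r" "r < u" using pos_rat_between[of v u] by auto
          have "P (M t r)" using mono[OF elim, of r u] r u by auto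
          then have "ennreal v \<le> (if P (M t r) then ennreal r else 0)" using r by (auto intro: ennreal_leI)
          also have "\<dots> \<le> ?S" by (rule SUP_upper[OF r(1)])
          finally show "ennreal v \<le> ?S" .
        qed
      qed
    qed
  qed
qed

lemma measurable_bound[measurable]: "bound \<in> borel_measurable \<mu>"
proof -
  have [measurable]: "\<And>r. r \<in> pos_rats \<Longrightarrow> (\<lambda>t. M t r) \<in> borel_measurable \<mu>" by auto
  show ?thesis unfolding bound_def[abs_def] finite_bound_def
  proof (rule measurable_Sup_of_sections)
    show "Measurable.pred \<mu> (\<lambda>t. M t r < \<infinity>)" if "r \<in> pos_rats" for r using that by measurable
    show "M t u < \<infinity>" if "orlicz_function (M t)" "0 < u" "u \<le> v" "M t v < \<infinity>" for t u v
      using orlicz_mono[OF that(1), of u v] that by (auto intro: order_le_less_trans)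
  qed
qed

lemma measurable_flat[measurable]: "flat \<in> borel_measurable \<mu>"
proof -
  have [measurable]: "\<And>r. r \<in> pos_rats \<Longrightarrow> (\<lambda>t. M t r) \<in> borel_measurable \<mu>" by auto
  have "(\<lambda>t. Sup {ennreal u |u. 0 < u \<and> M t u = 0}) \<in> borel_measurable \<mu>"
  proof (rule measurable_Sup_of_sections[where P="\<lambda>x. x = 0"])
    show "Measurable.pred \<mu> (\<lambda>t. M t r = 0)" if "r \<in> pos_rats" for r using that by measurable
    show "M t u = 0" if "orlicz_function (M t)" "0 < u" "u \<le> v" "M t v = 0" for t u v
      using orlicz_mono[OF that(1), of u v] that by auto
  qed
  moreover have "AE t in \<mu>. Sup {ennreal u |u. 0 < u \<and> M t u = 0} = flat t"
    using AE_orlicz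
  proof eventually_elim
    case (elim t)
    have "{ennreal u |u. 0 \<le> u \<and> M t u = 0} = insert 0 {ennreal u |u. 0 < u \<and> M t u = 0}"
      using orlicz_zero[OF elim] by (force simp: less_le)
    then show ?case unfolding flat_def zero_bound_def by (simp add: Sup_insert bot_ennreal[symmetric])
  qed
  ultimately show ?thesis by (rule borel_measurable_AE_eq)
qed

text \<open>The slope is the infimum of \<open>M t r / r\<close> over the positive rationals \<open>r\<close>.\<close>

lemma measurable_slope[measurable]: "slope \<in> borel_measurable \<mu>"
proof (rule borel_measurable_AE_eq)
  have [measurable]: "\<And>r. r \<in> pos_rats \<Longrightarrow> (\<lambda>t. M t r) \<in> borel_measurable \<mu>" by auto
  show "(\<lambda>t. INF r\<in>pos_rats. M t r / ennreal r) \<in> borel_measurable \<mu>"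
    by (rule borel_measurable_INF[OF countable_pos_rats]) measurable
  show "AE t in \<mu>. (INF r\<in>pos_rats. M t r / ennreal r) = slope t"
    using AE_orlicz
  proof eventually_elim
    case (elim t)
    show ?case (is "?I = _")
    proof (rule antisym)
      show "slope t \<le> ?I"
      proof (rule INF_greatest)
        fix r assume r: "r \<in> pos_rats"
        then show "slope t \<le> M t r / ennreal r"
          using slope_le[of r M t] divide_right_mono_ennreal[of "slope t * ennreal r" "M t r" "ennreal r"]
          by (auto simp: slope_def ennreal_mult_divide_eq)
      qed
      show "?I \<le> slope t" unfolding slope_def
      proof (rule slope_greatest[where M=M and t=t, OF elim])
        fix v :: real assume v: "0 < v"
        have *: "?I * ennreal r \<le> M t v" if r: "r \<in> pos_rats" "r < v" for r
        proof -
          have "?I * ennreal r \<le> M t r / ennreal r * ennreal r" by (intro mult_right_mono INF_lower r) auto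
          also have "\<dots> = M t r" using r by (simp add: ennreal_divide_times)
          also have "\<dots> \<le> M t v" using r by (intro orlicz_mono[OF elim]) auto
          finally show ?thesis .
        qed
        show "?I * ennreal v \<le> M t v"
        proof (cases "?I")
          case (real c)
          show ?thesis
          proof (cases "c = 0")
            case False
            have "ennreal (c * v) \<le> M t v"
            proof (rule ennreal_le_left)
              fix x assume x: "0 < x" "x < c * v"
              then have "x / c < v" using real False by (simp add: field_simps)
              then obtain r where r: "r \<in> pos_rats" "x / c < r" "r < v" using pos_rat_between[of "x/c" v] v by auto
              have "ennreal x \<le> ennreal (c * r)" using r False real by (auto intro!: ennreal_leI simp: field_simps)
              also have "\<dots> \<le> M t v" using *[OF r(1,3)] real r by (simp add: ennreal_mult)
              finally show "ennreal x \<le> M t v" .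
            qed (use False v real in auto)
            then show ?thesis using real v by (simp add: ennreal_mult)
          qed (use real in auto)
        next
          case top
          obtain r where r: "r \<in> pos_rats" "r < v" using pos_rat_between[of 0 v] v by auto
          then show ?thesis using *[OF r] top by (auto simp: ennreal_top_mult top_unique)
        qed
      qed
    qed
  qed
qed

lemma measurable_complementary:
  fixes x :: "'a \<Rightarrow> real"
  assumes [measurable]: "x \<in> borel_measurable \<mu>"
  shows "(\<lambda>t. complementary M t \<bar>x t\<bar>) \<in> borel_measurable \<mu>"
proof (rule borel_measurable_AE_eq)
  have [measurable]: "\<And>r. r \<in> pos_rats \<Longrightarrow> (\<lambda>t. M t r) \<in> borel_measurable \<mu>" by auto
  show "(\<lambda>t. SUP r\<in>pos_rats. ennreal (\<bar>x t\<bar> * r) - M t r) \<in> borel_measurable \<mu>"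
    by (rule borel_measurable_SUP[OF countable_pos_rats]) measurable
  show "AE t in \<mu>. (SUP r\<in>pos_rats. ennreal (\<bar>x t\<bar> * r) - M t r) = complementary M t \<bar>x t\<bar>"
    using AE_orlicz
  proof eventually_elim
    case (elim t)
    show ?case (is "?S = _")
    proof (rule antisym)
      show "?S \<le> complementary M t \<bar>x t\<bar>"
        by (rule SUP_least) (use young_inequality[of _ "\<bar>x t\<bar>" M t] in \<open>auto simp: ennreal_minus_le_iff\<close>)
      show "complementary M t \<bar>x t\<bar> \<le> ?S"
      proof (subst complementary_le_iff, safe)
        fix v :: real assume v: "0 < v"
        have *: "ennreal (\<bar>x t\<bar> * r) \<le> M t v + ?S" if r: "r \<in> pos_rats" "r < v" for r
        proof -
          have "ennreal (\<bar>x t\<bar> * r) - M t r \<le> ?S" by (rule SUP_upper[OF r(1)])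
          then have "ennreal (\<bar>x t\<bar> * r) \<le> M t r + ?S" by (auto simp: ennreal_minus_le_iff)
          also have "\<dots> \<le> M t v + ?S" using r by (intro add_right_mono orlicz_mono[OF elim]) auto
          finally show ?thesis .
        qed
        show "ennreal (\<bar>x t\<bar> * v) \<le> M t v + ?S"
        proof (cases "x t = 0")
          case False
          show ?thesis
          proof (rule ennreal_le_left)
            fix z assume z: "0 < z" "z < \<bar>x t\<bar> * v"
            then have "z / \<bar>x t\<bar> < v" using False by (simp add: field_simps)
            then obtain r where r: "r \<in> pos_rats" "z / \<bar>x t\<bar> < r" "r < v" using pos_rat_between[of "z/\<bar>x t\<bar>" v] v by auto
            have "ennreal z \<le> ennreal (\<bar>x t\<bar> * r)" using r False by (auto intro!: ennreal_leI simp: field_simps)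
            also have "\<dots> \<le> M t v + ?S" using *[OF r(1,3)] .
            finally show "ennreal z \<le> M t v + ?S" .
          qed (use False v in auto)
        qed simp
      qed
    qed
  qed
qed

section \<open>The modular\<close>

text \<open>The modular on real valued functions. All members of the spaces below are finite a.e., so the
  arguments can be carried out on real representatives.\<close>

definition rho :: "('a \<Rightarrow> real) \<Rightarrow> ennreal" where "rho x = (\<integral>\<^sup>+ t. M t \<bar>x t\<bar> \<partial>\<mu>)"

lemma modular_eq_rho: "modular \<mu> M (\<lambda>t. ereal (x t)) = rho x"
  by (simp add: modular_def rho_def)

lemma rho_mono: "AE t in \<mu>. \<bar>x t\<bar> \<le> \<bar>y t\<bar> \<Longrightarrow> rho x \<le> rho y"
proof -
  assume "AE t in \<mu>. \<bar>x t\<bar> \<le> \<bar>y t\<bar>"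
  with AE_orlicz have "AE t in \<mu>. M t \<bar>x t\<bar> \<le> M t \<bar>y t\<bar>" by eventually_elim (auto intro: orlicz_mono)
  then show ?thesis unfolding rho_def by (rule nn_integral_mono_AE)
qed

lemma rho_convex:
  assumes [measurable]: "x \<in> borel_measurable \<mu>" "y \<in> borel_measurable \<mu>" and s: "0 \<le> s" "s \<le> 1"
    and z: "AE t in \<mu>. \<bar>z t\<bar> \<le> (1 - s) * \<bar>x t\<bar> + s * \<bar>y t\<bar>"
  shows "rho z \<le> ennreal (1 - s) * rho x + ennreal s * rho y"
proof -
  have "rho z \<le> (\<integral>\<^sup>+ t. ennreal (1 - s) * M t \<bar>x t\<bar> + ennreal s * M t \<bar>y t\<bar> \<partial>\<mu>)"
    unfolding rho_def
  proof (intro nn_integral_mono_AE)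
    show "AE t in \<mu>. M t \<bar>z t\<bar> \<le> ennreal (1 - s) * M t \<bar>x t\<bar> + ennreal s * M t \<bar>y t\<bar>"
      using AE_orlicz z
    proof eventually_elim
      case (elim t)
      then show ?case
        using orlicz_mono[OF elim(1) _ elim(2)] orlicz_convex[OF elim(1), of "\<bar>x t\<bar>" "\<bar>y t\<bar>" s] s by auto
    qed
  qed
  also have "\<dots> = ennreal (1 - s) * rho x + ennreal s * rho y"
    unfolding rho_def by (simp add: nn_integral_add nn_integral_cmult)
  finally show ?thesis .
qed

lemma rho_zero: "rho (\<lambda>t. 0) = 0"
proof -
  have "AE t in \<mu>. M t \<bar>0\<bar> = 0" using AE_orlicz by eventually_elim (simp add: orlicz_zero)
  then show ?thesis unfolding rho_def by (simp add: nn_integral_0_iff_AE)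
qed

lemma rho_scale:
  assumes [measurable]: "x \<in> borel_measurable \<mu>" and s: "0 \<le> s" "s \<le> 1"
  shows "rho (\<lambda>t. s * x t) \<le> ennreal s * rho x"
  using rho_convex[of "\<lambda>t. 0" x s "\<lambda>t. s * x t"] s by (simp add: rho_zero abs_mult)

end

context musielak_orlicz_space
begin

text \<open>The condition that the Daugavet property imposes on the operator \<open>z \<mapsto> - (\<integral>g z) x\<close>: the
  norm of \<open>z - (\<integral>g z) x\<close> comes arbitrarily close to \<open>2\<close> on the unit ball. Here \<open>1 < rho (y / c)\<close> means
  that \<open>y\<close> has Luxemburg norm above \<open>c\<close>.\<close>

definition slice_property :: "('a \<Rightarrow> real) \<Rightarrow> ('a \<Rightarrow> real) \<Rightarrow> bool" where
  "slice_property x g \<longleftrightarrow> (\<forall>c. 0 < c \<longrightarrow> c < 2 \<longrightarrow>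
     (\<exists>z\<in>borel_measurable \<mu>. rho z \<le> 1 \<and> 1 < rho (\<lambda>t. (z t - (\<integral>s. g s * z s \<partial>\<mu>) * x t) / c)))"

text \<open>If \<open>\<bar>s\<bar> = \<bar>\<integral>g z\<bar> \<le> c - 1\<close>, then \<open>(z - s x) / c\<close> is dominated by a convex combination of \<open>z\<close> and
  \<open>x\<close> and has modular at most \<open>1\<close>. So the \<open>z\<close> provided by the slice property nearly norms \<open>g\<close>, up to
  its sign.\<close>

lemma slice_property_oriented:
  assumes slice: "slice_property x g" and x[measurable]: "x \<in> borel_measurable \<mu>" "rho x \<le> 1"
    and c: "0 < c" "c < 2"
  obtains z where "z \<in> borel_measurable \<mu>" "rho z \<le> 1" "c - 1 < (\<integral>s. g s * z s \<partial>\<mu>)"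
    "1 < rho (\<lambda>t. (z t - (\<integral>s. g s * z s \<partial>\<mu>) * x t) / c)"
proof -
  obtain z where z[measurable]: "z \<in> borel_measurable \<mu>" "rho z \<le> 1"
      and h: "1 < rho (\<lambda>t. (z t - (\<integral>s. g s * z s \<partial>\<mu>) * x t) / c)"
    using slice c unfolding slice_property_def by blast
  define s where "s = (\<integral>s. g s * z s \<partial>\<mu>)"
  have "c - 1 < \<bar>s\<bar>"
  proof (rule ccontr)
    assume "\<not> c - 1 < \<bar>s\<bar>"
    then have s: "1 + \<bar>s\<bar> \<le> c" by simp
    define \<tau> where "\<tau> = \<bar>s\<bar> / (1 + \<bar>s\<bar>)"
    have tau: "0 \<le> \<tau>" "\<tau> \<le> 1" "1 - \<tau> = 1 / (1 + \<bar>s\<bar>)" by (auto simp: \<tau>_def field_simps)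
    have "rho (\<lambda>t. (z t - s * x t) / c) \<le> ennreal (1 - \<tau>) * rho z + ennreal \<tau> * rho x"
    proof (rule rho_convex)
      have "\<bar>(z t - s * x t) / c\<bar> \<le> (1 - \<tau>) * \<bar>z t\<bar> + \<tau> * \<bar>x t\<bar>" for t
      proof -
        have "\<bar>(z t - s * x t) / c\<bar> \<le> (\<bar>z t\<bar> + \<bar>s\<bar> * \<bar>x t\<bar>) / c"
          using c by (auto simp: abs_mult[symmetric] intro!: divide_right_mono)
        also have "\<dots> \<le> (\<bar>z t\<bar> + \<bar>s\<bar> * \<bar>x t\<bar>) / (1 + \<bar>s\<bar>)"
          using s c by (intro divide_left_mono) auto
        also have "\<dots> = (1 - \<tau>) * \<bar>z t\<bar> + \<tau> * \<bar>x t\<bar>"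
          unfolding tau(3) by (simp add: \<tau>_def add_divide_distrib)
        finally show ?thesis .
      qed
      then show "AE t in \<mu>. \<bar>(z t - s * x t) / c\<bar> \<le> (1 - \<tau>) * \<bar>z t\<bar> + \<tau> * \<bar>x t\<bar>" by simp
    qed (use tau in auto)
    also have "\<dots> \<le> ennreal (1 - \<tau>) * 1 + ennreal \<tau> * 1"
      using z x by (intro add_mono mult_left_mono) auto
    also have "\<dots> = 1" using tau by (simp add: ennreal_plus[symmetric] del: ennreal_plus)
    finally show False using h by (simp add: s_def)
  qed
  show thesis
  proof (cases "0 \<le> s")
    case True
    then show thesis using that[of z] z h \<open>c - 1 < \<bar>s\<bar>\<close> by (auto simp: s_def)
  next
    case False
    have "(\<integral>s. g s * - z s \<partial>\<mu>) = - s" by (simp add: s_def)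
    moreover have "rho (\<lambda>t. - z t) = rho z" by (simp add: rho_def)
    moreover have "rho (\<lambda>t. (- z t - - s * x t) / c) = rho (\<lambda>t. (z t - s * x t) / c)"
    proof -
      have "\<bar>(- z t - - s * x t) / c\<bar> = \<bar>(z t - s * x t) / c\<bar>" for t by (simp add: abs_minus_commute)
      then show ?thesis by (simp only: rho_def)
    qed
    ultimately show thesis using that[of "\<lambda>t. - z t"] z h \<open>c - 1 < \<bar>s\<bar>\<close> False by (auto simp: s_def)
  qed
qed

text \<open>The engine of the converse direction. Suppose that on a set \<open>G\<close> the convexity estimate for
  \<open>\<theta> (z - s x)\<close> loses the amount \<open>k\<close> as soon as the value \<open>z\<close> is good, and that functions which nearly
  norm \<open>g\<close> take bad values only on a small part of \<open>G\<close>. The slice property provides such a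
  function with \<open>rho (\<theta> (z - s x)) > 1\<close> for \<open>\<theta> = (1 + \<delta>) / 2\<close>, while convexity bounds this
  modular by \<open>1 + O(\<delta>)\<close> minus \<open>k\<close> times the measure of the good part of \<open>G\<close>. This is impossible for small
  \<open>\<delta>\<close>.\<close>

lemma slice_property_loss:
  fixes k th l C :: real and good :: "'a \<Rightarrow> real \<Rightarrow> bool"
  assumes x[measurable]: "x \<in> borel_measurable \<mu>" and x0: "\<And>t. 0 \<le> x t" and rx: "rho x = 1"
    and l: "1 < l" "rho (\<lambda>t. l * x t) < \<infinity>"
    and dual: "\<And>z. z \<in> borel_measurable \<mu> \<Longrightarrow> rho z \<le> 1 \<Longrightarrow> \<bar>\<integral>t. g t * z t \<partial>\<mu>\<bar> \<le> 1"
    and slice: "slice_property x g"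
    and G[measurable]: "G \<in> sets \<mu>" and mG: "0 < emeasure \<mu> G" "emeasure \<mu> G < \<infinity>"
    and k: "0 < k" and th: "1/2 < th" and C: "0 \<le> C"
    and loss: "AE t in \<mu>. t \<in> G \<longrightarrow> (\<forall>\<theta> s z. 1/2 \<le> \<theta> \<longrightarrow> \<theta> \<le> th \<longrightarrow> 0 \<le> s \<longrightarrow> s \<le> 1 \<longrightarrow> good t z \<longrightarrow>
        M t \<bar>\<theta> * (z - s * x t)\<bar> + ennreal k \<le> ennreal \<theta> * (M t \<bar>z\<bar> + M t (x t)))"
    and good[measurable]: "\<And>z. z \<in> borel_measurable \<mu> \<Longrightarrow> {t\<in>G. good t (z t)} \<in> sets \<mu>"
    and bad: "\<And>z e. z \<in> borel_measurable \<mu> \<Longrightarrow> rho z \<le> 1 \<Longrightarrow> 0 < e \<Longrightarrow> 1 - e \<le> (\<integral>t. g t * z t \<partial>\<mu>) \<Longrightarrow>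
        measure \<mu> {t\<in>G. \<not> good t (z t)} \<le> C * e"
  shows False
proof -
  define K where "K = enn2real (rho (\<lambda>t. l * x t))"
  have K: "0 \<le> K" "rho (\<lambda>t. l * x t) = ennreal K" using l by (auto simp: K_def)
  define m where "m = measure \<mu> G"
  have m: "0 < m" "emeasure \<mu> G = ennreal m" using mG
    by (auto simp: m_def measure_def enn2real_positive_iff)
  define B where "B = 2 * C * k + 4 * K / (l - 1)"
  have B: "0 \<le> B" using C k K l by (auto simp: B_def)
  \<comment> \<open>B collects the coefficients of \<delta> in the final comparison, which fails when \<delta> B < k m.\<close>
  define \<delta> where "\<delta> = Min {1/2, 2 * th - 1, (l - 1) / 4, k * m / (B + 1) / 2}"
  have \<delta>: "0 < \<delta>" "\<delta> \<le> 1/2" "\<delta> \<le> 2 * th - 1" "4 * \<delta> \<le> l - 1" "\<delta> * B < k * m"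
  proof -
    show "0 < \<delta>" using th l k m B by (auto simp: \<delta>_def)
    show "\<delta> \<le> 1/2" "\<delta> \<le> 2 * th - 1" unfolding \<delta>_def by (rule Min_le; simp)+
    have "\<delta> \<le> (l - 1) / 4" unfolding \<delta>_def by (rule Min_le; simp)+
    then show "4 * \<delta> \<le> l - 1" by simp
    have "\<delta> \<le> k * m / (B + 1) / 2" unfolding \<delta>_def by (rule Min_le; simp)+
    then have "\<delta> * (B + 1) \<le> k * m / 2" using B by (simp add: field_simps)
    moreover have "\<delta> * B \<le> \<delta> * (B + 1)" using \<open>0 < \<delta>\<close> by simp
    moreover have "0 < k * m" using k m by simp
    ultimately show "\<delta> * B < k * m" by linarith
  qed
  define \<theta> where "\<theta> = (1 + \<delta>) / 2"
  \<comment> \<open>Since \<theta> exceeds 1/2, the weights \<theta> and \<theta> are not those of a convex combination; the factor r,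
    slightly above 1, is absorbed into x, and \<sigma> is the position of r between 1 and l.\<close>
  define r where "r = \<theta> / (1 - \<theta>)"
  define \<sigma> where "\<sigma> = (r - 1) / (l - 1)"
  have \<theta>: "1/2 \<le> \<theta>" "\<theta> \<le> th" "\<theta> \<le> 1" "0 < \<theta>" "1 - \<theta> = (1 - \<delta>) / 2" using \<delta> by (auto simp: \<theta>_def field_simps)
  have r: "1 \<le> r" "(1 - \<theta>) * r = \<theta>" "r - 1 \<le> 4 * \<delta>"
  proof -
    have pos: "1/4 \<le> 1 - \<theta>" using \<delta> \<theta>(5) by simp
    show "1 \<le> r" using pos \<theta>(1) by (simp add: r_def)
    show "(1 - \<theta>) * r = \<theta>" using pos by (simp add: r_def)
    have "\<delta> = \<theta> - (1 - \<theta>)" by (simp add: \<theta>_def)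
    moreover have "r - 1 = (\<theta> - (1 - \<theta>)) / (1 - \<theta>)" using pos by (subst diff_divide_distrib) (simp add: r_def)
    ultimately have "r - 1 = \<delta> / (1 - \<theta>)" by simp
    also have "\<dots> \<le> \<delta> / (1/4)" using \<delta> pos by (intro divide_left_mono) auto
    finally show "r - 1 \<le> 4 * \<delta>" by simp
  qed
  have \<sigma>: "0 \<le> \<sigma>" "\<sigma> \<le> 1" "\<sigma> \<le> 4 * \<delta> / (l - 1)" "(1 - \<sigma>) * 1 + \<sigma> * l = r"
  proof -
    show "0 \<le> \<sigma>" "\<sigma> \<le> 1" "\<sigma> \<le> 4 * \<delta> / (l - 1)" using r l \<delta> by (auto simp: \<sigma>_def divide_right_mono)
    have "\<sigma> * (l - 1) = r - 1" using l by (simp add: \<sigma>_def)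
    then show "(1 - \<sigma>) * 1 + \<sigma> * l = r" by (simp add: algebra_simps)
  qed
  have rr: "rho (\<lambda>t. r * x t) \<le> ennreal (1 + \<sigma> * K)"
  proof -
    have "rho (\<lambda>t. r * x t) \<le> ennreal (1 - \<sigma>) * rho x + ennreal \<sigma> * rho (\<lambda>t. l * x t)"
    proof (rule rho_convex)
      have "\<bar>r * x t\<bar> = (1 - \<sigma>) * \<bar>x t\<bar> + \<sigma> * \<bar>l * x t\<bar>" for t
      proof -
        have "\<bar>r * x t\<bar> = ((1 - \<sigma>) * 1 + \<sigma> * l) * x t" using x0[of t] r unfolding \<sigma>(4) by simp
        also have "\<dots> = (1 - \<sigma>) * \<bar>x t\<bar> + \<sigma> * \<bar>l * x t\<bar>" using x0[of t] l by (simp add: algebra_simps)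
        finally show ?thesis .
      qed
      then show "AE t in \<mu>. \<bar>r * x t\<bar> \<le> (1 - \<sigma>) * \<bar>x t\<bar> + \<sigma> * \<bar>l * x t\<bar>" by simp
    qed (use \<sigma> in auto)
    also have "\<dots> = ennreal ((1 - \<sigma>) + \<sigma> * K)" using \<sigma> K rx by (simp add: ennreal_mult)
    also have "\<dots> \<le> ennreal (1 + \<sigma> * K)" using \<sigma> by (intro ennreal_leI) auto
    finally show ?thesis .
  qed
  define c where "c = 2 / (1 + \<delta>)"
  have c: "0 < c" "c < 2" "1 / c = \<theta>" using \<delta> by (auto simp: c_def \<theta>_def field_simps)
  obtain z where z[measurable]: "z \<in> borel_measurable \<mu>" "rho z \<le> 1" and zs: "c - 1 < (\<integral>s. g s * z s \<partial>\<mu>)"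
    and h: "1 < rho (\<lambda>t. (z t - (\<integral>s. g s * z s \<partial>\<mu>) * x t) / c)"
    by (rule slice_property_oriented[OF slice x _ c(1,2)]) (use rx in auto)
  define s where "s = (\<integral>s. g s * z s \<partial>\<mu>)"
  have "1 - 2 * \<delta> \<le> c - 1"
  proof -
    have "(2 - 2 * \<delta>) * (1 + \<delta>) \<le> 2" by (simp add: algebra_simps)
    then show ?thesis using \<delta> by (simp add: c_def field_simps)
  qed
  then have s: "0 \<le> s" "s \<le> 1" "1 - 2 * \<delta> \<le> s" using zs dual[OF z] \<delta> by (auto simp: s_def)
  define A where "A = {t\<in>G. good t (z t)}"
  have [measurable]: "A \<in> sets \<mu>" using good[OF z(1)] by (simp add: A_def)
  have "measure \<mu> (G - A) \<le> C * (2 * \<delta>)"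
  proof -
    have "G - A = {t\<in>G. \<not> good t (z t)}" by (auto simp: A_def)
    then show ?thesis using bad[OF z, of "2 * \<delta>"] s \<delta> by (simp add: s_def)
  qed
  moreover have "measure \<mu> (G - A) = m - measure \<mu> A"
    unfolding m_def by (rule measure_Diff) (use mG in \<open>auto simp: A_def\<close>)
  ultimately have mA: "m - 2 * C * \<delta> \<le> measure \<mu> A" by simp
  have finA: "emeasure \<mu> A = ennreal (measure \<mu> A)"
    by (rule emeasure_eq_ennreal_measure) (metis A_def Collect_subset G emeasure_mono infinity_ennreal_def leD mG(2))
  have AE: "AE t in \<mu>. M t \<bar>(z t - s * x t) / c\<bar> + ennreal k * indicator A t
      \<le> ennreal \<theta> * M t \<bar>z t\<bar> + ennreal (1 - \<theta>) * M t \<bar>r * x t\<bar>"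
    using AE_orlicz loss
  proof eventually_elim
    case (elim t)
    note \<phi> = elim(1)
    have hc: "\<bar>(z t - s * x t) / c\<bar> = \<bar>\<theta> * (z t - s * x t)\<bar>" unfolding c(3)[symmetric] by simp
    show ?case
    proof (cases "t \<in> A")
      case True
      have "ennreal \<theta> * M t (x t) \<le> ennreal (1 - \<theta>) * M t \<bar>r * x t\<bar>"
      proof (cases "x t = 0")
        case False
        have "ennreal (1 - \<theta>) * (ennreal r * M t (x t)) \<le> ennreal (1 - \<theta>) * M t (r * x t)"
          using orlicz_lower_line[OF \<phi>, of "x t" "r * x t"] x0[of t] False r
          by (intro mult_left_mono) auto
        moreover have "ennreal (1 - \<theta>) * (ennreal r * M t (x t)) = ennreal \<theta> * M t (x t)"
        proof -
          have "ennreal \<theta> = ennreal (1 - \<theta>) * ennreal r"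
            using r(1,2) \<theta>(3) ennreal_mult[of "1 - \<theta>" r] by simp
          then show ?thesis by (simp add: mult.assoc)
        qed
        moreover have "\<bar>r * x t\<bar> = r * x t" using r(1) x0[of t] by simp
        ultimately show ?thesis by simp
      qed (simp add: orlicz_zero[OF \<phi>])
      moreover have "M t \<bar>\<theta> * (z t - s * x t)\<bar> + ennreal k \<le> ennreal \<theta> * (M t \<bar>z t\<bar> + M t (x t))"
        using elim(2) True \<theta> s by (auto simp: A_def)
      ultimately have "M t \<bar>\<theta> * (z t - s * x t)\<bar> + ennreal k
          \<le> ennreal \<theta> * M t \<bar>z t\<bar> + ennreal (1 - \<theta>) * M t \<bar>r * x t\<bar>"
        unfolding distrib_left by (meson add_left_mono order_trans)
      then show ?thesis using True unfolding hc by simp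
    next
      case False
      have "\<bar>\<theta> * (z t - s * x t)\<bar> \<le> \<theta> * (\<bar>z t\<bar> + \<bar>x t\<bar>)"
      proof -
        have "\<bar>s * x t\<bar> \<le> 1 * \<bar>x t\<bar>" unfolding abs_mult using s by (intro mult_right_mono) auto
        then have "\<bar>z t - s * x t\<bar> \<le> \<bar>z t\<bar> + \<bar>x t\<bar>" by simp
        then show ?thesis unfolding abs_mult using \<theta> by (simp add: mult_left_mono)
      qed
      also have "\<dots> = (1 - (1 - \<theta>)) * \<bar>z t\<bar> + (1 - \<theta>) * \<bar>r * x t\<bar>"
      proof -
        have "(1 - \<theta>) * \<bar>r * x t\<bar> = ((1 - \<theta>) * r) * \<bar>x t\<bar>" using r(1) by (simp add: abs_mult)
        then show ?thesis unfolding r(2) by (simp add: distrib_left)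
      qed
      finally have "M t \<bar>\<theta> * (z t - s * x t)\<bar> \<le> M t ((1 - (1 - \<theta>)) * \<bar>z t\<bar> + (1 - \<theta>) * \<bar>r * x t\<bar>)"
        by (intro orlicz_mono[OF \<phi>]) auto
      also have "\<dots> \<le> ennreal (1 - (1 - \<theta>)) * M t \<bar>z t\<bar> + ennreal (1 - \<theta>) * M t \<bar>r * x t\<bar>"
        using \<theta> by (intro orlicz_convex[OF \<phi>]) auto
      finally show ?thesis using False unfolding hc by simp
    qed
  qed
  have "rho (\<lambda>t. (z t - s * x t) / c) + ennreal k * emeasure \<mu> A
      = (\<integral>\<^sup>+t. M t \<bar>(z t - s * x t) / c\<bar> + ennreal k * indicator A t \<partial>\<mu>)"
  proof -
    have m: "(\<lambda>t. M t \<bar>(z t - s * x t) / c\<bar>) \<in> borel_measurable \<mu>" by measurable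
    show ?thesis unfolding rho_def by (subst nn_integral_add[OF m]) (auto simp: nn_integral_cmult)
  qed
  also have "\<dots> \<le> (\<integral>\<^sup>+t. ennreal \<theta> * M t \<bar>z t\<bar> + ennreal (1 - \<theta>) * M t \<bar>r * x t\<bar> \<partial>\<mu>)"
    by (rule nn_integral_mono_AE[OF AE])
  also have "\<dots> = ennreal \<theta> * rho z + ennreal (1 - \<theta>) * rho (\<lambda>t. r * x t)"
    unfolding rho_def by (subst nn_integral_add) (auto simp: nn_integral_cmult)
  also have "\<dots> \<le> ennreal \<theta> * 1 + ennreal (1 - \<theta>) * ennreal (1 + \<sigma> * K)"
    using z rr by (intro add_mono mult_left_mono) auto
  also have "\<dots> = ennreal (1 + (1 - \<theta>) * (\<sigma> * K))"
  proof -
    have "\<theta> + (1 - \<theta>) * (1 + \<sigma> * K) = 1 + (1 - \<theta>) * (\<sigma> * K)" by (simp add: algebra_simps)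
    moreover have "ennreal (\<theta> + (1 - \<theta>) * (1 + \<sigma> * K)) = ennreal \<theta> * 1 + ennreal (1 - \<theta>) * ennreal (1 + \<sigma> * K)"
      using \<theta>(3,4) \<sigma>(1) K(1) by (subst ennreal_plus) (auto simp: ennreal_mult simp del: ennreal_plus)
    ultimately show ?thesis by simp
  qed
  finally have le: "rho (\<lambda>t. (z t - s * x t) / c) + ennreal k * emeasure \<mu> A \<le> ennreal (1 + (1 - \<theta>) * (\<sigma> * K))" .
  have "1 + ennreal (k * measure \<mu> A) \<le> rho (\<lambda>t. (z t - s * x t) / c) + ennreal k * emeasure \<mu> A"
    using h k by (intro add_mono) (auto simp: s_def finA ennreal_mult)
  then have "1 + ennreal (k * measure \<mu> A) \<le> ennreal (1 + (1 - \<theta>) * (\<sigma> * K))"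
    using le by (rule order_trans)
  moreover have "ennreal (1 + k * measure \<mu> A) = 1 + ennreal (k * measure \<mu> A)" using k by simp
  ultimately have "ennreal (1 + k * measure \<mu> A) \<le> ennreal (1 + (1 - \<theta>) * (\<sigma> * K))" by (simp only:)
  moreover have pos: "0 \<le> (1 - \<theta>) * (\<sigma> * K)" using \<theta>(3) \<sigma>(1) K(1) by simp
  ultimately have "1 + k * measure \<mu> A \<le> 1 + (1 - \<theta>) * (\<sigma> * K)"
    by (subst (asm) ennreal_le_iff) simp_all
  then have *: "k * measure \<mu> A \<le> (1 - \<theta>) * (\<sigma> * K)" by (rule add_le_imp_le_left)
  have "(1 - \<theta>) * (\<sigma> * K) \<le> 1 * (\<sigma> * K)"
    by (rule mult_right_mono) (use \<theta>(4) \<sigma>(1) K(1) in auto)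
  also have "\<dots> = \<sigma> * K" by (rule mult_1_left)
  also have "\<dots> \<le> 4 * \<delta> / (l - 1) * K" by (rule mult_right_mono[OF \<sigma>(3) K(1)])
  also have "\<dots> = \<delta> * (4 * K / (l - 1))" by simp
  finally have **: "(1 - \<theta>) * (\<sigma> * K) \<le> \<delta> * (4 * K / (l - 1))" .
  have "k * (m - 2 * C * \<delta>) \<le> k * measure \<mu> A" by (rule mult_left_mono) (use mA k(1) in auto)
  with * ** have "k * (m - 2 * C * \<delta>) \<le> \<delta> * (4 * K / (l - 1))" by (meson order_trans)
  then have "k * m \<le> \<delta> * (4 * K / (l - 1)) + 2 * C * k * \<delta>" by (simp add: right_diff_distrib mult_ac)
  also have "\<dots> = \<delta> * B" by (simp only: B_def distrib_left mult_ac add.commute)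
  finally have "k * m \<le> \<delta> * B" .
  with \<delta>(5) show False by linarith
qed

end

section \<open>Small sets in non-atomic measures\<close>

lemma nonatomic_disjoint_family:
  assumes na: "nonatomic \<mu>" and A: "A \<in> sets \<mu>" "0 < emeasure \<mu> A"
  obtains E :: "nat \<Rightarrow> 'a set" where "\<And>i. i < n \<Longrightarrow> E i \<in> sets \<mu>" "\<And>i. i < n \<Longrightarrow> E i \<subseteq> A"
    "\<And>i. i < n \<Longrightarrow> 0 < emeasure \<mu> (E i)" "disjoint_family_on E {..<n}"
proof -
  have "\<exists>E. (\<forall>i<n. E i \<in> sets \<mu> \<and> E i \<subseteq> A \<and> 0 < emeasure \<mu> (E i)) \<and> disjoint_family_on E {..<n}"
    using A
  proof (induction n arbitrary: A)
    case (Suc n)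
    obtain B where B: "B \<in> sets \<mu>" "B \<subseteq> A" "0 < emeasure \<mu> B" "emeasure \<mu> B < emeasure \<mu> A"
      using na Suc.prems unfolding nonatomic_def by blast
    have pos: "0 < emeasure \<mu> (A - B)"
    proof (rule ccontr)
      assume "\<not> 0 < emeasure \<mu> (A - B)"
      then have "emeasure \<mu> (A - B) = 0" by simp
      moreover have "emeasure \<mu> A \<le> emeasure \<mu> B + emeasure \<mu> (A - B)"
        using emeasure_subadditive[of B \<mu> "A - B"] B Suc.prems by (simp add: Un_absorb1)
      ultimately show False using B by simp
    qed
    obtain E where E: "\<forall>i<n. E i \<in> sets \<mu> \<and> E i \<subseteq> B \<and> 0 < emeasure \<mu> (E i)" "disjoint_family_on E {..<n}"
      using Suc.IH[OF B(1,3)] by blast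
    define E' where "E' = E(n := A - B)"
    have 1: "E' i \<in> sets \<mu> \<and> E' i \<subseteq> A \<and> 0 < emeasure \<mu> (E' i)" if "i < Suc n" for i
      using that E(1) B Suc.prems pos by (cases "i = n") (auto simp: E'_def less_Suc_eq)
    have "disjoint_family_on E' {..<Suc n}"
    proof (unfold disjoint_family_on_def, safe)
      fix i j x assume ij: "i < Suc n" "j < Suc n" "i \<noteq> j" "x \<in> E' i" "x \<in> E' j"
      have "E i \<inter> E j = {}" if "i < n" "j < n"
        using E(2) that ij(3) by (auto simp: disjoint_family_on_def)
      then show "x \<in> {}" using ij E(1) by (cases "i = n"; cases "j = n") (auto simp: E'_def less_Suc_eq)
    qed
    then show ?case using 1 by blast
  qed (auto simp: disjoint_family_on_def)
  then show thesis using that by blast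
qed

text \<open>Among \<open>n\<close> disjoint non-null pieces of \<open>A\<close>, one carries at most the \<open>n\<close>-th part of the
  integral.\<close>

lemma nonatomic_small_subset:
  assumes na: "nonatomic \<mu>" and A: "A \<in> sets \<mu>" "0 < emeasure \<mu> A"
    and f[measurable]: "f \<in> borel_measurable \<mu>" and fin: "(\<integral>\<^sup>+t\<in>A. f t \<partial>\<mu>) < \<infinity>" and e: "0 < e"
  obtains B where "B \<in> sets \<mu>" "B \<subseteq> A" "0 < emeasure \<mu> B" "(\<integral>\<^sup>+t\<in>B. f t \<partial>\<mu>) \<le> ennreal e"
proof -
  define I where "I = enn2real (\<integral>\<^sup>+t\<in>A. f t \<partial>\<mu>)"
  have I: "0 \<le> I" "(\<integral>\<^sup>+t\<in>A. f t \<partial>\<mu>) = ennreal I" using fin by (auto simp: I_def)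
  obtain n :: nat where n: "I / e < n" using reals_Archimedean2 by blast
  have n0: "0 < n" using n I e by (cases n) (auto simp: field_simps)
  obtain E where E: "\<And>i. i < n \<Longrightarrow> E i \<in> sets \<mu>" "\<And>i. i < n \<Longrightarrow> E i \<subseteq> A"
      "\<And>i. i < n \<Longrightarrow> 0 < emeasure \<mu> (E i)" "disjoint_family_on E {..<n}"
    using nonatomic_disjoint_family[OF na A, of n] by blast
  have "\<exists>i<n. (\<integral>\<^sup>+t\<in>E i. f t \<partial>\<mu>) \<le> ennreal e"
  proof (rule ccontr)
    assume "\<not> ?thesis"
    then have gt: "\<And>i. i < n \<Longrightarrow> ennreal e \<le> (\<integral>\<^sup>+t\<in>E i. f t \<partial>\<mu>)" by (auto simp: not_le intro: less_imp_le)
    have "ennreal (real n * e) = (\<Sum>i<n. ennreal e)" using e by (simp add: ennreal_mult ennreal_of_nat_eq_real_of_nat)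
    also have "\<dots> \<le> (\<Sum>i<n. \<integral>\<^sup>+t\<in>E i. f t \<partial>\<mu>)" by (rule sum_mono) (use gt in auto)
    also have "\<dots> = (\<integral>\<^sup>+t. (\<Sum>i<n. f t * indicator (E i) t) \<partial>\<mu>)"
      by (rule nn_integral_sum[symmetric]) (use E(1) in auto)
    also have "\<dots> \<le> (\<integral>\<^sup>+t\<in>A. f t \<partial>\<mu>)"
    proof (rule nn_integral_mono)
      fix t
      have "(\<Sum>i<n. f t * indicator (E i) t) = f t * (\<Sum>i<n. indicator (E i) t)" by (simp add: sum_distrib_left)
      also have "(\<Sum>i<n. indicator (E i) t :: ennreal) = indicator (\<Union>i<n. E i) t"
        by (rule indicator_UN_disjoint[symmetric, unfolded sum.cong]) (use E(4) in auto)
      also have "f t * indicator (\<Union>i<n. E i) t \<le> f t * indicator A t"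
        using E(2) by (intro mult_left_mono) (auto simp: indicator_def)
      finally show "(\<Sum>i<n. f t * indicator (E i) t) \<le> f t * indicator A t" .
    qed
    finally have "real n * e \<le> I" using I e by (simp add: ennreal_le_iff)
    then show False using n e by (simp add: field_simps)
  qed
  then obtain i where i: "i < n" "(\<integral>\<^sup>+t\<in>E i. f t \<partial>\<mu>) \<le> ennreal e" by blast
  show thesis by (rule that[OF E(1)[OF i(1)] E(2)[OF i(1)] E(3)[OF i(1)] i(2)])
qed

section \<open>Functions of modular one\<close>

context musielak_orlicz_space
begin

lemma rho_split:
  assumes [measurable]: "x \<in> borel_measurable \<mu>" "G \<in> sets \<mu>"
  shows "rho x = (\<integral>\<^sup>+t\<in>G. M t \<bar>x t\<bar> \<partial>\<mu>) + rho (\<lambda>t. x t * indicator (space \<mu> - G) t)"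
proof -
  have "rho x = (\<integral>\<^sup>+t. M t \<bar>x t\<bar> * indicator G t + M t \<bar>x t * indicator (space \<mu> - G) t\<bar> \<partial>\<mu>)"
    unfolding rho_def
  proof (rule nn_integral_cong_AE)
    show "AE t in \<mu>. M t \<bar>x t\<bar> = M t \<bar>x t\<bar> * indicator G t + M t \<bar>x t * indicator (space \<mu> - G) t\<bar>"
      using AE_orlicz AE_space
    proof eventually_elim
      case (elim t)
      show ?case using orlicz_zero[OF elim(1)] elim(2) by (cases "t \<in> G") simp_all
    qed
  qed
  also have "\<dots> = (\<integral>\<^sup>+t\<in>G. M t \<bar>x t\<bar> \<partial>\<mu>) + rho (\<lambda>t. x t * indicator (space \<mu> - G) t)"
    unfolding rho_def by (rule nn_integral_add) measurable
  finally show ?thesis .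
qed

text \<open>The modular along a ray is convex, hence continuous inside the interval where it is finite, and
  takes all intermediate values. The factor \<open>l > 1\<close> makes \<open>1\<close> an interior point.\<close>

lemma rho_scaling_intermediate:
  assumes [measurable]: "x \<in> borel_measurable \<mu>" and l: "1 < l" "rho (\<lambda>t. l * x t) < \<infinity>"
    and p: "0 \<le> p" "ennreal p \<le> rho x"
  shows "\<exists>c. 0 \<le> c \<and> c \<le> 1 \<and> rho (\<lambda>t. c * x t) = ennreal p"
proof -
  define \<psi> where "\<psi> c = enn2real (rho (\<lambda>t. c * x t))" for c
  have fin: "rho (\<lambda>t. c * x t) < \<infinity>" if "\<bar>c\<bar> \<le> l" for c
  proof -
    have "\<bar>c * x t\<bar> \<le> \<bar>l * x t\<bar>" for t using that l by (simp add: abs_mult mult_right_mono)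
    then have "rho (\<lambda>t. c * x t) \<le> rho (\<lambda>t. l * x t)" by (intro rho_mono) auto
    then show ?thesis using l by simp
  qed
  have psi: "rho (\<lambda>t. c * x t) = ennreal (\<psi> c)" "0 \<le> \<psi> c" if "\<bar>c\<bar> \<le> l" for c
    using fin[OF that] by (auto simp: \<psi>_def)
  have "convex_on {-l<..<l} \<psi>"
  proof (rule convex_onI)
    fix s a b :: real assume s: "0 < s" "s < 1" and ab: "a \<in> {-l<..<l}" "b \<in> {-l<..<l}"
    have ab': "\<bar>a\<bar> \<le> l" "\<bar>b\<bar> \<le> l" using ab by auto
    have conv: "(1 - s) * a + s * b \<in> {-l<..<l}"
      using convexD_alt[of "{-l<..<l}" a b s] ab s by auto
    have "rho (\<lambda>t. ((1 - s) * a + s * b) * x t) \<le> ennreal (1 - s) * rho (\<lambda>t. a * x t) + ennreal s * rho (\<lambda>t. b * x t)"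
    proof (rule rho_convex)
      have "\<bar>((1 - s) * a + s * b) * x t\<bar> \<le> (1 - s) * \<bar>a * x t\<bar> + s * \<bar>b * x t\<bar>" for t
      proof -
        have "\<bar>(1 - s) * (a * x t) + s * (b * x t)\<bar> \<le> \<bar>(1 - s) * (a * x t)\<bar> + \<bar>s * (b * x t)\<bar>" by (rule abs_triangle_ineq)
        also have "\<dots> = (1 - s) * \<bar>a * x t\<bar> + s * \<bar>b * x t\<bar>" using s by (simp only: abs_mult) simp
        finally show ?thesis by (simp add: distrib_right mult.assoc)
      qed
      then show "AE t in \<mu>. \<bar>((1 - s) * a + s * b) * x t\<bar> \<le> (1 - s) * \<bar>a * x t\<bar> + s * \<bar>b * x t\<bar>" by simp
    qed (use s in auto)
    also have "\<dots> = ennreal ((1 - s) * \<psi> a + s * \<psi> b)"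
      using s psi[OF ab'(1)] psi[OF ab'(2)] by (simp add: ennreal_mult)
    finally have "ennreal (\<psi> ((1 - s) * a + s * b)) \<le> ennreal ((1 - s) * \<psi> a + s * \<psi> b)"
      using conv psi[of "(1 - s) * a + s * b"] by auto
    then show "\<psi> ((1 - s) *\<^sub>R a + s *\<^sub>R b) \<le> (1 - s) * \<psi> a + s * \<psi> b"
      using s psi[OF ab'(1)] psi[OF ab'(2)] by (subst (asm) ennreal_le_iff) simp_all
  qed simp
  then have "continuous_on {-l<..<l} \<psi>" by (intro convex_on_continuous) auto
  then have "continuous_on {0..1} \<psi>" by (rule continuous_on_subset) (use l in auto)
  moreover have "\<psi> 0 \<le> p" using p by (simp add: \<psi>_def rho_zero)
  moreover have "p \<le> \<psi> 1" using psi[of 1] p l by (simp add: ennreal_le_iff)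
  ultimately obtain c where "0 \<le> c" "c \<le> 1" "\<psi> c = p" using IVT'[of \<psi> 0 p 1] by auto
  then show ?thesis using psi[of c] l by auto
qed

text \<open>Start from \<open>y\<close> of modular above \<open>1\<close>, prescribe the values \<open>u\<close> on a subset \<open>G\<close> of \<open>G0\<close> so small
  that both \<open>u\<close> and \<open>y\<close> contribute little there, and scale \<open>y\<close> down off \<open>G\<close> to reach total modular
  \<open>1\<close>. A multiple of the result by some \<open>l > 1\<close> keeps finite modular, which is the slack that
  \<open>slice_property_loss\<close> needs.\<close>

lemma splice_to_modular_one:
  assumes na: "nonatomic \<mu>"
    and y[measurable]: "y \<in> borel_measurable \<mu>" and y0: "\<And>t. 0 \<le> y t"
    and ly: "1 < ly" "rho (\<lambda>t. ly * y t) < \<infinity>" "1 < rho y"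
    and G0[measurable]: "G0 \<in> sets \<mu>" and G0_pos: "0 < emeasure \<mu> G0" "emeasure \<mu> G0 < \<infinity>"
    and u[measurable]: "u \<in> borel_measurable \<mu>" and u0: "\<And>t. 0 \<le> u t"
    and lu: "1 < lu" "(\<integral>\<^sup>+t\<in>G0. M t (lu * u t) \<partial>\<mu>) < \<infinity>" and e: "0 < e"
  obtains G x l where "G \<in> sets \<mu>" "G \<subseteq> G0" "0 < emeasure \<mu> G" "(\<integral>\<^sup>+t\<in>G. M t (lu * u t) \<partial>\<mu>) \<le> ennreal e"
    "x \<in> borel_measurable \<mu>" "\<And>t. 0 \<le> x t" "\<And>t. t \<in> G \<Longrightarrow> x t = u t" "rho x = 1"
    "1 < l" "rho (\<lambda>t. l * x t) < \<infinity>"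
proof -
  have meas_lu[measurable]: "(\<lambda>t. M t (lu * u t)) \<in> borel_measurable \<mu>"
    using lu u0 by (intro measurable_superposition_nonneg) auto
  have meas_y[measurable]: "(\<lambda>t. M t \<bar>y t\<bar>) \<in> borel_measurable \<mu>" by measurable
  have rho_y: "rho y < \<infinity>"
  proof -
    have "\<bar>y t\<bar> \<le> \<bar>ly * y t\<bar>" for t using ly y0[of t] by (simp add: abs_mult mult_le_cancel_right1)
    then have "rho y \<le> rho (\<lambda>t. ly * y t)" by (intro rho_mono) auto
    then show ?thesis using ly by simp
  qed
  define q where "q = enn2real (rho y)"
  have q: "1 < q" "rho y = ennreal q"
  proof -
    show "rho y = ennreal q" using rho_y by (simp add: q_def)
    then show "1 < q" using ly(3) ennreal_leI[of q 1] by (cases "q \<le> 1") auto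
  qed
  define f where "f t = M t \<bar>y t\<bar> + M t (lu * u t)" for t
  have [measurable]: "f \<in> borel_measurable \<mu>" unfolding f_def by measurable
  have "(\<integral>\<^sup>+t\<in>G0. f t \<partial>\<mu>) = (\<integral>\<^sup>+t\<in>G0. M t \<bar>y t\<bar> \<partial>\<mu>) + (\<integral>\<^sup>+t\<in>G0. M t (lu * u t) \<partial>\<mu>)"
    unfolding f_def distrib_right by (rule nn_integral_add) measurable
  also have "\<dots> < \<infinity>"
  proof -
    have "(\<integral>\<^sup>+t\<in>G0. M t \<bar>y t\<bar> \<partial>\<mu>) \<le> rho y" unfolding rho_def by (rule nn_integral_mono) (auto simp: indicator_def)
    from order_le_less_trans[OF this rho_y] show ?thesis using lu(2) by simp
  qed
  finally have fin_f: "(\<integral>\<^sup>+t\<in>G0. f t \<partial>\<mu>) < \<infinity>" .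
  \<comment> \<open>After removing G the modular of y is still above 1, as d < q - 1; and u uses up at most 1/2 of it.\<close>
  define d where "d = Min {e, 1/2, (q - 1)/2}"
  have d: "0 < d" "d \<le> e" "d \<le> 1/2" "d < q - 1"
  proof -
    show "0 < d" using e q by (auto simp: d_def)
    show "d \<le> e" "d \<le> 1/2" unfolding d_def by (rule Min_le; simp)+
    have "d \<le> (q - 1)/2" unfolding d_def by (rule Min_le; simp)
    moreover have "(q - 1)/2 < q - 1" using q(1) by simp
    ultimately show "d < q - 1" by (rule order_le_less_trans)
  qed
  obtain G where G[measurable]: "G \<in> sets \<mu>" and GG: "G \<subseteq> G0" "0 < emeasure \<mu> G" "(\<integral>\<^sup>+t\<in>G. f t \<partial>\<mu>) \<le> ennreal d"
    using nonatomic_small_subset[OF na G0 G0_pos(1) \<open>f \<in> borel_measurable \<mu>\<close> fin_f d(1)] by blast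
  have Gu: "(\<integral>\<^sup>+t\<in>G. M t (lu * u t) \<partial>\<mu>) \<le> ennreal d"
    by (rule order_trans[OF nn_integral_mono GG(3)]) (auto simp: f_def indicator_def)
  have Gy: "(\<integral>\<^sup>+t\<in>G. M t \<bar>y t\<bar> \<partial>\<mu>) \<le> ennreal d"
    by (rule order_trans[OF nn_integral_mono GG(3)]) (auto simp: f_def indicator_def)
  define p where "p = enn2real (\<integral>\<^sup>+t\<in>G. M t (u t) \<partial>\<mu>)"
  have "(\<integral>\<^sup>+t\<in>G. M t (u t) \<partial>\<mu>) \<le> (\<integral>\<^sup>+t\<in>G. M t (lu * u t) \<partial>\<mu>)"
  proof (rule nn_integral_mono_AE)
    show "AE t in \<mu>. M t (u t) * indicator G t \<le> M t (lu * u t) * indicator G t"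
      using AE_orlicz
    proof eventually_elim
      case (elim t)
      have "u t \<le> lu * u t" using lu u0[of t] by (simp add: mult_le_cancel_right1)
      then show ?case using orlicz_mono[OF elim u0[of t]] by (intro mult_right_mono) auto
    qed
  qed
  from this Gu have Gp: "(\<integral>\<^sup>+t\<in>G. M t (u t) \<partial>\<mu>) \<le> ennreal d" by (rule order_trans)
  have "(\<integral>\<^sup>+t\<in>G. M t (u t) \<partial>\<mu>) < \<infinity>" by (rule order_le_less_trans[OF Gp]) simp
  then have p3: "(\<integral>\<^sup>+t\<in>G. M t (u t) \<partial>\<mu>) = ennreal p" unfolding p_def by simp
  have "p \<le> d" using Gp d(1) unfolding p3 by simp
  with d(3) have p12: "p \<le> 1/2" by linarith
  have p0: "0 \<le> p" unfolding p_def by (rule enn2real_nonneg)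
  note p = p0 p12 p3
  define y' where "y' t = y t * indicator (space \<mu> - G) t" for t
  have [measurable]: "y' \<in> borel_measurable \<mu>" unfolding y'_def by measurable
  have y'0: "0 \<le> y' t" for t using y0[of t] by (simp add: y'_def)
  have "ennreal 1 \<le> rho y'"
  proof (rule ccontr)
    assume "\<not> ennreal 1 \<le> rho y'"
    then have "rho y \<le> ennreal d + ennreal 1"
      unfolding rho_split[OF y G] y'_def[abs_def] by (intro add_mono[OF Gy]) simp
    also have "\<dots> = ennreal (d + 1)" using d by simp
    finally show False using q(2) d(1,4) by (simp add: ennreal_le_iff del: ennreal_plus)
  qed
  with p(1) have "ennreal (1 - p) \<le> rho y'" by (intro order_trans[OF ennreal_leI[of "1 - p" 1]]) simp_all
  moreover have fin_y': "rho (\<lambda>t. ly * y' t) < \<infinity>"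
  proof -
    have "\<bar>ly * y' t\<bar> \<le> \<bar>ly * y t\<bar>" for t by (auto simp: y'_def indicator_def)
    then have "rho (\<lambda>t. ly * y' t) \<le> rho (\<lambda>t. ly * y t)" by (intro rho_mono) auto
    then show ?thesis using ly by simp
  qed
  ultimately obtain c where c: "0 \<le> c" "c \<le> 1" "rho (\<lambda>t. c * y' t) = ennreal (1 - p)"
    using rho_scaling_intermediate[of y' ly "1 - p"] ly(1) p(1,2) by auto
  define x where "x t = (if t \<in> G then u t else c * y' t)" for t
  have [measurable]: "x \<in> borel_measurable \<mu>" unfolding x_def by measurable
  have off: "a * x t * indicator (space \<mu> - G) t = a * (c * y' t)" if "t \<in> space \<mu>" for t a
    using that by (auto simp: x_def y'_def indicator_def)
  have rho_off: "rho (\<lambda>t. a * x t * indicator (space \<mu> - G) t) = rho (\<lambda>t. a * (c * y' t))" for a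
    unfolding rho_def by (rule nn_integral_cong) (simp add: off)
  define l where "l = min lu ly"
  have l: "1 < l" "l \<le> lu" "l \<le> ly" using lu ly by (auto simp: l_def)
  show thesis
  proof (rule that[of G x l])
    show "G \<in> sets \<mu>" "G \<subseteq> G0" "0 < emeasure \<mu> G" "1 < l" using G GG l by auto
    show "(\<integral>\<^sup>+t\<in>G. M t (lu * u t) \<partial>\<mu>) \<le> ennreal e" by (rule order_trans[OF Gu ennreal_leI[OF d(2)]])
    show "x \<in> borel_measurable \<mu>" by measurable
    show "0 \<le> x t" for t using u0[of t] c y'0[of t] by (simp add: x_def)
    show "x t = u t" if "t \<in> G" for t using that by (simp add: x_def)
    have "(\<integral>\<^sup>+t\<in>G. M t \<bar>x t\<bar> \<partial>\<mu>) = ennreal p"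
      unfolding p(3)[symmetric] by (rule nn_integral_cong) (use u0 in \<open>auto simp: x_def indicator_def\<close>)
    then have "rho x = ennreal p + ennreal (1 - p)"
      using rho_split[of x G] rho_off[of 1] c by simp
    also have "\<dots> = ennreal (p + (1 - p))" by (rule ennreal_plus[symmetric]) (use p(1,2) in auto)
    also have "\<dots> = 1" by simp
    finally show "rho x = 1" .
    have "(\<integral>\<^sup>+t\<in>G. M t \<bar>l * x t\<bar> \<partial>\<mu>) \<le> (\<integral>\<^sup>+t\<in>G. M t (lu * u t) \<partial>\<mu>)"
    proof (rule nn_integral_mono_AE)
      show "AE t in \<mu>. M t \<bar>l * x t\<bar> * indicator G t \<le> M t (lu * u t) * indicator G t"
        using AE_orlicz
      proof eventually_elim
        case (elim t)
        have "\<bar>l * u t\<bar> = l * u t" using l(1) u0[of t] by simp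
        then have "\<bar>l * u t\<bar> \<le> lu * u t" using mult_right_mono[OF l(2) u0[of t]] by simp
        then show ?case using orlicz_mono[OF elim, of "\<bar>l * u t\<bar>" "lu * u t"] by (cases "t \<in> G") (simp_all add: x_def)
      qed
    qed
    also have "\<dots> < \<infinity>" by (rule order_le_less_trans[OF Gu]) simp
    finally have a: "(\<integral>\<^sup>+t\<in>G. M t \<bar>l * x t\<bar> \<partial>\<mu>) < \<infinity>" .
    have "rho (\<lambda>t. l * (c * y' t)) \<le> rho (\<lambda>t. ly * y' t)"
    proof (rule rho_mono)
      have "\<bar>l * (c * y' t)\<bar> \<le> \<bar>ly * y' t\<bar>" for t
      proof -
        have "l * c \<le> ly * 1" using l c by (intro mult_mono) auto
        then have "l * c * y' t \<le> ly * y' t" using y'0[of t] by (intro mult_right_mono) auto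
        then show ?thesis using l(1) c(1) ly(1) y'0[of t] by (simp add: abs_mult)
      qed
      then show "AE t in \<mu>. \<bar>l * (c * y' t)\<bar> \<le> \<bar>ly * y' t\<bar>" by simp
    qed
    then have "rho (\<lambda>t. l * (c * y' t)) < \<infinity>" using fin_y' by simp
    then show "rho (\<lambda>t. l * x t) < \<infinity>"
      unfolding rho_split[OF borel_measurable_times[OF borel_measurable_const \<open>x \<in> borel_measurable \<mu>\<close>] G, of l] rho_off
      using a by simp
  qed
qed

end

section \<open>Linearity of Orlicz functions\<close>

lemma ennreal_half_twice: "ennreal (1 / 2) * (2 * z) = z"
proof -
  have "ennreal (1 / 2) * ennreal 2 = 1" by (subst ennreal_mult[symmetric]) auto
  then show ?thesis by (simp add: mult.assoc[symmetric])
qed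

lemma ennreal_divide_mult_real:
  assumes "0 < r" "0 \<le> v" shows "a / ennreal r * ennreal v = ennreal (v / r) * a"
  unfolding ennreal_divide_times divide_ennreal[OF assms(2,1)] by (rule mult.commute)

text \<open>Along \<open>r, r/2, r/4, \<dots>\<close> the quotient \<open>M t r / r\<close> does not decrease by assumption, and by convexity it
  does not increase towards the origin. So its infimum, which is the slope, is attained at \<open>r\<close>.\<close>

lemma linear_below_finite_bound:
  assumes \<phi>: "orlicz_function (M t)"
    and half: "\<And>r. r \<in> pos_rats \<Longrightarrow> ennreal r < finite_bound (M t) \<Longrightarrow> M t r \<le> 2 * M t (r / 2)"
    and u: "0 < u" "ennreal u < finite_bound (M t)"
  shows "M t u = zero_bound (complementary M t) * ennreal u"
proof (rule antisym)
  obtain u' where u': "u < u'" "ennreal u' < finite_bound (M t)"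
  proof -
    obtain d where "ennreal u < d" "d < finite_bound (M t)" using dense u(2) by blast
    then show thesis using that[of "enn2real d"] u(1) by (cases d) (auto simp: ennreal_less_iff)
  qed
  obtain r where r: "r \<in> pos_rats" "u < r" "r < u'" using pos_rat_between[of u u'] u u' by auto
  have rb: "ennreal r < finite_bound (M t)" using r u' by (meson ennreal_leI less_imp_le order_le_less_trans)
  have fin: "M t r < \<infinity>" using orlicz_finite_below[OF \<phi> _ rb] r by auto
  have halves: "ennreal (1 / 2 ^ k) * M t r \<le> M t (r / 2 ^ k)" for k
  proof (induction k)
    case (Suc k)
    have "r / 2 ^ k \<in> pos_rats" using r by (auto intro!: Rats_divide Rats_power)
    moreover have "r / 2 ^ k \<le> r" using r by (auto simp: field_simps)
    then have "ennreal (r / 2 ^ k) < finite_bound (M t)" using rb by (meson ennreal_leI order_le_less_trans)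
    ultimately have le: "M t (r / 2 ^ k) \<le> 2 * M t (r / 2 ^ k / 2)" by (rule half)
    have "ennreal (1/2) * (ennreal (1 / 2 ^ k) * M t r) \<le> ennreal (1/2) * (2 * M t (r / 2 ^ k / 2))"
      by (rule mult_left_mono[OF order_trans[OF Suc le]]) simp
    also have "\<dots> = M t (r / 2 ^ k / 2)"
      by (rule ennreal_half_twice)
    finally have "ennreal (1/2) * (ennreal (1 / 2 ^ k) * M t r) \<le> M t (r / 2 ^ k / 2)" .
    moreover have "ennreal (1 / 2 ^ Suc k) = ennreal (1/2) * ennreal (1 / 2 ^ k)"
      by (subst ennreal_mult[symmetric]) auto
    moreover have "r / 2 ^ Suc k = r / 2 ^ k / 2" by simp
    ultimately show ?case by (simp only: mult.assoc)
  qed simp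
  have "M t r / ennreal r \<le> zero_bound (complementary M t)"
  proof (rule slope_greatest[where M=M and t=t, OF \<phi>])
    fix v :: real assume v: "0 < v"
    obtain k :: nat where "r / v < 2 ^ k" using real_arch_pow[of 2 "r / v"] by auto
    then have k: "r / 2 ^ k < v" using v by (simp add: field_simps)
    have "M t r / ennreal r * ennreal v = ennreal (v / r) * M t r"
      by (rule ennreal_divide_mult_real) (use r v in auto)
    also have "\<dots> = ennreal (v / (r / 2 ^ k)) * (ennreal (1 / 2 ^ k) * M t r)"
      using r v by (simp add: mult.assoc[symmetric] ennreal_mult[symmetric])
    also have "\<dots> \<le> ennreal (v / (r / 2 ^ k)) * M t (r / 2 ^ k)" by (rule mult_left_mono[OF halves]) simp
    also have "\<dots> \<le> M t v" by (rule orlicz_lower_line[OF \<phi>]) (use r k in auto)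
    finally show "M t r / ennreal r * ennreal v \<le> M t v" .
  qed
  then have "M t r / ennreal r * ennreal u \<le> zero_bound (complementary M t) * ennreal u" by (rule mult_right_mono) simp
  moreover have "M t (u / r * r) \<le> ennreal (u / r) * M t r"
    by (rule orlicz_scale[OF \<phi>]) (use r u in auto)
  moreover have "M t r / ennreal r * ennreal u = ennreal (u / r) * M t r"
    by (rule ennreal_divide_mult_real) (use r u in auto)
  moreover have "u / r * r = u" using r by auto
  ultimately show "M t u \<le> zero_bound (complementary M t) * ennreal u" by (metis order_trans)
qed (rule slope_le[OF u(1)])

text \<open>A function that is linear below its finite bound \<open>B\<close> but not on the whole half line has \<open>B < \<infinity>\<close>;
  left continuity makes it finite at \<open>B\<close>, and it is not identically zero below \<open>B\<close> because its zero
  bound is smaller. It therefore jumps to \<open>\<infinity>\<close> at \<open>B\<close> from a positive finite value.\<close>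

lemma linear_up_to_finite_bound:
  assumes \<phi>: "orlicz_function (M t)"
    and half: "\<And>r. r \<in> pos_rats \<Longrightarrow> ennreal r < finite_bound (M t) \<Longrightarrow> M t r \<le> 2 * M t (r / 2)"
    and lt: "zero_bound (M t) < finite_bound (M t)"
    and nl: "0 < u" "M t u \<noteq> zero_bound (complementary M t) * ennreal u"
  shows "finite_bound (M t) < \<infinity> \<and> M t (enn2real (finite_bound (M t))) < \<infinity> \<and>
    0 < M t (enn2real (finite_bound (M t)) / 2)"
proof -
  note lin = linear_below_finite_bound[where M=M and t=t, OF \<phi> half]
  have "\<not> ennreal u < finite_bound (M t)" using lin[OF _ _ nl(1)] nl(2) by blast
  then obtain B where B: "finite_bound (M t) = ennreal B" "0 \<le> B" by (cases "finite_bound (M t)") (auto simp: top_unique)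
  have B0: "0 < B" using finite_bound_pos[OF \<phi>] B by simp
  have "M t B \<le> zero_bound (complementary M t) * ennreal B"
  proof (rule orlicz_left_continuous[OF \<phi> B0])
    fix v assume v: "0 < v" "v < B"
    then have "M t v = zero_bound (complementary M t) * ennreal v" by (intro lin) (auto simp: B ennreal_less_iff)
    then show "M t v \<le> zero_bound (complementary M t) * ennreal B" using v by (auto intro!: mult_left_mono ennreal_leI)
  qed
  also have "\<dots> < \<infinity>" using slope_finite[where M=M and t=t, OF \<phi>] by (simp add: ennreal_mult_less_top)
  finally have fin: "M t B < \<infinity>" .
  have "0 < M t (B / 2)"
  proof (rule ccontr)
    assume "\<not> 0 < M t (B / 2)"
    then have "zero_bound (complementary M t) * ennreal (B / 2) = 0"
      using lin[of "B / 2"] B0 B by (simp add: ennreal_less_iff)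
    then have s0: "zero_bound (complementary M t) = 0" using B0 by simp
    have "ennreal v \<le> zero_bound (M t)" if "0 < v" "v < B" for v
      using lin[of v] that s0 by (intro le_zero_bound) (auto simp: B ennreal_less_iff)
    then have "ennreal B \<le> zero_bound (M t)" using ennreal_le_left[OF B0] by blast
    then show False using lt B by simp
  qed
  then show ?thesis using fin B by simp
qed

section \<open>Functions of modular above one\<close>

context musielak_orlicz_space
begin

text \<open>The limit of \<open>M t\<close> at its finite bound from the left. If its integral is at most \<open>1\<close>, the
  modular is at most \<open>1\<close> as soon as it is finite.\<close>

definition top_value where "top_value t = (SUP u\<in>{u. 0 < u \<and> ennreal u < bound t}. M t u)"

lemma measurable_top_value[measurable]: "top_value \<in> borel_measurable \<mu>"
proof (rule borel_measurable_AE_eq)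
  have [measurable]: "\<And>r. r \<in> pos_rats \<Longrightarrow> (\<lambda>t. M t r) \<in> borel_measurable \<mu>" by auto
  show "(\<lambda>t. SUP r\<in>pos_rats. if ennreal r < bound t then M t r else 0) \<in> borel_measurable \<mu>"
    by (rule borel_measurable_SUP[OF countable_pos_rats]) measurable
  show "AE t in \<mu>. (SUP r\<in>pos_rats. if ennreal r < bound t then M t r else 0) = top_value t"
    using AE_orlicz
  proof eventually_elim
    case (elim t)
    show ?case unfolding top_value_def
    proof (rule antisym)
      show "(SUP r\<in>pos_rats. if ennreal r < bound t then M t r else 0) \<le> (SUP u\<in>{u. 0 < u \<and> ennreal u < bound t}. M t u)"
        by (rule SUP_least) (auto intro: SUP_upper)
      show "(SUP u\<in>{u. 0 < u \<and> ennreal u < bound t}. M t u) \<le> (SUP r\<in>pos_rats. if ennreal r < bound t then M t r else 0)"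
      proof (rule SUP_least)
        fix u assume u: "u \<in> {u. 0 < u \<and> ennreal u < bound t}"
        then obtain d where d: "ennreal u < d" "d < bound t" using dense by blast
        then obtain u' where u': "d = ennreal u'" "0 \<le> u'" by (cases d) auto
        have "u < u'" using u d u' by (simp add: ennreal_less_iff)
        then obtain r where r: "r \<in> pos_rats" "u < r" "r < u'" using pos_rat_between[of u u'] u by auto
        have "ennreal r \<le> ennreal u'" using r by (intro ennreal_leI) auto
        from this d(2) have rb: "ennreal r < bound t" unfolding u'(1) by (rule order_le_less_trans)
        have "M t u \<le> M t r" using u r by (intro orlicz_mono[OF elim]) auto
        then show "M t u \<le> (SUP r\<in>pos_rats. if ennreal r < bound t then M t r else 0)"
          using rb by (intro SUP_upper2[OF r(1)]) simp
      qed
    qed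
  qed
qed

lemma rho_indicator:
  assumes [measurable]: "x \<in> borel_measurable \<mu>" "G \<in> sets \<mu>"
  shows "rho (\<lambda>t. x t * indicator G t) = (\<integral>\<^sup>+t\<in>G. M t \<bar>x t\<bar> \<partial>\<mu>)"
  unfolding rho_def
proof (rule nn_integral_cong_AE)
  show "AE t in \<mu>. M t \<bar>x t * indicator G t\<bar> = M t \<bar>x t\<bar> * indicator G t"
    using AE_orlicz
  proof eventually_elim
    case (elim t)
    show ?case using orlicz_zero[OF elim] by (cases "t \<in> G") simp_all
  qed
qed

text \<open>The functions \<open>(1 - 1 / (n + 2)) min (b t) n\<close> increase to the bound, so by monotone convergence the
  modular of one of them, cut off to a set of finite measure, exceeds \<open>1\<close>. Staying a factor away from
  the bound leaves room for \<open>l > 1\<close>; a second truncation, to the sets where \<open>M\<close> of the enlarged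
  function is at most \<open>m\<close>, makes the enlarged modular finite.\<close>

lemma exists_modular_above_one:
  assumes gt: "1 < (\<integral>\<^sup>+t. top_value t \<partial>\<mu>)"
  obtains y l where "y \<in> borel_measurable \<mu>" "\<And>t. 0 \<le> y t" "1 < l" "rho (\<lambda>t. l * y t) < \<infinity>" "1 < rho y"
proof -
  obtain F :: "nat \<Rightarrow> 'a set" where F: "range F \<subseteq> sets \<mu>" "(\<Union>i. F i) = space \<mu>"
      "\<And>i. emeasure \<mu> (F i) \<noteq> \<infinity>" "incseq F"
    using sigma_finite_incseq by blast
  have [measurable]: "F n \<in> sets \<mu>" for n using F by auto
  define \<beta> where "\<beta> n t = enn2real (min (bound t) (of_nat n))" for n t
  define x where "x n t = (1 - 1 / (real n + 2)) * \<beta> n t" for n t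
  have ebeta: "ennreal (\<beta> n t) = min (bound t) (of_nat n)" for n t
    unfolding \<beta>_def by (intro ennreal_enn2real) (simp add: min_less_iff_disj of_nat_less_top)
  have beta0: "0 \<le> \<beta> n t" for n t by (simp add: \<beta>_def)
  have x0: "0 \<le> x n t" for n t using beta0 by (simp add: x_def field_simps)
  have [measurable]: "x n \<in> borel_measurable \<mu>" for n unfolding x_def \<beta>_def by measurable
  have [measurable]: "(\<lambda>t. M t (x n t)) \<in> borel_measurable \<mu>" for n
    by (rule measurable_superposition_nonneg) (auto simp: x0)
  have beta_mono: "\<beta> n t \<le> \<beta> (Suc n) t" for n t
  proof -
    have "ennreal (\<beta> n t) \<le> ennreal (\<beta> (Suc n) t)" unfolding ebeta by (intro min.mono of_nat_mono) auto
    then show ?thesis using beta0 by (simp add: ennreal_le_iff)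
  qed
  have x_mono: "x n t \<le> x (Suc n) t" for n t
    unfolding x_def using beta_mono beta0 by (intro mult_mono) (auto simp: field_simps)
  have "(\<integral>\<^sup>+t. top_value t \<partial>\<mu>) \<le> (\<integral>\<^sup>+t. (SUP n. M t (x n t) * indicator (F n) t) \<partial>\<mu>)"
  proof (rule nn_integral_mono_AE)
    show "AE t in \<mu>. top_value t \<le> (SUP n. M t (x n t) * indicator (F n) t)"
      using AE_orlicz AE_space
    proof eventually_elim
      case (elim t)
      show ?case unfolding top_value_def
      proof (rule SUP_least)
        fix u assume u: "u \<in> {u. 0 < u \<and> ennreal u < bound t}"
        then obtain d where d: "ennreal u < d" "d < bound t" using dense by blast
        then obtain v where v: "d = ennreal v" "0 \<le> v" by (cases d) auto
        have uv: "u < v" using u d v by (simp add: ennreal_less_iff)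
        have "(\<lambda>n. (1 - 1 / (real n + 2)) * v) \<longlonglongrightarrow> v" by real_asymp
        then have "eventually (\<lambda>n. u < (1 - 1 / (real n + 2)) * v) sequentially" using uv by (rule order_tendstoD)
        moreover have "eventually (\<lambda>n. v \<le> real n) sequentially" by (rule eventually_sequentiallyI[of "nat \<lceil>v\<rceil>"]) linarith
        moreover obtain i where i: "t \<in> F i" using elim(2) F(2) by auto
        have "eventually (\<lambda>n. t \<in> F n) sequentially"
          using incseqD[OF F(4), of i] i by (intro eventually_sequentiallyI[of i]) auto
        ultimately have "eventually (\<lambda>n. u < (1 - 1 / (real n + 2)) * v \<and> v \<le> real n \<and> t \<in> F n) sequentially"
          by eventually_elim auto
        then obtain n where n: "u < (1 - 1 / (real n + 2)) * v" "v \<le> real n" "t \<in> F n"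
          using eventually_happens by force
        have "ennreal v \<le> of_nat n" using n(2) by (metis ennreal_leI ennreal_of_nat_eq_real_of_nat)
        then have "ennreal v \<le> ennreal (\<beta> n t)" unfolding ebeta using d v by simp
        then have "v \<le> \<beta> n t" using beta0 by (simp add: ennreal_le_iff)
        then have "(1 - 1 / (real n + 2)) * v \<le> x n t" unfolding x_def by (intro mult_left_mono) auto
        then have "M t u \<le> M t (x n t)" using u n by (intro orlicz_mono[OF elim(1)]) auto
        then show "M t u \<le> (SUP n. M t (x n t) * indicator (F n) t)" using n(3) by (intro SUP_upper2[of n]) auto
      qed
    qed
  qed
  also have "\<dots> = (SUP n. \<integral>\<^sup>+t. M t (x n t) * indicator (F n) t \<partial>\<mu>)"
  proof (rule nn_integral_monotone_convergence_SUP_AE)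
    show "AE t in \<mu>. M t (x n t) * indicator (F n) t \<le> M t (x (Suc n) t) * indicator (F (Suc n)) t" for n
      using AE_orlicz
    proof eventually_elim
      case (elim t)
      show ?case using orlicz_mono[OF elim x0 x_mono] incseq_SucD[OF F(4), of n]
        by (intro mult_mono) (auto simp: indicator_def)
    qed
  qed measurable
  finally have "1 < (SUP n. \<integral>\<^sup>+t. M t (x n t) * indicator (F n) t \<partial>\<mu>)" by (rule order_less_le_trans[OF gt])
  then obtain n where n: "1 < (\<integral>\<^sup>+t. M t (x n t) * indicator (F n) t \<partial>\<mu>)" unfolding less_SUP_iff by blast
  define l where "l = 1 + 1 / (real n + 2)"
  have l: "1 < l" by (simp add: l_def)
  have [measurable]: "(\<lambda>t. M t (l * x n t)) \<in> borel_measurable \<mu>"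
    by (rule measurable_superposition_nonneg) (use l x0 in auto)
  define H where "H m = {t\<in>F n. M t (l * x n t) \<le> of_nat m}" for m :: nat
  have H_eq: "H m = F n \<inter> {t\<in>space \<mu>. M t (l * x n t) \<le> of_nat m}" for m
    unfolding H_def using sets.sets_into_space[of "F n" \<mu>] by auto
  have [measurable]: "H m \<in> sets \<mu>" for m unfolding H_eq by measurable
  have incH: "incseq H" unfolding H_def by (auto simp: incseq_def intro: order_trans of_nat_mono)
  have "(\<integral>\<^sup>+t. M t (x n t) * indicator (F n) t \<partial>\<mu>) \<le> (\<integral>\<^sup>+t. (SUP m. M t (x n t) * indicator (H m) t) \<partial>\<mu>)"
  proof (rule nn_integral_mono_AE)
    show "AE t in \<mu>. M t (x n t) * indicator (F n) t \<le> (SUP m. M t (x n t) * indicator (H m) t)"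
      using AE_orlicz
    proof eventually_elim
      case (elim t)
      have "M t (l * x n t) < \<infinity>"
      proof (cases "\<beta> n t = 0")
        case True then show ?thesis using orlicz_zero[OF elim] by (simp add: x_def)
      next
        case False
        have "l * (1 - 1 / (real n + 2)) = 1 - 1 / (real n + 2) * (1 / (real n + 2))"
          unfolding l_def by (simp add: algebra_simps)
        then have "l * (1 - 1 / (real n + 2)) < 1" by simp
        then have "l * x n t < \<beta> n t" using False beta0[of n t] unfolding x_def mult.assoc[symmetric]
          by (simp add: mult_less_cancel_right1)
        then have "ennreal (l * x n t) < ennreal (\<beta> n t)" using False beta0[of n t] by (intro ennreal_lessI) auto
        also have "\<dots> \<le> bound t" unfolding ebeta by simp
        finally show ?thesis using orlicz_finite_below[OF elim] l x0 by (simp add: bound_def)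
      qed
      then obtain c where c: "M t (l * x n t) = ennreal c" "0 \<le> c" by (cases "M t (l * x n t)") auto
      obtain m :: nat where "c \<le> m" using real_arch_simple by blast
      then have "M t (l * x n t) \<le> of_nat m" using c by (simp add: ennreal_of_nat_eq_real_of_nat ennreal_leI)
      then show ?case by (intro SUP_upper2[of m]) (auto simp: H_def indicator_def)
    qed
  qed
  also have "\<dots> = (SUP m. \<integral>\<^sup>+t. M t (x n t) * indicator (H m) t \<partial>\<mu>)"
  proof (rule nn_integral_monotone_convergence_SUP_AE)
    show "AE t in \<mu>. M t (x n t) * indicator (H m) t \<le> M t (x n t) * indicator (H (Suc m)) t" for m
      using incseq_SucD[OF incH, of m] by (intro AE_I2 mult_left_mono) (auto simp: indicator_def)
  qed measurable
  finally have "1 < (SUP m. \<integral>\<^sup>+t. M t (x n t) * indicator (H m) t \<partial>\<mu>)" by (rule order_less_le_trans[OF n])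
  then obtain m where m: "1 < (\<integral>\<^sup>+t. M t (x n t) * indicator (H m) t \<partial>\<mu>)" unfolding less_SUP_iff by blast
  define y where "y t = x n t * indicator (H m) t" for t
  show thesis
  proof (rule that[of y l])
    show "y \<in> borel_measurable \<mu>" unfolding y_def by measurable
    show "0 \<le> y t" for t using x0 by (simp add: y_def)
    show "1 < l" by (rule l)
    show "1 < rho y" using m rho_indicator[of "x n" "H m"] x0 by (simp add: y_def[abs_def])
    have "rho (\<lambda>t. l * y t) = (\<integral>\<^sup>+t. M t (l * x n t) * indicator (H m) t \<partial>\<mu>)"
      using rho_indicator[of "\<lambda>t. l * x n t" "H m"] l x0 by (simp add: y_def[abs_def] mult.assoc)
    also have "\<dots> \<le> (\<integral>\<^sup>+t. of_nat m * indicator (F n) t \<partial>\<mu>)"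
      by (rule nn_integral_mono) (auto simp: H_def indicator_def)
    also have "\<dots> = of_nat m * emeasure \<mu> (F n)" by (simp add: nn_integral_cmult)
    also have "\<dots> < \<infinity>" using F(3)[of n] by (simp add: ennreal_mult_less_top less_top of_nat_less_top)
    finally show "rho (\<lambda>t. l * y t) < \<infinity>" .
  qed
qed

section \<open>Norming pairs without the slice property\<close>

text \<open>The element \<open>x\<close> and functional \<open>g\<close>, both of norm one, of a rank one operator to be tested. The
  room \<open>l > 1\<close> above \<open>x\<close> makes it possible to differentiate the modular at \<open>x\<close>, and the condition
  on the complementary function says that \<open>g\<close> belongs to the dual Orlicz space.\<close>

definition norming_pair :: "('a \<Rightarrow> real) \<Rightarrow> ('a \<Rightarrow> real) \<Rightarrow> bool" where
  "norming_pair x g \<longleftrightarrow>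
     x \<in> borel_measurable \<mu> \<and> (\<forall>t. 0 \<le> x t) \<and> rho x = 1 \<and> (\<exists>l>1. rho (\<lambda>t. l * x t) < \<infinity>) \<and>
     g \<in> borel_measurable \<mu> \<and> (\<exists>c>0. (\<integral>\<^sup>+t. complementary M t (c * \<bar>g t\<bar>) \<partial>\<mu>) < \<infinity>) \<and>
     (\<forall>z\<in>borel_measurable \<mu>. rho z \<le> 1 \<longrightarrow> (\<integral>\<^sup>+t. ennreal \<bar>g t * z t\<bar> \<partial>\<mu>) \<le> 1) \<and>
     (\<forall>e>0. \<exists>z\<in>borel_measurable \<mu>. rho z \<le> 1 \<and> 1 - e \<le> (\<integral>t. g t * z t \<partial>\<mu>))"

lemma norming_pair_integral:
  assumes "norming_pair x g" "z \<in> borel_measurable \<mu>" "rho z \<le> 1"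
  shows "integrable \<mu> (\<lambda>t. g t * z t)" "(\<integral>t. \<bar>g t * z t\<bar> \<partial>\<mu>) \<le> 1" "\<bar>\<integral>t. g t * z t \<partial>\<mu>\<bar> \<le> 1"
proof -
  have [measurable]: "g \<in> borel_measurable \<mu>" "z \<in> borel_measurable \<mu>" using assms by (auto simp: norming_pair_def)
  have le: "(\<integral>\<^sup>+t. ennreal \<bar>g t * z t\<bar> \<partial>\<mu>) \<le> 1" using assms by (auto simp: norming_pair_def)
  then show i: "integrable \<mu> (\<lambda>t. g t * z t)"
    unfolding integrable_iff_bounded real_norm_def by (intro conjI order_le_less_trans[OF le]) auto
  have "ennreal (\<integral>t. \<bar>g t * z t\<bar> \<partial>\<mu>) \<le> 1"
    using le nn_integral_eq_integral[OF integrable_abs[OF i]] by simp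
  then show "(\<integral>t. \<bar>g t * z t\<bar> \<partial>\<mu>) \<le> 1" by simp
  then show "\<bar>\<integral>t. g t * z t \<partial>\<mu>\<bar> \<le> 1" using integral_abs_bound[of \<mu> "\<lambda>t. g t * z t"] by linarith
qed

lemma measure_le_integral:
  fixes h :: "'a \<Rightarrow> real"
  assumes h: "integrable \<mu> h" "AE t in \<mu>. 0 \<le> h t" and B: "B \<in> sets \<mu>" "emeasure \<mu> B < \<infinity>"
    and le: "AE t in \<mu>. t \<in> B \<longrightarrow> c \<le> h t"
  shows "c * measure \<mu> B \<le> (\<integral>t. h t \<partial>\<mu>)"
proof -
  have "c * measure \<mu> B = (\<integral>t. c * indicator B t \<partial>\<mu>)" using B sets.sets_into_space[OF B(1)] by (simp add: Int_absorb2)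
  also have "\<dots> \<le> (\<integral>t. h t \<partial>\<mu>)"
  proof (rule integral_mono_AE)
    show "AE t in \<mu>. c * indicator B t \<le> h t" using h(2) le by eventually_elim (auto simp: indicator_def)
  qed (use B h in auto)
  finally show ?thesis .
qed

text \<open>On \<open>G0\<close> the sections satisfy \<open>2 M(u/2) < M(u)\<close> quantitatively. Take \<open>x = u\<close> on a small \<open>G\<close> and
  let \<open>g\<close> be a multiple of its indicator. A function that nearly norms \<open>g\<close> is mostly nonnegative on
  \<open>G\<close>. If \<open>- \<eta> \<le> z \<le> s u\<close>, then \<open>\<bar>z - s u\<bar> \<le> u + \<eta>\<close>, and about half of this falls where \<open>M\<close> is
  smaller than \<open>M(u) / 2\<close> by \<open>k\<close>; if \<open>z > s u\<close>, then \<open>0 \<le> z - s u \<le> z\<close> and the term \<open>\<theta> M(u)\<close> is saved.\<close>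

lemma no_slice_property_nonlinear:
  assumes na: "nonatomic \<mu>"
    and y: "y \<in> borel_measurable \<mu>" "\<And>t. 0 \<le> y t" "1 < ly" "rho (\<lambda>t. ly * y t) < \<infinity>" "1 < rho y"
    and G0: "G0 \<in> sets \<mu>" "0 < emeasure \<mu> G0" "emeasure \<mu> G0 < \<infinity>"
    and pos: "0 < u" "0 < d" "d \<le> 1" "0 < k" "1 < lu"
    and nonlinear: "\<And>t. t \<in> G0 \<Longrightarrow> 2 * M t ((1 / 2 + d) * u) + ennreal (2 * k) \<le> M t u"
    and fin: "\<And>t. t \<in> G0 \<Longrightarrow> M t (lu * u) \<le> ennreal K"
  shows "\<exists>x g. norming_pair x g \<and> \<not> slice_property x g"
proof -
  have "(\<integral>\<^sup>+t\<in>G0. M t (lu * u) \<partial>\<mu>) \<le> (\<integral>\<^sup>+t. ennreal K * indicator G0 t \<partial>\<mu>)"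
    by (rule nn_integral_mono) (use fin in \<open>auto simp: indicator_def\<close>)
  also have "\<dots> = ennreal K * emeasure \<mu> G0" using G0 by (simp add: nn_integral_cmult)
  also have "\<dots> < \<infinity>" using G0 by (simp add: ennreal_mult_less_top)
  finally have finI: "(\<integral>\<^sup>+t\<in>G0. M t (lu * u) \<partial>\<mu>) < \<infinity>" .
  obtain G x l where G[measurable]: "G \<in> sets \<mu>" and GG: "G \<subseteq> G0" "0 < emeasure \<mu> G"
      "(\<integral>\<^sup>+t\<in>G. M t (lu * u) \<partial>\<mu>) \<le> ennreal 1"
    and x[measurable]: "x \<in> borel_measurable \<mu>" and x0: "\<And>t. 0 \<le> x t" and xG: "\<And>t. t \<in> G \<Longrightarrow> x t = u"
    and rx: "rho x = 1" and l: "1 < l" "rho (\<lambda>t. l * x t) < \<infinity>"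
    by (rule splice_to_modular_one[OF na y G0, of "\<lambda>t. u" lu 1]) (use pos finI in auto)
  have finG: "emeasure \<mu> G < \<infinity>" using emeasure_mono[OF GG(1) G0(1)] G0(3) by (rule order_le_less_trans)
  define m where "m = measure \<mu> G"
  have m: "0 < m" "emeasure \<mu> G = ennreal m" using GG(2) finG
    by (auto simp: m_def measure_def enn2real_positive_iff)
  define ball where "ball = {z \<in> borel_measurable \<mu>. rho z \<le> 1}"
  \<comment> \<open>The dual norm of the indicator of G, by which g has to be divided.\<close>
  define Se where "Se = (SUP z\<in>ball. \<integral>\<^sup>+t. ennreal \<bar>z t\<bar> * indicator G t \<partial>\<mu>)"
  \<comment> \<open>Beyond u the function M t lies above the line through the origin and (u, 2 k).\<close>
  have bound_z: "AE t in \<mu>. t \<in> G \<longrightarrow> ennreal \<bar>z t\<bar> \<le> ennreal u + ennreal (u / (2 * k)) * M t \<bar>z t\<bar>" for z :: "'a \<Rightarrow> real"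
    using AE_orlicz
  proof eventually_elim
    case (elim t)
    show ?case
    proof
      assume t: "t \<in> G"
      show "ennreal \<bar>z t\<bar> \<le> ennreal u + ennreal (u / (2 * k)) * M t \<bar>z t\<bar>"
      proof (cases "\<bar>z t\<bar> \<le> u")
        case True then show ?thesis using ennreal_leI[OF True] by (simp add: add_increasing2)
      next
        case False
        have "ennreal (2 * k) \<le> 2 * M t ((1 / 2 + d) * u) + ennreal (2 * k)" by simp
        also have "\<dots> \<le> M t u" using t GG nonlinear by auto
        finally have "ennreal (\<bar>z t\<bar> / u) * ennreal (2 * k) \<le> ennreal (\<bar>z t\<bar> / u) * M t u" by (rule mult_left_mono) simp
        also have "\<dots> \<le> M t \<bar>z t\<bar>" by (rule orlicz_lower_line[OF elim]) (use pos False in auto)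
        finally have "ennreal (u / (2 * k)) * (ennreal (\<bar>z t\<bar> / u) * ennreal (2 * k)) \<le> ennreal (u / (2 * k)) * M t \<bar>z t\<bar>"
          by (rule mult_left_mono) simp
        moreover have "ennreal (u / (2 * k)) * (ennreal (\<bar>z t\<bar> / u) * ennreal (2 * k)) = ennreal \<bar>z t\<bar>"
          using pos by (simp add: ennreal_mult[symmetric])
        ultimately show ?thesis by (simp add: add_increasing)
      qed
    qed
  qed
  have "Se \<le> ennreal u * emeasure \<mu> G + ennreal (u / (2 * k))"
    unfolding Se_def
  proof (rule SUP_least)
    fix z assume z: "z \<in> ball"
    then have [measurable]: "z \<in> borel_measurable \<mu>" and rz: "rho z \<le> 1" by (auto simp: ball_def)
    have "(\<integral>\<^sup>+t. ennreal \<bar>z t\<bar> * indicator G t \<partial>\<mu>) \<le> (\<integral>\<^sup>+t. ennreal u * indicator G t + ennreal (u / (2 * k)) * M t \<bar>z t\<bar> \<partial>\<mu>)"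
      by (rule nn_integral_mono_AE) (use bound_z[of z] in eventually_elim, auto simp: indicator_def)
    also have "\<dots> = ennreal u * emeasure \<mu> G + ennreal (u / (2 * k)) * rho z"
      unfolding rho_def by (subst nn_integral_add) (auto simp: nn_integral_cmult)
    also have "\<dots> \<le> ennreal u * emeasure \<mu> G + ennreal (u / (2 * k)) * 1"
      using rz by (intro add_left_mono mult_left_mono) auto
    finally show "(\<integral>\<^sup>+t. ennreal \<bar>z t\<bar> * indicator G t \<partial>\<mu>) \<le> ennreal u * emeasure \<mu> G + ennreal (u / (2 * k))" by simp
  qed
  also have "\<dots> < \<infinity>" using finG by (simp add: ennreal_mult_less_top)
  finally have "Se < \<infinity>" .
  then obtain S where S: "Se = ennreal S" "0 \<le> S" by (cases Se) auto
  have "(\<lambda>t. u * indicator G t) \<in> ball"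
  proof -
    have "rho (\<lambda>t. u * indicator G t) = (\<integral>\<^sup>+t\<in>G. M t \<bar>u\<bar> \<partial>\<mu>)" using rho_indicator[of "\<lambda>t. u" G] by simp
    also have "\<dots> \<le> (\<integral>\<^sup>+t\<in>G. M t (lu * u) \<partial>\<mu>)"
    proof (rule nn_integral_mono_AE)
      show "AE t in \<mu>. M t \<bar>u\<bar> * indicator G t \<le> M t (lu * u) * indicator G t"
        using AE_orlicz
      proof eventually_elim
        case (elim t)
        show ?case using orlicz_mono[OF elim, of u "lu * u"] pos by (intro mult_right_mono) auto
      qed
    qed
    also have "\<dots> \<le> 1" using GG by simp
    finally show ?thesis by (simp add: ball_def)
  qed
  then have "(\<integral>\<^sup>+t. ennreal \<bar>u * indicator G t\<bar> * indicator G t \<partial>\<mu>) \<le> Se" unfolding Se_def by (rule SUP_upper)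
  moreover have "(\<integral>\<^sup>+t. ennreal \<bar>u * indicator G t\<bar> * indicator G t \<partial>\<mu>) = (\<integral>\<^sup>+t. ennreal u * indicator G t \<partial>\<mu>)"
    by (rule nn_integral_cong) (use pos in \<open>auto simp: indicator_def\<close>)
  moreover have "\<dots> = ennreal (u * m)" using pos m by (simp add: nn_integral_cmult ennreal_mult)
  ultimately have "u * m \<le> S" using S by (simp add: ennreal_le_iff)
  then have S0: "0 < S" using pos m by (meson mult_pos_pos order_less_le_trans)
  define g where "g t = indicator G t / S" for t
  have [measurable]: "g \<in> borel_measurable \<mu>" unfolding g_def by measurable
  have gz: "(\<integral>\<^sup>+t. ennreal \<bar>g t * z t\<bar> \<partial>\<mu>) = ennreal (1 / S) * (\<integral>\<^sup>+t. ennreal \<bar>z t\<bar> * indicator G t \<partial>\<mu>)"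
    if [measurable]: "z \<in> borel_measurable \<mu>" for z
  proof -
    have "(\<integral>\<^sup>+t. ennreal \<bar>g t * z t\<bar> \<partial>\<mu>) = (\<integral>\<^sup>+t. ennreal (1 / S) * (ennreal \<bar>z t\<bar> * indicator G t) \<partial>\<mu>)"
      by (rule nn_integral_cong) (use S0 in \<open>auto simp: g_def indicator_def abs_mult ennreal_mult[symmetric]\<close>)
    then show ?thesis by (simp add: nn_integral_cmult)
  qed
  have dual: "(\<integral>\<^sup>+t. ennreal \<bar>g t * z t\<bar> \<partial>\<mu>) \<le> 1" if z: "z \<in> borel_measurable \<mu>" "rho z \<le> 1" for z
  proof -
    have "(\<integral>\<^sup>+t. ennreal \<bar>z t\<bar> * indicator G t \<partial>\<mu>) \<le> ennreal S"
      unfolding S(1)[symmetric] Se_def using z by (intro SUP_upper) (auto simp: ball_def)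
    then have "ennreal (1 / S) * (\<integral>\<^sup>+t. ennreal \<bar>z t\<bar> * indicator G t \<partial>\<mu>) \<le> ennreal (1 / S) * ennreal S" by (rule mult_left_mono) simp
    also have "\<dots> = 1" using S0 by (simp add: ennreal_mult[symmetric])
    finally show ?thesis unfolding gz[OF z(1)] .
  qed
  have near: "\<exists>z\<in>borel_measurable \<mu>. rho z \<le> 1 \<and> 1 - e \<le> (\<integral>t. g t * z t \<partial>\<mu>)" if e: "0 < e" for e
  proof -
    have "ennreal (S * (1 - e)) < Se" unfolding S(1) using S0 e by (intro ennreal_lessI) (auto simp: mult_less_cancel_left2)
    then obtain z where z: "z \<in> ball" "ennreal (S * (1 - e)) < (\<integral>\<^sup>+t. ennreal \<bar>z t\<bar> * indicator G t \<partial>\<mu>)"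
      unfolding Se_def less_SUP_iff by blast
    then have zm[measurable]: "z \<in> borel_measurable \<mu>" and rz: "rho z \<le> 1" by (auto simp: ball_def)
    define a where "a t = \<bar>z t\<bar>" for t
    have am[measurable]: "a \<in> borel_measurable \<mu>" unfolding a_def by measurable
    have ra: "rho a \<le> 1" using rz by (simp add: rho_def a_def)
    have "ennreal (1 / S) * ennreal (S * (1 - e)) \<le> (\<integral>\<^sup>+t. ennreal \<bar>g t * a t\<bar> \<partial>\<mu>)"
      unfolding gz[OF am] by (rule mult_left_mono) (use z in \<open>simp_all add: a_def\<close>)
    also have "(\<integral>\<^sup>+t. ennreal \<bar>g t * a t\<bar> \<partial>\<mu>) = (\<integral>\<^sup>+t. ennreal (g t * a t) \<partial>\<mu>)"
      using S0 by (simp add: g_def a_def)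
    finally have le: "ennreal (1 / S) * ennreal (S * (1 - e)) \<le> (\<integral>\<^sup>+t. ennreal (g t * a t) \<partial>\<mu>)" .
    have "(\<integral>\<^sup>+t. ennreal (g t * a t) \<partial>\<mu>) \<le> 1" using dual[OF am ra] S0 by (simp add: g_def a_def)
    then have "(\<integral>\<^sup>+t. ennreal (g t * a t) \<partial>\<mu>) < \<infinity>" by (rule order_le_less_trans) simp
    moreover have "(\<integral>t. g t * a t \<partial>\<mu>) = enn2real (\<integral>\<^sup>+t. ennreal (g t * a t) \<partial>\<mu>)"
      by (rule integral_eq_nn_integral) (use S0 in \<open>auto simp: g_def a_def\<close>)
    ultimately have eq: "(\<integral>\<^sup>+t. ennreal (g t * a t) \<partial>\<mu>) = ennreal (\<integral>t. g t * a t \<partial>\<mu>)" by simp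
    have "1 - e \<le> (\<integral>t. g t * a t \<partial>\<mu>)"
    proof (cases "1 - e \<le> 0")
      case True
      moreover have "0 \<le> (\<integral>t. g t * a t \<partial>\<mu>)" by (rule integral_nonneg_AE) (use S0 in \<open>auto simp: g_def a_def\<close>)
      ultimately show ?thesis by linarith
    next
      case False
      have "ennreal (1 / S) * ennreal (S * (1 - e)) = ennreal (1 - e)" using S0 False by (simp add: ennreal_mult[symmetric])
      then show ?thesis using le eq False by (simp add: ennreal_le_iff2)
    qed
    then show ?thesis using am ra by blast
  qed
  have "(\<integral>\<^sup>+t. complementary M t (2 * k * S / u * \<bar>g t\<bar>) \<partial>\<mu>) \<le> (\<integral>\<^sup>+t. ennreal (2 * k) * indicator G t \<partial>\<mu>)"
  proof (rule nn_integral_mono_AE)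
    show "AE t in \<mu>. complementary M t (2 * k * S / u * \<bar>g t\<bar>) \<le> ennreal (2 * k) * indicator G t"
      using AE_orlicz
    proof eventually_elim
      case (elim t)
      show ?case
      proof (subst complementary_le_iff, safe)
        fix v :: real assume v: "0 < v"
        show "ennreal (2 * k * S / u * \<bar>g t\<bar> * v) \<le> M t v + ennreal (2 * k) * indicator G t"
        proof (cases "t \<in> G")
          case True
          have eq: "2 * k * S / u * \<bar>g t\<bar> * v = v / u * (2 * k)" using True S0 by (simp add: g_def)
          show ?thesis
          proof (cases "v \<le> u")
            case le: True
            have "v / u * (2 * k) \<le> 1 * (2 * k)" by (rule mult_right_mono) (use le v pos in auto)
            then have "ennreal (v / u * (2 * k)) \<le> ennreal (2 * k)" by (intro ennreal_leI) simp
            then show ?thesis unfolding eq using True by (simp add: add_increasing)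
          next
            case False
            have "ennreal (2 * k) \<le> 2 * M t ((1 / 2 + d) * u) + ennreal (2 * k)" by simp
            also have "\<dots> \<le> M t u" using True GG nonlinear by auto
            finally have "ennreal (v / u) * ennreal (2 * k) \<le> ennreal (v / u) * M t u" by (rule mult_left_mono) simp
            also have "\<dots> \<le> M t v" by (rule orlicz_lower_line[OF elim]) (use pos False in auto)
            also have "ennreal (v / u) * ennreal (2 * k) = ennreal (v / u * (2 * k))"
              by (rule ennreal_mult[symmetric]) (use v pos in auto)
            finally have "ennreal (v / u * (2 * k)) \<le> M t v" .
            then show ?thesis unfolding eq by (simp add: add_increasing2)
          qed
        qed (simp add: g_def)
      qed
    qed
  qed
  also have "\<dots> = ennreal (2 * k) * emeasure \<mu> G" by (simp add: nn_integral_cmult)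
  also have "\<dots> < \<infinity>" using finG by (simp add: ennreal_mult_less_top)
  finally have compl: "(\<integral>\<^sup>+t. complementary M t (2 * k * S / u * \<bar>g t\<bar>) \<partial>\<mu>) < \<infinity>" .
  have c0: "0 < 2 * k * S / u" using pos S0 by simp
  have pair: "norming_pair x g"
    unfolding norming_pair_def
    by (intro conjI ballI allI impI exI[of _ l] exI[of _ "2 * k * S / u"] x0 rx l compl c0 dual near) auto
  define \<zeta> where "\<zeta> = d / 2"
  define \<eta> where "\<eta> = u * \<zeta>"
  have \<zeta>: "0 < \<zeta>" "0 < \<eta>" using pos by (auto simp: \<zeta>_def \<eta>_def)
  have small: "\<theta> * (u + \<eta>) \<le> (1 / 2 + d) * u" if "0 \<le> \<theta>" "\<theta> \<le> (1 + \<zeta>) / 2" for \<theta>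
  proof -
    have "\<theta> * (u + \<eta>) \<le> (1 + \<zeta>) / 2 * (u + \<eta>)" using that pos \<zeta> by (intro mult_right_mono) auto
    also have "\<dots> = (1 / 2 + \<zeta> + \<zeta> * \<zeta> / 2) * u" by (simp add: \<eta>_def field_simps)
    also have "\<dots> \<le> (1 / 2 + d) * u"
    proof (rule mult_right_mono)
      have "\<zeta> * \<zeta> \<le> \<zeta> * 1" using pos \<zeta> by (intro mult_left_mono) (auto simp: \<zeta>_def)
      moreover have "d = 2 * \<zeta>" by (simp add: \<zeta>_def)
      ultimately show "1 / 2 + \<zeta> + \<zeta> * \<zeta> / 2 \<le> 1 / 2 + d" using \<zeta>(1) by linarith
    qed (use pos in simp)
    finally show ?thesis .
  qed
  have "\<not> slice_property x g"
  proof
    assume slice: "slice_property x g"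
    show False
    proof (rule slice_property_loss[where x=x and g=g and l=l and G=G and k=k and th="(1 + \<zeta>) / 2" and
          C="S / (2 * \<eta>)" and good="\<lambda>t z. - \<eta> \<le> z"])
      show "AE t in \<mu>. t \<in> G \<longrightarrow> (\<forall>\<theta> s z. 1/2 \<le> \<theta> \<longrightarrow> \<theta> \<le> (1 + \<zeta>) / 2 \<longrightarrow> 0 \<le> s \<longrightarrow> s \<le> 1 \<longrightarrow> - \<eta> \<le> z \<longrightarrow>
        M t \<bar>\<theta> * (z - s * x t)\<bar> + ennreal k \<le> ennreal \<theta> * (M t \<bar>z\<bar> + M t (x t)))"
        using AE_orlicz
      proof eventually_elim
        case (elim t)
        show ?case
        proof (intro impI allI)
          fix \<theta> s z :: real
          assume t: "t \<in> G" and \<theta>: "1/2 \<le> \<theta>" "\<theta> \<le> (1 + \<zeta>) / 2" and s: "0 \<le> s" "s \<le> 1" and z: "- \<eta> \<le> z"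
          have su: "s * u \<le> 1 * u" "0 \<le> s * u" using s pos by (auto intro: mult_right_mono)
          have "ennreal (1 / 2) * (2 * M t ((1 / 2 + d) * u) + ennreal (2 * k)) \<le> ennreal (1 / 2) * M t u"
            by (rule mult_left_mono) (use t GG nonlinear in auto)
          moreover have "ennreal (1 / 2) * (2 * M t ((1 / 2 + d) * u) + ennreal (2 * k)) = M t ((1 / 2 + d) * u) + ennreal k"
          proof -
            have "ennreal (1 / 2) * ennreal (2 * k) = ennreal k" by (subst ennreal_mult[symmetric]) (use pos in auto)
            then show ?thesis unfolding distrib_left ennreal_half_twice by (simp only:)
          qed
          moreover have "ennreal (1 / 2) * M t u \<le> ennreal \<theta> * M t u" using \<theta> by (intro mult_right_mono ennreal_leI) auto
          ultimately have key: "M t ((1 / 2 + d) * u) + ennreal k \<le> ennreal \<theta> * M t u" by (metis order_trans)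
          have "M t \<bar>\<theta> * (z - s * u)\<bar> + ennreal k \<le> ennreal \<theta> * M t \<bar>z\<bar> + ennreal \<theta> * M t u"
          proof (cases "z \<le> s * u")
            case True
            have "\<bar>\<theta> * (z - s * u)\<bar> = \<theta> * (s * u - z)" using True \<theta> by (simp add: abs_mult)
            also have "\<dots> \<le> \<theta> * (u + \<eta>)" using su z \<theta> by (intro mult_left_mono) auto
            also have "\<dots> \<le> (1 / 2 + d) * u" using \<theta> by (intro small) auto
            finally have "M t \<bar>\<theta> * (z - s * u)\<bar> \<le> M t ((1 / 2 + d) * u)" by (intro orlicz_mono[OF elim]) auto
            then have "M t \<bar>\<theta> * (z - s * u)\<bar> + ennreal k \<le> M t ((1 / 2 + d) * u) + ennreal k" by (rule add_right_mono)
            also note key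
            finally show ?thesis by (simp add: add_increasing)
          next
            case False
            then have z0: "0 \<le> z" using su by linarith
            have "\<bar>\<theta> * (z - s * u)\<bar> = \<theta> * (z - s * u)" using False \<theta> by simp
            also have "\<dots> \<le> \<theta> * z" using su \<theta> by (intro mult_left_mono) auto
            finally have "M t \<bar>\<theta> * (z - s * u)\<bar> \<le> M t (\<theta> * z)" by (intro orlicz_mono[OF elim]) auto
            also have "\<dots> \<le> ennreal \<theta> * M t z" using \<theta> z0 pos by (intro orlicz_scale[OF elim]) (auto simp: \<zeta>_def)
            finally have "M t \<bar>\<theta> * (z - s * u)\<bar> \<le> ennreal \<theta> * M t \<bar>z\<bar>" using z0 by simp
            moreover have "ennreal k \<le> ennreal \<theta> * M t u" by (rule order_trans[OF _ key]) simp
            ultimately show ?thesis by (rule add_mono)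
          qed
          then show "M t \<bar>\<theta> * (z - s * x t)\<bar> + ennreal k \<le> ennreal \<theta> * (M t \<bar>z\<bar> + M t (x t))"
            using xG[OF t] by (simp add: distrib_left)
        qed
      qed
      show "measure \<mu> {t\<in>G. \<not> - \<eta> \<le> z t} \<le> S / (2 * \<eta>) * e"
        if z: "z \<in> borel_measurable \<mu>" "rho z \<le> 1" and e: "0 < e" "1 - e \<le> (\<integral>t. g t * z t \<partial>\<mu>)" for z e
      proof -
        note [measurable] = z(1)
        note int = norming_pair_integral[OF pair z]
        define B where "B = {t\<in>G. \<not> - \<eta> \<le> z t}"
        have "B = G \<inter> {t\<in>space \<mu>. \<not> - \<eta> \<le> z t}" unfolding B_def using sets.sets_into_space[OF G] by auto
        then have Bm: "B \<in> sets \<mu>" by (simp only:) measurable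
        \<comment> \<open>The integral of g z is at least 1 - e and that of |g z| at most 1, so the negative part is small.\<close>
        have "2 * \<eta> / S * measure \<mu> B \<le> (\<integral>t. \<bar>g t * z t\<bar> - g t * z t \<partial>\<mu>)"
        proof (rule measure_le_integral[OF _ _ Bm])
          show "emeasure \<mu> B < \<infinity>" by (rule order_le_less_trans[OF emeasure_mono[OF _ G] finG]) (auto simp: B_def)
          show "AE t in \<mu>. t \<in> B \<longrightarrow> 2 * \<eta> / S \<le> \<bar>g t * z t\<bar> - g t * z t"
          proof (rule AE_I2, rule impI)
            fix t assume "t \<in> B"
            then have "t \<in> G" "z t < - \<eta>" by (auto simp: B_def)
            then have "\<bar>g t * z t\<bar> - g t * z t = 2 * (- z t) / S" using S0 \<zeta> by (simp add: g_def abs_mult)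
            moreover have "2 * \<eta> / S \<le> 2 * (- z t) / S" using \<open>z t < - \<eta>\<close> S0 by (intro divide_right_mono) auto
            ultimately show "2 * \<eta> / S \<le> \<bar>g t * z t\<bar> - g t * z t" by simp
          qed
        qed (use int(1) in auto)
        also have "\<dots> = (\<integral>t. \<bar>g t * z t\<bar> \<partial>\<mu>) - (\<integral>t. g t * z t \<partial>\<mu>)" using int(1) by (intro Bochner_Integration.integral_diff) auto
        also have "\<dots> \<le> e" using int(2) e by linarith
        finally have "2 * \<eta> / S * measure \<mu> B \<le> e" .
        then show ?thesis unfolding B_def[symmetric] using S0 \<zeta> by (simp add: field_simps)
      qed
      show "{t\<in>G. - \<eta> \<le> z t} \<in> sets \<mu>" if [measurable]: "z \<in> borel_measurable \<mu>" for z
      proof -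
        have "{t\<in>G. - \<eta> \<le> z t} = G \<inter> {t\<in>space \<mu>. - \<eta> \<le> z t}" using sets.sets_into_space[OF G] by auto
        then show ?thesis by measurable
      qed
      show "\<bar>\<integral>t. g t * z t \<partial>\<mu>\<bar> \<le> 1" if "z \<in> borel_measurable \<mu>" "rho z \<le> 1" for z
        by (rule norming_pair_integral(3)[OF pair that])
    qed (use x x0 rx l slice G GG finG pos \<zeta> S0 in auto)
  qed
  with pair show ?thesis by blast
qed

text \<open>On \<open>G0\<close> the sections are bounded at \<open>B t\<close>, bounded below at \<open>B t / 2\<close> and infinite beyond \<open>B t\<close>, so functions in
  the unit ball are bounded by \<open>B\<close> there. Take \<open>x = B / 2\<close> on a small \<open>G\<close> and \<open>g = 1 / B\<close> there,
  normalized by the measure of \<open>G\<close>. A function that nearly norms \<open>g\<close> is at least \<open>B / 2\<close> on most of \<open>G\<close>;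
  then \<open>0 \<le> z - s x \<le> z\<close>, and the whole term \<open>\<theta> M(B / 2)\<close> is saved.\<close>

lemma no_slice_property_jump:
  assumes na: "nonatomic \<mu>"
    and y: "y \<in> borel_measurable \<mu>" "\<And>t. 0 \<le> y t" "1 < ly" "rho (\<lambda>t. ly * y t) < \<infinity>" "1 < rho y"
    and G0: "G0 \<in> sets \<mu>" "0 < emeasure \<mu> G0" "emeasure \<mu> G0 < \<infinity>"
    and k: "0 < k" and bnd: "\<And>t. t \<in> G0 \<Longrightarrow> bound t = ennreal (B t)" "\<And>t. 0 \<le> B t" "\<And>t. t \<in> G0 \<Longrightarrow> 0 < B t"
    and Bm: "B \<in> borel_measurable \<mu>"
    and half: "\<And>t. t \<in> G0 \<Longrightarrow> ennreal (2 * k) \<le> M t (B t / 2)"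
    and fin: "\<And>t. t \<in> G0 \<Longrightarrow> M t (B t) \<le> ennreal K"
  shows "\<exists>x g. norming_pair x g \<and> \<not> slice_property x g"
proof -
  note Bm[measurable]
  have "(\<integral>\<^sup>+t\<in>G0. M t (2 * (B t / 2)) \<partial>\<mu>) \<le> (\<integral>\<^sup>+t. ennreal K * indicator G0 t \<partial>\<mu>)"
    by (rule nn_integral_mono) (use fin in \<open>auto simp: indicator_def\<close>)
  also have "\<dots> = ennreal K * emeasure \<mu> G0" using G0 by (simp add: nn_integral_cmult)
  also have "\<dots> < \<infinity>" using G0 by (simp add: ennreal_mult_less_top)
  finally have finI: "(\<integral>\<^sup>+t\<in>G0. M t (2 * (B t / 2)) \<partial>\<mu>) < \<infinity>" .
  have B2: "(\<lambda>t. B t / 2) \<in> borel_measurable \<mu>" by measurable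
  obtain G x l where G[measurable]: "G \<in> sets \<mu>" and GG: "G \<subseteq> G0" "0 < emeasure \<mu> G"
      "(\<integral>\<^sup>+t\<in>G. M t (2 * (B t / 2)) \<partial>\<mu>) \<le> ennreal 1"
    and x[measurable]: "x \<in> borel_measurable \<mu>" and x0: "\<And>t. 0 \<le> x t" and xG: "\<And>t. t \<in> G \<Longrightarrow> x t = B t / 2"
    and rx: "rho x = 1" and l: "1 < l" "rho (\<lambda>t. l * x t) < \<infinity>"
    by (rule splice_to_modular_one[OF na y G0 B2, of 2 1]) (use bnd finI in auto)
  have finG: "emeasure \<mu> G < \<infinity>" using emeasure_mono[OF GG(1) G0(1)] G0(3) by (rule order_le_less_trans)
  define m where "m = measure \<mu> G"
  have m: "0 < m" "emeasure \<mu> G = ennreal m" using GG(2) finG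
    by (auto simp: m_def measure_def enn2real_positive_iff)
  have BG: "0 < B t" if "t \<in> G" for t using that GG bnd by auto
  define g where "g t = indicator G t / (B t * m)" for t
  have [measurable]: "g \<in> borel_measurable \<mu>" unfolding g_def by measurable
  have below: "AE t in \<mu>. t \<in> G \<longrightarrow> \<bar>z t\<bar> \<le> B t" if z: "z \<in> borel_measurable \<mu>" "rho z \<le> 1" for z
  proof -
    note [measurable] = z(1)
    have "(\<integral>\<^sup>+ t. M t \<bar>z t\<bar> \<partial>\<mu>) \<noteq> \<infinity>" using z(2) by (auto simp: rho_def top_unique)
    then have "AE t in \<mu>. M t \<bar>z t\<bar> \<noteq> \<infinity>" by (intro nn_integral_PInf_AE) auto
    then show ?thesis
    proof eventually_elim
      case (elim t)
      show ?case
      proof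
        assume t: "t \<in> G"
        show "\<bar>z t\<bar> \<le> B t"
        proof (cases "z t = 0")
          case False
          then have "ennreal \<bar>z t\<bar> \<le> bound t" unfolding bound_def using elim by (intro le_finite_bound) (auto simp: less_top)
          also have "bound t = ennreal (B t)" using t GG bnd by auto
          finally show ?thesis using bnd(2)[of t] by (simp add: ennreal_le_iff)
        qed (use bnd in auto)
      qed
    qed
  qed
  have gle: "AE t in \<mu>. \<bar>g t * z t\<bar> \<le> indicator G t / m" if z: "z \<in> borel_measurable \<mu>" "rho z \<le> 1" for z
    using below[OF z]
  proof eventually_elim
    case (elim t)
    show ?case
    proof (cases "t \<in> G")
      case True
      then have "\<bar>z t\<bar> / B t \<le> 1" using elim BG by (simp add: divide_le_eq)
      then have "\<bar>z t\<bar> / B t / m \<le> 1 / m" using m by (intro divide_right_mono) auto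
      then show ?thesis using True m BG[OF True] by (simp add: g_def abs_mult)
    qed (simp add: g_def)
  qed
  have dual: "(\<integral>\<^sup>+t. ennreal \<bar>g t * z t\<bar> \<partial>\<mu>) \<le> 1" if z: "z \<in> borel_measurable \<mu>" "rho z \<le> 1" for z
  proof -
    have "(\<integral>\<^sup>+t. ennreal \<bar>g t * z t\<bar> \<partial>\<mu>) \<le> (\<integral>\<^sup>+t. ennreal (1 / m) * indicator G t \<partial>\<mu>)"
    proof (rule nn_integral_mono_AE)
      show "AE t in \<mu>. ennreal \<bar>g t * z t\<bar> \<le> ennreal (1 / m) * indicator G t"
        using gle[OF z] by eventually_elim (auto simp: indicator_def intro!: ennreal_leI split: if_splits)
    qed
    also have "\<dots> = 1" using m by (simp add: nn_integral_cmult ennreal_mult[symmetric])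
    finally show ?thesis .
  qed
  have ball: "(\<lambda>t. B t * indicator G t) \<in> borel_measurable \<mu>" "rho (\<lambda>t. B t * indicator G t) \<le> 1"
    using rho_indicator[of B G] GG bnd(2) by simp_all
  have "(\<integral>t. g t * (B t * indicator G t) \<partial>\<mu>) = (\<integral>t. indicator G t / m \<partial>\<mu>)"
  proof (rule Bochner_Integration.integral_cong)
    fix t show "g t * (B t * indicator G t) = indicator G t / m" using BG[of t] by (cases "t \<in> G") (auto simp: g_def)
  qed simp
  also have "\<dots> = 1" using m sets.sets_into_space[OF G] by (simp add: m_def[symmetric] Int_absorb2)
  finally have att: "(\<integral>t. g t * (B t * indicator G t) \<partial>\<mu>) = 1" .
  have near: "\<exists>z\<in>borel_measurable \<mu>. rho z \<le> 1 \<and> 1 - e \<le> (\<integral>t. g t * z t \<partial>\<mu>)" if e: "0 < e" for e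
    by (rule bexI[OF _ ball(1)]) (use ball(2) att e in auto)
  have "(\<integral>\<^sup>+t. complementary M t (m * \<bar>g t\<bar>) \<partial>\<mu>) \<le> (\<integral>\<^sup>+t. indicator G t \<partial>\<mu>)"
  proof (rule nn_integral_mono)
    fix t
    show "complementary M t (m * \<bar>g t\<bar>) \<le> indicator G t"
    proof (subst complementary_le_iff, safe)
      fix v :: real assume v: "0 < v"
      show "ennreal (m * \<bar>g t\<bar> * v) \<le> M t v + indicator G t"
      proof (cases "t \<in> G")
        case True
        have eq: "m * \<bar>g t\<bar> * v = v / B t" using True m BG[OF True] by (simp add: g_def)
        show ?thesis
        proof (cases "v \<le> B t")
          case le: True
          then have "ennreal (v / B t) \<le> ennreal 1" using BG[OF True] by (intro ennreal_leI) simp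
          then show ?thesis unfolding eq using True by (simp add: add_increasing)
        next
          case False
          then have "\<not> ennreal v \<le> bound t" using bnd(1)[of t] True GG(1) bnd(2)[of t] v by (auto simp: ennreal_le_iff)
          then have "\<not> M t v < \<infinity>" using le_finite_bound[OF v, of "M t"] by (auto simp: bound_def)
          then have "M t v = \<infinity>" by (simp add: less_top[symmetric])
          then show ?thesis by simp
        qed
      qed (simp add: g_def)
    qed
  qed
  also have "\<dots> < \<infinity>" using finG by simp
  finally have compl: "(\<integral>\<^sup>+t. complementary M t (m * \<bar>g t\<bar>) \<partial>\<mu>) < \<infinity>" .
  have pair: "norming_pair x g"
    unfolding norming_pair_def
    by (intro conjI ballI allI impI exI[of _ l] exI[of _ m] x0 rx l compl m(1) dual near) auto
  have "\<not> slice_property x g"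
  proof
    assume slice: "slice_property x g"
    show False
    proof (rule slice_property_loss[where x=x and g=g and l=l and G=G and k=k and th=1 and
          C="2 * m" and good="\<lambda>t z. B t / 2 \<le> z"])
      show "AE t in \<mu>. t \<in> G \<longrightarrow> (\<forall>\<theta> s z. 1/2 \<le> \<theta> \<longrightarrow> \<theta> \<le> 1 \<longrightarrow> 0 \<le> s \<longrightarrow> s \<le> 1 \<longrightarrow> B t / 2 \<le> z \<longrightarrow>
        M t \<bar>\<theta> * (z - s * x t)\<bar> + ennreal k \<le> ennreal \<theta> * (M t \<bar>z\<bar> + M t (x t)))"
        using AE_orlicz
      proof eventually_elim
        case (elim t)
        show ?case
        proof (intro impI allI)
          fix \<theta> s z :: real
          assume t: "t \<in> G" and \<theta>: "1/2 \<le> \<theta>" "\<theta> \<le> 1" and s: "0 \<le> s" "s \<le> 1" and z: "B t / 2 \<le> z"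
          have sx: "s * x t \<le> 1 * x t" "0 \<le> s * x t" using mult_right_mono[OF s(2) x0[of t]] s(1) x0[of t] by auto
          have z0: "0 \<le> z" using z bnd(2)[of t] by linarith
          have xz: "x t \<le> z" using xG[OF t] z by simp
          have "ennreal k = ennreal (1 / 2) * ennreal (2 * k)" by (subst ennreal_mult[symmetric]) (use k in auto)
          also have "\<dots> \<le> ennreal \<theta> * M t (x t)"
          proof (rule mult_mono)
            show "ennreal (2 * k) \<le> M t (x t)" unfolding xG[OF t] using half t GG by blast
            show "ennreal (1 / 2) \<le> ennreal \<theta>" by (rule ennreal_leI[OF \<theta>(1)])
          qed auto
          finally have key: "ennreal k \<le> ennreal \<theta> * M t (x t)" .
          have "\<bar>\<theta> * (z - s * x t)\<bar> = \<theta> * (z - s * x t)" using xz sx \<theta> by simp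
          also have "\<dots> \<le> \<theta> * z" using sx \<theta> by (intro mult_left_mono) auto
          finally have "M t \<bar>\<theta> * (z - s * x t)\<bar> \<le> M t (\<theta> * z)" by (intro orlicz_mono[OF elim]) auto
          also have "\<dots> \<le> ennreal \<theta> * M t z" using \<theta> z0 by (intro orlicz_scale[OF elim]) auto
          finally have "M t \<bar>\<theta> * (z - s * x t)\<bar> \<le> ennreal \<theta> * M t \<bar>z\<bar>" using z0 by simp
          from add_mono[OF this key]
          show "M t \<bar>\<theta> * (z - s * x t)\<bar> + ennreal k \<le> ennreal \<theta> * (M t \<bar>z\<bar> + M t (x t))"
            by (simp add: distrib_left)
        qed
      qed
      show "measure \<mu> {t\<in>G. \<not> B t / 2 \<le> z t} \<le> 2 * m * e"
        if z: "z \<in> borel_measurable \<mu>" "rho z \<le> 1" and e: "0 < e" "1 - e \<le> (\<integral>t. g t * z t \<partial>\<mu>)" for z e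
      proof -
        note [measurable] = z(1)
        note int = norming_pair_integral[OF pair z]
        define A where "A = {t\<in>G. \<not> B t / 2 \<le> z t}"
        have "A = G \<inter> {t\<in>space \<mu>. \<not> B t / 2 \<le> z t}" unfolding A_def using sets.sets_into_space[OF G] by auto
        then have Am: "A \<in> sets \<mu>" by (simp only:) measurable
        have Gint: "integrable \<mu> (\<lambda>t. indicator G t / m :: real)" using finG by (auto intro!: integrable_real_indicator)
        have "1 / (2 * m) * measure \<mu> A \<le> (\<integral>t. indicator G t / m - g t * z t \<partial>\<mu>)"
        proof (rule measure_le_integral[OF _ _ Am])
          show "emeasure \<mu> A < \<infinity>" by (rule order_le_less_trans[OF emeasure_mono[OF _ G] finG]) (auto simp: A_def)
          show "AE t in \<mu>. 0 \<le> indicator G t / m - g t * z t" using gle[OF z] by eventually_elim linarith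
          show "AE t in \<mu>. t \<in> A \<longrightarrow> 1 / (2 * m) \<le> indicator G t / m - g t * z t"
          proof (rule AE_I2, rule impI)
            fix t assume "t \<in> A"
            then have t: "t \<in> G" "z t < B t / 2" by (auto simp: A_def)
            have "z t / B t \<le> 1 / 2" using t BG[OF t(1)] by (simp add: divide_le_eq)
            then have "z t / B t / m \<le> 1 / 2 / m" using m by (intro divide_right_mono) auto
            then show "1 / (2 * m) \<le> indicator G t / m - g t * z t" using t(1) by (simp add: g_def field_simps)
          qed
        qed (use int(1) Gint in auto)
        also have "\<dots> = (\<integral>t. indicator G t / m \<partial>\<mu>) - (\<integral>t. g t * z t \<partial>\<mu>)" using int(1) Gint by (intro Bochner_Integration.integral_diff) auto
        also have "(\<integral>t. indicator G t / m \<partial>\<mu>) = 1" using m sets.sets_into_space[OF G] by (simp add: m_def[symmetric] Int_absorb2)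
        finally have "1 / (2 * m) * measure \<mu> A \<le> e" using e by linarith
        then show ?thesis unfolding A_def[symmetric] using m by (simp add: field_simps)
      qed
      show "{t\<in>G. B t / 2 \<le> z t} \<in> sets \<mu>" if [measurable]: "z \<in> borel_measurable \<mu>" for z
      proof -
        have "{t\<in>G. B t / 2 \<le> z t} = G \<inter> {t\<in>space \<mu>. B t / 2 \<le> z t}" using sets.sets_into_space[OF G] by auto
        then show ?thesis by measurable
      qed
      show "\<bar>\<integral>t. g t * z t \<partial>\<mu>\<bar> \<le> 1" if "z \<in> borel_measurable \<mu>" "rho z \<le> 1" for z
        by (rule norming_pair_integral(3)[OF pair that])
    qed (use x x0 rx l slice G GG finG k m in auto)
  qed
  with pair show ?thesis by blast
qed

lemma positive_piece:
  assumes cover: "\<not> (AE t in \<mu>. P t)" and I: "countable I" and meas: "\<And>i. i \<in> I \<Longrightarrow> S i \<in> sets \<mu>"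
    and sub: "AE t in \<mu>. \<not> P t \<longrightarrow> (\<exists>i\<in>I. t \<in> S i)"
  obtains i where "i \<in> I" "0 < emeasure \<mu> (S i)"
proof -
  have "\<exists>i\<in>I. 0 < emeasure \<mu> (S i)"
  proof (rule ccontr)
    assume "\<not> ?thesis"
    then have "AE t in \<mu>. \<forall>i\<in>I. t \<notin> S i"
      using meas by (intro AE_ball_countable'[OF _ I] AE_not_in) (auto simp: null_sets_def)
    with sub have "AE t in \<mu>. P t" by eventually_elim auto
    with cover show False by blast
  qed
  with that show thesis by blast
qed

lemma eventually_at_top_of_nat:
  assumes "c < \<infinity>" shows "eventually (\<lambda>n. c \<le> ennreal (real n)) sequentially"
proof -
  obtain r where r: "c = ennreal r" "0 \<le> r" using assms by (cases c) auto
  have "eventually (\<lambda>n. r \<le> real n) sequentially" by (rule eventually_sequentiallyI[of "nat \<lceil>r\<rceil>"]) linarith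
  then show ?thesis unfolding r(1) by eventually_elim (rule ennreal_leI)
qed

lemma eventually_inverse_small:
  assumes "0 < c" shows "eventually (\<lambda>n. ennreal (1 / (real n + 2)) < c) sequentially"
proof -
  have "(\<lambda>n. ennreal (1 / (real n + 2))) \<longlonglongrightarrow> ennreal 0" by (intro tendsto_ennrealI) real_asymp
  then show ?thesis using assms by (intro order_tendstoD) auto
qed

text \<open>A strict inequality at \<open>u / 2\<close> survives small changes of the argument, with a margin, by
  convexity between \<open>u / 2\<close> and \<open>u\<close>. The single parameter \<open>n\<close> serves as the index of a countable
  cover.\<close>

lemma nonlinear_point:
  assumes \<phi>: "orlicz_function (M t)" and u: "0 < u" "ennreal u < bound t" and lt: "2 * M t (u / 2) < M t u"
  shows "eventually (\<lambda>n. 2 * M t ((1 / 2 + 1 / (real n + 2)) * u) + ennreal (2 * (1 / (real n + 2))) \<le> M t u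
    \<and> M t ((1 + 1 / (real n + 2)) * u) \<le> ennreal (real n)) sequentially"
proof -
  obtain v where v: "u < v" "M t v < \<infinity>" using finite_below_finite_bound[OF \<phi> _ u(2)[unfolded bound_def]] u by auto
  have fu: "M t u < \<infinity>" using orlicz_mono[OF \<phi>, of u v] v u by (auto intro: order_le_less_trans)
  then obtain a where a: "M t u = ennreal a" "0 \<le> a" by (cases "M t u") auto
  have "M t (u / 2) \<le> M t u" using u by (intro orlicz_mono[OF \<phi>]) auto
  then obtain b where b: "M t (u / 2) = ennreal b" "0 \<le> b" using a by (cases "M t (u / 2)") (auto simp: top_unique)
  have "2 * M t (u / 2) = ennreal (2 * b)" unfolding b(1) using ennreal_mult[of 2 b] b(2) by simp
  then have ab: "2 * b < a" using lt a b by (simp add: ennreal_less_iff)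
  have conv: "M t ((1 / 2 + e) * u) \<le> ennreal (b + 2 * e * a)" if e: "0 \<le> e" "e \<le> 1 / 2" for e
  proof -
    have "(1 / 2 + e) * u = (1 - 2 * e) * (u / 2) + 2 * e * u" by (simp add: field_simps)
    then have "M t ((1 / 2 + e) * u) \<le> ennreal (1 - 2 * e) * M t (u / 2) + ennreal (2 * e) * M t u"
      using orlicz_convex[OF \<phi>, of "u / 2" u "2 * e"] u e by simp
    also have "\<dots> \<le> 1 * ennreal b + ennreal (2 * e) * ennreal a"
      unfolding a b using e by (intro add_mono mult_mono) (auto simp: ennreal_le_1)
    also have "\<dots> = ennreal (b + 2 * e * a)" using a b e by (simp add: ennreal_mult)
    finally show ?thesis .
  qed
  have "(\<lambda>n. 2 * (b + 2 * (1 / (real n + 2)) * a) + 2 * (1 / (real n + 2))) \<longlonglongrightarrow> 2 * b" by real_asymp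
  then have "eventually (\<lambda>n. 2 * (b + 2 * (1 / (real n + 2)) * a) + 2 * (1 / (real n + 2)) < a) sequentially"
    using ab by (rule order_tendstoD)
  moreover have "(\<lambda>n. (1 + 1 / (real n + 2)) * u) \<longlonglongrightarrow> u" by real_asymp
  then have "eventually (\<lambda>n. (1 + 1 / (real n + 2)) * u < v) sequentially" using v(1) by (rule order_tendstoD)
  moreover have "eventually (\<lambda>n. M t v \<le> ennreal (real n)) sequentially" by (rule eventually_at_top_of_nat[OF v(2)])
  ultimately show ?thesis
  proof eventually_elim
    case (elim n)
    define e where "e = 1 / (real n + 2)"
    have e: "0 \<le> e" "e \<le> 1 / 2" by (auto simp: e_def field_simps)
    have "2 * M t ((1 / 2 + e) * u) + ennreal (2 * e) \<le> 2 * ennreal (b + 2 * e * a) + ennreal (2 * e)"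
      by (intro add_right_mono mult_left_mono conv e) simp
    also have "\<dots> = ennreal (2 * (b + 2 * e * a) + 2 * e)"
    proof -
      have "0 \<le> b + 2 * e * a" using a b e by simp
      then have "ennreal (2 * (b + 2 * e * a) + 2 * e) = ennreal (2 * (b + 2 * e * a)) + ennreal (2 * e)"
        using e by (intro ennreal_plus) auto
      then show ?thesis using \<open>0 \<le> b + 2 * e * a\<close> by (simp only: ennreal_mult'' ennreal_numeral)
    qed
    also have "\<dots> \<le> M t u" unfolding a(1) using elim(1) by (intro ennreal_leI) (simp add: e_def)
    finally have 1: "2 * M t ((1 / 2 + e) * u) + ennreal (2 * e) \<le> M t u" .
    have "M t ((1 + e) * u) \<le> M t v" using elim(2) u e by (intro orlicz_mono[OF \<phi>]) (auto simp: e_def)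
    then show ?case using 1 elim(3) by (auto simp: e_def[symmetric])
  qed
qed

text \<open>The points where \<open>M t\<close> is neither linear nor a jump at \<open>flat t = bound t\<close> are covered by countably
  many sets on which one of the two preceding constructions has uniform constants. If the linear
  alternative fails, one of these sets has positive measure.\<close>

lemma slice_property_dichotomy:
  assumes na: "nonatomic \<mu>" and slice: "\<And>x g. norming_pair x g \<Longrightarrow> slice_property x g"
  shows "(AE t in \<mu>. flat t < bound t \<longrightarrow> (\<forall>u>0. M t u = slope t * ennreal u)) \<or> (\<integral>\<^sup>+t. top_value t \<partial>\<mu>) \<le> 1"
proof (rule ccontr)
  define P where "P t \<longleftrightarrow> (flat t < bound t \<longrightarrow> (\<forall>u>0. M t u = slope t * ennreal u))" for t
  assume "\<not> ?thesis"
  then have P: "\<not> (AE t in \<mu>. P t)" and "1 < (\<integral>\<^sup>+t. top_value t \<partial>\<mu>)" by (auto simp: P_def not_le)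
  from exists_modular_above_one[OF this(2)]
  obtain y ly where y: "y \<in> borel_measurable \<mu>" "\<And>t. 0 \<le> y t" "1 < ly" "rho (\<lambda>t. ly * y t) < \<infinity>" "1 < rho y"
    by blast
  obtain F :: "nat \<Rightarrow> 'a set" where F: "range F \<subseteq> sets \<mu>" "(\<Union>i. F i) = space \<mu>"
      "\<And>i. emeasure \<mu> (F i) \<noteq> \<infinity>" "incseq F"
    using sigma_finite_incseq by blast
  have Fm[measurable]: "F n \<in> sets \<mu>" for n using F by auto
  have Fev: "eventually (\<lambda>n. t \<in> F n) sequentially" if t: "t \<in> space \<mu>" for t
  proof -
    obtain i where "t \<in> F i" using t F(2) by auto
    then show ?thesis using incseqD[OF F(4), of i] by (intro eventually_sequentiallyI[of i]) auto
  qed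
  define B where "B t = enn2real (bound t)" for t
  have [measurable]: "B \<in> borel_measurable \<mu>" unfolding B_def by measurable
  have B0: "0 \<le> B t" for t by (simp add: B_def)
  have MB[measurable]: "(\<lambda>t. M t (B t)) \<in> borel_measurable \<mu>" "(\<lambda>t. M t (B t / 2)) \<in> borel_measurable \<mu>"
    by (intro measurable_superposition_nonneg; simp add: B0)+
  \<comment> \<open>The sets S1 (u, n) catch non-linearity at the rational point u, the sets S2 n the functions that are
    linear up to a finite bound and then jump.\<close>
  define S1 where "S1 p = {t \<in> space \<mu>. t \<in> F (snd p) \<and>
      2 * M t ((1 / 2 + 1 / (real (snd p) + 2)) * fst p) + ennreal (2 * (1 / (real (snd p) + 2))) \<le> M t (fst p) \<and>
      M t ((1 + 1 / (real (snd p) + 2)) * fst p) \<le> ennreal (real (snd p))}" for p :: "real \<times> nat"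
  define S2 where "S2 n = {t \<in> space \<mu>. t \<in> F n \<and> bound t < \<infinity> \<and> 0 < bound t \<and>
      ennreal (2 * (1 / (2 * (real n + 2)))) \<le> M t (B t / 2) \<and> M t (B t) \<le> ennreal (real n)}" for n :: nat
  have S1m: "S1 p \<in> sets \<mu>" if "fst p \<in> pos_rats" for p
  proof -
    have [measurable]: "(\<lambda>t. M t (c * fst p)) \<in> borel_measurable \<mu>" if "0 \<le> c" for c
      using \<open>fst p \<in> pos_rats\<close> that by (intro measurable_section) auto
    have [measurable]: "(\<lambda>t. M t (fst p)) \<in> borel_measurable \<mu>" using that by (intro measurable_section) auto
    have [measurable]: "(\<lambda>t. M t ((1 / 2 + 1 / (real (snd p) + 2)) * fst p)) \<in> borel_measurable \<mu>"
      "(\<lambda>t. M t ((1 + 1 / (real (snd p) + 2)) * fst p)) \<in> borel_measurable \<mu>" by auto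
    show ?thesis unfolding S1_def by measurable
  qed
  have S2m: "S2 n \<in> sets \<mu>" for n unfolding S2_def by measurable
  define I where "I = Inl ` (pos_rats \<times> (UNIV :: nat set)) \<union> Inr ` (UNIV :: nat set)"
  have "countable I" unfolding I_def using countable_pos_rats by auto
  define S where "S i = (case i of Inl p \<Rightarrow> S1 p | Inr n \<Rightarrow> S2 n)" for i
  obtain i where i: "i \<in> I" "0 < emeasure \<mu> (S i)"
  proof (rule positive_piece[OF P \<open>countable I\<close>])
    show "S i \<in> sets \<mu>" if "i \<in> I" for i using that S1m S2m by (auto simp: I_def S_def)
    show "AE t in \<mu>. \<not> P t \<longrightarrow> (\<exists>i\<in>I. t \<in> S i)"
      using AE_orlicz AE_space
    proof eventually_elim
      case (elim t)
      show ?case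
      proof
        assume "\<not> P t"
        then obtain u where u: "0 < u" "M t u \<noteq> slope t * ennreal u" and lt: "flat t < bound t" by (auto simp: P_def)
        show "\<exists>i\<in>I. t \<in> S i"
        proof (cases "\<exists>r\<in>pos_rats. ennreal r < bound t \<and> 2 * M t (r / 2) < M t r")
          case True
          then obtain r where r: "r \<in> pos_rats" "ennreal r < bound t" "2 * M t (r / 2) < M t r" by blast
          from nonlinear_point[OF elim(1) _ r(2,3)] r(1) Fev[OF elim(2)]
          have "eventually (\<lambda>n. t \<in> S1 (r, n)) sequentially"
            by (auto simp: S1_def elim(2) elim: eventually_elim2)
          then obtain n where "t \<in> S1 (r, n)" by (auto dest: eventually_happens)
          then show ?thesis using r(1) by (intro bexI[of _ "Inl (r, n)"]) (auto simp: S_def I_def)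
        next
          case False
          have fb: "finite_bound (M t) < \<infinity> \<and> M t (B t) < \<infinity> \<and> 0 < M t (B t / 2)"
            unfolding B_def bound_def
            by (rule linear_up_to_finite_bound[where M=M and t=t, OF elim(1) _ _ u(1)])
              (use False lt u(2) in \<open>auto simp: bound_def flat_def slope_def not_less\<close>)
          have "eventually (\<lambda>n. ennreal (1 / (real n + 2)) < M t (B t / 2)) sequentially"
            by (rule eventually_inverse_small) (use fb in auto)
          moreover have "eventually (\<lambda>n. M t (B t) \<le> ennreal (real n)) sequentially"
            by (rule eventually_at_top_of_nat) (use fb in auto)
          moreover note Fev[OF elim(2)]
          ultimately have "eventually (\<lambda>n. t \<in> S2 n) sequentially"
          proof eventually_elim
            case (elim n)
            have "2 * (1 / (2 * (real n + 2))) = 1 / (real n + 2)" by (simp add: field_simps)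
            then show ?case unfolding S2_def using elim fb \<open>t \<in> space \<mu>\<close> finite_bound_pos[OF \<open>orlicz_function (M t)\<close>]
              by (simp add: bound_def less_imp_le)
          qed
          then obtain n where "t \<in> S2 n" by (auto dest: eventually_happens)
          then show ?thesis by (intro bexI[of _ "Inr n"]) (auto simp: S_def I_def)
        qed
      qed
    qed
  qed
  have fin: "emeasure \<mu> A < \<infinity>" if "A \<subseteq> F n" for A n
    using emeasure_mono[OF that Fm] F(3)[of n] by (auto simp: less_top intro: order_le_less_trans)
  have "\<exists>x g. norming_pair x g \<and> \<not> slice_property x g"
  proof (cases i)
    case (Inl p)
    obtain u n where p: "p = (u, n)" by (cases p)
    have u: "0 < u" "u \<in> pos_rats" using i Inl p by (auto simp: I_def)
    have S1: "S1 p \<in> sets \<mu>" "0 < emeasure \<mu> (S1 p)" "emeasure \<mu> (S1 p) < \<infinity>"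
      using i Inl u p S1m[of p] fin[of "S1 p" n] by (auto simp: S_def S1_def)
    show ?thesis
      by (rule no_slice_property_nonlinear[OF na y S1, where u=u and d="1 / (real n + 2)" and
          k="1 / (real n + 2)" and lu="1 + 1 / (real n + 2)" and K="real n"])
        (use u p in \<open>auto simp: S1_def\<close>)
  next
    case (Inr n)
    have "S2 n \<subseteq> F n" by (auto simp: S2_def)
    then have S2: "S2 n \<in> sets \<mu>" "0 < emeasure \<mu> (S2 n)" "emeasure \<mu> (S2 n) < \<infinity>"
      using i Inr S2m[of n] fin[of "S2 n" n] by (auto simp: S_def)
    show ?thesis
      by (rule no_slice_property_jump[OF na y S2, where k="1 / (2 * (real n + 2))" and B=B and K="real n"])
        (auto simp: S2_def B_def enn2real_positive_iff)
  qed
  then show False using slice by blast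
qed

end

section \<open>Spaces of classes through real representatives\<close>

lemma mem_ae_class: "y \<in> ae_class \<mu> x \<longleftrightarrow> x \<in> borel_measurable \<mu> \<and> y \<in> borel_measurable \<mu> \<and> (AE t in \<mu>. x t = y t)"
  by (auto simp: ae_eq_def)

lemma ae_class_eq_iff:
  "x \<in> borel_measurable \<mu> \<Longrightarrow> y \<in> borel_measurable \<mu> \<Longrightarrow> ae_class \<mu> x = ae_class \<mu> y \<longleftrightarrow> (AE t in \<mu>. x t = y t)"
  using eq_equiv_class_iff[OF equiv_ae_eq, of x \<mu> y] by (auto simp: ae_eq_def)

lemma ae_class_self: "x \<in> borel_measurable \<mu> \<Longrightarrow> x \<in> ae_class \<mu> x"
  unfolding mem_ae_class by simp

definition real_class :: "'a measure \<Rightarrow> ('a \<Rightarrow> real) \<Rightarrow> ('a \<Rightarrow> ereal) set" where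
  "real_class \<mu> x = ae_class \<mu> (\<lambda>t. ereal (x t))"

lemma UN_const_eq: "A \<noteq> {} \<Longrightarrow> (\<And>x. x \<in> A \<Longrightarrow> f x = c) \<Longrightarrow> (\<Union>x\<in>A. f x) = c"
  by auto

lemma real_class_add:
  assumes [measurable]: "x \<in> borel_measurable \<mu>" "y \<in> borel_measurable \<mu>"
  shows "vadd (function_space \<mu> S n) (real_class \<mu> x) (real_class \<mu> y) = real_class \<mu> (\<lambda>t. x t + y t)"
proof -
  have ne: "real_class \<mu> x \<noteq> {}" "real_class \<mu> y \<noteq> {}"
    using ae_class_self[of "\<lambda>t. ereal (x t)" \<mu>] ae_class_self[of "\<lambda>t. ereal (y t)" \<mu>] by (auto simp: real_class_def)
  have "ae_class \<mu> (\<lambda>t. x' t + y' t) = real_class \<mu> (\<lambda>t. x t + y t)"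
    if x': "x' \<in> real_class \<mu> x" and y': "y' \<in> real_class \<mu> y" for x' y'
  proof -
    have [measurable]: "x' \<in> borel_measurable \<mu>" "y' \<in> borel_measurable \<mu>"
      and ae: "AE t in \<mu>. ereal (x t) = x' t" "AE t in \<mu>. ereal (y t) = y' t"
      using x' y' unfolding real_class_def mem_ae_class by auto
    show ?thesis unfolding real_class_def
    proof (subst ae_class_eq_iff)
      show "AE t in \<mu>. x' t + y' t = ereal (x t + y t)"
        using ae
      proof eventually_elim
        case (elim t)
        show ?case unfolding elim[symmetric] by simp
      qed
    qed measurable
  qed
  then show ?thesis unfolding function_space_def by (simp add: UN_const_eq ne)
qed

lemma real_class_scale:
  assumes [measurable]: "x \<in> borel_measurable \<mu>"
  shows "vscale (function_space \<mu> S n) c (real_class \<mu> x) = real_class \<mu> (\<lambda>t. c * x t)"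
proof -
  have ne: "real_class \<mu> x \<noteq> {}"
    using ae_class_self[of "\<lambda>t. ereal (x t)" \<mu>] by (auto simp: real_class_def)
  have "ae_class \<mu> (\<lambda>t. ereal c * x' t) = real_class \<mu> (\<lambda>t. c * x t)"
    if x': "x' \<in> real_class \<mu> x" for x'
  proof -
    have [measurable]: "x' \<in> borel_measurable \<mu>" and ae: "AE t in \<mu>. ereal (x t) = x' t"
      using x' unfolding real_class_def mem_ae_class by auto
    show ?thesis unfolding real_class_def
    proof (subst ae_class_eq_iff)
      show "AE t in \<mu>. ereal c * x' t = ereal (c * x t)"
        using ae
      proof eventually_elim
        case (elim t)
        show ?case unfolding elim[symmetric] by simp
      qed
    qed measurable
  qed
  then show ?thesis unfolding function_space_def by (simp add: UN_const_eq ne)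
qed

lemma real_class_zero: "vzero (function_space \<mu> S n) = real_class \<mu> (\<lambda>t. 0)"
  by (simp add: function_space_def real_class_def zero_ereal_def)

lemma real_class_eq_iff:
  assumes [measurable]: "x \<in> borel_measurable \<mu>" "y \<in> borel_measurable \<mu>"
  shows "real_class \<mu> x = real_class \<mu> y \<longleftrightarrow> (AE t in \<mu>. x t = y t)"
  unfolding real_class_def by (subst ae_class_eq_iff) auto

lemma norm_ae_class:
  assumes x: "x \<in> borel_measurable \<mu>"
    and inv: "\<And>y. y \<in> borel_measurable \<mu> \<Longrightarrow> AE t in \<mu>. x t = y t \<Longrightarrow> n y = n x"
  shows "vnorm (function_space \<mu> S n) (ae_class \<mu> x) = n x"
proof -
  have "n ` ae_class \<mu> x = {n x}"
  proof (intro equalityI subsetI)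
    fix r assume "r \<in> n ` ae_class \<mu> x"
    then obtain y where "y \<in> ae_class \<mu> x" "r = n y" by blast
    then have "y \<in> borel_measurable \<mu>" "AE t in \<mu>. x t = y t" "r = n y" unfolding mem_ae_class by auto
    then show "r \<in> {n x}" using inv[of y] by simp
  next
    fix r assume "r \<in> {n x}"
    then have "r = n x" by simp
    then show "r \<in> n ` ae_class \<mu> x" by (rule image_eqI[OF _ ae_class_self[OF x]])
  qed
  then show ?thesis by (simp add: function_space_def)
qed

text \<open>Because the members of \<open>S\<close> are finite a.e., every class has a real valued representative; \<open>R\<close>
  consists of these and \<open>rnorm\<close> is the norm on them, so that addition and scaling become pointwise
  operations on reals.\<close>

locale class_space =
  fixes \<mu> :: "'a measure" and S :: "('a \<Rightarrow> ereal) set" and n :: "('a \<Rightarrow> ereal) \<Rightarrow> real"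
  assumes meas: "x \<in> S \<Longrightarrow> x \<in> borel_measurable \<mu>"
    and closed: "x \<in> S \<Longrightarrow> y \<in> borel_measurable \<mu> \<Longrightarrow> AE t in \<mu>. x t = y t \<Longrightarrow> y \<in> S"
    and finite: "x \<in> S \<Longrightarrow> AE t in \<mu>. \<bar>x t\<bar> \<noteq> \<infinity>"
    and invariant: "x \<in> borel_measurable \<mu> \<Longrightarrow> y \<in> borel_measurable \<mu> \<Longrightarrow> AE t in \<mu>. x t = y t \<Longrightarrow> n x = n y"
begin

abbreviation X where "X \<equiv> function_space \<mu> S n"

definition R :: "('a \<Rightarrow> real) set" where "R = {x \<in> borel_measurable \<mu>. (\<lambda>t. ereal (x t)) \<in> S}"

definition rnorm :: "('a \<Rightarrow> real) \<Rightarrow> real" where "rnorm x = n (\<lambda>t. ereal (x t))"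

lemma R_measurable: "x \<in> R \<Longrightarrow> x \<in> borel_measurable \<mu>" by (simp add: R_def)

lemma norm_real_class: "x \<in> borel_measurable \<mu> \<Longrightarrow> vnorm X (real_class \<mu> x) = rnorm x"
  unfolding real_class_def rnorm_def by (rule norm_ae_class) (auto intro: invariant)

lemma carrier_eq: "vcarrier X = real_class \<mu> ` R"
proof (intro equalityI subsetI)
  fix C assume "C \<in> vcarrier X"
  then obtain x where x: "C = ae_class \<mu> x" "x \<in> S" by (auto simp: function_space_def)
  note [measurable] = meas[OF x(2)]
  have ae: "AE t in \<mu>. x t = ereal (real_of_ereal (x t))"
    using finite[OF x(2)] by eventually_elim (simp add: ereal_real)
  have "(\<lambda>t. ereal (real_of_ereal (x t))) \<in> S" by (rule closed[OF x(2) _ ae]) measurable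
  then have "(\<lambda>t. real_of_ereal (x t)) \<in> R" by (simp add: R_def)
  moreover have "C = real_class \<mu> (\<lambda>t. real_of_ereal (x t))"
    unfolding real_class_def x(1) using ae by (subst ae_class_eq_iff) auto
  ultimately show "C \<in> real_class \<mu> ` R" by blast
next
  fix C assume "C \<in> real_class \<mu> ` R"
  then show "C \<in> vcarrier X" by (auto simp: function_space_def R_def real_class_def)
qed

lemma unit_ball_image:
  "{h C |C. C \<in> vcarrier X \<and> vnorm X C \<le> 1} = {h (real_class \<mu> x) |x. x \<in> R \<and> rnorm x \<le> 1}"
  unfolding carrier_eq using norm_real_class[OF R_measurable] by force

text \<open>The Daugavet property, applied to the operator \<open>x \<mapsto> f x * y\<close> for a norm one functional \<open>f\<close> and
  a norm one \<open>y\<close>. The functional is defined on functions, the operator on classes, so \<open>f\<close> has to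
  respect a.e. equality.\<close>

lemma rank_one_functional:
  assumes D: "daugavet_property X"
    and R_scale: "\<And>c x. x \<in> R \<Longrightarrow> (\<lambda>t. c * x t) \<in> R"
    and y: "y \<in> R" "rnorm y = 1" and hom: "\<And>c. rnorm (\<lambda>t. c * y t) = \<bar>c\<bar> * rnorm y"
    and f_add: "\<And>x z. x \<in> R \<Longrightarrow> z \<in> R \<Longrightarrow> f (\<lambda>t. x t + z t) = f x + f z"
    and f_scale: "\<And>c x. x \<in> R \<Longrightarrow> f (\<lambda>t. c * x t) = c * f x"
    and f_cong: "\<And>x z. x \<in> borel_measurable \<mu> \<Longrightarrow> z \<in> borel_measurable \<mu> \<Longrightarrow> AE t in \<mu>. x t = z t \<Longrightarrow> f x = f z"
    and f_le: "\<And>x. x \<in> R \<Longrightarrow> \<bar>f x\<bar> \<le> rnorm x"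
    and near: "\<And>e. 0 < e \<Longrightarrow> \<exists>x\<in>R. rnorm x \<le> 1 \<and> 1 - e \<le> f x"
    and c: "c < 2"
  shows "\<exists>x\<in>R. rnorm x \<le> 1 \<and> c < rnorm (\<lambda>t. x t + f x * y t)"
proof -
  define F where "F C = f (SOME x. x \<in> borel_measurable \<mu> \<and> C = real_class \<mu> x)" for C
  have F: "F (real_class \<mu> x) = f x" if x: "x \<in> borel_measurable \<mu>" for x
  proof -
    define z where "z = (SOME z. z \<in> borel_measurable \<mu> \<and> real_class \<mu> x = real_class \<mu> z)"
    have "z \<in> borel_measurable \<mu> \<and> real_class \<mu> x = real_class \<mu> z"
      unfolding z_def by (rule someI[of _ x]) (use x in simp)
    then have "f z = f x" using x by (intro f_cong) (auto simp: real_class_eq_iff)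
    then show ?thesis by (simp add: F_def z_def)
  qed
  define T where "T C = vscale X (F C) (real_class \<mu> y)" for C
  note ym = R_measurable[OF y(1)]
  have T: "T (real_class \<mu> x) = real_class \<mu> (\<lambda>t. f x * y t)" if x: "x \<in> borel_measurable \<mu>" for x
    unfolding T_def F[OF x] by (rule real_class_scale[OF ym])
  have y_scaled: "(\<lambda>t. a * y t) \<in> R" "(\<lambda>t. a * y t) \<in> borel_measurable \<mu>" for a
    using R_scale[OF y(1)] R_measurable by auto
  have normT: "vnorm X (T (real_class \<mu> x)) = \<bar>f x\<bar>" if x: "x \<in> borel_measurable \<mu>" for x
    unfolding T[OF x] norm_real_class[OF y_scaled(2)] hom y by simp
  have lin: "linear_operator X T"
    unfolding linear_operator_def carrier_eq
  proof (intro conjI ballI allI; clarify)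
    fix x assume x: "x \<in> R"
    note xm = R_measurable[OF x]
    show "T (real_class \<mu> x) \<in> real_class \<mu> ` R" unfolding T[OF xm] using y_scaled by blast
    show "T (vscale X a (real_class \<mu> x)) = vscale X a (T (real_class \<mu> x))" for a
      using xm y_scaled(2)
      by (simp add: real_class_scale T R_measurable[OF R_scale[OF x]] f_scale[OF x] mult.assoc)
    fix z assume z: "z \<in> R"
    note zm = R_measurable[OF z]
    have "(\<lambda>t. x t + z t) \<in> borel_measurable \<mu>" using xm zm by measurable
    then show "T (vadd X (real_class \<mu> x) (real_class \<mu> z)) = vadd X (T (real_class \<mu> x)) (T (real_class \<mu> z))"
      using xm zm y_scaled(2)
      by (simp add: real_class_add T f_add[OF x z] distrib_right)
  qed
  have "bounded_operator X T"
    unfolding bounded_operator_def carrier_eq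
    using lin f_le by (auto intro!: exI[of _ 1] simp: normT R_measurable norm_real_class)
  moreover have "rank_one X T"
    unfolding rank_one_def
  proof (intro bexI conjI)
    show "real_class \<mu> y \<in> vcarrier X" unfolding carrier_eq using y by blast
    show "real_class \<mu> y \<noteq> vzero X"
    proof
      assume "real_class \<mu> y = vzero X"
      then have "AE t in \<mu>. y t = 0" unfolding real_class_zero by (subst (asm) real_class_eq_iff) (use ym in auto)
      then have "rnorm y = rnorm (\<lambda>t. 0 * y t)"
        unfolding rnorm_def using ym by (intro invariant) auto
      then show False using hom[of 0] y by simp
    qed
    show "T ` vcarrier X = range (\<lambda>a. vscale X a (real_class \<mu> y))"
    proof (intro equalityI subsetI)
      fix C assume "C \<in> range (\<lambda>a. vscale X a (real_class \<mu> y))"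
      then obtain a where a: "C = real_class \<mu> (\<lambda>t. a * y t)" using real_class_scale[OF ym] by auto
      obtain x where x: "x \<in> R" "1 / 2 \<le> f x" using near[of "1/2"] by auto
      have x': "(\<lambda>t. a / f x * x t) \<in> R" by (rule R_scale[OF x(1)])
      have "f (\<lambda>t. a / f x * x t) = a" unfolding f_scale[OF x(1)] using x by simp
      then have "T (real_class \<mu> (\<lambda>t. a / f x * x t)) = C" unfolding T[OF R_measurable[OF x']] a by simp
      then show "C \<in> T ` vcarrier X" unfolding carrier_eq using x' by blast
    qed (auto simp: T_def)
  qed
  ultimately have eq: "operator_norm X (\<lambda>C. vadd X C (T C)) = 1 + operator_norm X T"
    using D unfolding daugavet_property_def by blast
  have set1: "{vnorm X (T C) |C. C \<in> vcarrier X \<and> vnorm X C \<le> 1} = {\<bar>f x\<bar> |x. x \<in> R \<and> rnorm x \<le> 1}"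
    unfolding unit_ball_image by (rule Collect_cong) (use normT R_measurable in metis)
  have normIT: "vnorm X (vadd X (real_class \<mu> x) (T (real_class \<mu> x))) = rnorm (\<lambda>t. x t + f x * y t)" if x: "x \<in> R" for x
  proof -
    note xm = R_measurable[OF x]
    have "(\<lambda>t. x t + f x * y t) \<in> borel_measurable \<mu>" using xm ym by measurable
    then show ?thesis unfolding T[OF xm] real_class_add[OF xm y_scaled(2)] by (rule norm_real_class)
  qed
  have "1 \<le> operator_norm X T"
    unfolding operator_norm_def set1
  proof (rule field_le_epsilon)
    fix e :: real assume "0 < e"
    then obtain x where x: "x \<in> R" "rnorm x \<le> 1" "1 - e \<le> f x" using near by blast
    have "\<bar>f x\<bar> \<le> Sup {\<bar>f x\<bar> |x. x \<in> R \<and> rnorm x \<le> 1}"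
      using x f_le by (intro cSup_upper bdd_aboveI[of _ 1]) (auto intro: order_trans)
    then show "1 \<le> Sup {\<bar>f x\<bar> |x. x \<in> R \<and> rnorm x \<le> 1} + e" using x by linarith
  qed
  then have "c < Sup {vnorm X (vadd X C (T C)) |C. C \<in> vcarrier X \<and> vnorm X C \<le> 1}"
    using eq c unfolding operator_norm_def[of X "\<lambda>C. vadd X C (T C)"] by linarith
  moreover obtain x0 where "x0 \<in> R" "rnorm x0 \<le> 1" using near[of 1] by auto
  then have "{vnorm X (vadd X C (T C)) |C. C \<in> vcarrier X \<and> vnorm X C \<le> 1} \<noteq> {}"
    unfolding carrier_eq using norm_real_class[OF R_measurable] by force
  ultimately obtain C where C: "C \<in> vcarrier X" "vnorm X C \<le> 1" "c < vnorm X (vadd X C (T C))"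
    using less_cSupE by (smt (verit, best) mem_Collect_eq)
  then obtain x where x: "x \<in> R" "C = real_class \<mu> x" unfolding carrier_eq by blast
  show ?thesis using C x normIT[OF x(1)] norm_real_class[OF R_measurable[OF x(1)]] by auto
qed

text \<open>A rank one operator is \<open>x \<mapsto> f x * y\<close> with a bounded functional \<open>f\<close>. Changing the sign of \<open>x\<close> one may
  assume \<open>f x \<ge> 0\<close>, and then it is enough to find, for each \<open>x\<close> in the unit ball, another \<open>x'\<close> with
  \<open>\<parallel>x' + f x' y\<parallel> \<ge> 1 + f x \<parallel>y\<parallel> - e\<close>.\<close>

lemma daugavet_propertyI:
  assumes R_add: "\<And>x z. x \<in> R \<Longrightarrow> z \<in> R \<Longrightarrow> (\<lambda>t. x t + z t) \<in> R"
    and R_scale: "\<And>c x. x \<in> R \<Longrightarrow> (\<lambda>t. c * x t) \<in> R"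
    and hom: "\<And>c x. x \<in> R \<Longrightarrow> rnorm (\<lambda>t. c * x t) = \<bar>c\<bar> * rnorm x"
    and tri: "\<And>x z. x \<in> R \<Longrightarrow> z \<in> R \<Longrightarrow> rnorm (\<lambda>t. x t + z t) \<le> rnorm x + rnorm z"
    and definite: "\<And>x. x \<in> R \<Longrightarrow> \<not> (AE t in \<mu>. x t = 0) \<Longrightarrow> 0 < rnorm x"
    and main: "\<And>f L x y e. (\<And>x z. x \<in> R \<Longrightarrow> z \<in> R \<Longrightarrow> f (\<lambda>t. x t + z t) = f x + f z) \<Longrightarrow>
      (\<And>c x. x \<in> R \<Longrightarrow> f (\<lambda>t. c * x t) = c * f x) \<Longrightarrow> (\<And>x. x \<in> R \<Longrightarrow> \<bar>f x\<bar> \<le> L * rnorm x) \<Longrightarrow> 0 \<le> L \<Longrightarrow>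
      y \<in> R \<Longrightarrow> 0 < rnorm y \<Longrightarrow> x \<in> R \<Longrightarrow> rnorm x \<le> 1 \<Longrightarrow> 0 \<le> f x \<Longrightarrow> 0 < e \<Longrightarrow>
      \<exists>x'\<in>R. rnorm x' \<le> 1 \<and> 1 + f x * rnorm y - e \<le> rnorm (\<lambda>t. x' t + f x' * y t)"
  shows "daugavet_property X"
  unfolding daugavet_property_def
proof (intro allI impI)
  fix T assume T: "bounded_operator X T \<and> rank_one X T"
  then obtain Y where Y: "Y \<in> vcarrier X" "Y \<noteq> vzero X" "T ` vcarrier X = range (\<lambda>c. vscale X c Y)"
    unfolding rank_one_def by blast
  then obtain y where y: "y \<in> R" "Y = real_class \<mu> y" unfolding carrier_eq by blast
  note ym = R_measurable[OF y(1)]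
  have yne: "\<not> (AE t in \<mu>. y t = 0)"
    using Y(2) unfolding y(2) real_class_zero by (subst (asm) real_class_eq_iff) (use ym in auto)
  have ny: "0 < rnorm y" by (rule definite[OF y(1) yne])
  have rnorm0: "rnorm (\<lambda>t. 0) = 0" using hom[OF y(1), of 0] by simp
  have nonneg: "0 \<le> rnorm x" if x: "x \<in> R" for x
  proof (cases "AE t in \<mu>. x t = 0")
    case True
    then have "rnorm x = rnorm (\<lambda>t. 0)" unfolding rnorm_def using R_measurable[OF x] by (intro invariant) auto
    then show ?thesis using rnorm0 by simp
  qed (use definite[OF x] in force)
  have lin: "linear_operator X T" using T by (simp add: bounded_operator_def)
  define f where "f x = (SOME c. T (real_class \<mu> x) = real_class \<mu> (\<lambda>t. c * y t))" for x
  have y_scaled: "(\<lambda>t. a * y t) \<in> R" "(\<lambda>t. a * y t) \<in> borel_measurable \<mu>" for a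
    using R_scale[OF y(1)] R_measurable by auto
  have Tf: "T (real_class \<mu> x) = real_class \<mu> (\<lambda>t. f x * y t)" if x: "x \<in> R" for x
  proof -
    have "T (real_class \<mu> x) \<in> T ` vcarrier X" unfolding carrier_eq using x by blast
    then have "\<exists>c. T (real_class \<mu> x) = real_class \<mu> (\<lambda>t. c * y t)"
      unfolding Y(3) y(2) using real_class_scale[OF ym] by auto
    then show ?thesis unfolding f_def by (rule someI_ex)
  qed
  have unique: "c = d" if "real_class \<mu> (\<lambda>t. c * y t) = real_class \<mu> (\<lambda>t. d * y t)" for c d
  proof (rule ccontr)
    assume "c \<noteq> d"
    have "AE t in \<mu>. c * y t = d * y t" using that y_scaled(2) by (simp add: real_class_eq_iff)
    then have "AE t in \<mu>. y t = 0" by eventually_elim (use \<open>c \<noteq> d\<close> in auto)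
    then show False using yne by simp
  qed
  have f_add: "f (\<lambda>t. x t + z t) = f x + f z" if x: "x \<in> R" and z: "z \<in> R" for x z
  proof (rule unique)
    note xm = R_measurable[OF x] and zm = R_measurable[OF z]
    have "real_class \<mu> (\<lambda>t. f (\<lambda>t. x t + z t) * y t) = T (vadd X (real_class \<mu> x) (real_class \<mu> z))"
      unfolding real_class_add[OF xm zm] Tf[OF R_add[OF x z]] ..
    also have "\<dots> = vadd X (T (real_class \<mu> x)) (T (real_class \<mu> z))"
      using lin x z unfolding linear_operator_def carrier_eq by blast
    also have "\<dots> = real_class \<mu> (\<lambda>t. (f x + f z) * y t)"
      unfolding Tf[OF x] Tf[OF z] real_class_add[OF y_scaled(2) y_scaled(2)] by (simp add: distrib_right)
    finally show "real_class \<mu> (\<lambda>t. f (\<lambda>t. x t + z t) * y t) = real_class \<mu> (\<lambda>t. (f x + f z) * y t)" .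
  qed
  have f_scale: "f (\<lambda>t. c * x t) = c * f x" if x: "x \<in> R" for c x
  proof (rule unique)
    note xm = R_measurable[OF x]
    have "real_class \<mu> (\<lambda>t. f (\<lambda>t. c * x t) * y t) = T (vscale X c (real_class \<mu> x))"
      unfolding real_class_scale[OF xm] Tf[OF R_scale[OF x]] ..
    also have "\<dots> = vscale X c (T (real_class \<mu> x))"
      using lin x unfolding linear_operator_def carrier_eq by blast
    also have "\<dots> = real_class \<mu> (\<lambda>t. c * f x * y t)"
      unfolding Tf[OF x] real_class_scale[OF y_scaled(2)] by (simp add: mult.assoc)
    finally show "real_class \<mu> (\<lambda>t. f (\<lambda>t. c * x t) * y t) = real_class \<mu> (\<lambda>t. c * f x * y t)" .
  qed
  have normT: "vnorm X (T (real_class \<mu> x)) = \<bar>f x\<bar> * rnorm y" if x: "x \<in> R" for x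
    unfolding Tf[OF x] norm_real_class[OF y_scaled(2)] hom[OF y(1)] ..
  have normIT: "vnorm X (vadd X (real_class \<mu> x) (T (real_class \<mu> x))) = rnorm (\<lambda>t. x t + f x * y t)" if x: "x \<in> R" for x
    unfolding Tf[OF x] real_class_add[OF R_measurable[OF x] y_scaled(2)]
    by (rule norm_real_class[OF R_measurable[OF R_add[OF x y_scaled(1)]]])
  obtain K where "\<forall>C\<in>vcarrier X. vnorm X (T C) \<le> K * vnorm X C" using T unfolding bounded_operator_def by blast
  then have K: "\<bar>f x\<bar> * rnorm y \<le> K * rnorm x" if x: "x \<in> R" for x
    using x normT[OF x] norm_real_class[OF R_measurable[OF x]] unfolding carrier_eq by force
  define L where "L = \<bar>K\<bar> / rnorm y"
  have L: "0 \<le> L" using ny by (simp add: L_def)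
  have f_le: "\<bar>f x\<bar> \<le> L * rnorm x" if x: "x \<in> R" for x
  proof -
    have "\<bar>f x\<bar> * rnorm y \<le> \<bar>K\<bar> * rnorm x"
      by (rule order_trans[OF K[OF x] mult_right_mono[OF abs_ge_self nonneg[OF x]]])
    then show ?thesis using ny by (simp add: L_def field_simps)
  qed
  define A where "A = {\<bar>f x\<bar> * rnorm y |x. x \<in> R \<and> rnorm x \<le> 1}"
  define B where "B = {rnorm (\<lambda>t. x t + f x * y t) |x. x \<in> R \<and> rnorm x \<le> 1}"
  have opA: "operator_norm X T = Sup A"
    unfolding operator_norm_def unit_ball_image A_def
    by (rule arg_cong[where f=Sup], rule Collect_cong) (use normT in metis)
  have opB: "operator_norm X (\<lambda>C. vadd X C (T C)) = Sup B"
    unfolding operator_norm_def unit_ball_image B_def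
    by (rule arg_cong[where f=Sup], rule Collect_cong) (use normIT in metis)
  have ne: "\<exists>x. x \<in> R \<and> rnorm x \<le> 1"
    by (rule exI[of _ "\<lambda>t. 0 * y t"]) (use R_scale[OF y(1), of 0] rnorm0 in simp)
  have AL: "r \<le> L * rnorm y" if "r \<in> A" for r
  proof -
    obtain x where x: "r = \<bar>f x\<bar> * rnorm y" "x \<in> R" "rnorm x \<le> 1" using \<open>r \<in> A\<close> by (auto simp: A_def)
    have "\<bar>f x\<bar> \<le> L * 1" using f_le[OF x(2)] mult_left_mono[OF x(3) L] by linarith
    then show ?thesis unfolding x(1) using ny by (intro mult_right_mono) auto
  qed
  have bddA: "bdd_above A" by (rule bdd_aboveI[OF AL])
  have BA: "r \<le> 1 + Sup A" if "r \<in> B" for r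
  proof -
    obtain x where x: "r = rnorm (\<lambda>t. x t + f x * y t)" "x \<in> R" "rnorm x \<le> 1" using \<open>r \<in> B\<close> by (auto simp: B_def)
    have "r \<le> rnorm x + \<bar>f x\<bar> * rnorm y" unfolding x(1) using tri[OF x(2) y_scaled(1), of "f x"] hom[OF y(1)] by simp
    moreover have "\<bar>f x\<bar> * rnorm y \<le> Sup A" using x by (intro cSup_upper bddA) (auto simp: A_def)
    ultimately show ?thesis using x(3) by linarith
  qed
  have bddB: "bdd_above B" by (rule bdd_aboveI[OF BA])
  have "Sup B \<le> 1 + Sup A" by (rule cSup_least) (use ne BA in \<open>auto simp: B_def\<close>)
  moreover have "Sup A \<le> Sup B - 1"
  proof (rule cSup_least)
    show "A \<noteq> {}" using ne by (auto simp: A_def)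
    fix r assume "r \<in> A"
    then obtain x where x: "r = \<bar>f x\<bar> * rnorm y" "x \<in> R" "rnorm x \<le> 1" by (auto simp: A_def)
    define s :: real where "s = (if 0 \<le> f x then 1 else - 1)"
    define z where "z t = s * x t" for t
    have z: "z \<in> R" "rnorm z \<le> 1" "f z = \<bar>f x\<bar>"
      unfolding z_def using R_scale[OF x(2)] hom[OF x(2)] f_scale[OF x(2)] x(3) by (auto simp: s_def)
    show "r \<le> Sup B - 1"
    proof (rule field_le_epsilon)
      fix e :: real assume e: "0 < e"
      have "\<exists>x'\<in>R. rnorm x' \<le> 1 \<and> 1 + f z * rnorm y - e \<le> rnorm (\<lambda>t. x' t + f x' * y t)"
        by (rule main[OF f_add f_scale f_le L y(1) ny z(1,2) _ e]) (use z in auto)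
      then obtain x' where x': "x' \<in> R" "rnorm x' \<le> 1" "1 + f z * rnorm y - e \<le> rnorm (\<lambda>t. x' t + f x' * y t)" by blast
      have "rnorm (\<lambda>t. x' t + f x' * y t) \<le> Sup B" using x' by (intro cSup_upper bddB) (auto simp: B_def)
      then show "r \<le> Sup B - 1 + e" using x'(3) z(3) x(1) by simp
    qed
  qed
  ultimately show "operator_norm X (\<lambda>x. vadd X x (T x)) = 1 + operator_norm X T" unfolding opA opB by linarith
qed

end

section \<open>Sums of weighted spaces\<close>

text \<open>A property of sets that passes to disjoint unions and holds for all sets of small mass \<open>\<integral>f\<close> holds
  for the whole space. The sets all of whose measurable subsets have the property are closed under finite
  unions. The unions of a sequence of them that exhausts their supremal mass miss nothing but a null
  set for \<open>\<integral>f\<close>, since otherwise a small piece could be added; so finitely many leave a remainder of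
  small mass.\<close>

lemma nonatomic_set_induct:
  assumes na: "nonatomic \<mu>" and f[measurable]: "f \<in> borel_measurable \<mu>"
    and fin: "(\<integral>\<^sup>+t. f t \<partial>\<mu>) < \<infinity>" and e: "0 < e"
    and small: "\<And>A. A \<in> sets \<mu> \<Longrightarrow> (\<integral>\<^sup>+t\<in>A. f t \<partial>\<mu>) \<le> ennreal e \<Longrightarrow> P A"
    and disj: "\<And>A B. A \<in> sets \<mu> \<Longrightarrow> B \<in> sets \<mu> \<Longrightarrow> A \<inter> B = {} \<Longrightarrow> P A \<Longrightarrow> P B \<Longrightarrow> P (A \<union> B)"
  shows "P (space \<mu>)"
proof -
  define \<nu> where "\<nu> = density \<mu> f"
  have sets_nu[measurable_cong]: "sets \<nu> = sets \<mu>" and space_nu: "space \<nu> = space \<mu>" by (auto simp: \<nu>_def)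
  have em: "emeasure \<nu> A = (\<integral>\<^sup>+t\<in>A. f t \<partial>\<mu>)" if "A \<in> sets \<mu>" for A
    unfolding \<nu>_def using that by (simp add: emeasure_density)
  interpret nu: finite_measure \<nu>
  proof
    have "emeasure \<nu> (space \<nu>) = (\<integral>\<^sup>+t. f t \<partial>\<mu>)"
      unfolding space_nu em[OF sets.top] by (rule nn_integral_cong) (simp add: indicator_def)
    then show "emeasure \<nu> (space \<nu>) \<noteq> \<infinity>" using fin by simp
  qed
  have small': "P A" if "A \<in> sets \<mu>" "measure \<nu> A \<le> e" for A
  proof (rule small[OF that(1)])
    show "(\<integral>\<^sup>+t\<in>A. f t \<partial>\<mu>) \<le> ennreal e"
      unfolding em[OF that(1), symmetric] nu.emeasure_eq_measure by (rule ennreal_leI[OF that(2)])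
  qed
  define Q where "Q B \<longleftrightarrow> B \<in> sets \<mu> \<and> (\<forall>C\<in>sets \<mu>. C \<subseteq> B \<longrightarrow> P C)" for B
  have Q_small: "Q A" if "A \<in> sets \<mu>" "measure \<nu> A \<le> e" for A
    unfolding Q_def
  proof (intro conjI ballI impI)
    fix C assume "C \<in> sets \<mu>" "C \<subseteq> A"
    then show "P C" using nu.finite_measure_mono[of C A] that by (intro small') (auto simp: sets_nu)
  qed (use that in auto)
  have Q_Un: "Q (A \<union> B)" if A: "Q A" and B: "Q B" for A B
    unfolding Q_def
  proof (intro conjI ballI impI)
    show "A \<union> B \<in> sets \<mu>" using A B by (auto simp: Q_def)
    fix C assume C: "C \<in> sets \<mu>" "C \<subseteq> A \<union> B"
    have Am: "A \<in> sets \<mu>" using A by (simp add: Q_def)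
    have sub: "C - A \<subseteq> B" using C(2) by blast
    have "P (C \<inter> A)" using A sets.Int[OF C(1) Am] unfolding Q_def by blast
    moreover have "P (C - A)" using B sets.Diff[OF C(1) Am] sub unfolding Q_def by blast
    ultimately have "P (C \<inter> A \<union> (C - A))" using C(1) Am by (intro disj) auto
    then show "P C" by (simp add: Int_Diff_Un)
  qed
  define s where "s = Sup (measure \<nu> ` Collect Q)"
  have Q_empty: "Q {}" by (rule Q_small) (use e in auto)
  have bdd: "bdd_above (measure \<nu> ` Collect Q)"
    by (rule bdd_aboveI[of _ "measure \<nu> (space \<nu>)"]) (auto intro: nu.bounded_measure)
  have "\<exists>B. Q B \<and> s - 1 / (real n + 1) < measure \<nu> B" for n :: nat
  proof -
    have "s - 1 / (real n + 1) < Sup (measure \<nu> ` Collect Q)" unfolding s_def by simp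
    then show ?thesis using Q_empty by (subst (asm) less_cSup_iff[OF _ bdd]) auto
  qed
  then obtain B where B: "\<And>n. Q (B n)" "\<And>n. s - 1 / (real n + 1) < measure \<nu> (B n)" by metis
  define U where "U n = (\<Union>i\<le>n. B i)" for n
  have QU: "Q (U n)" for n
  proof (induction n)
    case (Suc n)
    have "U (Suc n) = U n \<union> B (Suc n)" by (auto simp: U_def atMost_Suc)
    then show ?case using Q_Un[OF Suc B(1)] by simp
  qed (simp add: U_def B)
  have Um[measurable]: "U n \<in> sets \<mu>" for n using QU by (auto simp: Q_def)
  define V where "V = space \<mu> - (\<Union>n. U n)"
  have Vm[measurable]: "V \<in> sets \<mu>" unfolding V_def by measurable
  have "measure \<nu> V = 0"
  proof (rule ccontr)
    assume "measure \<nu> V \<noteq> 0"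
    define W where "W = {t \<in> V. 0 < f t}"
    have "W = V \<inter> {t \<in> space \<mu>. 0 < f t}" unfolding W_def using sets.sets_into_space[OF Vm] by auto
    then have Wm: "W \<in> sets \<mu>" by (simp only:) measurable
    have "0 < emeasure \<mu> W"
    proof (rule ccontr)
      assume "\<not> 0 < emeasure \<mu> W"
      then have "AE t in \<mu>. t \<notin> W" using Wm by (intro AE_not_in) (auto simp: null_sets_def)
      then have "AE t in \<mu>. f t * indicator V t = 0" by eventually_elim (auto simp: W_def indicator_def)
      then have "emeasure \<nu> V = 0" unfolding em[OF Vm] by (subst nn_integral_0_iff_AE) auto
      then show False using \<open>measure \<nu> V \<noteq> 0\<close> by (simp add: measure_def)
    qed
    moreover have "(\<integral>\<^sup>+t\<in>W. f t \<partial>\<mu>) < \<infinity>"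
      by (rule order_le_less_trans[OF nn_integral_mono fin]) (simp add: indicator_def)
    ultimately obtain C where C: "C \<in> sets \<mu>" "C \<subseteq> W" "0 < emeasure \<mu> C" "(\<integral>\<^sup>+t\<in>C. f t \<partial>\<mu>) \<le> ennreal e"
      using nonatomic_small_subset[OF na Wm _ f _ e] by metis
    have mC: "measure \<nu> C \<le> e" using C(4) e unfolding em[OF C(1), symmetric] by (simp add: nu.emeasure_eq_measure)
    have "measure \<nu> C \<noteq> 0"
    proof
      assume "measure \<nu> C = 0"
      then have "(\<integral>\<^sup>+t\<in>C. f t \<partial>\<mu>) = 0" unfolding em[OF C(1), symmetric] by (simp add: nu.emeasure_eq_measure)
      then have "AE t in \<mu>. f t * indicator C t = 0" by (subst (asm) nn_integral_0_iff_AE) (use C(1) in auto)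
      then have "AE t in \<mu>. t \<notin> C" by eventually_elim (use C(2) in \<open>auto simp: W_def indicator_def\<close>)
      then have "emeasure \<mu> C = 0" using C(1) by (metis AE_iff_null_sets null_setsD1)
      then show False using C(3) by simp
    qed
    then have "0 < measure \<nu> C" by (simp add: zero_less_measure_iff)
    then obtain n :: nat where n: "1 / (real n + 1) < measure \<nu> C"
      using reals_Archimedean[of "measure \<nu> C"] by (auto simp: inverse_eq_divide add.commute)
    have "B n \<inter> C = {}" using C(2) by (auto simp: W_def V_def U_def)
    then have "measure \<nu> (B n \<union> C) = measure \<nu> (B n) + measure \<nu> C"
      using B(1)[of n] C(1) by (intro nu.finite_measure_Union) (auto simp: Q_def sets_nu)
    moreover have "measure \<nu> (B n \<union> C) \<le> s"
      unfolding s_def by (rule cSup_upper[OF _ bdd]) (use Q_Un[OF B(1) Q_small[OF C(1) mC], of n] in auto)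
    ultimately show False using B(2)[of n] n by linarith
  qed
  have "(\<lambda>n. measure \<nu> (U n)) \<longlonglongrightarrow> measure \<nu> (\<Union>n. U n)"
  proof (rule nu.finite_Lim_measure_incseq)
    show "range U \<subseteq> sets \<nu>" using Um by (auto simp: sets_nu)
    show "incseq U" unfolding U_def incseq_def by (auto intro: order_trans)
  qed
  moreover have "measure \<nu> (\<Union>n. U n) = measure \<nu> (space \<mu>)"
  proof -
    have "measure \<nu> V = measure \<nu> (space \<nu>) - measure \<nu> (\<Union>n. U n)"
      unfolding V_def space_nu[symmetric] by (rule nu.finite_measure_compl) (auto simp: sets_nu)
    then show ?thesis using \<open>measure \<nu> V = 0\<close> by (simp add: space_nu)
  qed
  ultimately have "(\<lambda>n. measure \<nu> (U n)) \<longlonglongrightarrow> measure \<nu> (space \<mu>)" by simp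
  then have "eventually (\<lambda>n. measure \<nu> (space \<mu>) - e < measure \<nu> (U n)) sequentially"
    using e by (intro order_tendstoD(1)) auto
  then obtain n where n: "measure \<nu> (space \<mu>) - e < measure \<nu> (U n)" by (auto dest: eventually_happens)
  have "measure \<nu> (space \<mu> - U n) = measure \<nu> (space \<mu>) - measure \<nu> (U n)"
    unfolding space_nu[symmetric] by (rule nu.finite_measure_compl) (auto simp: sets_nu)
  then have "Q (space \<mu> - U n)" using n by (intro Q_small) auto
  from Q_Un[OF QU[of n] this] have "Q (space \<mu>)" using sets.sets_into_space[OF Um, of n] by (simp add: Un_absorb1)
  then show ?thesis by (simp add: Q_def)
qed

text \<open>Functions on \<open>D\<close> are normed by a weighted integral, functions off \<open>D\<close> by a weighted supremum. Extending
  the weights by zero lets both seminorms be written on the whole space; \<open>Y\<close> consists of the functions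
  for which both are finite.\<close>

locale weighted_sum =
  fixes \<mu> :: "'a measure" and D :: "'a set" and \<kappa>1 \<kappa>2 :: "'a \<Rightarrow> real"
  assumes na: "nonatomic \<mu>" and D[measurable]: "D \<in> sets \<mu>"
    and k1[measurable]: "\<kappa>1 \<in> borel_measurable \<mu>" and k2[measurable]: "\<kappa>2 \<in> borel_measurable \<mu>"
    and k1_nonneg: "\<And>t. 0 \<le> \<kappa>1 t" and k2_nonneg: "\<And>t. 0 \<le> \<kappa>2 t"
    and k1_off: "\<And>t. t \<notin> D \<Longrightarrow> \<kappa>1 t = 0" and k2_off: "\<And>t. t \<in> D \<Longrightarrow> \<kappa>2 t = 0"
    and k1_pos: "AE t in \<mu>. t \<in> D \<longrightarrow> 0 < \<kappa>1 t" and k2_pos: "AE t in \<mu>. t \<notin> D \<longrightarrow> 0 < \<kappa>2 t"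
begin

definition Y :: "('a \<Rightarrow> real) set" where
  "Y = {x \<in> borel_measurable \<mu>. integrable \<mu> (\<lambda>t. x t * \<kappa>1 t) \<and> (\<exists>c. AE t in \<mu>. \<bar>x t * \<kappa>2 t\<bar> \<le> c)}"

definition int_norm :: "('a \<Rightarrow> real) \<Rightarrow> real" where "int_norm x = (\<integral>t. \<bar>x t * \<kappa>1 t\<bar> \<partial>\<mu>)"

definition sup_norm :: "('a \<Rightarrow> real) \<Rightarrow> real" where
  "sup_norm x = enn2real (esssup \<mu> (\<lambda>t. ennreal \<bar>x t * \<kappa>2 t\<bar>))"

lemma Y_measurable: "x \<in> Y \<Longrightarrow> x \<in> borel_measurable \<mu>" by (simp add: Y_def)
lemma Y_integrable: "x \<in> Y \<Longrightarrow> integrable \<mu> (\<lambda>t. x t * \<kappa>1 t)" by (simp add: Y_def)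

lemma sup_norm_nonneg: "0 \<le> sup_norm x" by (simp add: sup_norm_def)
lemma int_norm_nonneg: "0 \<le> int_norm x" by (simp add: int_norm_def integral_nonneg_AE)

lemma sup_norm_le: assumes [measurable]: "x \<in> borel_measurable \<mu>" and c: "0 \<le> c" "AE t in \<mu>. \<bar>x t * \<kappa>2 t\<bar> \<le> c" shows "sup_norm x \<le> c"
proof -
  have "esssup \<mu> (\<lambda>t. ennreal \<bar>x t * \<kappa>2 t\<bar>) \<le> ennreal c"
  proof (rule esssup_I)
    show "AE t in \<mu>. ennreal \<bar>x t * \<kappa>2 t\<bar> \<le> ennreal c" using c(2) by eventually_elim (rule ennreal_leI)
  qed measurable
  then show ?thesis unfolding sup_norm_def by (rule enn2real_leI[OF c(1)])
qed

lemma sup_norm_AE: assumes x: "x \<in> Y" shows "AE t in \<mu>. \<bar>x t * \<kappa>2 t\<bar> \<le> sup_norm x"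
proof -
  note [measurable] = Y_measurable[OF x]
  obtain c where "AE t in \<mu>. \<bar>x t * \<kappa>2 t\<bar> \<le> c" using x by (auto simp: Y_def)
  then have "AE t in \<mu>. ennreal \<bar>x t * \<kappa>2 t\<bar> \<le> ennreal c" by eventually_elim (rule ennreal_leI)
  then have "esssup \<mu> (\<lambda>t. ennreal \<bar>x t * \<kappa>2 t\<bar>) \<le> ennreal c" by (intro esssup_I) auto
  then have "esssup \<mu> (\<lambda>t. ennreal \<bar>x t * \<kappa>2 t\<bar>) < top" by (rule order_le_less_trans) simp
  then have eq: "esssup \<mu> (\<lambda>t. ennreal \<bar>x t * \<kappa>2 t\<bar>) = ennreal (sup_norm x)" by (simp add: sup_norm_def)
  show ?thesis using esssup_AE[of "\<lambda>t. ennreal \<bar>x t * \<kappa>2 t\<bar>" \<mu>] unfolding eq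
    by eventually_elim (simp add: sup_norm_nonneg)
qed

lemma Y_solid:
  assumes z: "z \<in> Y" and [measurable]: "x \<in> borel_measurable \<mu>" and le: "AE t in \<mu>. \<bar>x t\<bar> \<le> \<bar>z t\<bar>"
  shows "x \<in> Y" "int_norm x \<le> int_norm z" "sup_norm x \<le> sup_norm z"
proof -
  note [measurable] = Y_measurable[OF z]
  have 1: "AE t in \<mu>. \<bar>x t * \<kappa>1 t\<bar> \<le> \<bar>z t * \<kappa>1 t\<bar>"
    using le by eventually_elim (simp add: abs_mult k1_nonneg mult_right_mono)
  have 2: "AE t in \<mu>. \<bar>x t * \<kappa>2 t\<bar> \<le> sup_norm z"
    using le sup_norm_AE[OF z]
  proof eventually_elim
    case (elim t)
    have "\<bar>x t * \<kappa>2 t\<bar> \<le> \<bar>z t * \<kappa>2 t\<bar>" using elim(1) by (simp add: abs_mult k2_nonneg mult_right_mono)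
    then show ?case using elim(2) by simp
  qed
  have i: "integrable \<mu> (\<lambda>t. x t * \<kappa>1 t)"
    by (rule Bochner_Integration.integrable_bound[OF Y_integrable[OF z]]) (use 1 in auto)
  show "x \<in> Y" using i 2 by (auto simp: Y_def)
  show "int_norm x \<le> int_norm z" unfolding int_norm_def using 1 i Y_integrable[OF z] by (intro integral_mono_AE) auto
  show "sup_norm x \<le> sup_norm z" by (rule sup_norm_le[OF _ sup_norm_nonneg 2]) measurable
qed

lemma Y_add: assumes x: "x \<in> Y" and z: "z \<in> Y"
  shows "(\<lambda>t. x t + z t) \<in> Y" "int_norm (\<lambda>t. x t + z t) \<le> int_norm x + int_norm z" "sup_norm (\<lambda>t. x t + z t) \<le> sup_norm x + sup_norm z"
proof -
  note [measurable] = Y_measurable[OF x] Y_measurable[OF z]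
  have 2: "AE t in \<mu>. \<bar>(x t + z t) * \<kappa>2 t\<bar> \<le> sup_norm x + sup_norm z"
    using sup_norm_AE[OF x] sup_norm_AE[OF z] by eventually_elim (simp add: distrib_right)
  have i: "integrable \<mu> (\<lambda>t. (x t + z t) * \<kappa>1 t)"
    using Y_integrable[OF x] Y_integrable[OF z] by (simp add: distrib_right)
  show "(\<lambda>t. x t + z t) \<in> Y" using i 2 by (auto simp: Y_def)
  show "sup_norm (\<lambda>t. x t + z t) \<le> sup_norm x + sup_norm z" by (rule sup_norm_le[OF _ _ 2]) (auto simp: sup_norm_nonneg)
  have "int_norm (\<lambda>t. x t + z t) \<le> (\<integral>t. \<bar>x t * \<kappa>1 t\<bar> + \<bar>z t * \<kappa>1 t\<bar> \<partial>\<mu>)"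
    unfolding int_norm_def using i Y_integrable[OF x] Y_integrable[OF z]
    by (intro integral_mono) (auto simp: distrib_right)
  also have "\<dots> = int_norm x + int_norm z" unfolding int_norm_def using Y_integrable[OF x] Y_integrable[OF z] by simp
  finally show "int_norm (\<lambda>t. x t + z t) \<le> int_norm x + int_norm z" .
qed

lemma Y_scale: assumes x: "x \<in> Y"
  shows "(\<lambda>t. c * x t) \<in> Y" "int_norm (\<lambda>t. c * x t) = \<bar>c\<bar> * int_norm x" "sup_norm (\<lambda>t. c * x t) = \<bar>c\<bar> * sup_norm x"
proof -
  have *: "(\<lambda>t. c * x t) \<in> Y \<and> sup_norm (\<lambda>t. c * x t) \<le> \<bar>c\<bar> * sup_norm x" if x: "x \<in> Y" for c x
  proof -
    note [measurable] = Y_measurable[OF x]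
    have "AE t in \<mu>. \<bar>c * x t * \<kappa>2 t\<bar> \<le> \<bar>c\<bar> * sup_norm x"
      using sup_norm_AE[OF x] by eventually_elim (simp add: abs_mult mult.assoc mult_left_mono)
    moreover from this have "sup_norm (\<lambda>t. c * x t) \<le> \<bar>c\<bar> * sup_norm x" by (intro sup_norm_le) (auto simp: sup_norm_nonneg)
    moreover have "integrable \<mu> (\<lambda>t. c * x t * \<kappa>1 t)" using Y_integrable[OF x] by (simp add: mult.assoc)
    ultimately show ?thesis by (auto simp: Y_def)
  qed
  show cY: "(\<lambda>t. c * x t) \<in> Y" using *[OF x] by blast
  show "int_norm (\<lambda>t. c * x t) = \<bar>c\<bar> * int_norm x" unfolding int_norm_def by (simp add: abs_mult mult.assoc)
  show "sup_norm (\<lambda>t. c * x t) = \<bar>c\<bar> * sup_norm x"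
  proof (rule antisym)
    show "\<bar>c\<bar> * sup_norm x \<le> sup_norm (\<lambda>t. c * x t)"
    proof (cases "c = 0")
      case False
      have "sup_norm x = sup_norm (\<lambda>t. 1 / c * (c * x t))" using False by simp
      also have "\<dots> \<le> \<bar>1 / c\<bar> * sup_norm (\<lambda>t. c * x t)" using *[OF cY] by blast
      finally show ?thesis using False by (simp add: field_simps abs_divide)
    qed (simp add: sup_norm_nonneg)
  qed (use *[OF x] in blast)
qed

lemma Y_restrict: assumes x: "x \<in> Y" and A[measurable]: "A \<in> sets \<mu>"
  shows "(\<lambda>t. x t * indicator A t) \<in> Y" "int_norm x = int_norm (\<lambda>t. x t * indicator A t) + int_norm (\<lambda>t. x t * indicator (space \<mu> - A) t)"
proof -
  note [measurable] = Y_measurable[OF x]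
  have i: "(\<lambda>t. x t * indicator B t) \<in> Y" if [measurable]: "B \<in> sets \<mu>" for B
    by (rule Y_solid(1)[OF x]) (auto simp: indicator_def)
  show "(\<lambda>t. x t * indicator A t) \<in> Y" by (rule i[OF A])
  have "int_norm (\<lambda>t. x t * indicator A t) + int_norm (\<lambda>t. x t * indicator (space \<mu> - A) t)
      = (\<integral>t. \<bar>x t * indicator A t * \<kappa>1 t\<bar> + \<bar>x t * indicator (space \<mu> - A) t * \<kappa>1 t\<bar> \<partial>\<mu>)"
    unfolding int_norm_def using Y_integrable[OF i[OF A]] Y_integrable[OF i[of "space \<mu> - A"]] by simp
  also have "\<dots> = int_norm x" unfolding int_norm_def
    by (rule Bochner_Integration.integral_cong) (auto simp: indicator_def)
  finally show "int_norm x = int_norm (\<lambda>t. x t * indicator A t) + int_norm (\<lambda>t. x t * indicator (space \<mu> - A) t)" ..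
qed

lemma Y_union: assumes x: "x \<in> Y" and A: "A \<in> sets \<mu>" and B: "B \<in> sets \<mu>" and AB: "A \<inter> B = {}"
  shows "int_norm (\<lambda>t. x t * indicator (A \<union> B) t) = int_norm (\<lambda>t. x t * indicator A t) + int_norm (\<lambda>t. x t * indicator B t)"
proof -
  note [measurable] = Y_measurable[OF x] A B
  have "(\<lambda>t. x t * indicator (A \<union> B) t) \<in> Y" by (rule Y_restrict(1)[OF x]) measurable
  from Y_restrict(2)[OF this A]
  have "int_norm (\<lambda>t. x t * indicator (A \<union> B) t) = int_norm (\<lambda>t. x t * indicator (A \<union> B) t * indicator A t)
    + int_norm (\<lambda>t. x t * indicator (A \<union> B) t * indicator (space \<mu> - A) t)" .
  moreover have "x t * indicator (A \<union> B) t * indicator A t = x t * indicator A t" for t by (simp add: indicator_def)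
  moreover have "x t * indicator (A \<union> B) t * indicator (space \<mu> - A) t = x t * indicator B t" for t
    using AB sets.sets_into_space[OF B] by (auto simp: indicator_def)
  ultimately show ?thesis by simp
qed

lemma D_part: "x \<in> borel_measurable \<mu> \<Longrightarrow> (\<And>t. t \<notin> D \<Longrightarrow> x t = 0) \<Longrightarrow> sup_norm x = 0"
  using sup_norm_le[of x 0] sup_norm_nonneg[of x] k2_off by (intro antisym) (auto intro!: AE_I2 simp: mult_eq_0_iff)

lemma off_D_part: "(\<And>t. t \<in> D \<Longrightarrow> x t = 0) \<Longrightarrow> int_norm x = 0"
proof -
  assume "\<And>t. t \<in> D \<Longrightarrow> x t = 0"
  then have "\<bar>x t * \<kappa>1 t\<bar> = 0" for t using k1_off by (metis abs_0 mult_eq_0_iff)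
  then show ?thesis by (simp only: int_norm_def) simp
qed

text \<open>If \<open>f (u \<chi>\<^sub>A) < f u * \<parallel>u \<chi>\<^sub>A\<parallel>\<close> held for all sets \<open>A\<close> with small \<open>\<parallel>y \<chi>\<^sub>A\<parallel>\<close> on which \<open>u\<close> does
  not vanish, then, adding up over a partition, it would hold for the whole space, where it reads
  \<open>f u < f u\<close>. Normalizing \<open>u \<chi>\<^sub>A\<close> for an exceptional \<open>A\<close> gives \<open>u'\<close>, almost disjoint from \<open>y\<close>.\<close>

lemma concentrate_L1:
  assumes f_add: "\<And>x z. x \<in> Y \<Longrightarrow> z \<in> Y \<Longrightarrow> f (\<lambda>t. x t + z t) = f x + f z"
    and f_scale: "\<And>c x. x \<in> Y \<Longrightarrow> f (\<lambda>t. c * x t) = c * f x"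
    and f_le: "\<And>x. x \<in> Y \<Longrightarrow> \<bar>f x\<bar> \<le> L * (int_norm x + sup_norm x)"
    and u: "u \<in> Y" "\<And>t. t \<notin> D \<Longrightarrow> u t = 0" "int_norm u = 1" and y: "y \<in> Y" and e: "0 < e"
  obtains u' where "u' \<in> Y" "\<And>t. t \<notin> D \<Longrightarrow> u' t = 0" "int_norm u' = 1" "f u \<le> f u'"
    "\<And>s. 1 + \<bar>s\<bar> * int_norm y - 2 * \<bar>s\<bar> * e \<le> int_norm (\<lambda>t. u' t + s * y t)"
proof -
  note [measurable] = Y_measurable[OF u(1)] Y_measurable[OF y]
  define r where "r A t = u t * indicator A t" for A t
  have r: "r A \<in> Y" if "A \<in> sets \<mu>" for A unfolding r_def[abs_def] by (rule Y_restrict(1)[OF u(1) that])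
  \<comment> \<open>Sets on which u has no mass are harmless because f vanishes there.\<close>
  have f_null: "f (r A) = 0" if "A \<in> sets \<mu>" "int_norm (r A) = 0" for A
    using f_le[OF r[OF that(1)]] D_part[OF Y_measurable[OF r[OF that(1)]]] u(2) that by (simp add: r_def)
  have r_space: "r (space \<mu>) \<in> Y" "int_norm (r (space \<mu>)) = 1" "f (r (space \<mu>)) = f u"
  proof -
    show "r (space \<mu>) \<in> Y" by (rule r) simp
    have z: "(\<lambda>t. u t - r (space \<mu>) t) \<in> Y"
      by (rule Y_solid(1)[OF u(1)]) (auto simp: r_def indicator_def)
    have z0: "AE t in \<mu>. u t - r (space \<mu>) t = 0" by (rule AE_I2) (simp add: r_def)
    have "int_norm (\<lambda>t. u t - r (space \<mu>) t) = (\<integral>t. 0 \<partial>\<mu>)"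
      unfolding int_norm_def by (rule integral_cong_AE) (use z0 Y_measurable[OF z] in auto)
    moreover have "sup_norm (\<lambda>t. u t - r (space \<mu>) t) \<le> 0"
      by (rule sup_norm_le[OF Y_measurable[OF z]]) (use z0 in auto)
    ultimately have "f (\<lambda>t. u t - r (space \<mu>) t) = 0"
      using f_le[OF z] sup_norm_nonneg[of "\<lambda>t. u t - r (space \<mu>) t"] by simp
    then show "f (r (space \<mu>)) = f u" using f_add[OF z r[of "space \<mu>"]] by simp
    have "int_norm (r (space \<mu>)) = int_norm u" unfolding int_norm_def by (rule Bochner_Integration.integral_cong) (auto simp: r_def)
    then show "int_norm (r (space \<mu>)) = 1" using u(3) by simp
  qed
  have ay: "(\<integral>\<^sup>+t. ennreal \<bar>y t * \<kappa>1 t\<bar> \<partial>\<mu>) < \<infinity>"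
    using Y_integrable[OF y] by (simp add: integrable_iff_bounded)
  have nuA: "(\<integral>\<^sup>+t\<in>A. ennreal \<bar>y t * \<kappa>1 t\<bar> \<partial>\<mu>) = ennreal (int_norm (\<lambda>t. y t * indicator A t))" if A[measurable]: "A \<in> sets \<mu>" for A
  proof -
    have "(\<integral>\<^sup>+t\<in>A. ennreal \<bar>y t * \<kappa>1 t\<bar> \<partial>\<mu>) = (\<integral>\<^sup>+t. ennreal \<bar>y t * indicator A t * \<kappa>1 t\<bar> \<partial>\<mu>)"
      by (rule nn_integral_cong) (auto simp: indicator_def)
    also have "\<dots> = ennreal (int_norm (\<lambda>t. y t * indicator A t))"
      unfolding int_norm_def using Y_integrable[OF Y_restrict(1)[OF y A]] by (intro nn_integral_eq_integral) auto
    finally show ?thesis .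
  qed
  have "\<exists>A\<in>sets \<mu>. int_norm (\<lambda>t. y t * indicator A t) \<le> e \<and> 0 < int_norm (r A) \<and> f u * int_norm (r A) \<le> f (r A)"
  proof (rule ccontr)
    assume no: "\<not> ?thesis"
    define P where "P A \<longleftrightarrow> int_norm (r A) = 0 \<or> f (r A) < f u * int_norm (r A)" for A
    have "P (space \<mu>)"
    proof (rule nonatomic_set_induct[OF na _ ay e])
      fix A assume A: "A \<in> sets \<mu>" "(\<integral>\<^sup>+t\<in>A. ennreal \<bar>y t * \<kappa>1 t\<bar> \<partial>\<mu>) \<le> ennreal e"
      then have "int_norm (\<lambda>t. y t * indicator A t) \<le> e" using e unfolding nuA[OF A(1)] by simp
      then show "P A" using no A(1) int_norm_nonneg[of "r A"] unfolding P_def by force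
    next
      fix A B assume A: "A \<in> sets \<mu>" and B: "B \<in> sets \<mu>" and AB: "A \<inter> B = {}" and P: "P A" "P B"
      have ra: "int_norm (r (A \<union> B)) = int_norm (r A) + int_norm (r B)" unfolding r_def[abs_def] by (rule Y_union[OF u(1) A B AB])
      have "r (A \<union> B) = (\<lambda>t. r A t + r B t)" using AB by (auto simp: r_def indicator_def fun_eq_iff)
      then have "f (r (A \<union> B)) = f (r A) + f (r B)" using f_add[OF r[OF A] r[OF B]] by simp
      then show "P (A \<union> B)" unfolding P_def ra using P f_null[OF A] f_null[OF B] unfolding P_def
        by (auto simp: distrib_left)
    qed measurable
    then show False unfolding P_def r_space by simp
  qed
  then obtain A where A[measurable]: "A \<in> sets \<mu>" and A1: "int_norm (\<lambda>t. y t * indicator A t) \<le> e" "0 < int_norm (r A)" "f u * int_norm (r A) \<le> f (r A)"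
    by blast
  define u' where "u' t = 1 / int_norm (r A) * r A t" for t
  have u'Y: "u' \<in> Y" and au': "int_norm u' = 1" and fu': "f u' = f (r A) / int_norm (r A)"
    unfolding u'_def using Y_scale[OF r[OF A], of "1 / int_norm (r A)"] f_scale[OF r[OF A], of "1 / int_norm (r A)"] A1 by auto
  show thesis
  proof (rule that[of u'])
    show "u' \<in> Y" "int_norm u' = 1" by fact+
    show "u' t = 0" if "t \<notin> D" for t using u(2)[OF that] by (simp add: u'_def r_def)
    show "f u \<le> f u'" unfolding fu' using A1 by (simp add: pos_le_divide_eq)
    fix s :: real
    have sum: "(\<lambda>t. u' t + s * y t) \<in> Y" by (rule Y_add(1)[OF u'Y Y_scale(1)[OF y]])
    define yA where "yA t = y t * indicator A t" for t
    define yB where "yB t = y t * indicator (space \<mu> - A) t" for t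
    have yA: "yA \<in> Y" and yB: "yB \<in> Y" unfolding yA_def yB_def by (rule Y_restrict(1)[OF y]; measurable)+
    have y_split: "int_norm y = int_norm yA + int_norm yB" unfolding yA_def yB_def by (rule Y_restrict(2)[OF y A])
    have "int_norm (\<lambda>t. u' t + s * y t) = int_norm (\<lambda>t. (u' t + s * y t) * indicator A t) + int_norm (\<lambda>t. (u' t + s * y t) * indicator (space \<mu> - A) t)"
      by (rule Y_restrict(2)[OF sum A])
    moreover have "int_norm (\<lambda>t. (u' t + s * y t) * indicator (space \<mu> - A) t) = \<bar>s\<bar> * int_norm yB"
    proof -
      have "(\<lambda>t. (u' t + s * y t) * indicator (space \<mu> - A) t) = (\<lambda>t. s * yB t)"
        by (auto simp: u'_def r_def yB_def indicator_def fun_eq_iff)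
      then show ?thesis using Y_scale(2)[OF yB] by simp
    qed
    moreover have "1 \<le> int_norm (\<lambda>t. (u' t + s * y t) * indicator A t) + \<bar>s\<bar> * int_norm yA"
    proof -
      have s1: "(\<lambda>t. (u' t + s * y t) * indicator A t) \<in> Y" by (rule Y_restrict(1)[OF sum A])
      have "u' = (\<lambda>t. (u' t + s * y t) * indicator A t + (- s) * yA t)"
        by (auto simp: u'_def r_def yA_def indicator_def fun_eq_iff)
      then have "int_norm u' \<le> int_norm (\<lambda>t. (u' t + s * y t) * indicator A t) + int_norm (\<lambda>t. (- s) * yA t)"
        using Y_add(2)[OF s1 Y_scale(1)[OF yA, of "- s"]] by simp
      then show ?thesis using au' Y_scale(2)[OF yA, of "- s"] by simp
    qed
    moreover have "\<bar>s\<bar> * int_norm yA \<le> \<bar>s\<bar> * e" using A1(1) unfolding yA_def[abs_def] by (intro mult_left_mono) auto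
    ultimately show "1 + \<bar>s\<bar> * int_norm y - 2 * \<bar>s\<bar> * e \<le> int_norm (\<lambda>t. u' t + s * y t)"
      unfolding y_split distrib_left by linarith
  qed
qed

text \<open>On each of \<open>n\<close> disjoint subsets of the set where \<open>\<bar>y \<kappa>2\<bar>\<close> is within \<open>e\<close> of its supremum, \<open>x\<close> can be
  replaced by the sign of \<open>y\<close> divided by the weight. The changes are disjoint and bounded by \<open>2\<close>, so
  with suitable signs they sum up to a function of norm at most \<open>2\<close>; hence \<open>f\<close> is at most \<open>2 L / n\<close> on
  one of them.\<close>

lemma perturb_Linf:
  assumes f_add: "\<And>x z. x \<in> Y \<Longrightarrow> z \<in> Y \<Longrightarrow> f (\<lambda>t. x t + z t) = f x + f z"
    and f_scale: "\<And>c x. x \<in> Y \<Longrightarrow> f (\<lambda>t. c * x t) = c * f x"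
    and f_le: "\<And>x. x \<in> Y \<Longrightarrow> \<bar>f x\<bar> \<le> L * (int_norm x + sup_norm x)" and L: "0 \<le> L"
    and x: "x \<in> Y" "sup_norm x \<le> 1" and nonnull: "\<not> (AE t in \<mu>. t \<in> D)" and y: "y \<in> Y" and e: "0 < e"
  obtains x' where "x' \<in> Y" "\<And>t. t \<in> D \<Longrightarrow> x' t = x t" "sup_norm x' \<le> 1" "f x - e \<le> f x'"
    "\<And>s. 1 + s * sup_norm y - \<bar>s\<bar> * e \<le> sup_norm (\<lambda>t. x' t + s * y t)"
proof -
  note [measurable] = Y_measurable[OF x(1)] Y_measurable[OF y]
  define E where "E = {t \<in> space \<mu>. t \<notin> D \<and> 0 < \<kappa>2 t \<and> sup_norm y - e \<le> \<bar>y t * \<kappa>2 t\<bar>}"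
  have E[measurable]: "E \<in> sets \<mu>" unfolding E_def by measurable
  have Epos: "0 < emeasure \<mu> E"
  proof (rule ccontr)
    assume "\<not> 0 < emeasure \<mu> E"
    then have nE: "AE t in \<mu>. t \<notin> E" using E by (intro AE_not_in) (auto simp: null_sets_def)
    have ae: "AE t in \<mu>. t \<notin> D \<longrightarrow> \<bar>y t * \<kappa>2 t\<bar> < sup_norm y - e"
      using nE k2_pos AE_space by eventually_elim (auto simp: E_def)
    show False
    proof (cases "0 \<le> sup_norm y - e")
      case True
      have "AE t in \<mu>. \<bar>y t * \<kappa>2 t\<bar> \<le> sup_norm y - e" using ae
      proof eventually_elim
        case (elim t)
        then show ?case using k2_off[of t] True by (cases "t \<in> D") auto
      qed
      then have "sup_norm y \<le> sup_norm y - e" using True by (intro sup_norm_le) auto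
      then show False using e by simp
    next
      case False
      have "AE t in \<mu>. t \<in> D" using ae
      proof eventually_elim
        case (elim t)
        then show ?case using False abs_ge_zero[of "y t * \<kappa>2 t"] by linarith
      qed
      then show False using nonnull by simp
    qed
  qed
  obtain n :: nat where n: "2 * L / e < real n" using reals_Archimedean2 by blast
  have n0: "0 < real n" using n L e by (meson divide_nonneg_pos mult_nonneg_nonneg order_le_less_trans zero_le_numeral)
  obtain F where F: "\<And>i. i < n \<Longrightarrow> F i \<in> sets \<mu>" "\<And>i. i < n \<Longrightarrow> F i \<subseteq> E"
      "\<And>i. i < n \<Longrightarrow> 0 < emeasure \<mu> (F i)" "disjoint_family_on F {..<n}"
    using nonatomic_disjoint_family[OF na E Epos, of n] by blast
  define sg where "sg t = (if 0 \<le> y t then 1 else - 1 :: real)" for t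
  have [measurable]: "sg \<in> borel_measurable \<mu>" unfolding sg_def by measurable
  define d where "d t = (sg t / \<kappa>2 t - x t)" for t
  have [measurable]: "d \<in> borel_measurable \<mu>" unfolding d_def by measurable
  have in_E: "t \<notin> D" "0 < \<kappa>2 t" if "t \<in> E" for t using that by (auto simp: E_def)
  have d2: "AE t in \<mu>. t \<in> E \<longrightarrow> \<bar>d t * \<kappa>2 t\<bar> \<le> 2"
    using sup_norm_AE[OF x(1)]
  proof eventually_elim
    case (elim t)
    show ?case
    proof
      assume "t \<in> E"
      then have "d t * \<kappa>2 t = sg t - x t * \<kappa>2 t" using in_E[of t] by (simp add: d_def left_diff_distrib)
      moreover have "\<bar>sg t\<bar> = 1" by (simp add: sg_def)
      ultimately show "\<bar>d t * \<kappa>2 t\<bar> \<le> 2" using elim x(2) by linarith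
    qed
  qed
  have supported: "z \<in> Y \<and> int_norm z = 0 \<and> sup_norm z \<le> 2"
    if [measurable]: "z \<in> borel_measurable \<mu>" and off: "\<And>t. t \<notin> E \<Longrightarrow> z t = 0" and le: "\<And>t. t \<in> E \<Longrightarrow> \<bar>z t\<bar> \<le> \<bar>d t\<bar>" for z
  proof -
    have zD: "z t = 0" if "t \<in> D" for t using off in_E that by blast
    have ae: "AE t in \<mu>. \<bar>z t * \<kappa>2 t\<bar> \<le> 2" using d2
    proof eventually_elim
      case (elim t)
      show ?case
      proof (cases "t \<in> E")
        case True
        have "\<bar>z t * \<kappa>2 t\<bar> \<le> \<bar>d t * \<kappa>2 t\<bar>" using le[OF True] by (simp add: abs_mult mult_right_mono)
        then show ?thesis using elim True by simp
      qed (simp add: off)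
    qed
    have "z t * \<kappa>1 t = 0" for t using zD k1_off by (metis mult_eq_0_iff)
    then have "integrable \<mu> (\<lambda>t. z t * \<kappa>1 t)" by (simp only: integrable_zero)
    then show ?thesis using ae off_D_part[OF zD] sup_norm_le[OF _ _ ae] by (auto simp: Y_def)
  qed
  define g where "g i t = d t * indicator (F i) t" for i t
  have gY: "g i \<in> Y" if i: "i < n" for i
  proof -
    have [measurable]: "F i \<in> sets \<mu>" by (rule F(1)[OF i])
    have "g i \<in> borel_measurable \<mu>" unfolding g_def by measurable
    moreover have "g i t = 0" if "t \<notin> E" for t using that F(2)[OF i] by (auto simp: g_def indicator_def)
    moreover have "\<bar>g i t\<bar> \<le> \<bar>d t\<bar>" for t by (simp add: g_def indicator_def)
    ultimately show ?thesis using supported[of "g i"] by blast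
  qed
  define c where "c i = (if 0 \<le> f (g i) then 1 else - 1 :: real)" for i
  define G where "G k t = (\<Sum>i<k. c i * g i t)" for k t
  have f0: "f (\<lambda>t. 0) = 0" using f_scale[OF y, of 0] by simp
  have G: "G k \<in> Y \<and> f (G k) = (\<Sum>i<k. \<bar>f (g i)\<bar>)" if "k \<le> n" for k
    using that
  proof (induction k)
    case 0
    have "(\<lambda>t. 0) \<in> Y" using Y_scale(1)[OF y, of 0] by simp
    then show ?case using f0 by (simp add: G_def[abs_def])
  next
    case (Suc k)
    have gk: "g k \<in> Y" using gY Suc by simp
    have eq: "G (Suc k) = (\<lambda>t. G k t + c k * g k t)" by (auto simp: G_def fun_eq_iff)
    show ?case unfolding eq using Suc Y_add(1)[OF _ Y_scale(1)[OF gk]] f_add[OF _ Y_scale(1)[OF gk]] f_scale[OF gk]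
      by (auto simp: c_def)
  qed
  have "sup_norm (G n) \<le> 2 \<and> int_norm (G n) = 0"
  proof -
    have Gle: "\<bar>G n t\<bar> \<le> (if t \<in> E then \<bar>d t\<bar> else 0)" for t
    proof (cases "\<exists>i<n. t \<in> F i")
      case True
      then obtain i where i: "i < n" "t \<in> F i" by blast
      have "t \<notin> F j" if "j < n" "j \<noteq> i" for j
        using F(4) i that unfolding disjoint_family_on_def by blast
      then have "G n t = (\<Sum>j<n. if j = i then c i * d t else 0)"
        unfolding G_def g_def using i by (intro sum.cong) auto
      also have "\<dots> = c i * d t" using i by simp
      finally show ?thesis using i F(2) by (auto simp: c_def)
    next
      case False
      then have "G n t = 0" unfolding G_def g_def by (intro sum.neutral) auto
      then show ?thesis by simp
    qed
    have "G n \<in> borel_measurable \<mu>" using G[of n] Y_measurable by blast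
    moreover have "G n t = 0" if "t \<notin> E" for t using Gle[of t] that by simp
    moreover have "\<bar>G n t\<bar> \<le> \<bar>d t\<bar>" if "t \<in> E" for t using Gle[of t] that by simp
    ultimately show ?thesis using supported[of "G n"] by blast
  qed
  then have "(\<Sum>i<n. \<bar>f (g i)\<bar>) \<le> L * 2"
    using f_le[of "G n"] G[of n] mult_left_mono[of "int_norm (G n) + sup_norm (G n)" 2 L] L by auto
  have "\<exists>i<n. \<bar>f (g i)\<bar> \<le> e"
  proof (rule ccontr)
    assume "\<not> ?thesis"
    then have "(\<Sum>i<n. e) \<le> (\<Sum>i<n. \<bar>f (g i)\<bar>)" by (intro sum_mono) (auto simp: not_le less_imp_le)
    then have "real n * e \<le> L * 2" using \<open>(\<Sum>i<n. \<bar>f (g i)\<bar>) \<le> L * 2\<close> by simp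
    then show False using n e by (simp add: field_simps)
  qed
  then obtain i where i: "i < n" "\<bar>f (g i)\<bar> \<le> e" by blast
  have Fi[measurable]: "F i \<in> sets \<mu>" by (rule F(1)[OF i(1)])
  define x' where "x' t = x t + g i t" for t
  have x'Y: "x' \<in> Y" and fx': "f x' = f x + f (g i)"
    unfolding x'_def using Y_add(1)[OF x(1) gY[OF i(1)]] f_add[OF x(1) gY[OF i(1)]] by auto
  have x'F: "x' t * \<kappa>2 t = sg t" if "t \<in> F i" for t
    using that in_E[of t] F(2)[OF i(1)] by (auto simp: x'_def g_def d_def)
  have x'off: "x' t = x t" if "t \<notin> F i" for t using that by (simp add: x'_def g_def)
  show thesis
  proof (rule that[of x'])
    show "x' \<in> Y" by fact
    show "x' t = x t" if "t \<in> D" for t using that in_E F(2)[OF i(1)] by (intro x'off) blast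
    show "f x - e \<le> f x'" using fx' i(2) by linarith
    show "sup_norm x' \<le> 1"
    proof (rule sup_norm_le[OF Y_measurable[OF x'Y]])
      show "AE t in \<mu>. \<bar>x' t * \<kappa>2 t\<bar> \<le> 1" using sup_norm_AE[OF x(1)]
      proof eventually_elim
        case (elim t)
        show ?case
        proof (cases "t \<in> F i")
          case True then show ?thesis by (simp add: x'F sg_def)
        next
          case False then show ?thesis using elim x(2) by (simp add: x'off)
        qed
      qed
    qed simp
    fix s :: real
    have sum: "(\<lambda>t. x' t + s * y t) \<in> Y" by (rule Y_add(1)[OF x'Y Y_scale(1)[OF y]])
    have "AE t in \<mu>. t \<in> F i \<longrightarrow> 1 + s * sup_norm y - \<bar>s\<bar> * e \<le> sup_norm (\<lambda>t. x' t + s * y t)"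
      using sup_norm_AE[OF sum] sup_norm_AE[OF y]
    proof eventually_elim
      case (elim t)
      show ?case
      proof
        assume t: "t \<in> F i"
        then have tE: "t \<in> E" using F(2)[OF i(1)] by blast
        have ypos: "y t * \<kappa>2 t = sg t * \<bar>y t * \<kappa>2 t\<bar>" using in_E[OF tE] by (simp add: sg_def abs_mult)
        have "(x' t + s * y t) * \<kappa>2 t = x' t * \<kappa>2 t + s * (y t * \<kappa>2 t)" by (simp add: distrib_right)
        also have "\<dots> = sg t * (1 + s * \<bar>y t * \<kappa>2 t\<bar>)" unfolding x'F[OF t] by (subst ypos) (simp add: algebra_simps)
        finally have "\<bar>(x' t + s * y t) * \<kappa>2 t\<bar> = \<bar>1 + s * \<bar>y t * \<kappa>2 t\<bar>\<bar>" by (simp add: abs_mult sg_def)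
        moreover have "s * sup_norm y - \<bar>s\<bar> * e \<le> s * \<bar>y t * \<kappa>2 t\<bar>"
        proof (cases "0 \<le> s")
          case True
          have "s * (sup_norm y - e) \<le> s * \<bar>y t * \<kappa>2 t\<bar>" using True tE by (intro mult_left_mono) (auto simp: E_def)
          then show ?thesis using True by (simp add: right_diff_distrib)
        next
          case False
          have "s * sup_norm y \<le> s * \<bar>y t * \<kappa>2 t\<bar>" using False elim(2) by (intro mult_left_mono_neg) auto
          moreover have "0 \<le> \<bar>s\<bar> * e" using e by simp
          ultimately show ?thesis by linarith
        qed
        ultimately show "1 + s * sup_norm y - \<bar>s\<bar> * e \<le> sup_norm (\<lambda>t. x' t + s * y t)" using elim(1) by linarith
      qed
    qed
    then show "1 + s * sup_norm y - \<bar>s\<bar> * e \<le> sup_norm (\<lambda>t. x' t + s * y t)"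
    proof (rule contrapos_pp)
      assume no: "\<not> 1 + s * sup_norm y - \<bar>s\<bar> * e \<le> sup_norm (\<lambda>t. x' t + s * y t)"
      show "\<not> (AE t in \<mu>. t \<in> F i \<longrightarrow> 1 + s * sup_norm y - \<bar>s\<bar> * e \<le> sup_norm (\<lambda>t. x' t + s * y t))"
      proof
        assume "AE t in \<mu>. t \<in> F i \<longrightarrow> 1 + s * sup_norm y - \<bar>s\<bar> * e \<le> sup_norm (\<lambda>t. x' t + s * y t)"
        then have "AE t in \<mu>. t \<notin> F i" using no by (auto elim: eventually_mono)
        then have "emeasure \<mu> (F i) = 0" using Fi by (metis AE_iff_null_sets null_setsD1)
        then show False using F(3)[OF i(1)] by simp
      qed
    qed
  qed
qed

lemma Y_parts:
  assumes x: "x \<in> Y"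
  obtains x1 x2 where "x1 \<in> Y" "x2 \<in> Y" "\<And>t. x t = x1 t + x2 t" "\<And>t. t \<notin> D \<Longrightarrow> x1 t = 0" "\<And>t. t \<in> D \<Longrightarrow> x2 t = 0"
    "int_norm x1 = int_norm x" "sup_norm x1 = 0" "int_norm x2 = 0" "sup_norm x2 = sup_norm x"
proof -
  note [measurable] = Y_measurable[OF x]
  define x1 where "x1 t = x t * indicator D t" for t
  define x2 where "x2 t = x t * indicator (- D) t" for t
  have "{t \<in> space \<mu>. t \<notin> D} \<in> sets \<mu>" by measurable
  have Dc[measurable]: "Measurable.pred \<mu> (\<lambda>t. t \<in> - D)" by simp
  have x2m[measurable]: "x2 \<in> borel_measurable \<mu>"
  proof -
    have "x2 = (\<lambda>t. if t \<in> D then 0 else x t)" by (auto simp: x2_def fun_eq_iff)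
    then show ?thesis by (simp only:) measurable
  qed
  have x1m[measurable]: "x1 \<in> borel_measurable \<mu>" unfolding x1_def by measurable
  have y: "x1 \<in> Y" "x2 \<in> Y"
    by (rule Y_solid(1)[OF x]; simp add: x1_def x2_def indicator_def)+
  have "int_norm x1 = int_norm x" unfolding int_norm_def
    by (rule Bochner_Integration.integral_cong) (auto simp: x1_def indicator_def k1_off)
  moreover have "sup_norm x2 = sup_norm x"
  proof -
    have "x2 t * \<kappa>2 t = x t * \<kappa>2 t" for t by (cases "t \<in> D") (simp_all add: x2_def k2_off)
    then show ?thesis by (simp only: sup_norm_def)
  qed
  moreover have "sup_norm x1 = 0" by (rule D_part) (auto simp: x1_def)
  moreover have "int_norm x2 = 0" by (rule off_D_part) (auto simp: x2_def)
  ultimately show thesis using y by (intro that[of x1 x2]) (auto simp: x1_def x2_def indicator_def)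
qed

lemma nonnull_of_m: assumes x: "x \<in> Y" "0 < sup_norm x" shows "\<not> (AE t in \<mu>. t \<in> D)"
proof
  assume "AE t in \<mu>. t \<in> D"
  then have "AE t in \<mu>. \<bar>x t * \<kappa>2 t\<bar> \<le> 0" by eventually_elim (simp add: k2_off)
  then have "sup_norm x \<le> 0" using Y_measurable[OF x(1)] by (intro sup_norm_le) auto
  then show False using x by simp
qed

text \<open>The unit ball of a \<open>1\<close>-sum is the convex hull of the unit balls of its summands, so \<open>f x\<close> is at
  most the value of \<open>f\<close> at a unit vector \<open>u\<close> of one summand. Perturbing \<open>u\<close> within that summand gains
  the norm of the corresponding part of \<open>y\<close>, and the other part of \<open>y\<close> is gained because \<open>u\<close> vanishes
  there.\<close>

lemma almost_norming_1:
  assumes f_add: "\<And>x z. x \<in> Y \<Longrightarrow> z \<in> Y \<Longrightarrow> f (\<lambda>t. x t + z t) = f x + f z"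
    and f_scale: "\<And>c x. x \<in> Y \<Longrightarrow> f (\<lambda>t. c * x t) = c * f x"
    and f_le: "\<And>x. x \<in> Y \<Longrightarrow> \<bar>f x\<bar> \<le> L * (int_norm x + sup_norm x)" and L: "0 \<le> L"
    and y: "y \<in> Y" "0 < int_norm y + sup_norm y" and x: "x \<in> Y" "int_norm x + sup_norm x \<le> 1" "0 \<le> f x" and e: "0 < e"
  shows "\<exists>x'\<in>Y. int_norm x' + sup_norm x' \<le> 1 \<and> 1 + f x * (int_norm y + sup_norm y) - e \<le> int_norm (\<lambda>t. x' t + f x' * y t) + sup_norm (\<lambda>t. x' t + f x' * y t)"
proof -
  have neg: "(\<lambda>t. - z t) \<in> Y" "int_norm (\<lambda>t. - z t) = int_norm z" "sup_norm (\<lambda>t. - z t) = sup_norm z" "f (\<lambda>t. - z t) = - f z" if "z \<in> Y" for z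
    using Y_scale[OF that, of "- 1"] f_scale[OF that, of "- 1"] by auto
  have norm: "(\<exists>u\<in>Y. (\<forall>t. t \<notin> D \<longrightarrow> u t = 0) \<and> int_norm u = 1 \<and> f x \<le> f u) \<or>
      (\<exists>u\<in>Y. (\<forall>t. t \<in> D \<longrightarrow> u t = 0) \<and> sup_norm u = 1 \<and> f x \<le> f u)"
  proof -
    have unit1: "\<exists>u\<in>Y. (\<forall>t. t \<notin> D \<longrightarrow> u t = 0) \<and> int_norm u = 1 \<and> f z / int_norm z \<le> f u"
      if z: "z \<in> Y" "\<And>t. t \<notin> D \<Longrightarrow> z t = 0" "0 < int_norm z" for z
      using Y_scale[OF z(1), of "1 / int_norm z"] f_scale[OF z(1), of "1 / int_norm z"] z(2,3)
      by (intro bexI[of _ "\<lambda>t. 1 / int_norm z * z t"]) auto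
    have unit2: "\<exists>u\<in>Y. (\<forall>t. t \<in> D \<longrightarrow> u t = 0) \<and> sup_norm u = 1 \<and> f z / sup_norm z \<le> f u"
      if z: "z \<in> Y" "\<And>t. t \<in> D \<Longrightarrow> z t = 0" "0 < sup_norm z" for z
      using Y_scale[OF z(1), of "1 / sup_norm z"] f_scale[OF z(1), of "1 / sup_norm z"] z(2,3)
      by (intro bexI[of _ "\<lambda>t. 1 / sup_norm z * z t"]) auto
    obtain x1 x2 where X: "x1 \<in> Y" "x2 \<in> Y" "\<And>t. x t = x1 t + x2 t" "\<And>t. t \<notin> D \<Longrightarrow> x1 t = 0" "\<And>t. t \<in> D \<Longrightarrow> x2 t = 0"
      "int_norm x1 = int_norm x" "sup_norm x1 = 0" "int_norm x2 = 0" "sup_norm x2 = sup_norm x" using Y_parts[OF x(1)] by metis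
    have fx: "f x = f x1 + f x2" proof -
      have "x = (\<lambda>t. x1 t + x2 t)" by (rule ext) (rule X(3))
      then show ?thesis using f_add[OF X(1,2)] by simp
    qed
    consider "0 < int_norm x1" "f x \<le> f x1 / int_norm x1" | "0 < sup_norm x2" "f x \<le> f x2 / sup_norm x2"
      | "int_norm x1 = 0 \<or> f x1 < f x * int_norm x1" "sup_norm x2 = 0 \<or> f x2 < f x * sup_norm x2"
      using int_norm_nonneg[of x1] sup_norm_nonneg[of x2] by (force simp: pos_le_divide_eq not_le)
    then show ?thesis
    proof cases
      case 1 then show ?thesis using unit1[OF X(1,4)] by (meson order_trans)
    next
      case 2 then show ?thesis using unit2[OF X(2,5)] by (meson order_trans)
    next
      case 3
      have f1: "f x1 = 0" if "int_norm x1 = 0" using f_le[OF X(1)] that X(7) by simp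
      have f2: "f x2 = 0" if "sup_norm x2 = 0" using f_le[OF X(2)] that X(8) by simp
      \<comment> \<open>If neither part of x yields a unit vector on which f is at least f x, then f x < f x, unless both parts
        have norm zero. In that case f x = 0 and any unit vector with f \<ge> 0 will do; some part of y provides one.\<close>
      have zero: "int_norm x1 = 0 \<and> sup_norm x2 = 0"
      proof (rule ccontr)
        assume no: "\<not> ?thesis"
        have "f x1 \<le> f x * int_norm x1" "f x2 \<le> f x * sup_norm x2" using 3 f1 f2 by auto
        moreover have "f x1 < f x * int_norm x1 \<or> f x2 < f x * sup_norm x2" using 3 no by auto
        ultimately have "f x < f x * (int_norm x + sup_norm x)" unfolding fx using X by (auto simp: distrib_left fx)
        moreover have "f x * (int_norm x + sup_norm x) \<le> f x * 1" using x by (intro mult_left_mono) auto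
        ultimately show False by simp
      qed
      then have f0: "f x = 0" using fx f1 f2 by simp
      obtain y1 y2 where Z: "y1 \<in> Y" "y2 \<in> Y" "\<And>t. y t = y1 t + y2 t" "\<And>t. t \<notin> D \<Longrightarrow> y1 t = 0" "\<And>t. t \<in> D \<Longrightarrow> y2 t = 0"
        "int_norm y1 = int_norm y" "sup_norm y1 = 0" "int_norm y2 = 0" "sup_norm y2 = sup_norm y" using Y_parts[OF y(1)] by metis
      show ?thesis
      proof (cases "0 < int_norm y")
        case True
        show ?thesis
        proof (cases "0 \<le> f y1")
          case t: True
          then show ?thesis using unit1[OF Z(1,4)] True Z f0 by (smt (verit, best) divide_nonneg_nonneg)
        next
          case t: False
          then have "0 \<le> f (\<lambda>t. - y1 t)" using neg(4)[OF Z(1)] by linarith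
          then have "0 \<le> f (\<lambda>t. - y1 t) / int_norm (\<lambda>t. - y1 t)" by (intro divide_nonneg_nonneg int_norm_nonneg)
          then show ?thesis using unit1[OF neg(1)[OF Z(1)]] True Z neg[OF Z(1)] f0 by (smt (verit, best))
        qed
      next
        case False
        then have my: "0 < sup_norm y" using y(2) int_norm_nonneg[of y] by simp
        show ?thesis
        proof (cases "0 \<le> f y2")
          case t: True
          then show ?thesis using unit2[OF Z(2,5)] my Z f0 by (smt (verit, best) divide_nonneg_nonneg)
        next
          case t: False
          then have "0 \<le> f (\<lambda>t. - y2 t)" using neg(4)[OF Z(2)] by linarith
          then have "0 \<le> f (\<lambda>t. - y2 t) / sup_norm (\<lambda>t. - y2 t)" by (intro divide_nonneg_nonneg sup_norm_nonneg)
          then show ?thesis using unit2[OF neg(1)[OF Z(2)]] my Z neg[OF Z(2)] f0 by (smt (verit, best))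
        qed
      qed
    qed
  qed
  define N where "N = int_norm y + sup_norm y"
  have N: "0 < N" "int_norm y \<le> N" "sup_norm y \<le> N" using y(2) int_norm_nonneg[of y] sup_norm_nonneg[of y] by (auto simp: N_def)
  from norm show ?thesis
  proof
    assume "\<exists>u\<in>Y. (\<forall>t. t \<notin> D \<longrightarrow> u t = 0) \<and> int_norm u = 1 \<and> f x \<le> f u"
    then obtain u where u: "u \<in> Y" "\<And>t. t \<notin> D \<Longrightarrow> u t = 0" "int_norm u = 1" "f x \<le> f u" by blast
    define e' where "e' = e / (2 * L + 1)"
    have e': "0 < e'" "2 * L * e' \<le> e" using e L by (auto simp: e'_def field_simps)
    obtain u' where u': "u' \<in> Y" "\<And>t. t \<notin> D \<Longrightarrow> u' t = 0" "int_norm u' = 1" "f u \<le> f u'"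
      "\<And>s. 1 + \<bar>s\<bar> * int_norm y - 2 * \<bar>s\<bar> * e' \<le> int_norm (\<lambda>t. u' t + s * y t)"
      by (rule concentrate_L1[where f=f and L=L and u=u and y=y and e=e'])
        (rule that f_add f_scale f_le u(1-3) y(1) e'(1); assumption)+
    have mu': "sup_norm u' = 0" by (rule D_part[OF Y_measurable[OF u'(1)] u'(2)])
    define s where "s = f u'"
    have s: "f x \<le> s" "0 \<le> s" "s \<le> L" using u(4) u'(4) x(3) f_le[OF u'(1)] u'(3) mu' by (auto simp: s_def)
    have "sup_norm (\<lambda>t. s * y t) \<le> sup_norm (\<lambda>t. u' t + s * y t)"
    proof -
      have sum: "(\<lambda>t. u' t + s * y t) \<in> Y" by (rule Y_add(1)[OF u'(1) Y_scale(1)[OF y(1)]])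
      have "sup_norm (\<lambda>t. (u' t + s * y t) + (- u' t)) \<le> sup_norm (\<lambda>t. u' t + s * y t) + sup_norm (\<lambda>t. - u' t)"
        by (rule Y_add(3)[OF sum neg(1)[OF u'(1)]])
      then show ?thesis using neg(3)[OF u'(1)] mu' by simp
    qed
    then have "s * sup_norm y \<le> sup_norm (\<lambda>t. u' t + s * y t)" using Y_scale(3)[OF y(1), of s] s by simp
    moreover have "1 + s * int_norm y - 2 * s * e' \<le> int_norm (\<lambda>t. u' t + s * y t)" using u'(5)[of s] s by simp
    moreover have "2 * s * e' \<le> 2 * L * e'" using s e' by (intro mult_right_mono) auto
    moreover have "f x * N \<le> s * N" using s N by (intro mult_right_mono) auto
    moreover have "s * N = s * int_norm y + s * sup_norm y" by (simp add: N_def distrib_left)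
    ultimately have "1 + f x * N - e \<le> int_norm (\<lambda>t. u' t + s * y t) + sup_norm (\<lambda>t. u' t + s * y t)" using e'(2) by linarith
    then show ?thesis using u' mu' by (intro bexI[of _ u']) (auto simp: N_def s_def)
  next
    assume "\<exists>u\<in>Y. (\<forall>t. t \<in> D \<longrightarrow> u t = 0) \<and> sup_norm u = 1 \<and> f x \<le> f u"
    then obtain u where u: "u \<in> Y" "\<And>t. t \<in> D \<Longrightarrow> u t = 0" "sup_norm u = 1" "f x \<le> f u" by blast
    define e' where "e' = e / (N + L + 1)"
    have NL: "0 < N + L + 1" using N L by simp
    have e': "0 < e'" "e' * (N + L) \<le> e"
    proof -
      show "0 < e'" using e NL by (simp add: e'_def)
      then have "e' * (N + L) \<le> e' * (N + L + 1)" by (intro mult_left_mono) auto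
      also have "\<dots> = e" using NL by (simp add: e'_def)
      finally show "e' * (N + L) \<le> e" .
    qed
    obtain u' where u': "u' \<in> Y" "\<And>t. t \<in> D \<Longrightarrow> u' t = u t" "sup_norm u' \<le> 1" "f u - e' \<le> f u'"
      "\<And>s. 1 + s * sup_norm y - \<bar>s\<bar> * e' \<le> sup_norm (\<lambda>t. u' t + s * y t)"
    proof (rule perturb_Linf[where f=f and L=L and x=u and y=y and e=e'])
      show "sup_norm u \<le> 1" using u(3) by simp
      show "\<not> (AE t in \<mu>. t \<in> D)" using nonnull_of_m[OF u(1)] u(3) by simp
    qed (rule that f_add f_scale f_le L u(1) y(1) e'(1); assumption)+
    have u'0: "u' t = 0" if "t \<in> D" for t using u(2) u'(2) that by simp
    have au': "int_norm u' = 0" by (rule off_D_part[OF u'0])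
    define s where "s = f u'"
    have s: "f x - e' \<le> s" "\<bar>s\<bar> \<le> L"
    proof -
      show "f x - e' \<le> s" using u(4) u'(4) by (simp add: s_def)
      have "L * (int_norm u' + sup_norm u') \<le> L * 1" using u'(3) au' L by (intro mult_left_mono) auto
      then show "\<bar>s\<bar> \<le> L" using f_le[OF u'(1)] by (simp add: s_def)
    qed
    have "int_norm (\<lambda>t. s * y t) \<le> int_norm (\<lambda>t. u' t + s * y t)"
    proof -
      have sum: "(\<lambda>t. u' t + s * y t) \<in> Y" by (rule Y_add(1)[OF u'(1) Y_scale(1)[OF y(1)]])
      have "int_norm (\<lambda>t. (u' t + s * y t) + (- u' t)) \<le> int_norm (\<lambda>t. u' t + s * y t) + int_norm (\<lambda>t. - u' t)"
        by (rule Y_add(2)[OF sum neg(1)[OF u'(1)]])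
      then show ?thesis using neg(2)[OF u'(1)] au' by simp
    qed
    then have "\<bar>s\<bar> * int_norm y \<le> int_norm (\<lambda>t. u' t + s * y t)" using Y_scale(2)[OF y(1), of s] by simp
    moreover have "s * int_norm y \<le> \<bar>s\<bar> * int_norm y" using int_norm_nonneg[of y] by (intro mult_right_mono) auto
    moreover have "1 + s * sup_norm y - \<bar>s\<bar> * e' \<le> sup_norm (\<lambda>t. u' t + s * y t)" by (rule u'(5))
    moreover have "\<bar>s\<bar> * e' \<le> L * e'" using s e' by (intro mult_right_mono) auto
    moreover have "(f x - e') * N \<le> s * N" using s N by (intro mult_right_mono) auto
    moreover have "s * N = s * int_norm y + s * sup_norm y" by (simp add: N_def distrib_left)
    moreover have "(f x - e') * N = f x * N - e' * N" by (simp add: left_diff_distrib)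
    moreover have "e' * (N + L) = e' * N + L * e'" by (simp add: algebra_simps)
    ultimately have "1 + f x * N - e \<le> int_norm (\<lambda>t. u' t + s * y t) + sup_norm (\<lambda>t. u' t + s * y t)" using e'(2) by linarith
    then show ?thesis using u' au' by (intro bexI[of _ u']) (auto simp: N_def s_def)
  qed
qed

text \<open>In an \<open>\<infinity>\<close>-sum the two parts of \<open>x\<close> can be changed independently within the unit ball. It is enough
  to change the part that belongs to the summand in which \<open>y\<close> has the larger norm.\<close>

lemma almost_norming_inf:
  assumes f_add: "\<And>x z. x \<in> Y \<Longrightarrow> z \<in> Y \<Longrightarrow> f (\<lambda>t. x t + z t) = f x + f z"
    and f_scale: "\<And>c x. x \<in> Y \<Longrightarrow> f (\<lambda>t. c * x t) = c * f x"
    and f_le': "\<And>x. x \<in> Y \<Longrightarrow> \<bar>f x\<bar> \<le> L * max (int_norm x) (sup_norm x)" and L: "0 \<le> L"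
    and y: "y \<in> Y" "0 < max (int_norm y) (sup_norm y)" and x: "x \<in> Y" "max (int_norm x) (sup_norm x) \<le> 1" "0 \<le> f x" and e: "0 < e"
  shows "\<exists>x'\<in>Y. max (int_norm x') (sup_norm x') \<le> 1 \<and>
    1 + f x * max (int_norm y) (sup_norm y) - e \<le> max (int_norm (\<lambda>t. x' t + f x' * y t)) (sup_norm (\<lambda>t. x' t + f x' * y t))"
proof -
  have f_le: "\<bar>f x\<bar> \<le> L * (int_norm x + sup_norm x)" if "x \<in> Y" for x
    by (rule order_trans[OF f_le'[OF that] mult_left_mono[OF _ L]]) (simp add: int_norm_nonneg sup_norm_nonneg)
  have neg: "(\<lambda>t. - z t) \<in> Y" "int_norm (\<lambda>t. - z t) = int_norm z" "sup_norm (\<lambda>t. - z t) = sup_norm z" "f (\<lambda>t. - z t) = - f z" if "z \<in> Y" for z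
    using Y_scale[OF that, of "- 1"] f_scale[OF that, of "- 1"] by auto
  define N where "N = max (int_norm y) (sup_norm y)"
  have N: "0 < N" "int_norm y \<le> N" "sup_norm y \<le> N" using y(2) by (auto simp: N_def)
  show ?thesis
  proof (cases "int_norm y \<le> sup_norm y")
    case True
    then have Nm: "N = sup_norm y" by (simp add: N_def)
    define e' where "e' = e / (N + L + 1)"
    have NL: "0 < N + L + 1" using N L by simp
    have e': "0 < e'" "e' * (N + L) \<le> e"
    proof -
      show "0 < e'" using e NL by (simp add: e'_def)
      then have "e' * (N + L) \<le> e' * (N + L + 1)" by (intro mult_left_mono) auto
      also have "\<dots> = e" using NL by (simp add: e'_def)
      finally show "e' * (N + L) \<le> e" .
    qed
    have mx: "sup_norm x \<le> 1" using x by simp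
    obtain u' where u': "u' \<in> Y" "\<And>t. t \<in> D \<Longrightarrow> u' t = x t" "sup_norm u' \<le> 1" "f x - e' \<le> f u'"
      "\<And>s. 1 + s * sup_norm y - \<bar>s\<bar> * e' \<le> sup_norm (\<lambda>t. u' t + s * y t)"
    proof (rule perturb_Linf[where f=f and L=L and x=x and y=y and e=e'])
      show "\<not> (AE t in \<mu>. t \<in> D)" using nonnull_of_m[OF y(1)] N(1) Nm by simp
    qed (rule that f_add f_scale f_le L x(1) mx y(1) e'(1); assumption)+
    have "u' t * \<kappa>1 t = x t * \<kappa>1 t" for t using u'(2) k1_off by (cases "t \<in> D") auto
    then have au': "int_norm u' = int_norm x" by (simp only: int_norm_def)
    define s where "s = f u'"
    have s: "f x - e' \<le> s" "\<bar>s\<bar> \<le> L"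
    proof -
      show "f x - e' \<le> s" using u'(4) by (simp add: s_def)
      have "L * max (int_norm u') (sup_norm u') \<le> L * 1" using u'(3) au' x L by (intro mult_left_mono) auto
      then show "\<bar>s\<bar> \<le> L" using f_le'[OF u'(1)] by (simp add: s_def)
    qed
    have "1 + s * N - \<bar>s\<bar> * e' \<le> sup_norm (\<lambda>t. u' t + s * y t)" unfolding Nm by (rule u'(5))
    moreover have "\<bar>s\<bar> * e' \<le> L * e'" using s e' by (intro mult_right_mono) auto
    moreover have "(f x - e') * N \<le> s * N" using s N by (intro mult_right_mono) auto
    moreover have "(f x - e') * N = f x * N - e' * N" by (simp add: left_diff_distrib)
    moreover have "e' * (N + L) = e' * N + L * e'" by (simp add: algebra_simps)
    ultimately have "1 + f x * N - e \<le> sup_norm (\<lambda>t. u' t + s * y t)" using e'(2) by linarith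
    then show ?thesis using u' au' x by (intro bexI[of _ u']) (auto simp: N_def s_def)
  next
    case False
    then have Na: "N = int_norm y" by (simp add: N_def)
    obtain x1 x2 where X: "x1 \<in> Y" "x2 \<in> Y" "\<And>t. x t = x1 t + x2 t" "\<And>t. t \<notin> D \<Longrightarrow> x1 t = 0" "\<And>t. t \<in> D \<Longrightarrow> x2 t = 0"
      "int_norm x1 = int_norm x" "sup_norm x1 = 0" "int_norm x2 = 0" "sup_norm x2 = sup_norm x" using Y_parts[OF x(1)] by metis
    obtain y1 y2 where Z: "y1 \<in> Y" "y2 \<in> Y" "\<And>t. y t = y1 t + y2 t" "\<And>t. t \<notin> D \<Longrightarrow> y1 t = 0" "\<And>t. t \<in> D \<Longrightarrow> y2 t = 0"
      "int_norm y1 = int_norm y" "sup_norm y1 = 0" "int_norm y2 = 0" "sup_norm y2 = sup_norm y" using Y_parts[OF y(1)] by metis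
    have fx: "f x = f x1 + f x2" proof -
      have "x = (\<lambda>t. x1 t + x2 t)" by (rule ext) (rule X(3))
      then show ?thesis using f_add[OF X(1,2)] by simp
    qed
    have unit: "\<exists>u\<in>Y. (\<forall>t. t \<notin> D \<longrightarrow> u t = 0) \<and> int_norm u = 1 \<and> \<bar>f z\<bar> / int_norm z \<le> f u"
      if z: "z \<in> Y" "\<And>t. t \<notin> D \<Longrightarrow> z t = 0" "0 < int_norm z" for z
    proof -
      define c where "c = (if 0 \<le> f z then 1 else - 1) / int_norm z"
      show ?thesis
        using Y_scale[OF z(1), of c] f_scale[OF z(1), of c] z(2,3)
        by (intro bexI[of _ "\<lambda>t. c * z t"]) (auto simp: c_def abs_if)
    qed
    have "\<exists>u\<in>Y. (\<forall>t. t \<notin> D \<longrightarrow> u t = 0) \<and> int_norm u = 1 \<and> f x1 \<le> f u"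
    proof (cases "0 < int_norm x1")
      case True
      have "int_norm x1 \<le> 1" using X x by simp
      then have "f x1 \<le> \<bar>f x1\<bar> / int_norm x1" using True
        by (simp add: pos_le_divide_eq) (meson abs_ge_self abs_ge_zero mult_left_le order_trans mult_right_mono mult_le_one less_imp_le mult_left_le_one_le mult_right_le_one_le)
      then show ?thesis using unit[OF X(1,4) True] by (meson order_trans)
    next
      case no: False
      then have "f x1 = 0" using f_le'[OF X(1)] X(7) int_norm_nonneg[of x1] by simp
      moreover have "0 \<le> \<bar>f y1\<bar> / int_norm y1" by (simp add: int_norm_nonneg)
      moreover have "0 < int_norm y1" using N Na Z by simp
      ultimately show ?thesis using unit[OF Z(1,4)] by (metis order_trans)
    qed
    then obtain u where u: "u \<in> Y" "\<And>t. t \<notin> D \<Longrightarrow> u t = 0" "int_norm u = 1" "f x1 \<le> f u" by blast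
    define e' where "e' = e / (2 * L + 1)"
    have e': "0 < e'" "2 * L * e' \<le> e" using e L by (auto simp: e'_def field_simps)
    obtain u' where u': "u' \<in> Y" "\<And>t. t \<notin> D \<Longrightarrow> u' t = 0" "int_norm u' = 1" "f u \<le> f u'"
      "\<And>s. 1 + \<bar>s\<bar> * int_norm y - 2 * \<bar>s\<bar> * e' \<le> int_norm (\<lambda>t. u' t + s * y t)"
      by (rule concentrate_L1[where f=f and L=L and u=u and y=y and e=e'])
        (rule that f_add f_scale f_le u(1-3) y(1) e'(1); assumption)+
    define z where "z t = u' t + x2 t" for t
    have zY: "z \<in> Y" "f z = f u' + f x2" unfolding z_def using Y_add(1)[OF u'(1) X(2)] f_add[OF u'(1) X(2)] by auto
    have zD: "z t * \<kappa>1 t = u' t * \<kappa>1 t" for t using X(5) k1_off by (cases "t \<in> D") (auto simp: z_def)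
    have z2: "z t * \<kappa>2 t = x2 t * \<kappa>2 t" for t using u'(2) k2_off by (cases "t \<in> D") (auto simp: z_def)
    have az: "int_norm z = 1" using u'(3) unfolding int_norm_def zD .
    have mz: "sup_norm z \<le> 1" using X(9) x unfolding sup_norm_def z2 by simp
    define s where "s = f z"
    have s: "f x \<le> s" "0 \<le> s" "s \<le> L"
    proof -
      show "f x \<le> s" using u(4) u'(4) fx zY by (simp add: s_def)
      then show "0 \<le> s" using x by simp
      have "L * max (int_norm z) (sup_norm z) \<le> L * 1" using az mz L by (intro mult_left_mono) auto
      then show "s \<le> L" using f_le'[OF zY(1)] by (simp add: s_def)
    qed
    have "int_norm (\<lambda>t. z t + s * y t) = int_norm (\<lambda>t. u' t + s * y t)" by (simp add: int_norm_def distrib_right zD)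
    then have "1 + s * N - 2 * s * e' \<le> int_norm (\<lambda>t. z t + s * y t)" using u'(5)[of s] s by (simp add: Na)
    moreover have "2 * s * e' \<le> 2 * L * e'" using s e' by (intro mult_right_mono) auto
    moreover have "f x * N \<le> s * N" using s N by (intro mult_right_mono) auto
    ultimately have "1 + f x * N - e \<le> int_norm (\<lambda>t. z t + s * y t)" using e'(2) by linarith
    then show ?thesis using zY az mz by (intro bexI[of _ z]) (auto simp: N_def s_def)
  qed
qed

lemma definite_part: assumes x: "x \<in> Y" and ne: "\<not> (AE t in \<mu>. x t = 0)" shows "0 < int_norm x \<or> 0 < sup_norm x"
proof (rule ccontr)
  assume "\<not> ?thesis"
  then have z: "int_norm x = 0" "sup_norm x = 0" using int_norm_nonneg[of x] sup_norm_nonneg[of x] by linarith+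
  have "AE t in \<mu>. \<bar>x t * \<kappa>1 t\<bar> = 0"
    using z(1) Y_integrable[OF x] unfolding int_norm_def by (subst (asm) integral_nonneg_eq_0_iff_AE) auto
  with sup_norm_AE[OF x] k1_pos k2_pos have "AE t in \<mu>. x t = 0"
    by eventually_elim (use z(2) in auto)
  then show False using ne by simp
qed

end

lemma (in weighted_sum) daugavet_weighted_sum:
  assumes "class_space \<mu> S n" and R: "class_space.R \<mu> S = Y"
    and p: "p = max \<or> p = (+)" and norm: "\<And>x. x \<in> Y \<Longrightarrow> n (\<lambda>t. ereal (x t)) = p (int_norm x) (sup_norm x)"
  shows "daugavet_property (function_space \<mu> S n)"
proof -
  interpret class_space \<mu> S n by fact
  note RY = R
  have nrm: "rnorm x = p (int_norm x) (sup_norm x)" if "x \<in> Y" for x using norm[OF that] by (simp add: rnorm_def)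
  show ?thesis
  proof (rule daugavet_propertyI)
    show "(\<lambda>t. x t + z t) \<in> R" if "x \<in> R" "z \<in> R" for x z using that Y_add(1) unfolding RY by blast
    show "(\<lambda>t. c * x t) \<in> R" if "x \<in> R" for c x using that Y_scale(1) unfolding RY by blast
    show "rnorm (\<lambda>t. c * x t) = \<bar>c\<bar> * rnorm x" if "x \<in> R" for c x
      using p Y_scale[OF that[unfolded RY], of c] nrm that unfolding RY
      by (auto simp: distrib_left max_mult_distrib_left)
    show "rnorm (\<lambda>t. x t + z t) \<le> rnorm x + rnorm z" if "x \<in> R" "z \<in> R" for x z
      using p Y_add[OF that[unfolded RY]] nrm that unfolding RY by auto
    show "0 < rnorm x" if "x \<in> R" "\<not> (AE t in \<mu>. x t = 0)" for x
      using definite_part[OF that(1)[unfolded RY] that(2)] p nrm[OF that(1)[unfolded RY]] int_norm_nonneg[of x] sup_norm_nonneg[of x] by auto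
    show "\<exists>x'\<in>R. rnorm x' \<le> 1 \<and> 1 + f x * rnorm y - e \<le> rnorm (\<lambda>t. x' t + f x' * y t)"
      if f: "\<And>x z. x \<in> R \<Longrightarrow> z \<in> R \<Longrightarrow> f (\<lambda>t. x t + z t) = f x + f z"
        "\<And>c x. x \<in> R \<Longrightarrow> f (\<lambda>t. c * x t) = c * f x" "\<And>x. x \<in> R \<Longrightarrow> \<bar>f x\<bar> \<le> L * rnorm x" "0 \<le> L"
        and y: "y \<in> R" "0 < rnorm y" and x: "x \<in> R" "rnorm x \<le> 1" "0 \<le> f x" and e: "0 < e" for f L x y e
    proof -
      note f' = f[unfolded RY] and y' = y[unfolded RY] and x' = x[unfolded RY]
      have sum: "(\<lambda>t. x' t + f x' * y t) \<in> Y" if "x' \<in> Y" for x'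
        by (rule Y_add(1)[OF that Y_scale(1)[OF y'(1)]])
      from p show ?thesis
      proof
        assume p: "p = max"
        have "\<exists>x'\<in>Y. max (int_norm x') (sup_norm x') \<le> 1 \<and>
          1 + f x * max (int_norm y) (sup_norm y) - e \<le> max (int_norm (\<lambda>t. x' t + f x' * y t)) (sup_norm (\<lambda>t. x' t + f x' * y t))"
          by (rule almost_norming_inf[OF f'(1,2) _ f'(4) y'(1) _ x'(1) _ x'(3) e])
            (use f'(3) y' x' nrm p in auto)
        then obtain x' where "x' \<in> Y" "max (int_norm x') (sup_norm x') \<le> 1"
          "1 + f x * max (int_norm y) (sup_norm y) - e \<le> max (int_norm (\<lambda>t. x' t + f x' * y t)) (sup_norm (\<lambda>t. x' t + f x' * y t))" by blast
        then show ?thesis unfolding RY using nrm[OF sum] nrm y' p by (intro bexI[of _ x']) simp_all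
      next
        assume p: "p = (+)"
        have "\<exists>x'\<in>Y. int_norm x' + sup_norm x' \<le> 1 \<and>
          1 + f x * (int_norm y + sup_norm y) - e \<le> int_norm (\<lambda>t. x' t + f x' * y t) + sup_norm (\<lambda>t. x' t + f x' * y t)"
          by (rule almost_norming_1[OF f'(1,2) _ f'(4) y'(1) _ x'(1) _ x'(3) e])
            (use f'(3) y' x' nrm p in auto)
        then obtain x' where "x' \<in> Y" "int_norm x' + sup_norm x' \<le> 1"
          "1 + f x * (int_norm y + sup_norm y) - e \<le> int_norm (\<lambda>t. x' t + f x' * y t) + sup_norm (\<lambda>t. x' t + f x' * y t)" by blast
        then show ?thesis unfolding RY using nrm[OF sum] nrm y' p by (intro bexI[of _ x']) simp_all
      qed
    qed
  qed
qed

section \<open>Equalities of spaces\<close>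

lemma esssup_le_iff: "f \<in> borel_measurable \<mu> \<Longrightarrow> esssup \<mu> f \<le> c \<longleftrightarrow> (AE t in \<mu>. f t \<le> c)" for f :: "'a \<Rightarrow> ennreal"
proof
  assume "f \<in> borel_measurable \<mu>" "esssup \<mu> f \<le> c"
  with esssup_AE[of f \<mu>] show "AE t in \<mu>. f t \<le> c" by (auto elim: eventually_mono)
qed (rule esssup_I)

lemma norm_inf_le_iff:
  assumes [measurable]: "x \<in> borel_measurable \<mu>" and \<Gamma>: "\<Gamma> \<in> sets \<mu>" and u: "u \<in> borel_measurable (restrict_space \<mu> \<Gamma>)"
  shows "norm_inf \<mu> \<Gamma> u x \<le> c \<longleftrightarrow> (AE t in \<mu>. t \<in> \<Gamma> \<longrightarrow> e2ennreal \<bar>x t\<bar> * u t \<le> c)"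
proof -
  have [measurable]: "(\<lambda>t. e2ennreal \<bar>x t\<bar>) \<in> borel_measurable (restrict_space \<mu> \<Gamma>)"
    by (rule measurable_restrict_space1) measurable
  note u[measurable]
  have "(\<lambda>t. e2ennreal \<bar>x t\<bar> * u t) \<in> borel_measurable (restrict_space \<mu> \<Gamma>)" by measurable
  then show ?thesis unfolding norm_inf_def
    using \<Gamma> sets.sets_into_space[OF \<Gamma>] by (subst esssup_le_iff) (auto simp: AE_restrict_space_iff Int_absorb2)
qed

lemma norm_inf_cong:
  assumes "x \<in> borel_measurable \<mu>" "y \<in> borel_measurable \<mu>" "\<Gamma> \<in> sets \<mu>" "u \<in> borel_measurable (restrict_space \<mu> \<Gamma>)"
    and eq: "AE t in \<mu>. t \<in> \<Gamma> \<longrightarrow> x t = y t"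
  shows "norm_inf \<mu> \<Gamma> u x = norm_inf \<mu> \<Gamma> u y"
proof -
  have "norm_inf \<mu> \<Gamma> u x \<le> c \<longleftrightarrow> norm_inf \<mu> \<Gamma> u y \<le> c" for c
    unfolding norm_inf_le_iff[OF assms(1,3,4)] norm_inf_le_iff[OF assms(2,3,4)]
  proof
    assume "AE t in \<mu>. t \<in> \<Gamma> \<longrightarrow> e2ennreal \<bar>x t\<bar> * u t \<le> c"
    with eq show "AE t in \<mu>. t \<in> \<Gamma> \<longrightarrow> e2ennreal \<bar>y t\<bar> * u t \<le> c" by eventually_elim auto
  next
    assume "AE t in \<mu>. t \<in> \<Gamma> \<longrightarrow> e2ennreal \<bar>y t\<bar> * u t \<le> c"
    with eq show "AE t in \<mu>. t \<in> \<Gamma> \<longrightarrow> e2ennreal \<bar>x t\<bar> * u t \<le> c" by eventually_elim auto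
  qed
  then show ?thesis by (meson antisym order_refl)
qed

lemma norm_1_cong:
  assumes eq: "AE t in \<mu>. t \<in> \<Gamma> \<longrightarrow> x t = y t" shows "norm_1 \<mu> \<Gamma> u x = norm_1 \<mu> \<Gamma> u y"
  unfolding norm_1_def
  by (rule nn_integral_cong_AE) (use eq in eventually_elim, auto simp: indicator_def)

definition closed_functions :: "'a measure \<Rightarrow> ('a \<Rightarrow> ereal) set \<Rightarrow> bool" where
  "closed_functions \<mu> S \<longleftrightarrow> S \<subseteq> borel_measurable \<mu> \<and>
     (\<forall>x\<in>S. \<forall>y\<in>borel_measurable \<mu>. (AE t in \<mu>. x t = y t) \<longrightarrow> y \<in> S)"

definition ae_invariant :: "'a measure \<Rightarrow> ('a \<Rightarrow> ereal) set \<Rightarrow> (('a \<Rightarrow> ereal) \<Rightarrow> real) \<Rightarrow> bool" where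
  "ae_invariant \<mu> S n \<longleftrightarrow> (\<forall>x\<in>S. \<forall>y\<in>borel_measurable \<mu>. (AE t in \<mu>. x t = y t) \<longrightarrow> n y = n x)"

lemma closed_functionsD: "closed_functions \<mu> S \<Longrightarrow> x \<in> S \<Longrightarrow> y \<in> borel_measurable \<mu> \<Longrightarrow> AE t in \<mu>. x t = y t \<Longrightarrow> y \<in> S"
  by (auto simp: closed_functions_def)

lemma closed_functions_measurable: "closed_functions \<mu> S \<Longrightarrow> x \<in> S \<Longrightarrow> x \<in> borel_measurable \<mu>"
  by (auto simp: closed_functions_def)

lemma class_in_carrier_iff:
  assumes S: "closed_functions \<mu> S" and x: "x \<in> borel_measurable \<mu>"
  shows "ae_class \<mu> x \<in> ae_class \<mu> ` S \<longleftrightarrow> x \<in> S"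
proof
  assume "ae_class \<mu> x \<in> ae_class \<mu> ` S"
  then obtain y where y: "y \<in> S" "ae_class \<mu> x = ae_class \<mu> y" by blast
  then have "AE t in \<mu>. y t = x t"
    using ae_class_eq_iff[OF closed_functions_measurable[OF S y(1)] x] by simp
  then show "x \<in> S" by (rule closed_functionsD[OF S y(1) x])
qed blast

lemma vnorm_ae_class:
  assumes S: "closed_functions \<mu> S" and n: "ae_invariant \<mu> S n" and x: "x \<in> S"
  shows "vnorm (function_space \<mu> S n) (ae_class \<mu> x) = n x"
  by (rule norm_ae_class[OF closed_functions_measurable[OF S x]]) (use n x in \<open>auto simp: ae_invariant_def\<close>)

lemma vcarrier_function_space: "vcarrier (function_space \<mu> S n) = ae_class \<mu> ` S"
  by (simp add: function_space_def)

text \<open>For sets of functions closed under a.e. equality, equality of the spaces of classes is equality of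
  the sets.\<close>

lemma same_space_iff:
  assumes S: "closed_functions \<mu> S" "ae_invariant \<mu> S n" and S': "closed_functions \<mu> S'" "ae_invariant \<mu> S' n'"
  shows "same_space (function_space \<mu> S n) (function_space \<mu> S' n') \<longleftrightarrow> S = S' \<and> (\<forall>x\<in>S. n x = n' x)"
proof
  assume same: "same_space (function_space \<mu> S n) (function_space \<mu> S' n')"
  then have car: "ae_class \<mu> ` S = ae_class \<mu> ` S'" by (simp add: same_space_def vcarrier_function_space)
  have eq: "S = S'"
  proof (intro equalityI subsetI)
    fix x assume x: "x \<in> S"
    then have "ae_class \<mu> x \<in> ae_class \<mu> ` S'" using car by blast
    then show "x \<in> S'" using class_in_carrier_iff[OF S'(1) closed_functions_measurable[OF S(1) x]] by blast
  next
    fix x assume x: "x \<in> S'"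
    then have "ae_class \<mu> x \<in> ae_class \<mu> ` S" using car by blast
    then show "x \<in> S" using class_in_carrier_iff[OF S(1) closed_functions_measurable[OF S'(1) x]] by blast
  qed
  moreover have "n x = n' x" if x: "x \<in> S" for x
  proof -
    have "vnorm (function_space \<mu> S n) (ae_class \<mu> x) = vnorm (function_space \<mu> S' n') (ae_class \<mu> x)"
      using same x by (auto simp: same_space_def vcarrier_function_space)
    then show ?thesis using vnorm_ae_class[OF S x] vnorm_ae_class[OF S', of x] x eq by simp
  qed
  ultimately show "S = S' \<and> (\<forall>x\<in>S. n x = n' x)" by blast
next
  assume eq: "S = S' \<and> (\<forall>x\<in>S. n x = n' x)"
  show "same_space (function_space \<mu> S n) (function_space \<mu> S' n')"
    unfolding same_space_def vcarrier_function_space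
    using eq vnorm_ae_class[OF S] vnorm_ae_class[OF S'] by auto
qed

lemma restrict_class_ae_class:
  assumes [measurable]: "x \<in> borel_measurable \<mu>" "A \<in> sets \<mu>"
  shows "restrict_class \<mu> A (ae_class \<mu> x) = ae_class \<mu> (\<lambda>t. x t * indicator A t)"
  unfolding restrict_class_def
proof (rule UN_const_eq)
  show "ae_class \<mu> x \<noteq> {}" using ae_class_self[OF assms(1)] by blast
  fix y assume "y \<in> ae_class \<mu> x"
  then have [measurable]: "y \<in> borel_measurable \<mu>" and ae: "AE t in \<mu>. x t = y t" unfolding mem_ae_class by auto
  show "ae_class \<mu> (\<lambda>t. y t * indicator A t) = ae_class \<mu> (\<lambda>t. x t * indicator A t)"
  proof (subst ae_class_eq_iff)
    show "AE t in \<mu>. y t * indicator A t = x t * indicator A t" using ae by eventually_elim simp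
  qed measurable
qed

text \<open>A pair of functions on \<open>A\<close> and on its complement is the splitting of the function glued
  from them, so the splitting map is onto exactly when membership can be tested on the two parts.\<close>

lemma same_space_split_iff:
  fixes p :: "real \<Rightarrow> real \<Rightarrow> real"
  assumes A[measurable]: "A \<in> sets \<mu>" and S: "closed_functions \<mu> S" "ae_invariant \<mu> S n"
    and S1: "closed_functions \<mu> S1" "ae_invariant \<mu> S1 n1" "S1 \<subseteq> functions_on \<mu> A"
    and S2: "closed_functions \<mu> S2" "ae_invariant \<mu> S2 n2" "S2 \<subseteq> functions_on \<mu> (space \<mu> - A)"
  shows "same_space_split \<mu> A (function_space \<mu> S n) (direct_sum p (function_space \<mu> S1 n1) (function_space \<mu> S2 n2)) \<longleftrightarrow>
    (\<forall>x\<in>borel_measurable \<mu>. x \<in> S \<longleftrightarrow> (\<lambda>t. x t * indicator A t) \<in> S1 \<and> (\<lambda>t. x t * indicator (space \<mu> - A) t) \<in> S2) \<and>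
    (\<forall>x\<in>S. n x = p (n1 (\<lambda>t. x t * indicator A t)) (n2 (\<lambda>t. x t * indicator (space \<mu> - A) t)))"
    (is "?L \<longleftrightarrow> ?C \<and> ?N")
proof -
  define r1 where "r1 x t = x t * (indicator A t :: ereal)" for x :: "'a \<Rightarrow> ereal" and t
  define r2 where "r2 x t = x t * (indicator (space \<mu> - A) t :: ereal)" for x :: "'a \<Rightarrow> ereal" and t
  have r_meas[measurable]: "r1 x \<in> borel_measurable \<mu>" "r2 x \<in> borel_measurable \<mu>" if [measurable]: "x \<in> borel_measurable \<mu>" for x
    unfolding r1_def r2_def by measurable
  define split where "split = (\<lambda>X. (restrict_class \<mu> A X, restrict_class \<mu> (space \<mu> - A) X))"
  have split: "split (ae_class \<mu> x) = (ae_class \<mu> (r1 x), ae_class \<mu> (r2 x))" if "x \<in> borel_measurable \<mu>" for x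
    unfolding split_def r1_def[abs_def] r2_def[abs_def] using that by (simp add: restrict_class_ae_class)
  note Sm = closed_functions_measurable[OF S(1)]
  let ?X = "function_space \<mu> S n" and ?Z = "direct_sum p (function_space \<mu> S1 n1) (function_space \<mu> S2 n2)"
  have carX: "vcarrier ?X = ae_class \<mu> ` S" by (rule vcarrier_function_space)
  have carZ: "vcarrier ?Z = ae_class \<mu> ` S1 \<times> ae_class \<mu> ` S2" by (simp add: direct_sum_def vcarrier_function_space)
  have L: "?L \<longleftrightarrow> split ` vcarrier ?X = vcarrier ?Z \<and> (\<forall>X\<in>vcarrier ?X. vnorm ?X X = vnorm ?Z (split X))"
    by (simp add: same_space_split_def split_def Let_def)
  have in_S: "r1 x \<in> S1 \<and> r2 x \<in> S2" if "split ` vcarrier ?X = vcarrier ?Z" "x \<in> S" for x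
  proof -
    have "split (ae_class \<mu> x) \<in> vcarrier ?Z" using that carX by blast
    then show ?thesis unfolding split[OF Sm[OF that(2)]] carZ
      using class_in_carrier_iff[OF S1(1), of "r1 x"] class_in_carrier_iff[OF S2(1), of "r2 x"] Sm[OF that(2)] by auto
  qed
  have norm_iff: "vnorm ?X (ae_class \<mu> x) = vnorm ?Z (split (ae_class \<mu> x)) \<longleftrightarrow> n x = p (n1 (r1 x)) (n2 (r2 x))"
    if x: "x \<in> S" and r: "r1 x \<in> S1" "r2 x \<in> S2" for x
    unfolding split[OF Sm[OF x]] vnorm_ae_class[OF S x]
    using vnorm_ae_class[OF S1(1,2) r(1)] vnorm_ae_class[OF S2(1,2) r(2)] by (simp add: direct_sum_def)
  have rC: "?C \<longleftrightarrow> (\<forall>x\<in>borel_measurable \<mu>. x \<in> S \<longleftrightarrow> r1 x \<in> S1 \<and> r2 x \<in> S2)"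
    and rN: "?N \<longleftrightarrow> (\<forall>x\<in>S. n x = p (n1 (r1 x)) (n2 (r2 x)))"
    by (simp_all add: r1_def[abs_def] r2_def[abs_def])
  show ?thesis unfolding L rC rN
  proof (rule iffI)
    assume H: "split ` vcarrier ?X = vcarrier ?Z \<and> (\<forall>X\<in>vcarrier ?X. vnorm ?X X = vnorm ?Z (split X))"
    note im = conjunct1[OF H]
    show "(\<forall>x\<in>borel_measurable \<mu>. x \<in> S \<longleftrightarrow> r1 x \<in> S1 \<and> r2 x \<in> S2) \<and> (\<forall>x\<in>S. n x = p (n1 (r1 x)) (n2 (r2 x)))"
    proof (intro conjI ballI)
    show "n x = p (n1 (r1 x)) (n2 (r2 x))" if x: "x \<in> S" for x
      using norm_iff[OF x] in_S[OF im x] H x carX by blast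
    show "x \<in> S \<longleftrightarrow> r1 x \<in> S1 \<and> r2 x \<in> S2" if x[measurable]: "x \<in> borel_measurable \<mu>" for x
    proof
      assume r: "r1 x \<in> S1 \<and> r2 x \<in> S2"
      then have "split (ae_class \<mu> x) \<in> vcarrier ?Z" unfolding split[OF x] carZ by blast
      then obtain y where y: "y \<in> S" "split (ae_class \<mu> x) = split (ae_class \<mu> y)" unfolding im[symmetric] carX by blast
      note [measurable] = Sm[OF y(1)]
      from y(2) have "ae_class \<mu> (r1 x) = ae_class \<mu> (r1 y)" "ae_class \<mu> (r2 x) = ae_class \<mu> (r2 y)"
        unfolding split[OF x] split[OF Sm[OF y(1)]] by auto
      then have "AE t in \<mu>. r1 x t = r1 y t" "AE t in \<mu>. r2 x t = r2 y t"
        using ae_class_eq_iff[of "r1 x" \<mu> "r1 y"] ae_class_eq_iff[of "r2 x" \<mu> "r2 y"] by auto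
      with AE_space have "AE t in \<mu>. y t = x t"
      proof eventually_elim
        case (elim t)
        then show ?case by (cases "t \<in> A") (simp_all add: r1_def r2_def)
      qed
      then show "x \<in> S" by (rule closed_functionsD[OF S(1) y(1) x])
    qed (rule in_S[OF im])
    qed
  next
    assume H: "(\<forall>x\<in>borel_measurable \<mu>. x \<in> S \<longleftrightarrow> r1 x \<in> S1 \<and> r2 x \<in> S2) \<and> (\<forall>x\<in>S. n x = p (n1 (r1 x)) (n2 (r2 x)))"
    show "split ` vcarrier ?X = vcarrier ?Z \<and> (\<forall>X\<in>vcarrier ?X. vnorm ?X X = vnorm ?Z (split X))"
    proof (intro conjI ballI)
    show "split ` vcarrier ?X = vcarrier ?Z"
    proof (intro equalityI subsetI)
      fix Q assume "Q \<in> split ` vcarrier ?X"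
      then obtain x where x: "x \<in> S" "Q = split (ae_class \<mu> x)" unfolding carX by blast
      then show "Q \<in> vcarrier ?Z" unfolding carZ x(2) split[OF Sm[OF x(1)]] using H Sm[OF x(1)] by blast
    next
      fix Q assume "Q \<in> vcarrier ?Z"
      then obtain y z where yz: "y \<in> S1" "z \<in> S2" "Q = (ae_class \<mu> y, ae_class \<mu> z)" unfolding carZ by blast
      note ym[measurable] = closed_functions_measurable[OF S1(1) yz(1)] and zm[measurable] = closed_functions_measurable[OF S2(1) yz(2)]
      define x where "x t = (if t \<in> A then y t else z t)" for t
      have xm[measurable]: "x \<in> borel_measurable \<mu>" unfolding x_def by measurable
      have y0: "AE t in \<mu>. t \<notin> A \<longrightarrow> y t = 0" and z0: "AE t in \<mu>. t \<notin> space \<mu> - A \<longrightarrow> z t = 0"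
        using yz S1(3) S2(3) by (auto simp: functions_on_def)
      have e1: "AE t in \<mu>. y t = r1 x t" using y0
      proof eventually_elim
        case (elim t) then show ?case by (cases "t \<in> A") (simp_all add: r1_def x_def)
      qed
      have e2: "AE t in \<mu>. z t = r2 x t" using z0 AE_space
      proof eventually_elim
        case (elim t) then show ?case by (cases "t \<in> A") (simp_all add: r2_def x_def)
      qed
      have "r1 x \<in> S1" "r2 x \<in> S2"
        by (rule closed_functionsD[OF S1(1) yz(1) _ e1] closed_functionsD[OF S2(1) yz(2) _ e2]; measurable)+
      then have "x \<in> S" using H xm by blast
      moreover have "Q = split (ae_class \<mu> x)"
        unfolding split[OF xm] yz(3) using ae_class_eq_iff[of y \<mu> "r1 x"] ae_class_eq_iff[of z \<mu> "r2 x"] e1 e2 by auto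
      ultimately show "Q \<in> split ` vcarrier ?X" unfolding carX by blast
    qed
    show "vnorm ?X X = vnorm ?Z (split X)" if "X \<in> vcarrier ?X" for X
    proof -
      obtain x where x: "x \<in> S" "X = ae_class \<mu> x" using \<open>X \<in> vcarrier ?X\<close> unfolding carX by blast
      then show ?thesis using norm_iff[OF x(1)] H Sm[OF x(1)] by blast
    qed
    qed
  qed
qed

text \<open>A common form of all six equalities of spaces: \<open>p\<close> is \<open>max\<close> or \<open>+\<close>, and for \<open>D\<close> the whole space or
  the empty set one of the two summands is trivial. Membership and norm of
  \<open>x\<close> are expressed through \<open>x\<close> itself, without splitting it.\<close>

definition is_weighted_sum ::
    "'a measure \<Rightarrow> (real \<Rightarrow> real \<Rightarrow> real) \<Rightarrow> 'a set \<Rightarrow> ('a \<Rightarrow> ennreal) \<Rightarrow> ('a \<Rightarrow> ennreal)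
      \<Rightarrow> ('a \<Rightarrow> ereal) set \<Rightarrow> (('a \<Rightarrow> ereal) \<Rightarrow> real) \<Rightarrow> bool" where
  "is_weighted_sum \<mu> p D u1 u2 S n \<longleftrightarrow> weight_on \<mu> D u1 \<and> weight_on \<mu> (space \<mu> - D) u2 \<and>
     S = {x \<in> borel_measurable \<mu>. norm_1 \<mu> D u1 x < \<infinity> \<and> norm_inf \<mu> (space \<mu> - D) u2 x < \<infinity>} \<and>
     (\<forall>x\<in>S. n x = p (enn2real (norm_1 \<mu> D u1 x)) (enn2real (norm_inf \<mu> (space \<mu> - D) u2 x)))"

lemma weight_on_measurable: "weight_on \<mu> \<Gamma> u \<Longrightarrow> u \<in> borel_measurable (restrict_space \<mu> \<Gamma>)"
  by (simp add: weight_on_def)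

lemma closed_norm_1: "closed_functions \<mu> {x \<in> functions_on \<mu> \<Gamma>. norm_1 \<mu> \<Gamma> u x < \<infinity>}"
  and invariant_norm_1: "ae_invariant \<mu> {x \<in> functions_on \<mu> \<Gamma>. norm_1 \<mu> \<Gamma> u x < \<infinity>} (\<lambda>x. enn2real (norm_1 \<mu> \<Gamma> u x))"
proof -
  have eq: "norm_1 \<mu> \<Gamma> u y = norm_1 \<mu> \<Gamma> u x" if "AE t in \<mu>. x t = y t" for x y
    by (rule norm_1_cong) (use that in eventually_elim, simp)
  have "y \<in> functions_on \<mu> \<Gamma>" if "x \<in> functions_on \<mu> \<Gamma>" "y \<in> borel_measurable \<mu>" "AE t in \<mu>. x t = y t" for x y
  proof -
    have "AE t in \<mu>. t \<notin> \<Gamma> \<longrightarrow> x t = 0" using that(1) by (simp add: functions_on_def)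
    with that(3) have "AE t in \<mu>. t \<notin> \<Gamma> \<longrightarrow> y t = 0" by eventually_elim auto
    then show ?thesis using that(2) by (simp add: functions_on_def)
  qed
  then show "closed_functions \<mu> {x \<in> functions_on \<mu> \<Gamma>. norm_1 \<mu> \<Gamma> u x < \<infinity>}"
    unfolding closed_functions_def using eq by (auto simp: functions_on_def)
  show "ae_invariant \<mu> {x \<in> functions_on \<mu> \<Gamma>. norm_1 \<mu> \<Gamma> u x < \<infinity>} (\<lambda>x. enn2real (norm_1 \<mu> \<Gamma> u x))"
    unfolding ae_invariant_def using eq by auto
qed

lemma closed_norm_inf:
  assumes \<Gamma>: "\<Gamma> \<in> sets \<mu>" and u: "u \<in> borel_measurable (restrict_space \<mu> \<Gamma>)"
  shows "closed_functions \<mu> {x \<in> functions_on \<mu> \<Gamma>. norm_inf \<mu> \<Gamma> u x < \<infinity>}"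
    and "ae_invariant \<mu> {x \<in> functions_on \<mu> \<Gamma>. norm_inf \<mu> \<Gamma> u x < \<infinity>} (\<lambda>x. enn2real (norm_inf \<mu> \<Gamma> u x))"
proof -
  have eq: "norm_inf \<mu> \<Gamma> u y = norm_inf \<mu> \<Gamma> u x"
    if "x \<in> borel_measurable \<mu>" "y \<in> borel_measurable \<mu>" "AE t in \<mu>. x t = y t" for x y
    by (rule norm_inf_cong[OF that(2,1) \<Gamma> u]) (use that(3) in eventually_elim, simp)
  have fn: "y \<in> functions_on \<mu> \<Gamma>" if "x \<in> functions_on \<mu> \<Gamma>" "y \<in> borel_measurable \<mu>" "AE t in \<mu>. x t = y t" for x y
  proof -
    have "AE t in \<mu>. t \<notin> \<Gamma> \<longrightarrow> x t = 0" using that(1) by (simp add: functions_on_def)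
    with that(3) have "AE t in \<mu>. t \<notin> \<Gamma> \<longrightarrow> y t = 0" by eventually_elim auto
    then show ?thesis using that(2) by (simp add: functions_on_def)
  qed
  have on: "x \<in> borel_measurable \<mu>" if "x \<in> functions_on \<mu> \<Gamma>" for x using that by (simp add: functions_on_def)
  show "closed_functions \<mu> {x \<in> functions_on \<mu> \<Gamma>. norm_inf \<mu> \<Gamma> u x < \<infinity>}"
    unfolding closed_functions_def
  proof (intro conjI subsetI ballI impI)
    fix x assume "x \<in> {x \<in> functions_on \<mu> \<Gamma>. norm_inf \<mu> \<Gamma> u x < \<infinity>}"
    then show "x \<in> borel_measurable \<mu>" using on by blast
  next
    fix x y assume x: "x \<in> {x \<in> functions_on \<mu> \<Gamma>. norm_inf \<mu> \<Gamma> u x < \<infinity>}"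
      and y: "y \<in> borel_measurable \<mu>" "AE t in \<mu>. x t = y t"
    from x have x': "x \<in> functions_on \<mu> \<Gamma>" "norm_inf \<mu> \<Gamma> u x < \<infinity>" by auto
    show "y \<in> {x \<in> functions_on \<mu> \<Gamma>. norm_inf \<mu> \<Gamma> u x < \<infinity>}"
      using fn[OF x'(1) y] x'(2) eq[OF on[OF x'(1)] y] by simp
  qed
  show "ae_invariant \<mu> {x \<in> functions_on \<mu> \<Gamma>. norm_inf \<mu> \<Gamma> u x < \<infinity>} (\<lambda>x. enn2real (norm_inf \<mu> \<Gamma> u x))"
    unfolding ae_invariant_def
  proof (intro ballI impI)
    fix x y assume x: "x \<in> {x \<in> functions_on \<mu> \<Gamma>. norm_inf \<mu> \<Gamma> u x < \<infinity>}"
      and y: "y \<in> borel_measurable \<mu>" "AE t in \<mu>. x t = y t"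
    from x have x': "x \<in> functions_on \<mu> \<Gamma>" by auto
    show "enn2real (norm_inf \<mu> \<Gamma> u y) = enn2real (norm_inf \<mu> \<Gamma> u x)" using eq[OF on[OF x'] y] by simp
  qed
qed

lemma weight_on_empty: "weight_on \<mu> {} u"
  unfolding weight_on_def by (auto simp: measurable_def space_restrict_space)

lemma norm_1_empty: "norm_1 \<mu> {} u x = 0" by (simp add: norm_1_def)

lemma norm_inf_empty: "x \<in> borel_measurable \<mu> \<Longrightarrow> norm_inf \<mu> {} u x = 0"
  using norm_inf_le_iff[of x \<mu> "{}" u 0] weight_on_measurable[OF weight_on_empty] by auto

lemma functions_on_space: "functions_on \<mu> (space \<mu>) = borel_measurable \<mu>"
  by (auto simp: functions_on_def)

lemma same_space_L_1_iff:
  assumes S: "closed_functions \<mu> S" "ae_invariant \<mu> S n" and p: "p = max \<or> p = (+)"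
  shows "weight_on \<mu> (space \<mu>) u \<and> same_space (function_space \<mu> S n) (L_1 \<mu> (space \<mu>) u) \<longleftrightarrow>
    is_weighted_sum \<mu> p (space \<mu>) u u' S n"
proof -
  have p0: "p (enn2real c) 0 = enn2real c" for c using p enn2real_nonneg[of c] by (auto simp: max_absorb1)
  have *: "same_space (function_space \<mu> S n) (L_1 \<mu> (space \<mu>) u) \<longleftrightarrow>
      S = {x \<in> functions_on \<mu> (space \<mu>). norm_1 \<mu> (space \<mu>) u x < \<infinity>} \<and> (\<forall>x\<in>S. n x = enn2real (norm_1 \<mu> (space \<mu>) u x))"
    unfolding L_1_def by (rule same_space_iff[OF S closed_norm_1 invariant_norm_1])
  show ?thesis
    unfolding is_weighted_sum_def * functions_on_space by (auto simp: weight_on_empty norm_inf_empty p0)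
qed

lemma same_space_L_inf_iff:
  assumes S: "closed_functions \<mu> S" "ae_invariant \<mu> S n" and p: "p = max \<or> p = (+)"
  shows "weight_on \<mu> (space \<mu>) u \<and> same_space (function_space \<mu> S n) (L_inf \<mu> (space \<mu>) u) \<longleftrightarrow>
    is_weighted_sum \<mu> p {} u' u S n"
proof (cases "weight_on \<mu> (space \<mu>) u")
  case True
  have p0: "p 0 (enn2real c) = enn2real c" for c using p enn2real_nonneg[of c] by (auto simp: max_absorb2)
  have *: "same_space (function_space \<mu> S n) (L_inf \<mu> (space \<mu>) u) \<longleftrightarrow>
      S = {x \<in> functions_on \<mu> (space \<mu>). norm_inf \<mu> (space \<mu>) u x < \<infinity>} \<and> (\<forall>x\<in>S. n x = enn2real (norm_inf \<mu> (space \<mu>) u x))"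
    unfolding L_inf_def by (rule same_space_iff[OF S closed_norm_inf[OF sets.top weight_on_measurable[OF True]]])
  show ?thesis
    unfolding is_weighted_sum_def * functions_on_space by (auto simp: weight_on_empty norm_1_empty p0)
next
  case False
  then show ?thesis by (simp add: is_weighted_sum_def)
qed

lemma norm_parts:
  assumes [measurable]: "x \<in> borel_measurable \<mu>" and A[measurable]: "A \<in> sets \<mu>"
  shows "(\<lambda>t. x t * indicator A t) \<in> functions_on \<mu> A" "norm_1 \<mu> A u (\<lambda>t. x t * indicator A t) = norm_1 \<mu> A u x"
    "u \<in> borel_measurable (restrict_space \<mu> A) \<Longrightarrow> norm_inf \<mu> A u (\<lambda>t. x t * indicator A t) = norm_inf \<mu> A u x"
proof -
  show "(\<lambda>t. x t * indicator A t) \<in> functions_on \<mu> A" by (simp add: functions_on_def)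
  show "norm_1 \<mu> A u (\<lambda>t. x t * indicator A t) = norm_1 \<mu> A u x" by (rule norm_1_cong) simp
  show "norm_inf \<mu> A u (\<lambda>t. x t * indicator A t) = norm_inf \<mu> A u x" if "u \<in> borel_measurable (restrict_space \<mu> A)"
    by (rule norm_inf_cong[OF _ _ A that]) auto
qed

lemma same_space_split_inf_1_iff:
  assumes S: "closed_functions \<mu> S" "ae_invariant \<mu> S n" and A[measurable]: "A \<in> sets \<mu>"
  shows "weight_on \<mu> A u2 \<and> weight_on \<mu> (space \<mu> - A) u1 \<and>
      same_space_split \<mu> A (function_space \<mu> S n) (sum_inf (L_inf \<mu> A u2) (L_1 \<mu> (space \<mu> - A) u1)) \<longleftrightarrow>
    is_weighted_sum \<mu> max (space \<mu> - A) u1 u2 S n"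
proof (cases "weight_on \<mu> A u2 \<and> weight_on \<mu> (space \<mu> - A) u1")
  case True
  have AA: "space \<mu> - (space \<mu> - A) = A" using sets.sets_into_space[OF A] by blast
  have m: "u2 \<in> borel_measurable (restrict_space \<mu> A)" using True weight_on_measurable by blast
  have Ac: "space \<mu> - A \<in> sets \<mu>" by measurable
  have "same_space_split \<mu> A (function_space \<mu> S n) (sum_inf (L_inf \<mu> A u2) (L_1 \<mu> (space \<mu> - A) u1)) \<longleftrightarrow>
    (\<forall>x\<in>borel_measurable \<mu>. x \<in> S \<longleftrightarrow> norm_inf \<mu> A u2 x < \<infinity> \<and> norm_1 \<mu> (space \<mu> - A) u1 x < \<infinity>) \<and>
    (\<forall>x\<in>S. n x = max (enn2real (norm_inf \<mu> A u2 x)) (enn2real (norm_1 \<mu> (space \<mu> - A) u1 x)))"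
    unfolding sum_inf_def L_inf_def L_1_def
    using norm_parts[OF _ A] norm_parts[OF _ Ac] m closed_functions_measurable[OF S(1)]
    by (subst same_space_split_iff[OF A S closed_norm_inf[OF A m] _ closed_norm_1 invariant_norm_1]) auto
  also have "\<dots> \<longleftrightarrow> is_weighted_sum \<mu> max (space \<mu> - A) u1 u2 S n"
    unfolding is_weighted_sum_def AA using True closed_functions_measurable[OF S(1)] by (auto simp: max.commute)
  finally show ?thesis using True by blast
next
  case False
  have AA: "space \<mu> - (space \<mu> - A) = A" using sets.sets_into_space[OF A] by blast
  then show ?thesis using False unfolding is_weighted_sum_def AA by blast
qed

lemma same_space_split_1_inf_iff:
  assumes S: "closed_functions \<mu> S" "ae_invariant \<mu> S n" and A[measurable]: "A \<in> sets \<mu>"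
  shows "weight_on \<mu> A u1 \<and> weight_on \<mu> (space \<mu> - A) u2 \<and>
      same_space_split \<mu> A (function_space \<mu> S n) (sum_1 (L_1 \<mu> A u1) (L_inf \<mu> (space \<mu> - A) u2)) \<longleftrightarrow>
    is_weighted_sum \<mu> (+) A u1 u2 S n"
proof (cases "weight_on \<mu> A u1 \<and> weight_on \<mu> (space \<mu> - A) u2")
  case True
  have m: "u2 \<in> borel_measurable (restrict_space \<mu> (space \<mu> - A))" using True weight_on_measurable by blast
  have Ac: "space \<mu> - A \<in> sets \<mu>" by measurable
  have "same_space_split \<mu> A (function_space \<mu> S n) (sum_1 (L_1 \<mu> A u1) (L_inf \<mu> (space \<mu> - A) u2)) \<longleftrightarrow>
    (\<forall>x\<in>borel_measurable \<mu>. x \<in> S \<longleftrightarrow> norm_1 \<mu> A u1 x < \<infinity> \<and> norm_inf \<mu> (space \<mu> - A) u2 x < \<infinity>) \<and>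
    (\<forall>x\<in>S. n x = enn2real (norm_1 \<mu> A u1 x) + enn2real (norm_inf \<mu> (space \<mu> - A) u2 x))"
    unfolding sum_1_def L_inf_def L_1_def
    using norm_parts[OF _ A] norm_parts[OF _ Ac] m closed_functions_measurable[OF S(1)]
    by (subst same_space_split_iff[OF A S closed_norm_1 invariant_norm_1 _ closed_norm_inf[OF Ac m]]) auto
  also have "\<dots> \<longleftrightarrow> is_weighted_sum \<mu> (+) A u1 u2 S n"
    unfolding is_weighted_sum_def using True closed_functions_measurable[OF S(1)] by auto
  finally show ?thesis using True by blast
next
  case False
  then show ?thesis unfolding is_weighted_sum_def by blast
qed

lemma finite_of_norms:
  assumes u1: "weight_on \<mu> D u1" and u2: "weight_on \<mu> (space \<mu> - D) u2"
    and fin1: "(AE t in \<mu>. t \<in> D \<longrightarrow> e2ennreal \<bar>x t\<bar> * u1 t < \<infinity>)"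
    and fin2: "(AE t in \<mu>. t \<in> space \<mu> - D \<longrightarrow> e2ennreal \<bar>x t\<bar> * u2 t < \<infinity>)"
  shows "AE t in \<mu>. \<bar>x t\<bar> \<noteq> \<infinity>"
proof -
  have "AE t in \<mu>. t \<in> D \<longrightarrow> 0 < u1 t" "AE t in \<mu>. t \<in> space \<mu> - D \<longrightarrow> 0 < u2 t"
    using u1 u2 by (auto simp: weight_on_def elim: eventually_mono)
  with fin1 fin2 AE_space show ?thesis
  proof eventually_elim
    case (elim t)
    show ?case
    proof
      assume inf: "\<bar>x t\<bar> = \<infinity>"
      show False
      proof (cases "t \<in> D")
        case True
        then have "u1 t \<noteq> 0" using elim by auto
        then show ?thesis using elim(1) True inf by (simp add: ennreal_top_mult)
      next
        case False
        then have "u2 t \<noteq> 0" using elim by auto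
        then show ?thesis using elim False inf by (simp add: ennreal_top_mult)
      qed
    qed
  qed
qed

text \<open>Real representatives turn the extended real weights and norms into those of the locale
  \<open>weighted_sum\<close>.\<close>

lemma daugavet_is_weighted_sum:
  assumes na: "nonatomic \<mu>" and D[measurable]: "D \<in> sets \<mu>" and p: "p = max \<or> p = (+)"
    and sum: "is_weighted_sum \<mu> p D u1 u2 S n"
    and inv: "\<And>x y. x \<in> borel_measurable \<mu> \<Longrightarrow> y \<in> borel_measurable \<mu> \<Longrightarrow> AE t in \<mu>. x t = y t \<Longrightarrow> n x = n y"
  shows "daugavet_property (function_space \<mu> S n)"
proof -
  define D' where "D' = space \<mu> - D"
  have D'[measurable]: "D' \<in> sets \<mu>" unfolding D'_def by measurable
  have w: "weight_on \<mu> D u1" "weight_on \<mu> D' u2"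
    and S: "S = {x \<in> borel_measurable \<mu>. norm_1 \<mu> D u1 x < \<infinity> \<and> norm_inf \<mu> D' u2 x < \<infinity>}"
    and n: "\<And>x. x \<in> S \<Longrightarrow> n x = p (enn2real (norm_1 \<mu> D u1 x)) (enn2real (norm_inf \<mu> D' u2 x))"
    using sum by (auto simp: is_weighted_sum_def D'_def)
  define \<kappa>1 where "\<kappa>1 t = enn2real (u1 t * indicator D t)" for t
  define \<kappa>2 where "\<kappa>2 t = enn2real (u2 t * indicator D' t)" for t
  have u1m[measurable]: "(\<lambda>t. u1 t * indicator D t) \<in> borel_measurable \<mu>"
    using weight_on_measurable[OF w(1)] by (subst borel_measurable_restrict_space_iff_ennreal[symmetric]) auto
  have u2m[measurable]: "(\<lambda>t. u2 t * indicator D' t) \<in> borel_measurable \<mu>"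
    using weight_on_measurable[OF w(2)] by (subst borel_measurable_restrict_space_iff_ennreal[symmetric]) auto
  have w1: "AE t in \<mu>. t \<in> D \<longrightarrow> 0 < u1 t \<and> u1 t < \<infinity>" and w2: "AE t in \<mu>. t \<in> D' \<longrightarrow> 0 < u2 t \<and> u2 t < \<infinity>"
    using w by (auto simp: weight_on_def)
  interpret weighted_sum \<mu> D \<kappa>1 \<kappa>2
  proof
    show "\<kappa>1 \<in> borel_measurable \<mu>" "\<kappa>2 \<in> borel_measurable \<mu>" unfolding \<kappa>1_def \<kappa>2_def by measurable
    show "AE t in \<mu>. t \<in> D \<longrightarrow> 0 < \<kappa>1 t" using w1
      by eventually_elim (auto simp: \<kappa>1_def enn2real_positive_iff)
    show "AE t in \<mu>. t \<notin> D \<longrightarrow> 0 < \<kappa>2 t" using w2 AE_space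
      by eventually_elim (auto simp: \<kappa>2_def enn2real_positive_iff D'_def)
  qed (auto simp: na \<kappa>1_def \<kappa>2_def D'_def)
  have n1: "norm_1 \<mu> D u1 (\<lambda>t. ereal (x t)) = (\<integral>\<^sup>+t. ennreal \<bar>x t * \<kappa>1 t\<bar> \<partial>\<mu>)" if [measurable]: "x \<in> borel_measurable \<mu>" for x
    unfolding norm_1_def
  proof (rule nn_integral_cong_AE)
    show "AE t in \<mu>. e2ennreal \<bar>ereal (x t)\<bar> * u1 t * indicator D t = ennreal \<bar>x t * \<kappa>1 t\<bar>" using w1
    proof eventually_elim
      case (elim t)
      show ?case
      proof (cases "t \<in> D")
        case True
        then have "u1 t = ennreal (\<kappa>1 t)" "0 \<le> \<kappa>1 t" using elim by (auto simp: \<kappa>1_def)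
        then show ?thesis using True by (simp add: abs_mult ennreal_mult)
      qed (simp add: \<kappa>1_def)
    qed
  qed
  have n2: "norm_inf \<mu> D' u2 (\<lambda>t. ereal (x t)) = esssup \<mu> (\<lambda>t. ennreal \<bar>x t * \<kappa>2 t\<bar>)" if [measurable]: "x \<in> borel_measurable \<mu>" for x
  proof -
    have "AE t in \<mu>. (t \<in> D' \<longrightarrow> e2ennreal \<bar>ereal (x t)\<bar> * u2 t \<le> c) = (ennreal \<bar>x t * \<kappa>2 t\<bar> \<le> c)" for c using w2
    proof eventually_elim
      case (elim t)
      show ?case
      proof (cases "t \<in> D'")
        case True
        then have "u2 t = ennreal (\<kappa>2 t)" "0 \<le> \<kappa>2 t" using elim by (auto simp: \<kappa>2_def)
        then show ?thesis using True by (simp add: abs_mult ennreal_mult)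
      qed (simp add: \<kappa>2_def)
    qed
    then have "(AE t in \<mu>. t \<in> D' \<longrightarrow> e2ennreal \<bar>ereal (x t)\<bar> * u2 t \<le> c) \<longleftrightarrow> (AE t in \<mu>. ennreal \<bar>x t * \<kappa>2 t\<bar> \<le> c)" for c
      by (rule eventually_subst)
    then have "norm_inf \<mu> D' u2 (\<lambda>t. ereal (x t)) \<le> c \<longleftrightarrow> esssup \<mu> (\<lambda>t. ennreal \<bar>x t * \<kappa>2 t\<bar>) \<le> c" for c
      using weight_on_measurable[OF w(2)] by (simp add: norm_inf_le_iff esssup_le_iff)
    then show ?thesis by (meson antisym order_refl)
  qed
  have SY: "(\<lambda>t. ereal (x t)) \<in> S \<longleftrightarrow> x \<in> Y" if x[measurable]: "x \<in> borel_measurable \<mu>" for x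
  proof -
    have "norm_1 \<mu> D u1 (\<lambda>t. ereal (x t)) < \<infinity> \<longleftrightarrow> integrable \<mu> (\<lambda>t. x t * \<kappa>1 t)"
      unfolding n1[OF x] by (simp add: integrable_iff_bounded)
    moreover have "norm_inf \<mu> D' u2 (\<lambda>t. ereal (x t)) < \<infinity> \<longleftrightarrow> (\<exists>c. AE t in \<mu>. \<bar>x t * \<kappa>2 t\<bar> \<le> c)"
    proof
      assume "norm_inf \<mu> D' u2 (\<lambda>t. ereal (x t)) < \<infinity>"
      then obtain c where c: "esssup \<mu> (\<lambda>t. ennreal \<bar>x t * \<kappa>2 t\<bar>) = ennreal c" "0 \<le> c"
        unfolding n2[OF x] by (cases "esssup \<mu> (\<lambda>t. ennreal \<bar>x t * \<kappa>2 t\<bar>)") auto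
      have "AE t in \<mu>. \<bar>x t * \<kappa>2 t\<bar> \<le> c" using esssup_AE[of "\<lambda>t. ennreal \<bar>x t * \<kappa>2 t\<bar>" \<mu>] unfolding c(1)
        by eventually_elim (use c(2) in simp)
      then show "\<exists>c. AE t in \<mu>. \<bar>x t * \<kappa>2 t\<bar> \<le> c" by blast
    next
      assume "\<exists>c. AE t in \<mu>. \<bar>x t * \<kappa>2 t\<bar> \<le> c"
      then obtain c where "AE t in \<mu>. \<bar>x t * \<kappa>2 t\<bar> \<le> c" by blast
      then have "AE t in \<mu>. ennreal \<bar>x t * \<kappa>2 t\<bar> \<le> ennreal c" by eventually_elim (rule ennreal_leI)
      then have "esssup \<mu> (\<lambda>t. ennreal \<bar>x t * \<kappa>2 t\<bar>) \<le> ennreal c" by (intro esssup_I) auto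
      then show "norm_inf \<mu> D' u2 (\<lambda>t. ereal (x t)) < \<infinity>" unfolding n2[OF x] by (rule order_le_less_trans) simp
    qed
    ultimately show ?thesis unfolding S Y_def by simp
  qed
  have cs: "class_space \<mu> S n"
  proof
    show "x \<in> borel_measurable \<mu>" if "x \<in> S" for x using that by (simp add: S)
    show "y \<in> S" if x: "x \<in> S" and y: "y \<in> borel_measurable \<mu>" and eq: "AE t in \<mu>. x t = y t" for x y
    proof -
      have eq': "AE t in \<mu>. t \<in> \<Gamma> \<longrightarrow> x t = y t" for \<Gamma> using eq by eventually_elim simp
      have xm: "x \<in> borel_measurable \<mu>" using x by (simp add: S)
      have "norm_1 \<mu> D u1 x = norm_1 \<mu> D u1 y" by (rule norm_1_cong[OF eq'])
      moreover have "norm_inf \<mu> D' u2 x = norm_inf \<mu> D' u2 y"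
        by (rule norm_inf_cong[OF xm y D' weight_on_measurable[OF w(2)] eq'])
      ultimately show ?thesis using x y by (simp add: S)
    qed
    show "AE t in \<mu>. \<bar>x t\<bar> \<noteq> \<infinity>" if x: "x \<in> S" for x
    proof -
      have xm[measurable]: "x \<in> borel_measurable \<mu>" using x by (simp add: S)
      have "norm_1 \<mu> D u1 x < \<infinity>" using x by (simp add: S)
      then have "(\<integral>\<^sup>+t. e2ennreal \<bar>x t\<bar> * (u1 t * indicator D t) \<partial>\<mu>) \<noteq> \<infinity>" by (simp add: norm_1_def mult.assoc)
      then have a1: "AE t in \<mu>. e2ennreal \<bar>x t\<bar> * (u1 t * indicator D t) \<noteq> \<infinity>" by (intro nn_integral_PInf_AE) auto
      have a2: "AE t in \<mu>. t \<in> D' \<longrightarrow> e2ennreal \<bar>x t\<bar> * u2 t \<le> norm_inf \<mu> D' u2 x"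
        using norm_inf_le_iff[OF xm D' weight_on_measurable[OF w(2)], of "norm_inf \<mu> D' u2 x"] by simp
      have fin: "norm_inf \<mu> D' u2 x < \<infinity>" using x by (simp add: S)
      have f1: "AE t in \<mu>. t \<in> D \<longrightarrow> e2ennreal \<bar>x t\<bar> * u1 t < \<infinity>" using a1 by eventually_elim (auto simp: less_top)
      have f2: "AE t in \<mu>. t \<in> space \<mu> - D \<longrightarrow> e2ennreal \<bar>x t\<bar> * u2 t < \<infinity>"
        using a2 fin unfolding D'_def by (auto elim!: eventually_mono intro: order_le_less_trans)
      show ?thesis by (rule finite_of_norms[OF w(1) w(2)[unfolded D'_def] f1 f2])
    qed
  qed (rule inv)
  then have RY: "class_space.R \<mu> S = Y"
    using class_space.R_def[OF cs] SY by (auto simp: Y_def)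
  show ?thesis
  proof (rule daugavet_weighted_sum[OF cs RY p])
    fix x assume x: "x \<in> Y"
    note xm = Y_measurable[OF x]
    have "enn2real (norm_1 \<mu> D u1 (\<lambda>t. ereal (x t))) = int_norm x"
      unfolding n1[OF xm] int_norm_def by (rule integral_eq_nn_integral[symmetric]) (use xm in auto)
    moreover have "enn2real (norm_inf \<mu> D' u2 (\<lambda>t. ereal (x t))) = sup_norm x" unfolding n2[OF xm] sup_norm_def ..
    ultimately show "n (\<lambda>t. ereal (x t)) = p (int_norm x) (sup_norm x)" using n SY[OF xm] x by simp
  qed
qed

section \<open>The Luxemburg and the Orlicz norm\<close>

lemma ereal_divide_eq_mult: "0 < c \<Longrightarrow> x / ereal c = ereal (1 / c) * x"
  by (cases x) auto

lemma ennreal_inverse_inverse: "1 / (1 / x) = x" for x :: ennreal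
proof (cases x)
  case (real r)
  then show ?thesis
    by (cases "r = 0") (auto simp: divide_ennreal ennreal_1[symmetric] simp del: ennreal_1)
qed simp

lemma modular_cong:
  assumes "AE t in \<mu>. x t = y t" shows "modular \<mu> \<Phi> x = modular \<mu> \<Phi> y"
  unfolding modular_def by (rule nn_integral_cong_AE) (use assms in eventually_elim, simp)

lemma modular_finite_AE:
  assumes meas: "\<And>r. r \<in> borel_measurable \<mu> \<Longrightarrow> (\<lambda>t. \<Phi> t \<bar>r t :: real\<bar>) \<in> borel_measurable \<mu>"
    and [measurable]: "x \<in> borel_measurable \<mu>" and fin: "modular \<mu> \<Phi> x < \<infinity>"
  shows "AE t in \<mu>. \<bar>x t\<bar> \<noteq> \<infinity>"
proof -
  have [measurable]: "(\<lambda>t. \<Phi> t \<bar>real_of_ereal (x t)\<bar>) \<in> borel_measurable \<mu>" by (rule meas) measurable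
  have eq: "modular \<mu> \<Phi> x = (\<integral>\<^sup>+t. (if \<bar>x t\<bar> = \<infinity> then \<infinity> else \<Phi> t \<bar>real_of_ereal (x t)\<bar>) \<partial>\<mu>)"
    unfolding modular_def by (rule nn_integral_cong) (auto simp: abs_real_of_ereal)
  have "AE t in \<mu>. (if \<bar>x t\<bar> = \<infinity> then \<infinity> else \<Phi> t \<bar>real_of_ereal (x t)\<bar>) \<noteq> \<infinity>"
    using fin unfolding eq by (intro nn_integral_PInf_AE) auto
  then show ?thesis by eventually_elim auto
qed

lemma real_representative:
  assumes "AE t in \<mu>. \<bar>x t\<bar> \<noteq> \<infinity>" shows "AE t in \<mu>. x t = ereal (real_of_ereal (x t))"
  using assms by eventually_elim (simp add: ereal_real)

lemma Inf_positive_above: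
  fixes m :: real assumes "0 \<le> m" shows "Inf {c. 0 < c \<and> m \<le> c} = m"
proof (rule antisym)
  show "m \<le> Inf {c. 0 < c \<and> m \<le> c}" by (rule cInf_greatest) (use assms in \<open>auto intro: exI[of _ "m + 1"]\<close>)
  show "Inf {c. 0 < c \<and> m \<le> c} \<le> m"
  proof (rule field_le_epsilon)
    fix e :: real assume "0 < e"
    then show "Inf {c. 0 < c \<and> m \<le> c} \<le> m + e"
      using assms by (intro cInf_lower bdd_belowI[of _ 0]) auto
  qed
qed

context musielak_orlicz_space
begin

lemma M_superposition: "r \<in> borel_measurable \<mu> \<Longrightarrow> (\<lambda>t. M t \<bar>r t :: real\<bar>) \<in> borel_measurable \<mu>"
  by (rule measurable_superposition)

lemma luxemburg_invariant:
  assumes "AE t in \<mu>. x t = y t" shows "luxemburg_norm \<mu> M x = luxemburg_norm \<mu> M y"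
proof -
  have "modular \<mu> M (\<lambda>t. x t / ereal c) = modular \<mu> M (\<lambda>t. y t / ereal c)" for c
    by (rule modular_cong) (use assms in eventually_elim, simp)
  then show ?thesis by (simp add: luxemburg_norm_def)
qed

lemma orlicz_invariant:
  assumes "AE t in \<mu>. x t = y t" shows "orlicz_norm \<mu> M x = orlicz_norm \<mu> M y"
proof -
  have "(\<integral>\<^sup>+ t. e2ennreal \<bar>x t * z t\<bar> \<partial>\<mu>) = (\<integral>\<^sup>+ t. e2ennreal \<bar>y t * z t\<bar> \<partial>\<mu>)" for z
    by (rule nn_integral_cong_AE) (use assms in eventually_elim, simp)
  then show ?thesis by (simp add: orlicz_norm_def)
qed

lemma closed_mo_functions: "closed_functions \<mu> (mo_functions \<mu> \<Phi>)"
  unfolding closed_functions_def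
proof (intro conjI subsetI ballI impI)
  fix x y assume x: "x \<in> mo_functions \<mu> \<Phi>" and y: "y \<in> borel_measurable \<mu>" and eq: "AE t in \<mu>. x t = y t"
  have "modular \<mu> \<Phi> (\<lambda>t. ereal c * y t) = modular \<mu> \<Phi> (\<lambda>t. ereal c * x t)" for c
    by (rule modular_cong) (use eq in eventually_elim, simp)
  then show "y \<in> mo_functions \<mu> \<Phi>" using x y by (simp add: mo_functions_def)
qed (simp add: mo_functions_def)

lemma mo_functions_finite:
  assumes meas: "\<And>r. r \<in> borel_measurable \<mu> \<Longrightarrow> (\<lambda>t. \<Phi> t \<bar>r t :: real\<bar>) \<in> borel_measurable \<mu>"
    and x: "x \<in> mo_functions \<mu> \<Phi>"
  shows "AE t in \<mu>. \<bar>x t\<bar> \<noteq> \<infinity>"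
proof -
  obtain c where c: "0 < c" "modular \<mu> \<Phi> (\<lambda>t. ereal c * x t) < \<infinity>" and xm: "x \<in> borel_measurable \<mu>"
    using x by (auto simp: mo_functions_def)
  have cx: "(\<lambda>t. ereal c * x t) \<in> borel_measurable \<mu>" using xm by (intro borel_measurable_ereal_times) auto
  have "AE t in \<mu>. \<bar>ereal c * x t\<bar> \<noteq> \<infinity>" by (rule modular_finite_AE[where \<Phi>=\<Phi>, OF meas cx c(2)])
  then show ?thesis
  proof eventually_elim
    case (elim t)
    show ?case using elim c(1) by (cases "x t") auto
  qed
qed

lemma modular_divide_real:
  assumes eq: "AE t in \<mu>. x t = ereal (r t)" and c: "0 < c"
  shows "modular \<mu> M (\<lambda>t. x t / ereal c) = rho (\<lambda>t. r t / c)"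
proof -
  have "modular \<mu> M (\<lambda>t. x t / ereal c) = modular \<mu> M (\<lambda>t. ereal (r t / c))"
    by (rule modular_cong, rule eventually_mono[OF eq]) (use c in simp)
  then show ?thesis by (simp only: modular_eq_rho)
qed

lemma mo_functions_iff:
  "x \<in> mo_functions \<mu> M \<longleftrightarrow> x \<in> borel_measurable \<mu> \<and> (\<exists>c>0. modular \<mu> M (\<lambda>t. x t / ereal c) \<le> 1)"
proof (intro iffI conjI)
  assume x: "x \<in> mo_functions \<mu> M"
  then show xm[measurable]: "x \<in> borel_measurable \<mu>" by (simp add: mo_functions_def)
  obtain c where c: "0 < c" "modular \<mu> M (\<lambda>t. ereal c * x t) < \<infinity>" using x by (auto simp: mo_functions_def)
  define r where "r t = real_of_ereal (x t)" for t
  have [measurable]: "r \<in> borel_measurable \<mu>" unfolding r_def by measurable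
  have eq: "AE t in \<mu>. x t = ereal (r t)" unfolding r_def
    by (rule real_representative[OF mo_functions_finite[OF M_superposition x]])
  have "(\<lambda>t. x t / ereal (1 / c)) = (\<lambda>t. ereal c * x t)" using c(1) by (simp add: ereal_divide_eq_mult fun_eq_iff)
  then have "rho (\<lambda>t. c * r t) < \<infinity>" using modular_divide_real[OF eq, of "1 / c"] c by (simp add: mult.commute)
  then obtain K where K: "rho (\<lambda>t. c * r t) = ennreal K" "0 \<le> K" by (cases "rho (\<lambda>t. c * r t)") auto
  define s where "s = 1 / (K + 1)"
  have s: "0 < s" "s \<le> 1" "s * K \<le> 1" using K(2) by (auto simp: s_def)
  have "rho (\<lambda>t. s * (c * r t)) \<le> ennreal s * rho (\<lambda>t. c * r t)" by (rule rho_scale) (use s in auto)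
  also have "\<dots> = ennreal (s * K)" using K s by (simp add: ennreal_mult)
  also have "\<dots> \<le> ennreal 1" by (rule ennreal_leI[OF s(3)])
  finally have "rho (\<lambda>t. s * (c * r t)) \<le> 1" by simp
  moreover have "modular \<mu> M (\<lambda>t. x t / ereal (1 / (s * c))) = rho (\<lambda>t. r t / (1 / (s * c)))"
    by (rule modular_divide_real[OF eq]) (use s c in simp)
  moreover have "(\<lambda>t. r t / (1 / (s * c))) = (\<lambda>t. s * (c * r t))" by (simp add: fun_eq_iff)
  ultimately show "\<exists>c>0. modular \<mu> M (\<lambda>t. x t / ereal c) \<le> 1" using s c by (intro exI[of _ "1 / (s * c)"]) auto
next
  assume H: "x \<in> borel_measurable \<mu> \<and> (\<exists>c>0. modular \<mu> M (\<lambda>t. x t / ereal c) \<le> 1)"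
  then obtain c where c: "0 < c" "modular \<mu> M (\<lambda>t. x t / ereal c) \<le> 1" by blast
  have "modular \<mu> M (\<lambda>t. ereal (1 / c) * x t) < \<infinity>"
    using c by (simp add: ereal_divide_eq_mult order_le_less_trans[OF _ ennreal_one_less_top])
  then show "x \<in> mo_functions \<mu> M" using H c(1) by (auto simp: mo_functions_def intro!: exI[of _ "1 / c"])
qed

text \<open>The unit ball of the modular is the product of a weighted \<open>L\<^sub>\<infinity>\<close> ball on \<open>D\<close> and a weighted
  \<open>L\<^sub>1\<close> ball off \<open>D\<close>.\<close>

definition split_ball :: "'a set \<Rightarrow> bool" where
  "split_ball D \<longleftrightarrow> D \<in> sets \<mu> \<and> (AE t in \<mu>. t \<in> D \<longrightarrow> 0 < bound t \<and> bound t < \<infinity>) \<and>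
     (AE t in \<mu>. t \<in> space \<mu> - D \<longrightarrow> 0 < slope t \<and> slope t < \<infinity>) \<and>
     (\<forall>r\<in>borel_measurable \<mu>. rho r \<le> 1 \<longleftrightarrow>
       (AE t in \<mu>. t \<in> D \<longrightarrow> ennreal \<bar>r t\<bar> \<le> bound t) \<and>
       (\<integral>\<^sup>+t\<in>space \<mu> - D. ennreal \<bar>r t\<bar> * slope t \<partial>\<mu>) \<le> 1)"

lemma split_ball_iff:
  assumes "split_ball D" "r \<in> borel_measurable \<mu>"
  shows "rho r \<le> 1 \<longleftrightarrow> (AE t in \<mu>. t \<in> D \<longrightarrow> ennreal \<bar>r t\<bar> \<le> bound t) \<and>
    (\<integral>\<^sup>+t\<in>space \<mu> - D. ennreal \<bar>r t\<bar> * slope t \<partial>\<mu>) \<le> 1"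
proof -
  have "\<forall>r\<in>borel_measurable \<mu>. rho r \<le> 1 \<longleftrightarrow> (AE t in \<mu>. t \<in> D \<longrightarrow> ennreal \<bar>r t\<bar> \<le> bound t) \<and>
    (\<integral>\<^sup>+t\<in>space \<mu> - D. ennreal \<bar>r t\<bar> * slope t \<partial>\<mu>) \<le> 1"
    using assms(1) unfolding split_ball_def by (elim conjE)
  then show ?thesis by (rule bspec[OF _ assms(2)])
qed

lemma weight_bound: "split_ball D \<Longrightarrow> weight_on \<mu> D bound"
  unfolding split_ball_def weight_on_def by (auto intro: measurable_restrict_space1)

lemma weight_slope: "split_ball D \<Longrightarrow> weight_on \<mu> (space \<mu> - D) slope"
  unfolding split_ball_def weight_on_def by (auto intro: measurable_restrict_space1)

lemma weight_on_inverse: assumes "weight_on \<mu> \<Gamma> u" shows "weight_on \<mu> \<Gamma> (\<lambda>t. 1 / u t)"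
proof -
  have "AE t in \<mu>. t \<in> \<Gamma> \<longrightarrow> 0 < u t \<and> u t < \<infinity>" using assms by (simp add: weight_on_def)
  then have "AE t in \<mu>. t \<in> \<Gamma> \<longrightarrow> 0 < 1 / u t \<and> 1 / u t < \<infinity>"
  proof eventually_elim
    case (elim t)
    show ?case
    proof
      assume "t \<in> \<Gamma>"
      then obtain r where "u t = ennreal r" "0 < r" using elim by (cases "u t") auto
      then show "0 < 1 / u t \<and> 1 / u t < \<infinity>" by (simp add: divide_ennreal ennreal_1[symmetric] del: ennreal_1)
    qed
  qed
  moreover have "(\<lambda>t. 1 / u t) \<in> borel_measurable (restrict_space \<mu> \<Gamma>)"
    using weight_on_measurable[OF assms] by measurable
  ultimately show ?thesis by (simp add: weight_on_def)
qed

lemma norm_1_finite_AE: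
  assumes [measurable]: "x \<in> borel_measurable \<mu>" and \<Gamma>: "\<Gamma> \<in> sets \<mu>" and u: "u \<in> borel_measurable \<mu>" and fin: "norm_1 \<mu> \<Gamma> u x < \<infinity>"
  shows "AE t in \<mu>. t \<in> \<Gamma> \<longrightarrow> e2ennreal \<bar>x t\<bar> * u t < \<infinity>"
proof -
  note [measurable] = u \<Gamma>
  have "AE t in \<mu>. e2ennreal \<bar>x t\<bar> * u t * indicator \<Gamma> t \<noteq> \<infinity>"
    using fin unfolding norm_1_def by (intro nn_integral_PInf_AE) auto
  then show ?thesis by eventually_elim (auto simp: less_top)
qed

lemma luxemburg_ball_iff:
  assumes ball: "split_ball D" and x[measurable]: "x \<in> borel_measurable \<mu>" and c: "0 < c"
  shows "modular \<mu> M (\<lambda>t. x t / ereal c) \<le> 1 \<longleftrightarrow>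
    norm_inf \<mu> D (\<lambda>t. 1 / bound t) x \<le> ennreal c \<and> norm_1 \<mu> (space \<mu> - D) slope x \<le> ennreal c"
proof -
  have D[measurable]: "D \<in> sets \<mu>" and b: "AE t in \<mu>. t \<in> D \<longrightarrow> 0 < bound t \<and> bound t < \<infinity>"
    using ball by (auto simp: split_ball_def)
  have v: "(\<lambda>t. 1 / bound t) \<in> borel_measurable (restrict_space \<mu> D)"
    by (rule measurable_restrict_space1) measurable
  note inf_iff = norm_inf_le_iff[OF x D v]
  have *: "modular \<mu> M (\<lambda>t. x t / ereal c) \<le> 1 \<longleftrightarrow>
    norm_inf \<mu> D (\<lambda>t. 1 / bound t) x \<le> ennreal c \<and> norm_1 \<mu> (space \<mu> - D) slope x \<le> ennreal c"
    if fin: "AE t in \<mu>. \<bar>x t\<bar> \<noteq> \<infinity>"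
  proof -
    define r where "r t = real_of_ereal (x t)" for t
    have [measurable]: "r \<in> borel_measurable \<mu>" unfolding r_def by measurable
    have eq: "AE t in \<mu>. x t = ereal (r t)" unfolding r_def by (rule real_representative[OF fin])
    have e2: "AE t in \<mu>. e2ennreal \<bar>x t\<bar> = ennreal \<bar>r t\<bar>" using eq by eventually_elim simp
    have "AE t in \<mu>. (t \<in> D \<longrightarrow> ennreal \<bar>r t / c\<bar> \<le> bound t) = (t \<in> D \<longrightarrow> e2ennreal \<bar>x t\<bar> * (1 / bound t) \<le> ennreal c)"
      using e2 b
    proof eventually_elim
      case (elim t)
      show ?case
      proof (cases "t \<in> D")
        case True
        then obtain B where B: "bound t = ennreal B" "0 < B" using elim by (cases "bound t") auto
        have "ennreal \<bar>r t\<bar> * (1 / ennreal B) = ennreal (\<bar>r t\<bar> / B)"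
          using B(2) by (simp add: divide_ennreal ennreal_mult[symmetric] ennreal_1[symmetric] del: ennreal_1)
        moreover have "\<bar>r t\<bar> / B \<le> c \<longleftrightarrow> \<bar>r t / c\<bar> \<le> B" using B(2) c by (simp add: field_simps abs_divide)
        ultimately show ?thesis using True B c elim by (simp add: ennreal_le_iff)
      qed simp
    qed
    then have 1: "(AE t in \<mu>. t \<in> D \<longrightarrow> ennreal \<bar>r t / c\<bar> \<le> bound t) \<longleftrightarrow> norm_inf \<mu> D (\<lambda>t. 1 / bound t) x \<le> ennreal c"
      unfolding inf_iff by (rule eventually_subst)
    have n1: "norm_1 \<mu> (space \<mu> - D) slope x = (\<integral>\<^sup>+t. ennreal \<bar>r t\<bar> * slope t * indicator (space \<mu> - D) t \<partial>\<mu>)"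
      unfolding norm_1_def by (rule nn_integral_cong_AE) (use e2 in eventually_elim, simp)
    have "(\<integral>\<^sup>+t\<in>space \<mu> - D. ennreal \<bar>r t / c\<bar> * slope t \<partial>\<mu>)
      = (\<integral>\<^sup>+t. ennreal (1 / c) * (ennreal \<bar>r t\<bar> * slope t * indicator (space \<mu> - D) t) \<partial>\<mu>)"
    proof (rule nn_integral_cong)
      fix t
      have "ennreal \<bar>r t / c\<bar> = ennreal (1 / c) * ennreal \<bar>r t\<bar>" using c by (simp add: abs_divide ennreal_mult[symmetric])
      then show "ennreal \<bar>r t / c\<bar> * slope t * indicator (space \<mu> - D) t = ennreal (1 / c) * (ennreal \<bar>r t\<bar> * slope t * indicator (space \<mu> - D) t)"
        by (simp add: mult.assoc)
    qed
    also have "\<dots> = ennreal (1 / c) * norm_1 \<mu> (space \<mu> - D) slope x" unfolding n1 by (rule nn_integral_cmult) measurable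
    finally have n2: "(\<integral>\<^sup>+t\<in>space \<mu> - D. ennreal \<bar>r t / c\<bar> * slope t \<partial>\<mu>) = ennreal (1 / c) * norm_1 \<mu> (space \<mu> - D) slope x" .
    have "ennreal (1 / c) * Q \<le> 1 \<longleftrightarrow> Q \<le> ennreal c" for Q
    proof
      assume "ennreal (1 / c) * Q \<le> 1"
      then have "ennreal c * (ennreal (1 / c) * Q) \<le> ennreal c * 1" by (rule mult_left_mono) simp
      then show "Q \<le> ennreal c" using c by (simp add: mult.assoc[symmetric] ennreal_mult[symmetric])
    next
      assume "Q \<le> ennreal c"
      then have "ennreal (1 / c) * Q \<le> ennreal (1 / c) * ennreal c" by (rule mult_left_mono) simp
      then show "ennreal (1 / c) * Q \<le> 1" using c by (simp add: ennreal_mult[symmetric])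
    qed
    then have 2: "(\<integral>\<^sup>+t\<in>space \<mu> - D. ennreal \<bar>r t / c\<bar> * slope t \<partial>\<mu>) \<le> 1 \<longleftrightarrow> norm_1 \<mu> (space \<mu> - D) slope x \<le> ennreal c"
      unfolding n2 .
    have rc: "(\<lambda>t. r t / c) \<in> borel_measurable \<mu>" by measurable
    have "rho (\<lambda>t. r t / c) \<le> 1 \<longleftrightarrow> (AE t in \<mu>. t \<in> D \<longrightarrow> ennreal \<bar>r t / c\<bar> \<le> bound t) \<and>
       (\<integral>\<^sup>+t\<in>space \<mu> - D. ennreal \<bar>r t / c\<bar> * slope t \<partial>\<mu>) \<le> 1"
      by (rule split_ball_iff[OF ball rc])
    then show ?thesis unfolding modular_divide_real[OF eq c] 1 2 .
  qed
  show ?thesis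
  proof
    assume le: "modular \<mu> M (\<lambda>t. x t / ereal c) \<le> 1"
    then have "x \<in> mo_functions \<mu> M" unfolding mo_functions_iff using x c by blast
    from mo_functions_finite[OF M_superposition this] have "AE t in \<mu>. \<bar>x t\<bar> \<noteq> \<infinity>" .
    from *[OF this] le show "norm_inf \<mu> D (\<lambda>t. 1 / bound t) x \<le> ennreal c \<and> norm_1 \<mu> (space \<mu> - D) slope x \<le> ennreal c" by blast
  next
    assume le: "norm_inf \<mu> D (\<lambda>t. 1 / bound t) x \<le> ennreal c \<and> norm_1 \<mu> (space \<mu> - D) slope x \<le> ennreal c"
    have f1: "AE t in \<mu>. t \<in> D \<longrightarrow> e2ennreal \<bar>x t\<bar> * (1 / bound t) < \<infinity>"
      using le[THEN conjunct1] unfolding inf_iff by (rule eventually_mono) (auto intro: order_le_less_trans)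
    have "norm_1 \<mu> (space \<mu> - D) slope x < \<infinity>" by (rule order_le_less_trans[OF le[THEN conjunct2]]) simp
    then have f2: "AE t in \<mu>. t \<in> space \<mu> - D \<longrightarrow> e2ennreal \<bar>x t\<bar> * slope t < \<infinity>" by (intro norm_1_finite_AE) auto
    have "AE t in \<mu>. \<bar>x t\<bar> \<noteq> \<infinity>"
      by (rule finite_of_norms[OF weight_on_inverse[OF weight_bound[OF ball]] weight_slope[OF ball] f1 f2])
    from *[OF this] le show "modular \<mu> M (\<lambda>t. x t / ereal c) \<le> 1" by blast
  qed
qed

text \<open>The Luxemburg norm is the gauge of the modular unit ball.\<close>

lemma luxemburg_weighted_sum:
  assumes ball: "split_ball D"
  shows "is_weighted_sum \<mu> max (space \<mu> - D) slope (\<lambda>t. 1 / bound t) (mo_functions \<mu> M) (luxemburg_norm \<mu> M)"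
proof -
  have D: "D \<in> sets \<mu>" using ball by (simp add: split_ball_def)
  have DD: "space \<mu> - (space \<mu> - D) = D" using sets.sets_into_space[OF D] by blast
  let ?P = "norm_inf \<mu> D (\<lambda>t. 1 / bound t)" and ?Q = "norm_1 \<mu> (space \<mu> - D) slope"
  have S: "x \<in> mo_functions \<mu> M \<longleftrightarrow> x \<in> borel_measurable \<mu> \<and> ?Q x < \<infinity> \<and> ?P x < \<infinity>" for x
  proof (cases "x \<in> borel_measurable \<mu>")
    case x: True
    have "(\<exists>c>0. modular \<mu> M (\<lambda>t. x t / ereal c) \<le> 1) \<longleftrightarrow> (\<exists>c>0. ?P x \<le> ennreal c \<and> ?Q x \<le> ennreal c)"
      using luxemburg_ball_iff[OF ball x] by blast
    also have "\<dots> \<longleftrightarrow> ?Q x < \<infinity> \<and> ?P x < \<infinity>"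
    proof
      assume "\<exists>c>0. ?P x \<le> ennreal c \<and> ?Q x \<le> ennreal c"
      then show "?Q x < \<infinity> \<and> ?P x < \<infinity>" by (auto intro: order_le_less_trans)
    next
      assume fin: "?Q x < \<infinity> \<and> ?P x < \<infinity>"
      then obtain p q where pq: "?P x = ennreal p" "0 \<le> p" "?Q x = ennreal q" "0 \<le> q" by (cases "?P x"; cases "?Q x") auto
      show "\<exists>c>0. ?P x \<le> ennreal c \<and> ?Q x \<le> ennreal c"
        unfolding pq(1,3) by (rule exI[of _ "p + q + 1"]) (use pq(2,4) in \<open>auto intro: ennreal_leI simp del: ennreal_plus\<close>)
    qed
    finally show ?thesis unfolding mo_functions_iff using x by blast
  qed (simp add: mo_functions_def)
  have n: "luxemburg_norm \<mu> M x = max (enn2real (?Q x)) (enn2real (?P x))" if xS: "x \<in> mo_functions \<mu> M" for x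
  proof -
    have x: "x \<in> borel_measurable \<mu>" and fin: "?Q x < \<infinity>" "?P x < \<infinity>" using xS unfolding S by auto
    obtain p q where pq: "?P x = ennreal p" "0 \<le> p" "?Q x = ennreal q" "0 \<le> q" using fin by (cases "?P x"; cases "?Q x") auto
    have "{c. 0 < c \<and> modular \<mu> M (\<lambda>t. x t / ereal c) \<le> 1} = {c. 0 < c \<and> max q p \<le> c}"
      using luxemburg_ball_iff[OF ball x] unfolding pq(1,3) by (auto simp: ennreal_le_iff)
    then have "luxemburg_norm \<mu> M x = Inf {c. 0 < c \<and> max q p \<le> c}" by (simp only: luxemburg_norm_def)
    also have "\<dots> = max q p" by (rule Inf_positive_above) (use pq in auto)
    finally have "luxemburg_norm \<mu> M x = max q p" .
    then show ?thesis using pq by simp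
  qed
  show ?thesis
    unfolding is_weighted_sum_def DD
    using weight_slope[OF ball] weight_on_inverse[OF weight_bound[OF ball]] S n by auto
qed

text \<open>The Orlicz norm before the conversion to a real number, which would turn \<open>\<infinity>\<close> into \<open>0\<close>.\<close>

definition orlicz_sup :: "('a \<Rightarrow> ereal) \<Rightarrow> ennreal" where
  "orlicz_sup x = (SUP y\<in>{y \<in> borel_measurable \<mu>. modular \<mu> M y \<le> 1}. \<integral>\<^sup>+ t. e2ennreal \<bar>x t * y t\<bar> \<partial>\<mu>)"

lemma e2ennreal_abs_mult: "e2ennreal \<bar>x * ereal r\<bar> = e2ennreal \<bar>x\<bar> * ennreal \<bar>r\<bar>"
  by (cases x) (auto simp: abs_mult ennreal_mult ennreal_top_mult e2ennreal_neg)

lemma orlicz_sup_real: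
  "orlicz_sup x = (SUP r\<in>{r \<in> borel_measurable \<mu>. rho r \<le> 1}. \<integral>\<^sup>+ t. e2ennreal \<bar>x t\<bar> * ennreal \<bar>r t\<bar> \<partial>\<mu>)"
  unfolding orlicz_sup_def
proof (rule antisym)
  show "(SUP y\<in>{y \<in> borel_measurable \<mu>. modular \<mu> M y \<le> 1}. \<integral>\<^sup>+ t. e2ennreal \<bar>x t * y t\<bar> \<partial>\<mu>) \<le>
    (SUP r\<in>{r \<in> borel_measurable \<mu>. rho r \<le> 1}. \<integral>\<^sup>+ t. e2ennreal \<bar>x t\<bar> * ennreal \<bar>r t\<bar> \<partial>\<mu>)"
  proof (rule SUP_least)
    fix y assume "y \<in> {y \<in> borel_measurable \<mu>. modular \<mu> M y \<le> 1}"
    then have y[measurable]: "y \<in> borel_measurable \<mu>" and le: "modular \<mu> M y \<le> 1" by auto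
    have "modular \<mu> M y < \<infinity>" by (rule order_le_less_trans[OF le]) simp
    then have eq: "AE t in \<mu>. y t = ereal (real_of_ereal (y t))"
      by (intro real_representative modular_finite_AE[where \<Phi>=M, OF M_superposition y])
    define r where "r t = real_of_ereal (y t)" for t
    have [measurable]: "r \<in> borel_measurable \<mu>" unfolding r_def by measurable
    have "rho r = modular \<mu> M (\<lambda>t. ereal (r t))" by (simp only: modular_eq_rho)
    also have "\<dots> = modular \<mu> M y" unfolding r_def by (rule modular_cong) (use eq in eventually_elim, simp)
    finally have "r \<in> {r \<in> borel_measurable \<mu>. rho r \<le> 1}" using le by simp
    moreover have "(\<integral>\<^sup>+ t. e2ennreal \<bar>x t * y t\<bar> \<partial>\<mu>) = (\<integral>\<^sup>+ t. e2ennreal \<bar>x t\<bar> * ennreal \<bar>r t\<bar> \<partial>\<mu>)"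
    proof (rule nn_integral_cong_AE)
      show "AE t in \<mu>. e2ennreal \<bar>x t * y t\<bar> = e2ennreal \<bar>x t\<bar> * ennreal \<bar>r t\<bar>" using eq
        by eventually_elim (metis e2ennreal_abs_mult r_def)
    qed
    ultimately show "(\<integral>\<^sup>+ t. e2ennreal \<bar>x t * y t\<bar> \<partial>\<mu>) \<le>
      (SUP r\<in>{r \<in> borel_measurable \<mu>. rho r \<le> 1}. \<integral>\<^sup>+ t. e2ennreal \<bar>x t\<bar> * ennreal \<bar>r t\<bar> \<partial>\<mu>)" by (metis (no_types, lifting) SUP_upper)
  qed
  show "(SUP r\<in>{r \<in> borel_measurable \<mu>. rho r \<le> 1}. \<integral>\<^sup>+ t. e2ennreal \<bar>x t\<bar> * ennreal \<bar>r t\<bar> \<partial>\<mu>)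
    \<le> (SUP y\<in>{y \<in> borel_measurable \<mu>. modular \<mu> M y \<le> 1}. \<integral>\<^sup>+ t. e2ennreal \<bar>x t * y t\<bar> \<partial>\<mu>)"
  proof (rule SUP_least)
    fix r :: "'a \<Rightarrow> real" assume "r \<in> {r \<in> borel_measurable \<mu>. rho r \<le> 1}"
    then have [measurable]: "r \<in> borel_measurable \<mu>" and le: "rho r \<le> 1" by auto
    have "(\<lambda>t. ereal (r t)) \<in> {y \<in> borel_measurable \<mu>. modular \<mu> M y \<le> 1}" using le by (simp add: modular_eq_rho)
    from SUP_upper[OF this, of "\<lambda>y. \<integral>\<^sup>+ t. e2ennreal \<bar>x t * y t\<bar> \<partial>\<mu>"]
    show "(\<integral>\<^sup>+ t. e2ennreal \<bar>x t\<bar> * ennreal \<bar>r t\<bar> \<partial>\<mu>) \<le>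
      (SUP y\<in>{y \<in> borel_measurable \<mu>. modular \<mu> M y \<le> 1}. \<integral>\<^sup>+ t. e2ennreal \<bar>x t * y t\<bar> \<partial>\<mu>)"
      by (simp only: e2ennreal_abs_mult)
  qed
qed

lemma orlicz_norm_eq: "orlicz_norm \<mu> M x = enn2real (orlicz_sup x)"
  by (simp add: orlicz_norm_def orlicz_sup_def)

lemma young_integral:
  fixes r s :: "'a \<Rightarrow> real"
  assumes [measurable]: "r \<in> borel_measurable \<mu>" "s \<in> borel_measurable \<mu>"
  shows "(\<integral>\<^sup>+t. ennreal \<bar>r t\<bar> * ennreal \<bar>s t\<bar> \<partial>\<mu>) \<le> rho s + (\<integral>\<^sup>+t. complementary M t \<bar>r t\<bar> \<partial>\<mu>)"
proof -
  note [measurable] = measurable_complementary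
  have "(\<integral>\<^sup>+t. ennreal \<bar>r t\<bar> * ennreal \<bar>s t\<bar> \<partial>\<mu>) \<le> (\<integral>\<^sup>+t. M t \<bar>s t\<bar> + complementary M t \<bar>r t\<bar> \<partial>\<mu>)"
  proof (rule nn_integral_mono)
    fix t
    show "ennreal \<bar>r t\<bar> * ennreal \<bar>s t\<bar> \<le> M t \<bar>s t\<bar> + complementary M t \<bar>r t\<bar>"
    proof (cases "s t = 0")
      case False
      then show ?thesis using young_inequality[of "\<bar>s t\<bar>" "\<bar>r t\<bar>" M t] by (simp add: ennreal_mult)
    qed simp
  qed
  also have "\<dots> = rho s + (\<integral>\<^sup>+t. complementary M t \<bar>r t\<bar> \<partial>\<mu>)"
    unfolding rho_def by (rule nn_integral_add) measurable
  finally show ?thesis .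
qed

lemma complementary_superposition: "r \<in> borel_measurable \<mu> \<Longrightarrow> (\<lambda>t. complementary M t \<bar>r t :: real\<bar>) \<in> borel_measurable \<mu>"
  by (rule measurable_complementary)

text \<open>By Young's inequality, \<open>c \<integral>\<bar>x s\<bar> \<le> rho s + \<integral>N(c \<bar>x\<bar>)\<close>.\<close>

lemma orlicz_sup_finite:
  assumes x: "x \<in> mo_functions \<mu> (complementary M)" shows "orlicz_sup x < \<infinity>"
proof -
  obtain c where c: "0 < c" "modular \<mu> (complementary M) (\<lambda>t. ereal c * x t) < \<infinity>" and [measurable]: "x \<in> borel_measurable \<mu>"
    using x by (auto simp: mo_functions_def)
  define r where "r t = real_of_ereal (x t)" for t
  have [measurable]: "r \<in> borel_measurable \<mu>" unfolding r_def by measurable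
  have eq: "AE t in \<mu>. x t = ereal (r t)" unfolding r_def
    by (rule real_representative[OF mo_functions_finite[OF complementary_superposition x]])
  have "modular \<mu> (complementary M) (\<lambda>t. ereal c * x t) = modular \<mu> (complementary M) (\<lambda>t. ereal (c * r t))"
    by (rule modular_cong) (use eq in eventually_elim, simp)
  also have "\<dots> = (\<integral>\<^sup>+t. complementary M t \<bar>c * r t\<bar> \<partial>\<mu>)" by (simp add: modular_def)
  finally have fin: "(\<integral>\<^sup>+t. complementary M t \<bar>c * r t\<bar> \<partial>\<mu>) < \<infinity>" using c by simp
  have "orlicz_sup x \<le> ennreal (1 / c) * (1 + (\<integral>\<^sup>+t. complementary M t \<bar>c * r t\<bar> \<partial>\<mu>))"
    unfolding orlicz_sup_real
  proof (rule SUP_least)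
    fix s :: "'a \<Rightarrow> real" assume "s \<in> {r \<in> borel_measurable \<mu>. rho r \<le> 1}"
    then have [measurable]: "s \<in> borel_measurable \<mu>" and le: "rho s \<le> 1" by auto
    have "(\<integral>\<^sup>+ t. e2ennreal \<bar>x t\<bar> * ennreal \<bar>s t\<bar> \<partial>\<mu>) = (\<integral>\<^sup>+ t. ennreal (1 / c) * (ennreal \<bar>c * r t\<bar> * ennreal \<bar>s t\<bar>) \<partial>\<mu>)"
    proof (rule nn_integral_cong_AE)
      show "AE t in \<mu>. e2ennreal \<bar>x t\<bar> * ennreal \<bar>s t\<bar> = ennreal (1 / c) * (ennreal \<bar>c * r t\<bar> * ennreal \<bar>s t\<bar>)" using eq
      proof eventually_elim
        case (elim t)
        have "ennreal (1 / c) * (ennreal \<bar>c * r t\<bar> * ennreal \<bar>s t\<bar>) = ennreal (1 / c * \<bar>c * r t\<bar>) * ennreal \<bar>s t\<bar>"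
          using c(1) by (subst ennreal_mult) (auto simp: mult.assoc)
        then show ?case using c(1) elim by (simp add: abs_mult)
      qed
    qed
    also have "\<dots> = ennreal (1 / c) * (\<integral>\<^sup>+ t. ennreal \<bar>c * r t\<bar> * ennreal \<bar>s t\<bar> \<partial>\<mu>)" by (rule nn_integral_cmult) measurable
    also have "\<dots> \<le> ennreal (1 / c) * (1 + (\<integral>\<^sup>+t. complementary M t \<bar>c * r t\<bar> \<partial>\<mu>))"
    proof (rule mult_left_mono)
      have "(\<integral>\<^sup>+ t. ennreal \<bar>c * r t\<bar> * ennreal \<bar>s t\<bar> \<partial>\<mu>) \<le> rho s + (\<integral>\<^sup>+t. complementary M t \<bar>c * r t\<bar> \<partial>\<mu>)"
        by (rule young_integral) measurable
      also have "\<dots> \<le> 1 + (\<integral>\<^sup>+t. complementary M t \<bar>c * r t\<bar> \<partial>\<mu>)" by (rule add_right_mono[OF le])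
      finally show "(\<integral>\<^sup>+ t. ennreal \<bar>c * r t\<bar> * ennreal \<bar>s t\<bar> \<partial>\<mu>) \<le> 1 + (\<integral>\<^sup>+t. complementary M t \<bar>c * r t\<bar> \<partial>\<mu>)" .
    qed simp
    finally show "(\<integral>\<^sup>+ t. e2ennreal \<bar>x t\<bar> * ennreal \<bar>s t\<bar> \<partial>\<mu>) \<le> ennreal (1 / c) * (1 + (\<integral>\<^sup>+t. complementary M t \<bar>c * r t\<bar> \<partial>\<mu>))" .
  qed
  also have "\<dots> < \<infinity>" using fin by (simp add: ennreal_mult_less_top)
  finally show ?thesis .
qed


lemma orlicz_sup_upper:
  "r \<in> borel_measurable \<mu> \<Longrightarrow> rho r \<le> 1 \<Longrightarrow> (\<integral>\<^sup>+ t. e2ennreal \<bar>x t\<bar> * ennreal \<bar>r t\<bar> \<partial>\<mu>) \<le> orlicz_sup x"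
  unfolding orlicz_sup_real by (rule SUP_upper) simp

lemma ennreal_cancel_inverse: "0 < b \<Longrightarrow> b < \<infinity> \<Longrightarrow> a * (1 / b) * b = a" for a b :: ennreal
proof -
  assume "0 < b" "b < \<infinity>"
  then obtain r where r: "b = ennreal r" "0 < r" by (cases b) auto
  have "1 / b * b = 1" using r by (simp add: divide_ennreal ennreal_mult[symmetric] ennreal_1[symmetric] del: ennreal_1)
  then show ?thesis by (simp add: mult.assoc)
qed

text \<open>The supremum of \<open>\<integral>\<bar>x r\<bar>\<close> over a product ball is the sum of the suprema over its factors. On \<open>D\<close> it is
  attained at the bound; off \<open>D\<close> it is approached by normalized indicators of sets on which \<open>\<bar>x\<bar> / w\<close>
  is close to its essential supremum.\<close>

lemma orlicz_sup_eq:
  assumes ball: "split_ball D" and x[measurable]: "x \<in> borel_measurable \<mu>"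
  shows "orlicz_sup x = norm_1 \<mu> D bound x + norm_inf \<mu> (space \<mu> - D) (\<lambda>t. 1 / slope t) x"
proof (rule antisym)
  have D[measurable]: "D \<in> sets \<mu>" and b: "AE t in \<mu>. t \<in> D \<longrightarrow> 0 < bound t \<and> bound t < \<infinity>"
    and sl: "AE t in \<mu>. t \<in> space \<mu> - D \<longrightarrow> 0 < slope t \<and> slope t < \<infinity>"
    using ball by (auto simp: split_ball_def)
  define D' where "D' = space \<mu> - D"
  have D'[measurable]: "D' \<in> sets \<mu>" unfolding D'_def by measurable
  define e where "e t = e2ennreal \<bar>x t\<bar>" for t
  have [measurable]: "e \<in> borel_measurable \<mu>" unfolding e_def by measurable
  have w: "(\<lambda>t. 1 / slope t) \<in> borel_measurable (restrict_space \<mu> D')"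
    by (rule measurable_restrict_space1) measurable
  define P where "P = norm_1 \<mu> D bound x"
  define Q where "Q = norm_inf \<mu> D' (\<lambda>t. 1 / slope t) x"
  have P: "P = (\<integral>\<^sup>+t. e t * bound t * indicator D t \<partial>\<mu>)" by (simp add: P_def norm_1_def e_def)
  have Q_iff: "Q \<le> c \<longleftrightarrow> (AE t in \<mu>. t \<in> D' \<longrightarrow> e t * (1 / slope t) \<le> c)" for c
    unfolding Q_def e_def by (rule norm_inf_le_iff[OF x D' w])
  have "orlicz_sup x \<le> P + Q"
    unfolding orlicz_sup_real
  proof (rule SUP_least)
    fix r :: "'a \<Rightarrow> real" assume "r \<in> {r \<in> borel_measurable \<mu>. rho r \<le> 1}"
    then have r[measurable]: "r \<in> borel_measurable \<mu>" and le: "rho r \<le> 1" by auto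
    from le have r1: "AE t in \<mu>. t \<in> D \<longrightarrow> ennreal \<bar>r t\<bar> \<le> bound t"
      and r2: "(\<integral>\<^sup>+t\<in>D'. ennreal \<bar>r t\<bar> * slope t \<partial>\<mu>) \<le> 1"
      unfolding split_ball_iff[OF ball r] D'_def by auto
    have "AE t in \<mu>. t \<in> D' \<longrightarrow> e t * (1 / slope t) \<le> Q" using Q_iff[of Q] by simp
    with r1 sl AE_space have "AE t in \<mu>. e t * ennreal \<bar>r t\<bar> \<le> e t * bound t * indicator D t + Q * (ennreal \<bar>r t\<bar> * slope t * indicator D' t)"
    proof eventually_elim
      case (elim t)
      show ?case
      proof (cases "t \<in> D")
        case True
        then show ?thesis using elim by (simp add: add_increasing2 mult_left_mono)
      next
        case False
        then have t: "t \<in> D'" using elim by (simp add: D'_def)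
        then have "e t * (1 / slope t) * slope t \<le> Q * slope t" using elim by (intro mult_right_mono) auto
        then have "e t \<le> Q * slope t" using ennreal_cancel_inverse[of "slope t" "e t"] elim t by (simp add: D'_def)
        then have "e t * ennreal \<bar>r t\<bar> \<le> Q * slope t * ennreal \<bar>r t\<bar>" by (rule mult_right_mono) simp
        then show ?thesis using t by (simp add: mult_ac add_increasing)
      qed
    qed
    then have "(\<integral>\<^sup>+ t. e t * ennreal \<bar>r t\<bar> \<partial>\<mu>) \<le> (\<integral>\<^sup>+ t. e t * bound t * indicator D t + Q * (ennreal \<bar>r t\<bar> * slope t * indicator D' t) \<partial>\<mu>)"
      by (rule nn_integral_mono_AE)
    also have "\<dots> = P + Q * (\<integral>\<^sup>+t\<in>D'. ennreal \<bar>r t\<bar> * slope t \<partial>\<mu>)"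
      unfolding P by (subst nn_integral_add) (auto simp: nn_integral_cmult)
    also have "\<dots> \<le> P + Q * 1" by (intro add_left_mono mult_left_mono r2) simp
    finally show "(\<integral>\<^sup>+ t. e2ennreal \<bar>x t\<bar> * ennreal \<bar>r t\<bar> \<partial>\<mu>) \<le> P + Q" by (simp add: e_def)
  qed
  then show "orlicz_sup x \<le> norm_1 \<mu> D bound x + norm_inf \<mu> (space \<mu> - D) (\<lambda>t. 1 / slope t) x"
    by (simp add: P_def Q_def D'_def)
  define B where "B t = enn2real (bound t) * indicator D t" for t
  have [measurable]: "B \<in> borel_measurable \<mu>" unfolding B_def by measurable
  have eB: "AE t in \<mu>. ennreal (B t) = bound t * indicator D t" using b
    by eventually_elim (auto simp: B_def indicator_def)
  have B0: "0 \<le> B t" for t by (simp add: B_def)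
  have "P \<le> orlicz_sup x"
  proof -
    have "rho B \<le> 1" unfolding split_ball_iff[OF ball \<open>B \<in> borel_measurable \<mu>\<close>]
    proof
      show "AE t in \<mu>. t \<in> D \<longrightarrow> ennreal \<bar>B t\<bar> \<le> bound t" using eB by eventually_elim (auto simp: B0)
      have "(\<integral>\<^sup>+t\<in>space \<mu> - D. ennreal \<bar>B t\<bar> * slope t \<partial>\<mu>) = (\<integral>\<^sup>+t. 0 \<partial>\<mu>)"
        by (rule nn_integral_cong) (auto simp: B_def indicator_def)
      then show "(\<integral>\<^sup>+t\<in>space \<mu> - D. ennreal \<bar>B t\<bar> * slope t \<partial>\<mu>) \<le> 1" by simp
    qed
    then have "(\<integral>\<^sup>+ t. e2ennreal \<bar>x t\<bar> * ennreal \<bar>B t\<bar> \<partial>\<mu>) \<le> orlicz_sup x" by (intro orlicz_sup_upper) auto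
    moreover have "(\<integral>\<^sup>+ t. e2ennreal \<bar>x t\<bar> * ennreal \<bar>B t\<bar> \<partial>\<mu>) = P" unfolding P
      by (rule nn_integral_cong_AE) (use eB in eventually_elim, simp add: B0 e_def mult.assoc)
    ultimately show ?thesis by simp
  qed
  have step: "P + c \<le> orlicz_sup x" if c: "c < Q" for c
  proof -
    obtain F :: "nat \<Rightarrow> 'a set" where F: "range F \<subseteq> sets \<mu>" "(\<Union>i. F i) = space \<mu>"
        "\<And>i. emeasure \<mu> (F i) \<noteq> \<infinity>" "incseq F"
      using sigma_finite_incseq by blast
    have [measurable]: "F n \<in> sets \<mu>" for n using F by auto
    \<comment> \<open>The exhaustion by F n, and the bound n on the slope, make the integral of the slope over E n finite.\<close>
    define E where "E n = {t \<in> space \<mu>. t \<in> D' \<and> t \<in> F n \<and> c < e t * (1 / slope t) \<and> 0 < slope t \<and> slope t \<le> of_nat n}" for n :: nat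
    have Em[measurable]: "E n \<in> sets \<mu>" for n unfolding E_def by measurable
    have "\<not> (AE t in \<mu>. t \<in> D' \<longrightarrow> e t * (1 / slope t) \<le> c)" unfolding Q_iff[symmetric] using c by simp
    then obtain n where n: "0 < emeasure \<mu> (E n)"
    proof (rule positive_piece[where I=UNIV and S=E])
      show "AE t in \<mu>. \<not> (t \<in> D' \<longrightarrow> e t * (1 / slope t) \<le> c) \<longrightarrow> (\<exists>i\<in>UNIV. t \<in> E i)"
        using sl AE_space
      proof eventually_elim
        case (elim t)
        show ?case
        proof
          assume H: "\<not> (t \<in> D' \<longrightarrow> e t * (1 / slope t) \<le> c)"
          then have s: "0 < slope t" "slope t < \<infinity>" using elim by (auto simp: D'_def)
          then obtain k where k: "slope t = ennreal k" "0 \<le> k" by (cases "slope t") auto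
          obtain i where i: "t \<in> F i" using elim(2) F(2) by auto
          obtain j :: nat where j: "k \<le> j" using real_arch_simple by blast
          have "t \<in> F (max i j)" using i incseqD[OF F(4), of i "max i j"] by auto
          moreover have "slope t \<le> of_nat (max i j)"
            unfolding k(1) ennreal_of_nat_eq_real_of_nat using j by (intro ennreal_leI) auto
          ultimately have "t \<in> E (max i j)" using H elim s by (auto simp: E_def not_le)
          then show "\<exists>i\<in>UNIV. t \<in> E i" by blast
        qed
      qed
    qed auto
    define I where "I = (\<integral>\<^sup>+t\<in>E n. slope t \<partial>\<mu>)"
    have "I \<le> (\<integral>\<^sup>+t. of_nat n * indicator (F n) t \<partial>\<mu>)"
      unfolding I_def by (rule nn_integral_mono) (auto simp: E_def indicator_def)
    also have "\<dots> = of_nat n * emeasure \<mu> (F n)" by (simp add: nn_integral_cmult)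
    also have "\<dots> < \<infinity>" using F(3)[of n] by (simp add: ennreal_mult_less_top less_top of_nat_less_top)
    finally have Ifin: "I < \<infinity>" .
    have "I \<noteq> 0"
    proof
      assume "I = 0"
      then have "AE t in \<mu>. slope t * indicator (E n) t = 0" unfolding I_def by (subst (asm) nn_integral_0_iff_AE) auto
      then have "AE t in \<mu>. t \<notin> E n" by eventually_elim (auto simp: E_def indicator_def)
      then have "(\<integral>\<^sup>+t. indicator (E n) t \<partial>\<mu>) = (\<integral>\<^sup>+t. 0 \<partial>\<mu>)" by (intro nn_integral_cong_AE) (auto elim: eventually_mono)
      then show False using n by simp
    qed
    then obtain i where i: "I = ennreal i" "0 < i" using Ifin by (cases I) auto
    define r where "r t = B t + 1 / i * indicator (E n) t" for t
    have r[measurable]: "r \<in> borel_measurable \<mu>" unfolding r_def by measurable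
    have r0: "0 \<le> r t" for t using B0[of t] i by (simp add: r_def)
    have ED: "t \<notin> D" if "t \<in> E n" for t using that by (auto simp: E_def D'_def)
    have "rho r \<le> 1" unfolding split_ball_iff[OF ball r]
    proof
      show "AE t in \<mu>. t \<in> D \<longrightarrow> ennreal \<bar>r t\<bar> \<le> bound t" using eB
      proof eventually_elim
        case (elim t)
        show ?case
        proof
          assume t: "t \<in> D"
          then have "t \<notin> E n" using ED by blast
          then have "r t = B t" by (simp add: r_def)
          then show "ennreal \<bar>r t\<bar> \<le> bound t" using elim t B0[of t] by simp
        qed
      qed
      have "(\<integral>\<^sup>+t\<in>space \<mu> - D. ennreal \<bar>r t\<bar> * slope t \<partial>\<mu>) = (\<integral>\<^sup>+t. ennreal (1 / i) * (slope t * indicator (E n) t) \<partial>\<mu>)"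
        by (rule nn_integral_cong) (use ED i in \<open>auto simp: r_def B_def indicator_def\<close>)
      also have "\<dots> = ennreal (1 / i) * I" unfolding I_def by (rule nn_integral_cmult) measurable
      also have "\<dots> = 1" using i by (simp add: ennreal_mult[symmetric])
      finally show "(\<integral>\<^sup>+t\<in>space \<mu> - D. ennreal \<bar>r t\<bar> * slope t \<partial>\<mu>) \<le> 1" by simp
    qed
    then have up: "(\<integral>\<^sup>+ t. e t * ennreal \<bar>r t\<bar> \<partial>\<mu>) \<le> orlicz_sup x" unfolding e_def by (intro orlicz_sup_upper) auto
    have "P + c = P + ennreal (1 / i) * (c * I)"
      using i by (simp add: mult.left_commute[of _ c] ennreal_mult[symmetric])
    also have "\<dots> = (\<integral>\<^sup>+ t. e t * bound t * indicator D t + ennreal (1 / i) * (c * (slope t * indicator (E n) t)) \<partial>\<mu>)"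
      unfolding P I_def by (subst nn_integral_add) (auto simp: nn_integral_cmult)
    also have "\<dots> \<le> (\<integral>\<^sup>+ t. e t * ennreal \<bar>r t\<bar> \<partial>\<mu>)"
    proof (rule nn_integral_mono_AE)
      show "AE t in \<mu>. e t * bound t * indicator D t + ennreal (1 / i) * (c * (slope t * indicator (E n) t)) \<le> e t * ennreal \<bar>r t\<bar>"
        using eB
      proof eventually_elim
        case (elim t)
        show ?case
        proof (cases "t \<in> E n")
          case True
          then have s: "0 < slope t" "slope t \<le> of_nat n" "c < e t * (1 / slope t)" by (auto simp: E_def)
          have fin: "slope t < \<infinity>" using order_le_less_trans[OF s(2) of_nat_less_top] by simp
          have "c * slope t \<le> e t * (1 / slope t) * slope t" using s by (intro mult_right_mono) auto
          also have "\<dots> = e t" by (rule ennreal_cancel_inverse[OF s(1) fin])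
          finally have "ennreal (1 / i) * (c * slope t) \<le> ennreal (1 / i) * e t" by (rule mult_left_mono) simp
          then show ?thesis using True ED[OF True] i by (simp add: r_def B_def mult.commute)
        next
          case False
          then show ?thesis using elim B0[of t] by (simp add: r_def mult.assoc)
        qed
      qed
    qed
    finally show ?thesis using up by simp
  qed
  have "P + Q \<le> orlicz_sup x"
  proof (cases "P < \<infinity>")
    case True
    have "Q \<le> orlicz_sup x - P"
    proof (rule dense_le)
      fix c assume "c < Q"
      from step[OF this] show "c \<le> orlicz_sup x - P" by (simp add: ennreal_le_minus_iff add.commute)
    qed
    then have "P + Q \<le> P + (orlicz_sup x - P)" by (rule add_left_mono)
    also have "\<dots> = orlicz_sup x" by (rule ennreal_ineq_diff_add[OF \<open>P \<le> orlicz_sup x\<close>, symmetric])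
    finally show ?thesis .
  next
    case False
    then show ?thesis using \<open>P \<le> orlicz_sup x\<close> by (auto simp: less_top[symmetric] top_unique)
  qed
  then show "norm_1 \<mu> D bound x + norm_inf \<mu> (space \<mu> - D) (\<lambda>t. 1 / slope t) x \<le> orlicz_sup x"
    by (simp add: P_def Q_def D'_def)
qed

lemma complementary_le_bound: "0 \<le> u \<Longrightarrow> bound t < \<infinity> \<Longrightarrow> complementary M t u \<le> ennreal u * bound t"
proof (subst complementary_le_iff, safe)
  fix v :: real assume u: "0 \<le> u" and v: "0 < v" and fin: "bound t < \<infinity>"
  show "ennreal (u * v) \<le> M t v + ennreal u * bound t"
  proof (cases "ennreal v \<le> bound t")
    case True
    then have "ennreal u * ennreal v \<le> ennreal u * bound t" by (rule mult_left_mono) simp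
    then show ?thesis using u v by (simp add: ennreal_mult add_increasing)
  next
    case False
    then have "\<not> M t v < \<infinity>" using le_finite_bound[OF v, of "M t"] by (auto simp: bound_def)
    then show ?thesis by (simp add: less_top[symmetric])
  qed
qed

text \<open>If the two weighted norms of \<open>x\<close> are finite, a small multiple of \<open>x\<close> has finite modular for the
  complementary function \<open>N\<close>: off \<open>D\<close> it falls below the slope, where \<open>N\<close> vanishes, and on \<open>D\<close> the
  function \<open>N t\<close> is at most the line of slope \<open>bound t\<close>.\<close>

lemma orlicz_weighted_sum:
  assumes ball: "split_ball D"
  shows "is_weighted_sum \<mu> (+) D bound (\<lambda>t. 1 / slope t) (mo_functions \<mu> (complementary M)) (orlicz_norm \<mu> M)"
proof -
  have D[measurable]: "D \<in> sets \<mu>" and b: "AE t in \<mu>. t \<in> D \<longrightarrow> 0 < bound t \<and> bound t < \<infinity>"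
    and sl: "AE t in \<mu>. t \<in> space \<mu> - D \<longrightarrow> 0 < slope t \<and> slope t < \<infinity>"
    using ball by (auto simp: split_ball_def)
  have D'[measurable]: "space \<mu> - D \<in> sets \<mu>" by measurable
  have w: "(\<lambda>t. 1 / slope t) \<in> borel_measurable (restrict_space \<mu> (space \<mu> - D))"
    by (rule measurable_restrict_space1) measurable
  let ?P = "norm_1 \<mu> D bound" and ?Q = "norm_inf \<mu> (space \<mu> - D) (\<lambda>t. 1 / slope t)"
  have S: "x \<in> mo_functions \<mu> (complementary M) \<longleftrightarrow> x \<in> borel_measurable \<mu> \<and> ?P x < \<infinity> \<and> ?Q x < \<infinity>" for x
  proof
    assume x: "x \<in> mo_functions \<mu> (complementary M)"
    then have xm: "x \<in> borel_measurable \<mu>" by (simp add: mo_functions_def)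
    have "?P x + ?Q x < \<infinity>" using orlicz_sup_finite[OF x] orlicz_sup_eq[OF ball xm] by simp
    then show "x \<in> borel_measurable \<mu> \<and> ?P x < \<infinity> \<and> ?Q x < \<infinity>" using xm by simp
  next
    assume H: "x \<in> borel_measurable \<mu> \<and> ?P x < \<infinity> \<and> ?Q x < \<infinity>"
    then have x[measurable]: "x \<in> borel_measurable \<mu>" by blast
    obtain K where K: "?Q x = ennreal K" "0 \<le> K" using H by (cases "?Q x") auto
    have Q: "AE t in \<mu>. t \<in> space \<mu> - D \<longrightarrow> e2ennreal \<bar>x t\<bar> * (1 / slope t) \<le> ennreal K"
      using norm_inf_le_iff[OF x D' w, of "ennreal K"] K by simp
    have f1: "AE t in \<mu>. t \<in> D \<longrightarrow> e2ennreal \<bar>x t\<bar> * bound t < \<infinity>" using H by (intro norm_1_finite_AE) auto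
    have f2: "AE t in \<mu>. t \<in> space \<mu> - D \<longrightarrow> e2ennreal \<bar>x t\<bar> * (1 / slope t) < \<infinity>"
      using Q by (rule eventually_mono) (auto intro: order_le_less_trans)
    have fin: "AE t in \<mu>. \<bar>x t\<bar> \<noteq> \<infinity>"
      by (rule finite_of_norms[OF weight_bound[OF ball] weight_on_inverse[OF weight_slope[OF ball]] f1 f2])
    define r where "r t = real_of_ereal (x t)" for t
    have [measurable]: "r \<in> borel_measurable \<mu>" unfolding r_def by measurable
    have eq: "AE t in \<mu>. x t = ereal (r t)" unfolding r_def by (rule real_representative[OF fin])
    define c where "c = 1 / (K + 1)"
    have c: "0 < c" "c * K \<le> 1" using K(2) by (auto simp: c_def)
    have "modular \<mu> (complementary M) (\<lambda>t. ereal c * x t) = modular \<mu> (complementary M) (\<lambda>t. ereal (c * r t))"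
      by (rule modular_cong) (use eq in eventually_elim, simp)
    also have "\<dots> = (\<integral>\<^sup>+t. complementary M t \<bar>c * r t\<bar> \<partial>\<mu>)" by (simp add: modular_def)
    also have "\<dots> \<le> (\<integral>\<^sup>+t. ennreal c * (e2ennreal \<bar>x t\<bar> * bound t * indicator D t) \<partial>\<mu>)"
    proof (rule nn_integral_mono_AE)
      show "AE t in \<mu>. complementary M t \<bar>c * r t\<bar> \<le> ennreal c * (e2ennreal \<bar>x t\<bar> * bound t * indicator D t)"
        using eq Q b sl AE_space
      proof eventually_elim
        case (elim t)
        have e: "e2ennreal \<bar>x t\<bar> = ennreal \<bar>r t\<bar>" using elim(1) by simp
        show ?case
        proof (cases "t \<in> D")
          case True
          have "complementary M t \<bar>c * r t\<bar> \<le> ennreal \<bar>c * r t\<bar> * bound t" using elim True by (intro complementary_le_bound) auto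
          also have "ennreal \<bar>c * r t\<bar> = ennreal c * ennreal \<bar>r t\<bar>" using c by (simp add: abs_mult ennreal_mult)
          finally show ?thesis using True by (simp add: e mult.assoc)
        next
          case False
          then have s: "0 < slope t" "slope t < \<infinity>" and le: "ennreal \<bar>r t\<bar> * (1 / slope t) \<le> ennreal K" using elim e by auto
          have "ennreal \<bar>r t\<bar> * (1 / slope t) * slope t \<le> ennreal K * slope t" by (rule mult_right_mono[OF le]) simp
          then have "ennreal \<bar>r t\<bar> \<le> ennreal K * slope t" using ennreal_cancel_inverse[OF s] by simp
          then have "ennreal c * ennreal \<bar>r t\<bar> \<le> ennreal c * (ennreal K * slope t)" by (rule mult_left_mono) simp
          also have "\<dots> = ennreal (c * K) * slope t" using c K by (simp add: ennreal_mult mult.assoc)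
          also have "\<dots> \<le> 1 * slope t" using c(2) ennreal_leI[OF c(2)] by (intro mult_right_mono) auto
          finally have "ennreal \<bar>c * r t\<bar> \<le> slope t" using c by (simp add: abs_mult ennreal_mult)
          then have "complementary M t \<bar>c * r t\<bar> = 0" by (subst complementary_zero_iff) (auto simp: slope_def)
          then show ?thesis by simp
        qed
      qed
    qed
    also have "\<dots> = ennreal c * ?P x" unfolding norm_1_def by (rule nn_integral_cmult) measurable
    also have "\<dots> < \<infinity>" using H by (simp add: ennreal_mult_less_top)
    finally show "x \<in> mo_functions \<mu> (complementary M)" using c x by (auto simp: mo_functions_def)
  qed
  have n: "orlicz_norm \<mu> M x = enn2real (?P x) + enn2real (?Q x)" if "x \<in> mo_functions \<mu> (complementary M)" for x
    using that orlicz_sup_eq[OF ball, of x] unfolding S orlicz_norm_eq by (simp add: enn2real_plus)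
  show ?thesis
    unfolding is_weighted_sum_def
    using weight_bound[OF ball] weight_on_inverse[OF weight_slope[OF ball]] S n by auto
qed

text \<open>Where \<open>flat t = bound t\<close> the function \<open>M t\<close> jumps from \<open>0\<close> to \<open>\<infinity>\<close> and its contribution to the
  modular is a constraint; elsewhere \<open>M t\<close> is linear and the modular is a weighted integral.\<close>

lemma split_ball_linear:
  assumes lin: "AE t in \<mu>. flat t < bound t \<longrightarrow> (\<forall>u>0. M t u = slope t * ennreal u)"
  shows "split_ball {t \<in> space \<mu>. flat t = bound t}"
proof -
  define D where "D = {t \<in> space \<mu>. flat t = bound t}"
  have D[measurable]: "D \<in> sets \<mu>" unfolding D_def by measurable
  have b: "AE t in \<mu>. t \<in> D \<longrightarrow> 0 < bound t \<and> bound t < \<infinity>" using AE_orlicz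
  proof eventually_elim
    case (elim t)
    show ?case using finite_bound_pos[OF elim] zero_bound_finite[OF elim] by (auto simp: D_def bound_def flat_def)
  qed
  have sl: "AE t in \<mu>. t \<in> space \<mu> - D \<longrightarrow> 0 < slope t \<and> slope t < \<infinity> \<and> (\<forall>u\<ge>0. M t u = ennreal u * slope t)"
    using AE_orlicz lin
  proof eventually_elim
    case (elim t)
    show ?case
    proof
      assume t: "t \<in> space \<mu> - D"
      have "flat t \<le> bound t" unfolding flat_def bound_def by (rule zero_bound_le_finite_bound[OF elim(1)])
      then have "flat t < bound t" using t by (auto simp: D_def)
      then have L: "M t u = slope t * ennreal u" if "0 < u" for u using elim(2) that by blast
      then have L': "M t u = ennreal u * slope t" if "0 \<le> u" for u
        using that orlicz_zero[OF elim(1)] by (cases "u = 0") (auto simp: mult.commute)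
      obtain u where "0 < u" "0 < M t u" using orlicz_unbounded[OF elim(1), of 0] by auto
      then have "slope t \<noteq> 0" using L by auto
      then show "0 < slope t \<and> slope t < \<infinity> \<and> (\<forall>u\<ge>0. M t u = ennreal u * slope t)"
        using L' slope_finite[where M=M and t=t, OF elim(1)] by (auto simp: slope_def zero_less_iff_neq_zero)
    qed
  qed
  have jump: "AE t in \<mu>. t \<in> D \<longrightarrow> (\<forall>u\<ge>0. M t u = (if ennreal u \<le> bound t then 0 else \<infinity>))" using AE_orlicz
  proof eventually_elim
    case (elim t)
    show ?case
    proof (intro impI allI)
      fix u :: real assume t: "t \<in> D" and u: "0 \<le> u"
      have eq: "zero_bound (M t) = bound t" using t by (simp add: D_def flat_def)
      show "M t u = (if ennreal u \<le> bound t then 0 else \<infinity>)"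
      proof (cases "ennreal u \<le> bound t")
        case True
        have "M t u \<le> 0"
        proof (cases "u = 0")
          case False
          show ?thesis
          proof (rule orlicz_left_continuous[OF elim])
            fix v assume v: "0 < v" "v < u"
            have "ennreal v < ennreal u" using v by (simp add: ennreal_less_iff)
            then show "M t v \<le> 0" using orlicz_zero_below[OF elim, of v] v True unfolding eq by (simp add: order_less_le_trans)
          qed (use u False in simp)
        qed (simp add: orlicz_zero[OF elim])
        then show ?thesis using True by simp
      next
        case False
        have "0 < u" using False u by (cases "u = 0") auto
        then have "\<not> M t u < \<infinity>" using le_finite_bound[of u "M t"] False by (auto simp: bound_def)
        then show ?thesis using False by (simp add: less_top[symmetric])
      qed
    qed
  qed
  have "rho r \<le> 1 \<longleftrightarrow> (AE t in \<mu>. t \<in> D \<longrightarrow> ennreal \<bar>r t\<bar> \<le> bound t) \<and>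
       (\<integral>\<^sup>+t\<in>space \<mu> - D. ennreal \<bar>r t\<bar> * slope t \<partial>\<mu>) \<le> 1" if r[measurable]: "r \<in> borel_measurable \<mu>" for r
  proof (intro iffI conjI)
    assume le: "rho r \<le> 1"
    have "rho r < \<infinity>" by (rule order_le_less_trans[OF le]) simp
    then have "AE t in \<mu>. M t \<bar>r t\<bar> \<noteq> \<infinity>" unfolding rho_def by (intro nn_integral_PInf_AE) auto
    with jump show "AE t in \<mu>. t \<in> D \<longrightarrow> ennreal \<bar>r t\<bar> \<le> bound t"
    proof eventually_elim
      case (elim t)
      show ?case
      proof
        assume "t \<in> D"
        then have "M t \<bar>r t\<bar> = (if ennreal \<bar>r t\<bar> \<le> bound t then 0 else \<infinity>)" using elim(1) by simp
        then show "ennreal \<bar>r t\<bar> \<le> bound t" using elim(2) by (simp split: if_splits)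
      qed
    qed
    have "(\<integral>\<^sup>+t\<in>space \<mu> - D. ennreal \<bar>r t\<bar> * slope t \<partial>\<mu>) \<le> rho r" unfolding rho_def
    proof (rule nn_integral_mono_AE)
      show "AE t in \<mu>. ennreal \<bar>r t\<bar> * slope t * indicator (space \<mu> - D) t \<le> M t \<bar>r t\<bar>" using sl
        by eventually_elim (auto simp: indicator_def)
    qed
    then show "(\<integral>\<^sup>+t\<in>space \<mu> - D. ennreal \<bar>r t\<bar> * slope t \<partial>\<mu>) \<le> 1" using le by (rule order_trans)
  next
    assume H: "(AE t in \<mu>. t \<in> D \<longrightarrow> ennreal \<bar>r t\<bar> \<le> bound t) \<and>
       (\<integral>\<^sup>+t\<in>space \<mu> - D. ennreal \<bar>r t\<bar> * slope t \<partial>\<mu>) \<le> 1"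
    have "rho r \<le> (\<integral>\<^sup>+t\<in>space \<mu> - D. ennreal \<bar>r t\<bar> * slope t \<partial>\<mu>)" unfolding rho_def
    proof (rule nn_integral_mono_AE)
      show "AE t in \<mu>. M t \<bar>r t\<bar> \<le> ennreal \<bar>r t\<bar> * slope t * indicator (space \<mu> - D) t"
        using sl jump H[THEN conjunct1] AE_space by eventually_elim (auto simp: indicator_def)
    qed
    then show "rho r \<le> 1" using H by (meson order_trans)
  qed
  moreover have "AE t in \<mu>. t \<in> space \<mu> - D \<longrightarrow> 0 < slope t \<and> slope t < \<infinity>" using sl by eventually_elim auto
  ultimately show ?thesis unfolding split_ball_def D_def[symmetric] using D b by blast
qed

text \<open>A function of finite modular is bounded by \<open>bound\<close>; conversely, if it is bounded by \<open>bound\<close>, its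
  modular is at most the integral of \<open>top_value\<close>. The bound is finite a.e. because an Orlicz function is
  unbounded.\<close>

lemma split_ball_small:
  assumes small: "(\<integral>\<^sup>+t. top_value t \<partial>\<mu>) \<le> 1" shows "split_ball (space \<mu>)"
proof -
  have "(\<integral>\<^sup>+t. top_value t \<partial>\<mu>) < \<infinity>" by (rule order_le_less_trans[OF small]) simp
  then have tv: "AE t in \<mu>. top_value t \<noteq> \<infinity>" by (intro nn_integral_PInf_AE) auto
  have b: "AE t in \<mu>. 0 < bound t \<and> bound t < \<infinity>" using AE_orlicz tv
  proof eventually_elim
    case (elim t)
    have "bound t < \<infinity>"
    proof (rule ccontr)
      assume "\<not> bound t < \<infinity>"
      then have inf: "bound t = \<infinity>" by (simp add: less_top[symmetric])
      have "top_value t < \<infinity>" using elim(2) by (simp add: less_top)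
      then obtain u where u: "0 < u" "top_value t < M t u" using orlicz_unbounded[OF elim(1)] by blast
      have "M t u \<le> top_value t" unfolding top_value_def by (rule SUP_upper) (use u inf in simp)
      then show False using u by simp
    qed
    then show ?case using finite_bound_pos[OF elim(1)] by (simp add: bound_def)
  qed
  have "rho r \<le> 1 \<longleftrightarrow> (AE t in \<mu>. t \<in> space \<mu> \<longrightarrow> ennreal \<bar>r t\<bar> \<le> bound t) \<and>
       (\<integral>\<^sup>+t\<in>space \<mu> - space \<mu>. ennreal \<bar>r t\<bar> * slope t \<partial>\<mu>) \<le> 1" if r[measurable]: "r \<in> borel_measurable \<mu>" for r
  proof
    assume le: "rho r \<le> 1"
    have "rho r < \<infinity>" by (rule order_le_less_trans[OF le]) simp
    then have "AE t in \<mu>. M t \<bar>r t\<bar> \<noteq> \<infinity>" unfolding rho_def by (intro nn_integral_PInf_AE) auto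
    then have "AE t in \<mu>. t \<in> space \<mu> \<longrightarrow> ennreal \<bar>r t\<bar> \<le> bound t"
    proof eventually_elim
      case (elim t)
      show ?case using le_finite_bound[of "\<bar>r t\<bar>" "M t"] elim by (cases "r t = 0") (auto simp: bound_def less_top)
    qed
    then show "(AE t in \<mu>. t \<in> space \<mu> \<longrightarrow> ennreal \<bar>r t\<bar> \<le> bound t) \<and>
       (\<integral>\<^sup>+t\<in>space \<mu> - space \<mu>. ennreal \<bar>r t\<bar> * slope t \<partial>\<mu>) \<le> 1" by simp
  next
    assume "(AE t in \<mu>. t \<in> space \<mu> \<longrightarrow> ennreal \<bar>r t\<bar> \<le> bound t) \<and>
       (\<integral>\<^sup>+t\<in>space \<mu> - space \<mu>. ennreal \<bar>r t\<bar> * slope t \<partial>\<mu>) \<le> 1"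
    then have le: "AE t in \<mu>. t \<in> space \<mu> \<longrightarrow> ennreal \<bar>r t\<bar> \<le> bound t" by blast
    have "rho r \<le> (\<integral>\<^sup>+t. top_value t \<partial>\<mu>)" unfolding rho_def
    proof (rule nn_integral_mono_AE)
      show "AE t in \<mu>. M t \<bar>r t\<bar> \<le> top_value t" using AE_orlicz le AE_space
      proof eventually_elim
        case (elim t)
        show ?case
        proof (cases "r t = 0")
          case False
          show ?thesis
          proof (rule orlicz_left_continuous[OF elim(1)])
            fix v assume v: "0 < v" "v < \<bar>r t\<bar>"
            have "ennreal v < ennreal \<bar>r t\<bar>" using v by (intro ennreal_lessI) auto
            also have "\<dots> \<le> bound t" using elim by simp
            finally show "M t v \<le> top_value t" unfolding top_value_def using v by (intro SUP_upper) simp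
          qed (use False in simp)
        qed (simp add: orlicz_zero[OF elim(1)])
      qed
    qed
    then show "rho r \<le> 1" using small by (rule order_trans)
  qed
  then show ?thesis unfolding split_ball_def using b by (auto elim: eventually_mono)
qed

end

section \<open>From the Daugavet property to slices\<close>

context musielak_orlicz_space
begin

lemma luxemburg_le: "0 < c \<Longrightarrow> rho (\<lambda>t. z t / c) \<le> 1 \<Longrightarrow> luxemburg_norm \<mu> M (\<lambda>t. ereal (z t)) \<le> c"
  unfolding luxemburg_norm_def
  using modular_divide_real[of "\<lambda>t. ereal (z t)" z c] by (intro cInf_lower bdd_belowI[of _ 0]) auto

text \<open>The infimum in the Luxemburg norm is taken over an interval unbounded above, since the modular is
  monotone.\<close>

lemma luxemburg_less:
  assumes z: "z \<in> borel_measurable \<mu>" "(\<lambda>t. ereal (z t)) \<in> mo_functions \<mu> M"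
    and less: "luxemburg_norm \<mu> M (\<lambda>t. ereal (z t)) < c"
  shows "0 < c" "rho (\<lambda>t. z t / c) \<le> 1"
proof -
  have "{c. 0 < c \<and> modular \<mu> M (\<lambda>t. ereal (z t) / ereal c) \<le> 1} \<noteq> {}" using z(2) unfolding mo_functions_iff by blast
  then obtain d where d: "0 < d" "modular \<mu> M (\<lambda>t. ereal (z t) / ereal d) \<le> 1" "d < c"
    using cInf_lessD[OF _ less[unfolded luxemburg_norm_def]] by blast
  show c: "0 < c" using d by simp
  have "rho (\<lambda>t. z t / c) \<le> rho (\<lambda>t. z t / d)"
    by (rule rho_mono) (use d c in \<open>auto simp: abs_divide intro!: AE_I2 divide_left_mono\<close>)
  then show "rho (\<lambda>t. z t / c) \<le> 1" using d modular_divide_real[of "\<lambda>t. ereal (z t)" z d] by simp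
qed

lemma luxemburg_scale_le:
  assumes z: "z \<in> borel_measurable \<mu>" "(\<lambda>t. ereal (z t)) \<in> mo_functions \<mu> M" and a: "a \<noteq> 0"
  shows "luxemburg_norm \<mu> M (\<lambda>t. ereal (a * z t)) \<le> \<bar>a\<bar> * luxemburg_norm \<mu> M (\<lambda>t. ereal (z t))"
proof -
  have "luxemburg_norm \<mu> M (\<lambda>t. ereal (a * z t)) / \<bar>a\<bar> \<le> luxemburg_norm \<mu> M (\<lambda>t. ereal (z t))"
  proof (rule dense_ge)
    fix c assume "luxemburg_norm \<mu> M (\<lambda>t. ereal (z t)) < c"
    from luxemburg_less[OF z this] have c: "0 < c" "rho (\<lambda>t. z t / c) \<le> 1" .
    have "\<bar>a * z t / (\<bar>a\<bar> * c)\<bar> = \<bar>z t / c\<bar>" for t using a by (simp add: abs_mult abs_divide)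
    then have "rho (\<lambda>t. a * z t / (\<bar>a\<bar> * c)) \<le> 1" using c(2) by (simp only: rho_def)
    then have "luxemburg_norm \<mu> M (\<lambda>t. ereal (a * z t)) \<le> \<bar>a\<bar> * c" using a c by (intro luxemburg_le) auto
    then show "luxemburg_norm \<mu> M (\<lambda>t. ereal (a * z t)) / \<bar>a\<bar> \<le> c" using a by (simp add: pos_divide_le_eq mult.commute)
  qed
  then show ?thesis using a by (simp add: pos_divide_le_eq mult.commute)
qed

lemma mo_functions_scale:
  assumes "(\<lambda>t. ereal (z t)) \<in> mo_functions \<mu> \<Phi>" "z \<in> borel_measurable \<mu>" and zero: "modular \<mu> \<Phi> (\<lambda>t. 0) < \<infinity>"
  shows "(\<lambda>t. ereal (a * z t)) \<in> mo_functions \<mu> \<Phi>"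
proof (cases "a = 0")
  case True
  then show ?thesis using zero by (auto simp: mo_functions_def zero_ereal_def[symmetric] intro!: exI[of _ 1])
next
  case False
  obtain c where c: "0 < c" "modular \<mu> \<Phi> (\<lambda>t. ereal c * ereal (z t)) < \<infinity>" using assms(1) by (auto simp: mo_functions_def)
  have "modular \<mu> \<Phi> (\<lambda>t. ereal (c / \<bar>a\<bar>) * ereal (a * z t)) = modular \<mu> \<Phi> (\<lambda>t. ereal c * ereal (z t))"
    unfolding modular_def
    by (rule nn_integral_cong) (use False in \<open>simp add: abs_mult\<close>)
  then show ?thesis using c False assms(2) by (auto simp: mo_functions_def intro!: exI[of _ "c / \<bar>a\<bar>"])
qed

lemma luxemburg_scale:
  assumes z: "z \<in> borel_measurable \<mu>" "(\<lambda>t. ereal (z t)) \<in> mo_functions \<mu> M"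
  shows "luxemburg_norm \<mu> M (\<lambda>t. ereal (a * z t)) = \<bar>a\<bar> * luxemburg_norm \<mu> M (\<lambda>t. ereal (z t))"
proof (cases "a = 0")
  case True
  have "{c. 0 < c \<and> modular \<mu> M (\<lambda>t. 0 / ereal c) \<le> 1} = {c. 0 < c \<and> 0 \<le> c}"
    using modular_eq_rho[of "\<lambda>t. 0"] rho_zero by (auto simp: zero_ereal_def[symmetric])
  then show ?thesis using True Inf_positive_above[of 0] by (simp add: luxemburg_norm_def zero_ereal_def[symmetric])
next
  case False
  have zm: "modular \<mu> M (\<lambda>t. 0) < \<infinity>" using modular_eq_rho[of "\<lambda>t. 0"] rho_zero by (simp add: zero_ereal_def[symmetric])
  have az: "(\<lambda>t. a * z t) \<in> borel_measurable \<mu>" "(\<lambda>t. ereal (a * z t)) \<in> mo_functions \<mu> M"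
    using z mo_functions_scale[OF z(2,1) zm] by auto
  show ?thesis
  proof (rule antisym[OF luxemburg_scale_le[OF z False]])
    have "luxemburg_norm \<mu> M (\<lambda>t. ereal (1 / a * (a * z t))) \<le> \<bar>1 / a\<bar> * luxemburg_norm \<mu> M (\<lambda>t. ereal (a * z t))"
      by (rule luxemburg_scale_le[OF az]) (use False in simp)
    then show "\<bar>a\<bar> * luxemburg_norm \<mu> M (\<lambda>t. ereal (z t)) \<le> luxemburg_norm \<mu> M (\<lambda>t. ereal (a * z t))"
      using False by (simp add: field_simps abs_divide)
  qed
qed

lemma class_space_luxemburg: "class_space \<mu> (mo_functions \<mu> M) (luxemburg_norm \<mu> M)"
proof
  show "x \<in> borel_measurable \<mu>" if "x \<in> mo_functions \<mu> M" for x using that by (simp add: mo_functions_def)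
  show "y \<in> mo_functions \<mu> M" if "x \<in> mo_functions \<mu> M" "y \<in> borel_measurable \<mu>" "AE t in \<mu>. x t = y t" for x y
    by (rule closed_functionsD[OF closed_mo_functions that])
  show "AE t in \<mu>. \<bar>x t\<bar> \<noteq> \<infinity>" if "x \<in> mo_functions \<mu> M" for x by (rule mo_functions_finite[OF M_superposition that])
  show "luxemburg_norm \<mu> M x = luxemburg_norm \<mu> M y" if "AE t in \<mu>. x t = y t" for x y by (rule luxemburg_invariant[OF that])
qed

lemma class_space_orlicz: "class_space \<mu> (mo_functions \<mu> (complementary M)) (orlicz_norm \<mu> M)"
proof
  show "x \<in> borel_measurable \<mu>" if "x \<in> mo_functions \<mu> (complementary M)" for x using that by (simp add: mo_functions_def)
  show "y \<in> mo_functions \<mu> (complementary M)" if "x \<in> mo_functions \<mu> (complementary M)" "y \<in> borel_measurable \<mu>" "AE t in \<mu>. x t = y t" for x y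
    by (rule closed_functionsD[OF closed_mo_functions that])
  show "AE t in \<mu>. \<bar>x t\<bar> \<noteq> \<infinity>" if "x \<in> mo_functions \<mu> (complementary M)" for x
    by (rule mo_functions_finite[OF complementary_superposition that])
  show "orlicz_norm \<mu> M x = orlicz_norm \<mu> M y" if "AE t in \<mu>. x t = y t" for x y by (rule orlicz_invariant[OF that])
qed

text \<open>The slice property for \<open>x\<close> and \<open>g\<close> is the Daugavet property of the operator given by the
  functional \<open>\<integral>g z\<close> and the element \<open>- x\<close>.\<close>

lemma slice_property_of_luxemburg:
  assumes D: "daugavet_property (function_space \<mu> (mo_functions \<mu> M) (luxemburg_norm \<mu> M))"
    and pair: "norming_pair x g"
  shows "slice_property x g"
proof -
  interpret class_space \<mu> "mo_functions \<mu> M" "luxemburg_norm \<mu> M" by (rule class_space_luxemburg)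
  have x[measurable]: "x \<in> borel_measurable \<mu>" and x0: "\<And>t. 0 \<le> x t" and rx: "rho x = 1" and g[measurable]: "g \<in> borel_measurable \<mu>"
    and near: "\<And>e. 0 < e \<Longrightarrow> \<exists>z\<in>borel_measurable \<mu>. rho z \<le> 1 \<and> 1 - e \<le> (\<integral>t. g t * z t \<partial>\<mu>)"
    using pair by (auto simp: norming_pair_def)
  have Rm: "z \<in> borel_measurable \<mu> \<and> (\<lambda>t. ereal (z t)) \<in> mo_functions \<mu> M" if "z \<in> R" for z using that by (simp add: R_def)
  have ballR: "z \<in> R \<and> rnorm z \<le> 1" if z: "z \<in> borel_measurable \<mu>" "rho z \<le> 1" for z
  proof -
    have "modular \<mu> M (\<lambda>t. ereal (z t) / ereal 1) \<le> 1" using modular_divide_real[of "\<lambda>t. ereal (z t)" z 1] z by simp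
    then have "z \<in> R" unfolding R_def mo_functions_iff using z(1) by (auto intro!: exI[of _ 1])
    then show ?thesis using luxemburg_le[of 1 z] z by (simp add: rnorm_def)
  qed
  have zm: "modular \<mu> M (\<lambda>t. 0) < \<infinity>" using modular_eq_rho[of "\<lambda>t. 0"] rho_zero by (simp add: zero_ereal_def[symmetric])
  have R_scale: "(\<lambda>t. a * z t) \<in> R" if "z \<in> R" for a z
    using Rm[OF that] mo_functions_scale[OF _ _ zm, of z a] by (simp add: R_def borel_measurable_times)
  have hom: "rnorm (\<lambda>t. a * z t) = \<bar>a\<bar> * rnorm z" if "z \<in> R" for a z
    unfolding rnorm_def using Rm[OF that] by (intro luxemburg_scale) auto
  have less: "0 < c \<and> rho (\<lambda>t. z t / c) \<le> 1" if "z \<in> R" "rnorm z < c" for z c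
    using luxemburg_less[of z c] Rm[OF that(1)] that(2) by (simp add: rnorm_def)
  define f where "f z = (\<integral>t. g t * z t \<partial>\<mu>)" for z
  have int: "integrable \<mu> (\<lambda>t. g t * z t)" if z: "z \<in> R" for z
  proof -
    obtain c where c: "rnorm z < c" using lt_ex gt_ex by blast
    have zc: "(\<lambda>t. z t / c) \<in> borel_measurable \<mu>" using R_measurable[OF z] by measurable
    have "integrable \<mu> (\<lambda>t. c * (g t * (z t / c)))"
      by (rule integrable_mult_right[OF norming_pair_integral(1)[OF pair zc]]) (use less[OF z c] in blast)
    moreover have "(\<lambda>t. c * (g t * (z t / c))) = (\<lambda>t. g t * z t)" using less[OF z c] by (simp add: fun_eq_iff)
    ultimately show ?thesis by (simp only:)
  qed
  have f_le: "\<bar>f z\<bar> \<le> rnorm z" if z: "z \<in> R" for z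
  proof (rule dense_ge)
    fix c assume c: "rnorm z < c"
    have zc: "(\<lambda>t. z t / c) \<in> borel_measurable \<mu>" using R_measurable[OF z] by measurable
    have "\<bar>\<integral>t. g t * (z t / c) \<partial>\<mu>\<bar> \<le> 1" by (rule norming_pair_integral(3)[OF pair zc]) (use less[OF z c] in blast)
    then show "\<bar>f z\<bar> \<le> c" using less[OF z c] by (simp add: f_def abs_divide divide_le_eq)
  qed
  define y where "y t = (- 1) * x t" for t
  have xR: "x \<in> R" "rnorm x \<le> 1" using ballR[OF x] rx by auto
  have "rnorm x = 1"
  proof (rule antisym[OF xR(2)], rule ccontr)
    assume "\<not> 1 \<le> rnorm x"
    then obtain c where c: "rnorm x < c" "c < 1" using dense[of "rnorm x" 1] by auto
    note lc = less[OF xR(1) c(1)]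
    have "rho (\<lambda>t. c * (x t / c)) \<le> ennreal c * rho (\<lambda>t. x t / c)" by (rule rho_scale) (use c lc in auto)
    also have "\<dots> \<le> ennreal c * 1" using lc by (intro mult_left_mono) auto
    finally have "1 \<le> ennreal c" using rx lc by simp
    then show False using c lc by simp
  qed
  then have y: "y \<in> R" "rnorm y = 1" unfolding y_def[abs_def] hom[OF xR(1)] by (simp_all only: R_scale[OF xR(1)])
  show ?thesis
    unfolding slice_property_def
  proof (intro allI impI)
    fix c :: real assume c: "0 < c" "c < 2"
    obtain c1 where c1: "c < c1" "c1 < 2" using dense c(2) by blast
    have "\<exists>z\<in>R. rnorm z \<le> 1 \<and> c1 < rnorm (\<lambda>t. z t + f z * y t)"
    proof (rule rank_one_functional[OF D])
      show "f (\<lambda>t. u t + z t) = f u + f z" if "u \<in> R" "z \<in> R" for u z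
        unfolding f_def using int[OF that(1)] int[OF that(2)] by (simp add: distrib_left)
      show "f (\<lambda>t. a * u t) = a * f u" if "u \<in> R" for a u
        unfolding f_def by (simp add: mult.left_commute)
      show "f u = f z" if "u \<in> borel_measurable \<mu>" "z \<in> borel_measurable \<mu>" "AE t in \<mu>. u t = z t" for u z
        unfolding f_def
      proof (rule integral_cong_AE)
        show "AE t in \<mu>. g t * u t = g t * z t" using that(3) by eventually_elim simp
      qed (use that g in auto)
      show "\<exists>z\<in>R. rnorm z \<le> 1 \<and> 1 - e \<le> f z" if "0 < e" for e
        using near[OF that] ballR unfolding f_def by blast
    qed (use R_scale y hom[OF y(1)] f_le c1 in auto)
    then obtain z where z: "z \<in> R" "rnorm z \<le> 1" "c1 < rnorm (\<lambda>t. z t + f z * y t)" by blast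
    \<comment> \<open>The z obtained has norm at most 1; dividing it by k > 1 gives modular at most 1 and trades c1 for c.\<close>
    define k where "k = c1 / c"
    have k: "1 < k" "c1 / k = c" "0 < c1" using c c1 by (auto simp: k_def)
    have zk: "rho (\<lambda>t. z t / k) \<le> 1" using less[OF z(1), of k] z(2) k(1) by simp
    have zkm: "(\<lambda>t. z t / k) \<in> borel_measurable \<mu>" using R_measurable[OF z(1)] by measurable
    have fk: "(\<integral>s. g s * (z s / k) \<partial>\<mu>) = f z / k" by (simp add: f_def)
    have "1 < rho (\<lambda>t. (z t / k - f z / k * x t) / c)"
    proof (rule ccontr)
      assume "\<not> ?thesis"
      moreover have "(z t / k - f z / k * x t) / c = (z t + f z * y t) / c1" for t
        unfolding k_def y_def using c c1 by (simp add: field_simps)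
      ultimately have "rho (\<lambda>t. (z t + f z * y t) / c1) \<le> 1" by simp
      from luxemburg_le[OF k(3) this] show False using z(3) by (simp add: rnorm_def)
    qed
    then show "\<exists>z\<in>borel_measurable \<mu>. rho z \<le> 1 \<and> 1 < rho (\<lambda>t. (z t - (\<integral>s. g s * z s \<partial>\<mu>) * x t) / c)"
      using zkm zk unfolding fk[symmetric] by (intro bexI[of _ "\<lambda>t. z t / k"]) simp_all
  qed
qed

text \<open>The slope \<open>p\<close> of the chord of \<open>\<phi>\<close> over the interval from \<open>x\<close> to \<open>(1 + h) x\<close> is \<open>e / (h x)\<close>. Off
  that interval \<open>\<phi>\<close> lies above the chord, and on the interval below it by at most the increment \<open>e\<close>; so
  \<open>p\<close> is a subgradient of \<open>\<phi>\<close> at \<open>x\<close> up to the error \<open>e\<close>: \<open>p (s - x) + \<phi> x \<le> \<phi> s + e\<close> for all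
  \<open>s \<ge> 0\<close>.\<close>

lemma chord_inequality:
  assumes \<phi>: "orlicz_function \<phi>" and x: "0 < x" and h: "0 < h" and fin: "\<phi> ((1 + h) * x) < \<infinity>" and s: "0 \<le> s"
  defines "e \<equiv> enn2real (\<phi> ((1 + h) * x)) - enn2real (\<phi> x)"
  shows "ennreal (e / (h * x) * s) + \<phi> x \<le> \<phi> s + ennreal (e / h + e)" "0 \<le> e"
proof -
  define b where "b = (1 + h) * x"
  have b: "x < b" "b - x = h * x" "0 < b" using x h by (auto simp: b_def algebra_simps add_pos_pos)
  have le: "\<phi> x \<le> \<phi> b" by (rule orlicz_mono[OF \<phi>]) (use x b in auto)
  obtain m' where m': "\<phi> b = ennreal m'" "0 \<le> m'" using fin by (cases "\<phi> b") (auto simp: b_def)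
  obtain m where m: "\<phi> x = ennreal m" "0 \<le> m" using le m' by (cases "\<phi> x") (auto simp: top_unique)
  have e: "e = m' - m" using m m' by (simp add: e_def b_def)
  show e0: "0 \<le> e" using le m m' by (simp add: e ennreal_le_iff)
  show "ennreal (e / (h * x) * s) + \<phi> x \<le> \<phi> s + ennreal (e / h + e)"
  proof (cases "\<phi> s")
    case (real k)
    define p where "p = e / (h * x)"
    have p: "0 \<le> p" "p * (h * x) = e" "p * x = e / h" using e0 x h by (auto simp: p_def)
    have comb: "\<phi> z \<le> ennreal (1 - \<tau>) * \<phi> u + ennreal \<tau> * \<phi> v"
      if "0 \<le> u" "u \<le> z" "z \<le> v" "u < v" "\<tau> = (z - u) / (v - u)" for u v z \<tau>
    proof -
      have t: "0 \<le> \<tau>" "\<tau> \<le> 1" using that by auto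
      have "\<tau> * (v - u) = z - u" using that by simp
      then have "z = (1 - \<tau>) * u + \<tau> * v" by (simp add: algebra_simps)
      then show ?thesis using orlicz_convex[OF \<phi>, of u v \<tau>] t that by simp
    qed
    have "p * s + m \<le> k + e / h + e"
    proof -
      consider "s \<le> x" | "x < s" "s \<le> b" | "b < s" by linarith
      then show ?thesis
      proof cases
        case 1
        define \<tau> where "\<tau> = (x - s) / (b - s)"
        have t: "0 \<le> \<tau>" "\<tau> \<le> 1" "\<tau> * (b - s) = x - s" using 1 b by (auto simp: \<tau>_def)
        have "ennreal m \<le> ennreal (1 - \<tau>) * ennreal k + ennreal \<tau> * ennreal m'"
          using comb[of s x b \<tau>] 1 b s real m m' by (simp add: \<tau>_def)
        also have "\<dots> = ennreal ((1 - \<tau>) * k + \<tau> * m')" using t real m' by (simp add: ennreal_mult)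
        finally have "m \<le> (1 - \<tau>) * k + \<tau> * m'" using t real m' by (simp add: ennreal_le_iff del: ennreal_plus)
        then have "m * (b - s) \<le> ((1 - \<tau>) * k + \<tau> * m') * (b - s)" using 1 b by (intro mult_right_mono) auto
        also have "\<dots> = (b - x) * k + (x - s) * m'"
        proof -
          have "((1 - \<tau>) * k + \<tau> * m') * (b - s) = ((b - s) - \<tau> * (b - s)) * k + (\<tau> * (b - s)) * m'" by (simp add: algebra_simps)
          then show ?thesis unfolding t(3) by simp
        qed
        finally have "(b - x) * m \<le> (b - x) * k + (x - s) * e" by (simp add: e algebra_simps)
        also have "(x - s) * e = (b - x) * (p * (x - s))" unfolding b(2) p(2)[symmetric] by simp
        finally have "(b - x) * m \<le> (b - x) * (k + p * (x - s))" by (simp add: distrib_left)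
        then have "m \<le> k + p * (x - s)" using b(1) by simp
        then have "m + p * s \<le> k + p * x" by (simp add: right_diff_distrib)
        then show ?thesis using p(3) e0 by simp
      next
        case 2
        have "\<phi> x \<le> \<phi> s" by (rule orlicz_mono[OF \<phi>]) (use 2 x in auto)
        then have "m \<le> k" using m real by (simp add: ennreal_le_iff)
        moreover have "p * s \<le> p * b" using 2 p by (intro mult_left_mono) auto
        moreover have "p * b = e / h + e" using p(2,3) by (simp add: b_def algebra_simps)
        ultimately show ?thesis by simp
      next
        case 3
        define \<tau> where "\<tau> = (b - x) / (s - x)"
        have t: "0 \<le> \<tau>" "\<tau> \<le> 1" "\<tau> * (s - x) = b - x" using 3 b by (auto simp: \<tau>_def)
        have "ennreal m' \<le> ennreal (1 - \<tau>) * ennreal m + ennreal \<tau> * ennreal k"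
          using comb[of x b s \<tau>] 3 b x real m m' by (simp add: \<tau>_def)
        also have "\<dots> = ennreal ((1 - \<tau>) * m + \<tau> * k)" using t real m by (simp add: ennreal_mult)
        finally have "m' \<le> (1 - \<tau>) * m + \<tau> * k" using t real m by (simp add: ennreal_le_iff del: ennreal_plus)
        then have "m' * (s - x) \<le> ((1 - \<tau>) * m + \<tau> * k) * (s - x)" using 3 b by (intro mult_right_mono) auto
        also have "\<dots> = (s - x - (b - x)) * m + (b - x) * k"
        proof -
          have "((1 - \<tau>) * m + \<tau> * k) * (s - x) = ((s - x) - \<tau> * (s - x)) * m + (\<tau> * (s - x)) * k" by (simp add: algebra_simps)
          then show ?thesis unfolding t(3) by simp
        qed
        finally have "(s - x) * e + (b - x) * m \<le> (b - x) * k" by (simp add: e algebra_simps)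
        moreover have "(s - x) * e = (b - x) * (p * (s - x))" unfolding b(2) p(2)[symmetric] by simp
        ultimately have "(b - x) * (p * (s - x) + m) \<le> (b - x) * k" by (simp add: distrib_left)
        then have "p * (s - x) + m \<le> k" using b(1) by simp
        then have "p * s + m \<le> k + p * x" by (simp add: right_diff_distrib)
        then show ?thesis using p(3) e0 by simp
      qed
    qed
    then have "ennreal (p * s + m) \<le> ennreal (k + (e / h + e))" by (intro ennreal_leI) simp
    moreover have "0 \<le> e / h + e" using e0 h by simp
    ultimately show ?thesis using p s m real by (simp add: p_def[symmetric] del: ennreal_plus flip: ennreal_plus)
  qed simp
qed


lemma real_mo_functions_complementary:
  "z \<in> borel_measurable \<mu> \<Longrightarrow> (\<lambda>t. ereal (z t)) \<in> mo_functions \<mu> (complementary M) \<longleftrightarrow>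
     (\<exists>c>0. (\<integral>\<^sup>+t. complementary M t \<bar>c * z t\<bar> \<partial>\<mu>) < \<infinity>)"
  by (simp add: mo_functions_def modular_def)

lemma orlicz_pairing:
  assumes z: "z \<in> borel_measurable \<mu>" "(\<lambda>t. ereal (z t)) \<in> mo_functions \<mu> (complementary M)"
    and s: "s \<in> borel_measurable \<mu>" "rho s \<le> 1"
  shows "(\<integral>\<^sup>+t. ennreal \<bar>z t * s t\<bar> \<partial>\<mu>) \<le> ennreal (orlicz_norm \<mu> M (\<lambda>t. ereal (z t)))"
proof -
  have "(\<integral>\<^sup>+t. ennreal \<bar>z t * s t\<bar> \<partial>\<mu>) \<le> orlicz_sup (\<lambda>t. ereal (z t))"
    using orlicz_sup_upper[OF s, of "\<lambda>t. ereal (z t)"] by (simp add: abs_mult ennreal_mult)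
  then show ?thesis using orlicz_sup_finite[OF z(2)] by (simp add: orlicz_norm_eq)
qed

lemma orlicz_norm_le:
  assumes le: "\<And>s. s \<in> borel_measurable \<mu> \<Longrightarrow> rho s \<le> 1 \<Longrightarrow> (\<integral>\<^sup>+t. ennreal \<bar>z t * s t\<bar> \<partial>\<mu>) \<le> ennreal c" and c: "0 \<le> c"
  shows "orlicz_norm \<mu> M (\<lambda>t. ereal (z t)) \<le> c"
proof -
  have "orlicz_sup (\<lambda>t. ereal (z t)) \<le> ennreal c"
    unfolding orlicz_sup_real
  proof (rule SUP_least)
    fix s :: "'a \<Rightarrow> real" assume "s \<in> {r \<in> borel_measurable \<mu>. rho r \<le> 1}"
    then show "(\<integral>\<^sup>+ t. e2ennreal \<bar>ereal (z t)\<bar> * ennreal \<bar>s t\<bar> \<partial>\<mu>) \<le> ennreal c"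
      using le[of s] by (simp add: abs_mult ennreal_mult)
  qed
  then show ?thesis unfolding orlicz_norm_eq by (rule enn2real_leI[OF c])
qed

lemma orlicz_norm_scale:
  assumes z: "z \<in> borel_measurable \<mu>" "(\<lambda>t. ereal (z t)) \<in> mo_functions \<mu> (complementary M)"
  shows "orlicz_norm \<mu> M (\<lambda>t. ereal (a * z t)) = \<bar>a\<bar> * orlicz_norm \<mu> M (\<lambda>t. ereal (z t))"
proof -
  have "orlicz_sup (\<lambda>t. ereal (a * z t)) =
      (SUP r\<in>{r \<in> borel_measurable \<mu>. rho r \<le> 1}. ennreal \<bar>a\<bar> * (\<integral>\<^sup>+ t. e2ennreal \<bar>ereal (z t)\<bar> * ennreal \<bar>r t\<bar> \<partial>\<mu>))"
    unfolding orlicz_sup_real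
  proof (rule SUP_cong[OF refl])
    fix r :: "'a \<Rightarrow> real" assume "r \<in> {r \<in> borel_measurable \<mu>. rho r \<le> 1}"
    then have [measurable]: "r \<in> borel_measurable \<mu>" by simp
    note [measurable] = z(1)
    have "(\<integral>\<^sup>+ t. e2ennreal \<bar>ereal (a * z t)\<bar> * ennreal \<bar>r t\<bar> \<partial>\<mu>) =
        (\<integral>\<^sup>+ t. ennreal \<bar>a\<bar> * (e2ennreal \<bar>ereal (z t)\<bar> * ennreal \<bar>r t\<bar>) \<partial>\<mu>)"
      by (rule nn_integral_cong) (simp add: abs_mult ennreal_mult mult.assoc)
    then show "(\<integral>\<^sup>+ t. e2ennreal \<bar>ereal (a * z t)\<bar> * ennreal \<bar>r t\<bar> \<partial>\<mu>) =
        ennreal \<bar>a\<bar> * (\<integral>\<^sup>+ t. e2ennreal \<bar>ereal (z t)\<bar> * ennreal \<bar>r t\<bar> \<partial>\<mu>)"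
      by (simp add: nn_integral_cmult)
  qed
  also have "\<dots> = ennreal \<bar>a\<bar> * orlicz_sup (\<lambda>t. ereal (z t))"
    unfolding orlicz_sup_real by (rule SUP_mult_left_ennreal[symmetric])
  finally show ?thesis by (simp add: orlicz_norm_eq enn2real_mult)
qed

text \<open>The functional \<open>\<integral>z x\<close> has norm one on the Orlicz space when \<open>rho x = 1\<close>. With \<open>p\<close> the chord slopes of
  \<open>M t\<close> over \<open>[x t, (1 + h) x t]\<close> and \<open>H\<close> the integral of the increments, integrating the chord
  inequality shows that the Orlicz norm of \<open>p\<close> is at most \<open>\<integral>p x + H\<close>, so that \<open>p\<close> attains the norm up
  to \<open>H\<close>. Here \<open>\<integral>p x = H / h \<ge> 1\<close> by convexity, while \<open>H\<close> is small with \<open>h\<close>.\<close>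

lemma chord_slopes_nearly_norming:
  assumes x: "x \<in> borel_measurable \<mu>" "\<And>t. 0 \<le> x t" "rho x = 1" and l: "1 < l" "rho (\<lambda>t. l * x t) < \<infinity>" and \<epsilon>: "0 < \<epsilon>"
  obtains z where "z \<in> borel_measurable \<mu>" "\<And>t. 0 \<le> z t" "(\<lambda>t. ereal (z t)) \<in> mo_functions \<mu> (complementary M)"
    "orlicz_norm \<mu> M (\<lambda>t. ereal (z t)) \<le> 1" "ennreal (1 - \<epsilon>) \<le> (\<integral>\<^sup>+t. ennreal (z t * x t) \<partial>\<mu>)"
proof -
  note [measurable] = x(1)
  obtain K where K: "rho (\<lambda>t. l * x t) = ennreal K" "0 \<le> K" using l(2) by (cases "rho (\<lambda>t. l * x t)") auto
  \<comment> \<open>The multiple 1 + h is placed at the fraction \<tau> of the way from 1 to l.\<close>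
  define \<tau> where "\<tau> = min 1 (\<epsilon> / (K + 1))"
  have tau: "0 < \<tau>" "\<tau> \<le> 1" using \<epsilon> K(2) by (auto simp: \<tau>_def)
  have tauK: "\<tau> * K \<le> \<epsilon>"
  proof -
    have "\<tau> * K \<le> \<epsilon> / (K + 1) * K" using K(2) by (intro mult_right_mono) (auto simp: \<tau>_def)
    also have "\<dots> \<le> \<epsilon>" using K(2) \<epsilon> by (simp add: field_simps)
    finally show ?thesis .
  qed
  define h where "h = \<tau> * (l - 1)"
  have h: "0 < h" using tau l by (simp add: h_def)
  define y where "y t = (1 + h) * x t" for t
  have y0: "0 \<le> y t" for t using h x(2) by (simp add: y_def)
  have [measurable]: "y \<in> borel_measurable \<mu>" unfolding y_def by measurable
  have "rho y \<le> ennreal (1 - \<tau>) * rho x + ennreal \<tau> * rho (\<lambda>t. l * x t)"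
  proof (rule rho_convex)
    show "AE t in \<mu>. \<bar>y t\<bar> \<le> (1 - \<tau>) * \<bar>x t\<bar> + \<tau> * \<bar>l * x t\<bar>"
    proof (rule AE_I2)
      fix t
      have "y t = (1 - \<tau>) * x t + \<tau> * (l * x t)" by (simp add: y_def h_def algebra_simps)
      then show "\<bar>y t\<bar> \<le> (1 - \<tau>) * \<bar>x t\<bar> + \<tau> * \<bar>l * x t\<bar>" using y0[of t] x(2)[of t] l by (simp add: abs_mult)
    qed
  qed (use tau in auto)
  also have "\<dots> = ennreal (1 - \<tau> + \<tau> * K)" using tau K x(3) by (simp add: ennreal_mult ennreal_plus)
  also have "\<dots> \<le> ennreal (1 + \<epsilon>)" using tau tauK by (intro ennreal_leI) simp
  finally have rho_y: "rho y \<le> ennreal (1 + \<epsilon>)" .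
  have mx: "(\<lambda>t. M t (x t)) \<in> borel_measurable \<mu>" "(\<lambda>t. M t (y t)) \<in> borel_measurable \<mu>"
    using measurable_superposition_nonneg x(2) y0 by auto
  note [measurable] = mx
  have rho_x: "rho x = (\<integral>\<^sup>+t. M t (x t) \<partial>\<mu>)" and rho_y': "rho y = (\<integral>\<^sup>+t. M t (y t) \<partial>\<mu>)"
    unfolding rho_def using x(2) y0 by simp_all
  have "(\<integral>\<^sup>+t. M t (y t) \<partial>\<mu>) \<noteq> \<infinity>" using rho_y unfolding rho_y' by (auto simp: top_unique)
  then have fin: "AE t in \<mu>. M t (y t) < \<infinity>" using nn_integral_PInf_AE[OF mx(2)] by (simp add: less_top)
  define e where "e t = enn2real (M t (y t)) - enn2real (M t (x t))" for t
  define p where "p t = (if x t = 0 then 0 else max 0 (e t) / (h * x t))" for t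
  have [measurable]: "e \<in> borel_measurable \<mu>" unfolding e_def by measurable
  have pm[measurable]: "p \<in> borel_measurable \<mu>" unfolding p_def by measurable
  have p0: "0 \<le> p t" for t using x(2)[of t] h by (simp add: p_def)
  have e0: "AE t in \<mu>. 0 \<le> e t \<and> ennreal (e t) + M t (x t) = M t (y t) \<and> p t * x t = e t / h" using AE_orlicz fin
  proof eventually_elim
    case (elim t)
    have le: "M t (x t) \<le> M t (y t)" by (rule orlicz_mono[OF elim(1)]) (use x(2)[of t] h in \<open>auto simp: y_def algebra_simps\<close>)
    obtain b where b: "M t (y t) = ennreal b" "0 \<le> b" using elim(2) by (cases "M t (y t)") auto
    obtain a where a: "M t (x t) = ennreal a" "0 \<le> a" using le b by (cases "M t (x t)") (auto simp: top_unique)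
    have ab: "a \<le> b" using le a b by (simp add: ennreal_le_iff)
    have e: "e t = b - a" using a b by (simp add: e_def)
    have "p t * x t = e t / h"
    proof (cases "x t = 0")
      case True
      then have "y t = x t" by (simp add: y_def)
      then show ?thesis using True by (simp add: e_def)
    qed (use ab e h in \<open>simp add: p_def\<close>)
    then show ?case using a b ab e by (simp flip: ennreal_plus)
  qed
  define H where "H = (\<integral>\<^sup>+t. ennreal (e t) \<partial>\<mu>)"
  have "H + 1 = (\<integral>\<^sup>+t. ennreal (e t) + M t (x t) \<partial>\<mu>)"
    unfolding H_def x(3)[symmetric] rho_x by (rule nn_integral_add[symmetric]) measurable
  also have "\<dots> = rho y" unfolding rho_y' by (rule nn_integral_cong_AE) (use e0 in eventually_elim, simp)
  finally have H1: "H + 1 = rho y" .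
  then have "H + 1 \<le> ennreal \<epsilon> + 1" using rho_y \<epsilon> by (simp add: ennreal_plus add.commute)
  then have "H \<le> ennreal \<epsilon>" by simp
  then obtain r where r: "H = ennreal r" "0 \<le> r" "r \<le> \<epsilon>" using \<epsilon> by (cases H) (auto simp: top_unique ennreal_le_iff)
  have "h \<le> r"
  proof -
    have "rho (\<lambda>t. 1 / (1 + h) * y t) \<le> ennreal (1 / (1 + h)) * rho y" by (rule rho_scale) (use h in auto)
    moreover have "(\<lambda>t. 1 / (1 + h) * y t) = x" using h by (simp add: y_def fun_eq_iff)
    ultimately have "1 \<le> ennreal (1 / (1 + h)) * (ennreal r + 1)" using x(3) H1 r by simp
    also have "\<dots> = ennreal (1 / (1 + h) * (r + 1))" using r h by (subst ennreal_mult) (auto simp: ennreal_plus)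
    finally have "1 \<le> 1 / (1 + h) * (r + 1)" by simp
    then show ?thesis using h by (simp add: field_simps)
  qed
  define I where "I = r / h"
  have I: "1 \<le> I" using \<open>h \<le> r\<close> h by (simp add: I_def)
  have Q: "(\<integral>\<^sup>+t. ennreal (e t / h + e t) \<partial>\<mu>) = ennreal (I + r)"
  proof -
    have "(\<integral>\<^sup>+t. ennreal (e t / h + e t) \<partial>\<mu>) = (\<integral>\<^sup>+t. ennreal (1 / h + 1) * ennreal (e t) \<partial>\<mu>)"
    proof (rule nn_integral_cong_AE)
      show "AE t in \<mu>. ennreal (e t / h + e t) = ennreal (1 / h + 1) * ennreal (e t)" using e0
      proof eventually_elim
        case (elim t)
        have "e t / h + e t = (1 / h + 1) * e t" by (simp add: distrib_right)
        then show ?case using elim h by (simp add: ennreal_mult del: ennreal_plus)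
      qed
    qed
    also have "\<dots> = ennreal (1 / h + 1) * H" unfolding H_def by (rule nn_integral_cmult) measurable
    also have "\<dots> = ennreal ((1 / h + 1) * r)" using r h by (simp add: ennreal_mult del: ennreal_plus)
    also have "(1 / h + 1) * r = I + r" by (simp add: I_def distrib_right)
    finally show ?thesis .
  qed
  have chord: "AE t in \<mu>. 0 \<le> e t \<and> (\<forall>s\<ge>0. ennreal (p t * s) + M t (x t) \<le> M t s + ennreal (e t / h + e t))"
    using AE_orlicz fin e0
  proof eventually_elim
    case (elim t)
    show ?case
    proof (intro conjI allI impI)
      fix s :: real assume s: "0 \<le> s"
      show "ennreal (p t * s) + M t (x t) \<le> M t s + ennreal (e t / h + e t)"
      proof (cases "x t = 0")
        case True
        then show ?thesis using orlicz_zero[OF elim(1)] by (simp add: p_def)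
      next
        case False
        then have xt: "0 < x t" using x(2)[of t] by simp
        have "M t ((1 + h) * x t) < \<infinity>" using elim(2) by (simp add: y_def)
        from chord_inequality(1)[OF elim(1) xt h this s] show ?thesis
          using elim(3) False by (simp add: p_def e_def[symmetric] y_def[symmetric])
      qed
    qed (use elim in simp)
  qed
  have le: "(\<integral>\<^sup>+t. ennreal \<bar>p t * s t\<bar> \<partial>\<mu>) \<le> ennreal (I + r)" if s[measurable]: "s \<in> borel_measurable \<mu>" and s1: "rho s \<le> 1" for s
  proof -
    have "(\<integral>\<^sup>+t. ennreal \<bar>p t * s t\<bar> \<partial>\<mu>) + 1 = (\<integral>\<^sup>+t. ennreal \<bar>p t * s t\<bar> + M t (x t) \<partial>\<mu>)"
      unfolding x(3)[symmetric] rho_x by (rule nn_integral_add[symmetric]) measurable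
    also have "\<dots> \<le> (\<integral>\<^sup>+t. M t \<bar>s t\<bar> + ennreal (e t / h + e t) \<partial>\<mu>)"
      by (rule nn_integral_mono_AE) (use chord in eventually_elim, simp add: abs_mult p0)
    also have "\<dots> = rho s + ennreal (I + r)" unfolding rho_def Q[symmetric] by (rule nn_integral_add) measurable
    also have "\<dots> \<le> 1 + ennreal (I + r)" by (rule add_right_mono[OF s1])
    finally have "1 + (\<integral>\<^sup>+t. ennreal \<bar>p t * s t\<bar> \<partial>\<mu>) \<le> 1 + ennreal (I + r)" by (simp only: add.commute)
    then show ?thesis by simp
  qed
  define c where "c = I + r"
  have c: "0 < c" using I r by (simp add: c_def)
  define z where "z t = p t / c" for t
  have zm: "z \<in> borel_measurable \<mu>" unfolding z_def by measurable
  have z0: "0 \<le> z t" for t using p0 c by (simp add: z_def)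
  have "(\<integral>\<^sup>+t. complementary M t \<bar>c * z t\<bar> \<partial>\<mu>) \<le> (\<integral>\<^sup>+t. ennreal (e t / h + e t) \<partial>\<mu>)"
  proof (rule nn_integral_mono_AE)
    show "AE t in \<mu>. complementary M t \<bar>c * z t\<bar> \<le> ennreal (e t / h + e t)" using chord
    proof eventually_elim
      case (elim t)
      have "ennreal (p t * s) \<le> M t s + ennreal (e t / h + e t)" if "0 < s" for s
        using elim that order_trans[of "ennreal (p t * s)" "ennreal (p t * s) + M t (x t)"] by fastforce
      then show ?case unfolding complementary_le_iff using c p0 by (simp add: z_def)
    qed
  qed
  also have "\<dots> < \<infinity>" unfolding Q by simp
  finally have mo: "(\<lambda>t. ereal (z t)) \<in> mo_functions \<mu> (complementary M)"
    unfolding real_mo_functions_complementary[OF zm] using c by blast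
  have scale: "(\<integral>\<^sup>+t. ennreal \<bar>z t * s t\<bar> \<partial>\<mu>) = ennreal (1 / c) * (\<integral>\<^sup>+t. ennreal \<bar>p t * s t\<bar> \<partial>\<mu>)"
    if [measurable]: "s \<in> borel_measurable \<mu>" for s
  proof -
    have "ennreal \<bar>z t * s t\<bar> = ennreal (1 / c) * ennreal \<bar>p t * s t\<bar>" for t
      using c by (simp add: z_def ennreal_mult[symmetric] abs_mult abs_divide)
    then show ?thesis by (simp add: nn_integral_cmult)
  qed
  have z1: "orlicz_norm \<mu> M (\<lambda>t. ereal (z t)) \<le> 1"
  proof (rule orlicz_norm_le)
    fix s assume s: "s \<in> borel_measurable \<mu>" "rho s \<le> 1"
    have "(\<integral>\<^sup>+t. ennreal \<bar>z t * s t\<bar> \<partial>\<mu>) \<le> ennreal (1 / c) * ennreal c"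
      unfolding scale[OF s(1)] by (rule mult_left_mono[OF le[OF s, folded c_def]]) simp
    then show "(\<integral>\<^sup>+t. ennreal \<bar>z t * s t\<bar> \<partial>\<mu>) \<le> ennreal 1" using c by (simp add: ennreal_mult[symmetric])
  qed simp
  have "(\<integral>\<^sup>+t. ennreal \<bar>p t * x t\<bar> \<partial>\<mu>) = (\<integral>\<^sup>+t. ennreal (1 / h) * ennreal (e t) \<partial>\<mu>)"
    by (rule nn_integral_cong_AE) (use e0 in eventually_elim, use h in \<open>simp add: ennreal_mult[symmetric]\<close>)
  also have "\<dots> = ennreal (1 / h) * H" unfolding H_def by (rule nn_integral_cmult) measurable
  also have "\<dots> = ennreal I" using r h by (simp add: I_def ennreal_mult[symmetric])
  finally have px: "(\<integral>\<^sup>+t. ennreal \<bar>p t * x t\<bar> \<partial>\<mu>) = ennreal I" .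
  have "(\<integral>\<^sup>+t. ennreal (z t * x t) \<partial>\<mu>) = (\<integral>\<^sup>+t. ennreal \<bar>z t * x t\<bar> \<partial>\<mu>)"
    using z0 x(2) by simp
  also have "\<dots> = ennreal (I / c)" unfolding scale[OF x(1)] px using I c by (simp add: ennreal_mult[symmetric])
  finally have zx: "(\<integral>\<^sup>+t. ennreal (z t * x t) \<partial>\<mu>) = ennreal (I / c)" .
  have "1 - \<epsilon> \<le> I / c"
  proof -
    have "(1 - \<epsilon>) * c \<le> (1 - r) * c" using r c by (intro mult_right_mono) auto
    also have "\<dots> = I - (I - 1) * r - r * r" by (simp add: c_def algebra_simps)
    also have "\<dots> \<le> I" using mult_nonneg_nonneg[of "I - 1" r] mult_nonneg_nonneg[of r r] I r by linarith
    finally show ?thesis using c by (simp add: pos_le_divide_eq)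
  qed
  then have "ennreal (1 - \<epsilon>) \<le> (\<integral>\<^sup>+t. ennreal (z t * x t) \<partial>\<mu>)" unfolding zx by (rule ennreal_leI)
  then show thesis using that[OF zm z0 mo z1] by blast
qed


text \<open>The transposed operator: its functional is \<open>- \<integral>z x\<close>, its element is \<open>g\<close>. If \<open>z - (\<integral>z x) g\<close> has Orlicz
  norm above \<open>c\<close>, test it with some \<open>s'\<close> in the modular unit ball; moving the operator to the other side,
  \<open>\<integral>z (s' - (\<integral>g s') x) > c\<close>, so that \<open>s' - (\<integral>g s') x\<close> has Luxemburg norm above \<open>c\<close>.\<close>

lemma slice_property_of_orlicz:
  assumes D: "daugavet_property (function_space \<mu> (mo_functions \<mu> (complementary M)) (orlicz_norm \<mu> M))"
    and pair: "norming_pair x g"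
  shows "slice_property x g"
proof -
  interpret class_space \<mu> "mo_functions \<mu> (complementary M)" "orlicz_norm \<mu> M" by (rule class_space_orlicz)
  have x: "x \<in> borel_measurable \<mu>" and x0: "\<And>t. 0 \<le> x t" and rx: "rho x = 1" and g: "g \<in> borel_measurable \<mu>"
    and dual: "\<And>s. s \<in> borel_measurable \<mu> \<Longrightarrow> rho s \<le> 1 \<Longrightarrow> (\<integral>\<^sup>+t. ennreal \<bar>g t * s t\<bar> \<partial>\<mu>) \<le> 1"
    and near: "\<And>e. 0 < e \<Longrightarrow> \<exists>s\<in>borel_measurable \<mu>. rho s \<le> 1 \<and> 1 - e \<le> (\<integral>t. g t * s t \<partial>\<mu>)"
    using pair by (auto simp: norming_pair_def)
  obtain l where l: "1 < l" "rho (\<lambda>t. l * x t) < \<infinity>" using pair by (auto simp: norming_pair_def)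
  obtain k where k: "0 < k" "(\<integral>\<^sup>+t. complementary M t (k * \<bar>g t\<bar>) \<partial>\<mu>) < \<infinity>" using pair by (auto simp: norming_pair_def)
  note [measurable] = x g
  have Rm: "z \<in> borel_measurable \<mu> \<and> (\<lambda>t. ereal (z t)) \<in> mo_functions \<mu> (complementary M)" if "z \<in> R" for z
    using that by (simp add: R_def)
  have zm: "modular \<mu> (complementary M) (\<lambda>t. 0) < \<infinity>"
  proof -
    have "complementary M t 0 \<le> 0" for t unfolding complementary_le_iff by simp
    then show ?thesis by (simp add: modular_def)
  qed
  have R_scale: "(\<lambda>t. a * z t) \<in> R" if "z \<in> R" for a z
    using Rm[OF that] mo_functions_scale[OF _ _ zm, of z a] by (simp add: R_def borel_measurable_times)
  have hom: "rnorm (\<lambda>t. a * z t) = \<bar>a\<bar> * rnorm z" if "z \<in> R" for a z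
    unfolding rnorm_def using Rm[OF that] by (intro orlicz_norm_scale) auto
  have rn0: "0 \<le> rnorm z" for z by (simp add: rnorm_def orlicz_norm_def)
  have int: "integrable \<mu> (\<lambda>t. z t * s t) \<and> \<bar>\<integral>t. z t * s t \<partial>\<mu>\<bar> \<le> rnorm z"
    if z: "z \<in> R" and s: "s \<in> borel_measurable \<mu>" "rho s \<le> 1" for z s
  proof -
    note [measurable] = R_measurable[OF z] s(1)
    have le: "(\<integral>\<^sup>+t. ennreal \<bar>z t * s t\<bar> \<partial>\<mu>) \<le> ennreal (rnorm z)"
      unfolding rnorm_def using Rm[OF z] s by (intro orlicz_pairing) auto
    then have i: "integrable \<mu> (\<lambda>t. z t * s t)"
      by (intro integrableI_bounded) (auto intro: order_le_less_trans)
    have "\<bar>\<integral>t. z t * s t \<partial>\<mu>\<bar> \<le> (\<integral>t. \<bar>z t * s t\<bar> \<partial>\<mu>)" by (rule integral_abs_bound)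
    also have "\<dots> = enn2real (\<integral>\<^sup>+t. ennreal \<bar>z t * s t\<bar> \<partial>\<mu>)"
      by (rule integral_eq_nn_integral) auto
    also have "\<dots> \<le> rnorm z" by (rule enn2real_leI[OF rn0 le])
    finally show ?thesis using i by blast
  qed
  have gR: "g \<in> R" unfolding R_def
    using k g real_mo_functions_complementary[OF g] by (auto simp: abs_mult)
  have g1: "rnorm g = 1"
  proof (rule antisym)
    show "rnorm g \<le> 1" unfolding rnorm_def by (rule orlicz_norm_le) (use dual in auto)
    show "1 \<le> rnorm g"
    proof (rule field_le_epsilon)
      fix e :: real assume "0 < e"
      from near[OF this] obtain s where "s \<in> borel_measurable \<mu>" "rho s \<le> 1" "1 - e \<le> (\<integral>t. g t * s t \<partial>\<mu>)" by blast
      then show "1 \<le> rnorm g + e" using int[OF gR, of s] by linarith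
    qed
  qed
  define f where "f z = - (\<integral>t. z t * x t \<partial>\<mu>)" for z
  have intx: "integrable \<mu> (\<lambda>t. z t * x t)" "\<bar>f z\<bar> \<le> rnorm z" if "z \<in> R" for z
    using int[OF that x] rx by (auto simp: f_def)
  show ?thesis
    unfolding slice_property_def
  proof (intro allI impI)
    fix c :: real assume c: "0 < c" "c < 2"
    have "\<exists>z\<in>R. rnorm z \<le> 1 \<and> c < rnorm (\<lambda>t. z t + f z * g t)"
    proof (rule rank_one_functional[OF D])
      show "f (\<lambda>t. u t + z t) = f u + f z" if "u \<in> R" "z \<in> R" for u z
        unfolding f_def using intx(1)[OF that(1)] intx(1)[OF that(2)] by (simp add: distrib_right)
      show "f (\<lambda>t. a * u t) = a * f u" if "u \<in> R" for a u
        unfolding f_def by (simp add: mult.assoc)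
      show "f u = f z" if u: "u \<in> borel_measurable \<mu>" "z \<in> borel_measurable \<mu>" and eq: "AE t in \<mu>. u t = z t" for u z
      proof -
        note [measurable] = u
        have "(\<integral>t. u t * x t \<partial>\<mu>) = (\<integral>t. z t * x t \<partial>\<mu>)"
        proof (rule integral_cong_AE)
          show "AE t in \<mu>. u t * x t = z t * x t" using eq by eventually_elim simp
        qed measurable
        then show ?thesis by (simp add: f_def)
      qed
      show "\<exists>z\<in>R. rnorm z \<le> 1 \<and> 1 - e \<le> f z" if e: "0 < e" for e
      proof -
        obtain p where p: "p \<in> borel_measurable \<mu>" "\<And>t. 0 \<le> p t" "(\<lambda>t. ereal (p t)) \<in> mo_functions \<mu> (complementary M)"
          "orlicz_norm \<mu> M (\<lambda>t. ereal (p t)) \<le> 1" "ennreal (1 - e) \<le> (\<integral>\<^sup>+t. ennreal (p t * x t) \<partial>\<mu>)"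
          using chord_slopes_nearly_norming[OF x x0 rx l e] by blast
        have pR: "p \<in> R" using p by (simp add: R_def)
        have "(\<integral>\<^sup>+t. ennreal (p t * x t) \<partial>\<mu>) = ennreal (\<integral>t. p t * x t \<partial>\<mu>)"
          by (rule nn_integral_eq_integral[OF intx(1)[OF pR]]) (use p x0 in auto)
        moreover have "0 \<le> (\<integral>t. p t * x t \<partial>\<mu>)" using p x0 by (intro integral_nonneg_AE) auto
        ultimately have "1 - e \<le> (\<integral>t. p t * x t \<partial>\<mu>)" using p(5) by (simp add: ennreal_le_iff)
        then have "1 - e \<le> f (\<lambda>t. - 1 * p t)" by (simp add: f_def)
        moreover have "rnorm (\<lambda>t. - 1 * p t) \<le> 1" unfolding hom[OF pR] using p(4) by (simp add: rnorm_def)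
        ultimately show ?thesis using R_scale[OF pR, of "- 1"] by blast
      qed
    qed (use R_scale gR g1 hom[OF gR] intx(2) c in auto)
    then obtain z where z: "z \<in> R" "rnorm z \<le> 1" "c < rnorm (\<lambda>t. z t + f z * g t)" by blast
    note [measurable] = R_measurable[OF z(1)]
    define F where "F t = z t + f z * g t" for t
    have [measurable]: "F \<in> borel_measurable \<mu>" unfolding F_def by measurable
    obtain s where s: "s \<in> borel_measurable \<mu>" "rho s \<le> 1" "ennreal c < (\<integral>\<^sup>+t. ennreal \<bar>F t * s t\<bar> \<partial>\<mu>)"
      using orlicz_norm_le[of F c] z(3) c(1) by (auto simp: rnorm_def F_def not_le[symmetric])
    define s' where "s' t = sgn (F t) * \<bar>s t\<bar>" for t
    have s'[measurable]: "s' \<in> borel_measurable \<mu>" unfolding s'_def using s(1) by measurable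
    have "rho s' \<le> rho s" by (rule rho_mono) (auto simp: s'_def abs_mult abs_sgn_eq)
    then have s'1: "rho s' \<le> 1" using s(2) by simp
    have Fs: "F t * s' t = \<bar>F t * s t\<bar>" for t by (auto simp: s'_def abs_mult sgn_if)
    have iz: "integrable \<mu> (\<lambda>t. z t * s' t)" and ig: "integrable \<mu> (\<lambda>t. g t * s' t)"
      using int[OF z(1) s' s'1] int[OF gR s' s'1] by auto
    have FF: "(\<lambda>t. F t * s' t) = (\<lambda>t. z t * s' t + f z * (g t * s' t))" by (simp add: F_def algebra_simps)
    have iF: "integrable \<mu> (\<lambda>t. F t * s' t)" unfolding FF using iz ig by simp
    define \<sigma> where "\<sigma> = (\<integral>t. g t * s' t \<partial>\<mu>)"
    have F_int: "(\<integral>t. F t * s' t \<partial>\<mu>) = (\<integral>t. z t * s' t \<partial>\<mu>) + f z * \<sigma>" unfolding FF \<sigma>_def using iz ig by simp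
    have "ennreal c < ennreal (\<integral>t. F t * s' t \<partial>\<mu>)"
      using s(3) nn_integral_eq_integral[OF iF] by (simp add: Fs)
    then have big: "c < (\<integral>t. z t * s' t \<partial>\<mu>) + f z * \<sigma>" unfolding F_int using c by (simp add: ennreal_less_iff)
    have "1 < rho (\<lambda>t. (s' t - \<sigma> * x t) / c)"
    proof (rule ccontr)
      assume "\<not> ?thesis"
      then have q: "rho (\<lambda>t. (s' t - \<sigma> * x t) / c) \<le> 1" by simp
      have qm: "(\<lambda>t. (s' t - \<sigma> * x t) / c) \<in> borel_measurable \<mu>" by measurable
      have q1: "(\<integral>t. z t * ((s' t - \<sigma> * x t) / c) \<partial>\<mu>) \<le> 1" using int[OF z(1) qm q] z(2) by linarith
      have q2: "(\<lambda>t. z t * ((s' t - \<sigma> * x t) / c)) = (\<lambda>t. (z t * s' t - \<sigma> * (z t * x t)) / c)"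
        by (simp add: fun_eq_iff algebra_simps)
      have "((\<integral>t. z t * s' t \<partial>\<mu>) - \<sigma> * (\<integral>t. z t * x t \<partial>\<mu>)) / c \<le> 1"
        using q1 iz intx(1)[OF z(1)] unfolding q2 by simp
      then show False using big c by (simp add: f_def divide_le_eq mult.commute)
    qed
    then show "\<exists>z\<in>borel_measurable \<mu>. rho z \<le> 1 \<and> 1 < rho (\<lambda>t. (z t - (\<integral>s. g s * z s \<partial>\<mu>) * x t) / c)"
      using s' s'1 unfolding \<sigma>_def by blast
  qed
qed

lemma split_ball_norms:
  assumes ball: "split_ball D"
  shows "is_weighted_sum \<mu> max (space \<mu> - D) slope (\<lambda>t. 1 / bound t) (mo_functions \<mu> M) (luxemburg_norm \<mu> M)"
    "is_weighted_sum \<mu> (+) D bound (\<lambda>t. 1 / slope t) (mo_functions \<mu> (complementary M)) (orlicz_norm \<mu> M)"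
  by (rule luxemburg_weighted_sum[OF ball] orlicz_weighted_sum[OF ball])+

end

section \<open>The equivalence\<close>

theorem theorem4p13:
  fixes \<mu> :: "'a measure"
    and M N :: "'a \<Rightarrow> real \<Rightarrow> ennreal"
    and v w :: "'a \<Rightarrow> ennreal"
    and \<Omega>_inf :: "'a set"
  assumes "sigma_finite_measure \<mu>" and "complete_measure \<mu>" and "nonatomic \<mu>"
    and "musielak_orlicz \<mu> M" and "N = complementary M"
    and "v = (\<lambda>t. 1 / finite_bound (M t))"
    and "w = (\<lambda>t. zero_bound (N t))"
    and "\<Omega>_inf = {t \<in> space \<mu>. zero_bound (M t) = finite_bound (M t)}"
  defines "i \<equiv> daugavet_property (luxemburg_space \<mu> M)"
    and "ii \<equiv>
      weight_on \<mu> (space \<mu>) w \<and> same_space (luxemburg_space \<mu> M) (L_1 \<mu> (space \<mu>) w)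
      \<or> weight_on \<mu> (space \<mu>) v \<and> same_space (luxemburg_space \<mu> M) (L_inf \<mu> (space \<mu>) v)
      \<or> weight_on \<mu> \<Omega>_inf v \<and> weight_on \<mu> (space \<mu> - \<Omega>_inf) w \<and>
        same_space_split \<mu> \<Omega>_inf (luxemburg_space \<mu> M)
          (sum_inf (L_inf \<mu> \<Omega>_inf v) (L_1 \<mu> (space \<mu> - \<Omega>_inf) w))"
    and "iii \<equiv>
      weight_on \<mu> (space \<mu>) (\<lambda>t. 1 / w t) \<and>
        same_space (orlicz_space \<mu> N M) (L_inf \<mu> (space \<mu>) (\<lambda>t. 1 / w t))
      \<or> weight_on \<mu> (space \<mu>) (\<lambda>t. 1 / v t) \<and>
        same_space (orlicz_space \<mu> N M) (L_1 \<mu> (space \<mu>) (\<lambda>t. 1 / v t))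
      \<or> weight_on \<mu> \<Omega>_inf (\<lambda>t. 1 / v t) \<and> weight_on \<mu> (space \<mu> - \<Omega>_inf) (\<lambda>t. 1 / w t) \<and>
        same_space_split \<mu> \<Omega>_inf (orlicz_space \<mu> N M)
          (sum_1 (L_1 \<mu> \<Omega>_inf (\<lambda>t. 1 / v t)) (L_inf \<mu> (space \<mu> - \<Omega>_inf) (\<lambda>t. 1 / w t)))"
    and "iv \<equiv> daugavet_property (orlicz_space \<mu> N M)"
  shows "(i \<longleftrightarrow> ii) \<and> (ii \<longleftrightarrow> iii) \<and> (iii \<longleftrightarrow> iv)"
proof -
  interpret complete_measure \<mu> by fact
  interpret sigma_finite_measure \<mu> by fact
  interpret musielak_orlicz_space \<mu> M by unfold_locales fact
  have na: "nonatomic \<mu>" by fact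
  have v: "v = (\<lambda>t. 1 / bound t)" and w: "w = slope" and Inf: "\<Omega>_inf = {t \<in> space \<mu>. flat t = bound t}"
    using assms(5-8) by (auto simp: bound_def[abs_def] slope_def[abs_def] flat_def[abs_def])
  have v': "(\<lambda>t. 1 / v t) = bound" unfolding v by (simp only: ennreal_inverse_inverse)
  have Inf_sets: "\<Omega>_inf \<in> sets \<mu>" unfolding Inf by measurable
  define lux where "lux D \<longleftrightarrow> is_weighted_sum \<mu> max D slope (\<lambda>t. 1 / bound t) (mo_functions \<mu> M) (luxemburg_norm \<mu> M)" for D
  define orl where "orl D \<longleftrightarrow> is_weighted_sum \<mu> (+) D bound (\<lambda>t. 1 / slope t) (mo_functions \<mu> (complementary M)) (orlicz_norm \<mu> M)" for D
  have inv: "ae_invariant \<mu> (mo_functions \<mu> M) (luxemburg_norm \<mu> M)"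
    "ae_invariant \<mu> (mo_functions \<mu> (complementary M)) (orlicz_norm \<mu> M)"
    unfolding ae_invariant_def by (auto intro: luxemburg_invariant[symmetric] orlicz_invariant[symmetric])
  note lux_space = closed_mo_functions inv(1) and orl_space = closed_mo_functions inv(2)
  have ii: "ii \<longleftrightarrow> lux (space \<mu>) \<or> lux {} \<or> lux (space \<mu> - \<Omega>_inf)"
    unfolding ii_def luxemburg_space_def lux_def v w
    by (simp only: same_space_L_1_iff[OF lux_space disjI1[OF refl], where u'="\<lambda>t. 1 / bound t"]
        same_space_L_inf_iff[OF lux_space disjI1[OF refl], where u'=slope] same_space_split_inf_1_iff[OF lux_space Inf_sets])
  have iii: "iii \<longleftrightarrow> orl {} \<or> orl (space \<mu>) \<or> orl \<Omega>_inf"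
    unfolding iii_def orlicz_space_def orl_def v' w \<open>N = complementary M\<close>
    by (simp only: same_space_L_1_iff[OF orl_space disjI2[OF refl], where u'="\<lambda>t. 1 / slope t"]
        same_space_L_inf_iff[OF orl_space disjI2[OF refl], where u'=bound] same_space_split_1_inf_iff[OF orl_space Inf_sets])
  have *: "lux (space \<mu>) \<or> lux {} \<or> lux (space \<mu> - \<Omega>_inf)" if "ii"
    using that unfolding ii .
  have **: "orl {} \<or> orl (space \<mu>) \<or> orl \<Omega>_inf" if "iii" using that unfolding iii .
  have dichotomy: "ii \<and> iii" if slice: "\<And>x g. norming_pair x g \<Longrightarrow> slice_property x g"
    using slice_property_dichotomy[OF na slice]
  proof
    assume "AE t in \<mu>. flat t < bound t \<longrightarrow> (\<forall>u>0. M t u = slope t * ennreal u)"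
    from split_ball_norms[OF split_ball_linear[OF this]] show "ii \<and> iii"
      unfolding ii iii lux_def orl_def Inf by blast
  next
    assume "(\<integral>\<^sup>+t. top_value t \<partial>\<mu>) \<le> 1"
    from split_ball_norms[OF split_ball_small[OF this]] show "ii \<and> iii"
      unfolding ii iii lux_def orl_def Diff_cancel by blast
  qed
  have "i" if ii: "ii"
  proof -
    obtain D where "D \<in> sets \<mu>" "lux D" using *[OF ii] Inf_sets by (metis sets.Diff sets.empty_sets sets.top)
    then show ?thesis unfolding i_def luxemburg_space_def lux_def
      by (intro daugavet_is_weighted_sum[OF na, where p=max]) (auto intro: luxemburg_invariant)
  qed
  moreover have "iv" if iii: "iii"
  proof -
    obtain D where "D \<in> sets \<mu>" "orl D" using **[OF iii] Inf_sets by (metis sets.empty_sets sets.top)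
    then show ?thesis unfolding iv_def orlicz_space_def orl_def \<open>N = complementary M\<close>
      by (intro daugavet_is_weighted_sum[OF na, where p="(+)"]) (auto intro: orlicz_invariant)
  qed
  moreover have "ii \<and> iii" if "i"
    by (rule dichotomy[OF slice_property_of_luxemburg[OF that[unfolded i_def luxemburg_space_def]]])
  moreover have "ii \<and> iii" if "iv"
    by (rule dichotomy[OF slice_property_of_orlicz[OF that[unfolded iv_def orlicz_space_def \<open>N = complementary M\<close>]]])
  ultimately show ?thesis by blast
qed

end
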